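(* Let $n,m\ge 0$ and let $u_{i,j}\in\mathbb{C}$, $0\le i\le n$, $|j|\le m$, be parameters, with $u_{-i,j}=\overline{u_{i,-j}}$. From them construct, level by level by the recursive algorithm described in the context, the scalars $\hat E_{i,0}$ ($1\le i\le n$) and $\hat{\tilde E}_{0,j}$ ($1\le j\le m$), the matrices $\mathcal K_{i,j}$ ($1\le i\le n$, $1\le j\le m$), the numbers $(e^j_1)^T H^3_{i,j}e^j_1$ ($1\le i\le n$, $1\le j\le m$), and the vector polynomials $\Phi_{i,j},\tilde\Phi_{i,j}$ ($0\le i\le n$, $0\le j\le m$). Consider the conditions $$(\ast)\qquad u_{0,0}>0,\quad |\hat E_{i,0}|<1,\quad |\hat{\tilde E}_{0,j}|<1,\quad \|\mathcal K_{i,j}\|<1,\quad (e^j_1)^T H^3_{i,j}e^j_1<1\qquad (1\le i\le n,\ 1\le j\le m).$$ If $(\ast)$ holds, then there exists a positive definite linear functional $\mathcal L$ on $\prod^{n,m}$ such that $$\mathcal L(\Phi_{i,m}\Phi_{j,m}^\dagger)=\delta_{i,j}I_{m+1}\ (0\le i,j\le n),\qquad \mathcal L(\tilde\Phi_{n,i}\tilde\Phi_{n,j}^\dagger)=\delta_{i,j}I_{n+1}\ (0\le i,j\le m).$$ The conditions $(\ast)$ are also necessary: if $\mathcal L$ is a positive definite linear functional on $\prod^{n,m}$ and $u_{i,j}$ are its parameters (as defined in the context), then $(\ast)$ holds.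
   Context: **Functionals.** $\prod^{n,m}=\mathrm{span}\{z^iw^j:|i|\le n,|j|\le m\}$, $\hat\prod^{n,m}=\mathrm{span}\{z^iw^j:0\le i\le n,0\le j\le m\}$. For a matrix valued Laurent polynomial $Q$ put $Q^\dagger(z,w)=Q(1/\bar z,1/\bar w)^\dagger$ (conjugate transpose). A linear functional $\mathcal L$ on $\prod^{n,m}$ with $\mathcal L(z^{-i}w^{-j})=\overline{\mathcal L(z^iw^j)}$ is positive definite if $\mathcal L(pp^\dagger)>0$ for all nonzero $p\in\hat\prod^{n,m}$; it is applied entrywise to matrices. $\|\cdot\|$ is the operator norm. **Notation.** $e^k_r$ is the $r$-th standard basis vector of $\mathbb{R}^k$; $U_k=[0,I_k]$ and $U^1_k=[I_k,0]$ are $k\times(k+1)$. The upper Cholesky factor of a positive definite $M$ is the upper triangular $B$ with positive diagonal and $M=BB^\dagger$. Bars denote entrywise conjugation. $\Phi_{n,m}$ is a column of $m+1$ polynomials and $\tilde\Phi_{n,m}$ a column of $n+1$ polynomials in $\hat\prod^{n,m}$. $\overleftarrow\Phi_{n,m}(z,w)=z^nw^m\Phi_{n,m}(1/\bar z,1/\bar w)^\dagger$ (a row vector), and similarly for $\tilde\Phi_{n,m}$. $\Phi^m_{n,n}$ is the $(m+1)\times(m+1)$ matrix with $\Phi_{n,m}=z^n\Phi^m_{n,n}[w^m,\dots,1]^T+(\text{lower powers of }z)$; $\tilde\Phi^n_{m,m}$ is the $(n+1)\times(n+1)$ matrix with $\tilde\Phi_{n,m}=w^m\tilde\Phi^n_{m,m}[z^n,\dots,1]^T+(\text{lower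 powers of }w)$. Matrices with zero rows or columns are empty, and terms containing them are absent. **Algorithm.** (Each level is constructed as long as the relevant conditions in $(\ast)$ hold at the previous levels and at the steps indicated.) *Level $(0,0)$:* $\Phi_{0,0}=\tilde\Phi_{0,0}=1/\sqrt{u_{0,0}}$, $I_{0,0}=I^1_{0,0}=1$. *Level $(i,0)$, $i\ge1$:* $\hat E_{i,0}=u_{i,0}$, $A_{i,0}=\sqrt{1-|u_{i,0}|^2}$, $\Phi_{i,0}=A_{i,0}^{-1}(z\Phi_{i-1,0}-\hat E_{i,0}\overleftarrow\Phi_{i-1,0})$, $\tilde\Phi_{i,0}=[\Phi_{i,0},\Phi_{i-1,0},\dots,\Phi_{0,0}]^T$; $\mathcal K_{i,0},\mathcal K^1_{i,0},\Gamma_{i,0},\Gamma^1_{i,0}$ are empty; $\tilde\Gamma_{i,0}=U_i$, $\tilde\Gamma^1_{i,0}=\tilde\Phi^{i-1}_{0,0}U^1_i(\tilde\Phi^i_{0,0})^{-1}$, $I_{i,0}=(e^{i+1}_1)^T$, $I^1_{i,0}=-\overline{u_{i,0}}(e^{i+1}_1)^T+A_{i,0}I^1_{i-1,0}U_i$. *Level $(0,j)$, $j\ge1$:* $\hat{\tilde E}_{0,j}=u_{0,j}$, $\tilde A_{0,j}=\sqrt{1-|u_{0,j}|^2}$, $\tilde\Phi_{0,j}=\tilde A_{0,j}^{-1}(w\tilde\Phi_{0,j-1}-\hat{\tilde E}_{0,j}\overleftarrow{\tilde\Phi}_{0,j-1})$, $\Phi_{0,j}=[\tilde\Phi_{0,j},\dots,\tilde\Phi_{0,0}]^T$;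 $\mathcal K_{0,j},\mathcal K^1_{0,j},\tilde\Gamma_{0,j},\tilde\Gamma^1_{0,j}$ are empty; $\Gamma_{0,j}=U_j$, $\Gamma^1_{0,j}=\Phi^{j-1}_{0,0}U^1_j(\Phi^j_{0,0})^{-1}$, $I_{0,j}=e^{j+1}_1$, $I^1_{0,j}=-\overline{u_{0,j}}e^{j+1}_1+\tilde A_{0,j}U_j^TI^1_{0,j-1}$. *Level $(n,m)$, $n,m\ge1$* (all data at levels $(n-1,m)$, $(n,m-1)$ and earlier known): 1. $\mathcal K_{n,m}$ ($m\times n$): $\mathcal K_{1,1}=u_{-1,1}$; otherwise $$\mathcal K_{n,m}=\Phi^{m-1}_{n,n}\Big(u_{-n,m}e^m_m(e^n_n)^T+(U^1_{m-1})^TH_{n,m-1}+e^m_m(e^m_m)^T\tilde H_{n-1,m}U^1_{n-1}\Big)(\tilde\Phi^{n-1}_{m,m})^\dagger,$$ where $H_{n,m-1}=(\Phi^{m-2}_{n,n})^{-1}(\mathcal K_{n,m-1}-\mathcal K^1_{n,m-1}\hat{\tilde E}_{n-1,m}^\dagger)((\tilde\Phi^{n-1}_{m-1,m-1})^\dagger)^{-1}$ (absent if $m=1$) and $\tilde H_{n-1,m}=(\Phi^{m-1}_{n-1,n-1})^{-1}(\mathcal K_{n-1,m}-\hat E_{n,m-1}\overline{\mathcal K^1_{n-1,m}})((\tilde\Phi^{n-2}_{m,m})^\dagger)^{-1}$ (absent if $n=1$). 2. If $\|\mathcal K_{n,m}\|<1$: $\Gamma_{n,m}=[0,B]$ ($m\times(m+1)$),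 $\tilde\Gamma_{n,m}=[0,\tilde B]$ ($n\times(n+1)$), with $B$, $\tilde B$ the upper Cholesky factors of $I_m-\mathcal K_{n,m}\mathcal K_{n,m}^\dagger$ and $I_n-\mathcal K_{n,m}^\dagger\mathcal K_{n,m}$. 3. $\mathcal K^1_{n,m}$ ($m\times n$): the $(1,1)$ entry is $\overline{u_{n,m}}$; rows $2,\dots,m$ are $U_{m-1}\mathcal K^1_{n,m}=(\Gamma_{n,m-1}U_{m-1}^T)^{-1}(\mathcal K^1_{n,m-1}-\mathcal K_{n,m-1}\hat{\tilde E}_{n-1,m})(\tilde A_{n-1,m}^{-1})^T$; columns $2,\dots,n$ are $\mathcal K^1_{n,m}U_{n-1}^T=A_{n,m-1}^{-1}(\mathcal K^1_{n-1,m}-\hat E_{n,m-1}\overline{\mathcal K_{n-1,m}})(U_{n-1}\tilde\Gamma_{n-1,m}^T)^{-1}$. 4. Let $\hat\Gamma_{i,j}$ (resp. $\hat{\tilde\Gamma}_{i,j}$) be the upper triangular matrix whose first row is the first row of $\Gamma^1_{i,j}$ (resp. $\tilde\Gamma^1_{i,j}$) and whose remaining rows form $\Gamma_{i,j}$ (resp. $\tilde\Gamma_{i,j}$). Then $\hat E_{n,m}$ and $\hat{\tilde E}_{n,m}$ are determined by $$\hat\Gamma_{n-1,m}\hat E_{n,m}=U_m^T\big(A_{n,m-1}\mathcal K_{n,m}(I^1_{n-1,m})^\dagger+\hat E_{n,m-1}\overline{\Gamma^1_{n-1,m}}\big)+e^{m+1}_1(e^m_1)^T\big(A_{n,m-1}\mathcal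 K^1_{n,m}I_{n-1,m}^T+\hat E_{n,m-1}\overline{\Gamma_{n-1,m}}\big),$$ $$\hat{\tilde\Gamma}_{n,m-1}\hat{\tilde E}_{n,m}=U_n^T\big(\tilde A_{n-1,m}\mathcal K_{n,m}^\dagger\overline{I^1_{n,m-1}}+\hat{\tilde E}_{n-1,m}\overline{\tilde\Gamma^1_{n,m-1}}\big)+e^{n+1}_1(e^n_1)^T\big(\tilde A_{n-1,m}(\mathcal K^1_{n,m})^T\overline{I_{n,m-1}}+\hat{\tilde E}_{n-1,m}\overline{\tilde\Gamma_{n,m-1}}\big).$$ 5. Put $$H^2_{n,m}=I_{n,m-1}\big((I^1_{n,m-1})^\dagger\overline{\mathcal K_{n,m}}\tilde A_{n-1,m}^T+(\tilde\Gamma^1_{n,m-1})^\dagger\hat{\tilde E}_{n-1,m}\big)U_n(\hat{\tilde\Gamma}_{n,m-1}^T)^{-1}(I^1_{n,m-1})^T(U_m\Gamma_{n,m}^\dagger)^{-1},$$ $$H^1_{n,m}=\tilde A_{n-1,m}^Te^n_1(e^{n+1}_1)^T(\hat{\tilde\Gamma}_{n,m-1}^T)^{-1}(I^1_{n,m-1})^T(U_m\Gamma_{n,m}^\dagger)^{-1}+\overline{\tilde A_{n-1,m}}^{\,-1}\hat{\tilde E}_{n-1,m}^\dagger\tilde A_{n-1,m}\mathcal K_{n,m}^\dagger(U_m\Gamma_{n,m}^\dagger)^{-1},$$ $$H^3_{n,m}=(H^2_{n,m}+\mathcal K^1_{n,m}H^1_{n,m})(H^2_{n,m}+\mathcal K^1_{n,m}H^1_{n,m})^\dagger+\mathcal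 K^1_{n,m}(\mathcal K^1_{n,m})^\dagger.$$ 6. If $(e^m_1)^TH^3_{n,m}e^m_1<1$: $\Gamma^1_{n,m}$ ($m\times(m+1)$) has first column $\big(1-(e^m_1)^TH^3_{n,m}e^m_1\big)^{1/2}e^m_1$ and its other columns are $$\Gamma^1_{n,m}U_m^T=\big(I_{n,m-1}\hat{\tilde E}_{n,m}(I^1_{n,m-1})^T+\Gamma_{n,m-1}^\dagger\Gamma^1_{n,m-1}+\mathcal K^1_{n,m}\overline{\tilde A_{n-1,m}}^{\,-1}\hat{\tilde E}_{n-1,m}^\dagger\tilde A_{n-1,m}\mathcal K_{n,m}^\dagger\big)(U_m\Gamma_{n,m}^\dagger)^{-1}.$$ 7. $I_{n,m}=[\,e^{m+1}_1,\ -\Gamma_{n,m}^\dagger\mathcal K_{n,m}(U_n\tilde\Gamma_{n,m}^\dagger)^{-1}]$; $\Phi_{n,m}$ solves $\hat\Gamma_{n,m}\Phi_{n,m}=e^{m+1}_1(e^m_1)^T(w\Phi_{n,m-1}-\mathcal K^1_{n,m}\overleftarrow{\tilde\Phi}_{n-1,m}^T)+U_m^T(\Phi_{n,m-1}-\mathcal K_{n,m}\tilde\Phi_{n-1,m})$; $\tilde\Phi_{n,m}=I_{n,m}^\dagger\Phi_{n,m}+\tilde\Gamma_{n,m}^\dagger\tilde\Phi_{n-1,m}$; $A_{n,m}=\Phi^m_{n-1,n-1}(\Phi^m_{n,n})^{-1}$; $\tilde A_{n,m}=\tilde\Phi^n_{m-1,m-1}(\tilde\Phi^n_{m,m})^{-1}$;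 $I^1_{n,m}=-\overline{A_{n,m}}^{\,-1}\hat E_{n,m}^\dagger A_{n,m}I_{n,m}+A_{n,m}^TI^1_{n-1,m}\tilde\Gamma_{n,m}$; $\tilde\Gamma^1_{n,m}=\tilde\Phi^{n-1}_{m,m}U^1_n(\tilde\Phi^n_{m,m})^{-1}$. **Parameters of a functional.** Let $\mathcal L$ be positive definite and $\langle X,Y\rangle=\mathcal L(XY^\dagger)$. Its orthonormal vector polynomials are $\Phi_{n,m}=[\phi^m_{n,m},\dots,\phi^0_{n,m}]^T$, where $\phi^l_{n,m}$ is the unit vector with positive $z^nw^l$ coefficient in $\mathrm{span}(\{z^iw^j:i<n,\ j\le m\}\cup\{z^nw^j:j\le l\})$ orthogonal to all these monomials except $z^nw^l$ ($i,j\ge0$), and $\tilde\Phi_{n,m}=[\tilde\phi^n_{n,m},\dots,\tilde\phi^0_{n,m}]^T$, defined in the same way with the roles of $z,w$ and $n,m$ interchanged. Its parameters are $u_{0,0}=\mathcal L(1)$; $u_{i,0}=\langle z\Phi_{i-1,0},\overleftarrow\Phi_{i-1,0}\rangle$; $u_{0,j}=\langle w\tilde\Phi_{0,j-1},\overleftarrow{\tilde\Phi}_{0,j-1}\rangle$; and for $i,j\ge1$, $u_{i,j}$ is the conjugate of the $(1,1)$ entry of $\langle w\Phi_{i,j-1},\overleftarrow{\tilde\Phi}_{i-1,j}^T\rangle$, $u_{-1,1}=\langle\Phi_{1,0},\tilde\Phi_{0,1}\rangle$, and for $(i,j)\ne(1,1)$, $u_{-i,j}=(e^j_j)^T(\Phi^{j-1}_{i,i})^{-1}\langle\Phi_{i,j-1},\tilde\Phi_{i-1,j}\rangle((\tilde\Phi^{i-1}_{j,j})^\dagger)^{-1}e^i_i$.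 The remaining ones are given by $u_{-i,-j}=\overline{u_{i,j}}$. *)

theory Defs
  imports
    Complex_Main
    "HOL-Library.Complex_Order"
    "HOL-Library.Poly_Mapping"
    "HOL-Library.Product_Plus"
    "Jordan_Normal_Form.Gauss_Jordan_Elimination"
    "Jordan_Normal_Form.Schur_Decomposition"
begin

text \<open>
  Empty matrices have zero rows or zero columns, and a product \<open>(k \<times> 0) \<cdot> (0 \<times> l)\<close> is the zero
  matrix, so terms with an empty factor vanish. The order on \<^typ>\<open>complex\<close> is the one of
  Complex\_Order: \<open>0 < c\<close> means that \<open>c\<close> is real and positive.
  Matrix entries \<open>$$\<close> are indexed from 0, so the \<open>(1,1)\<close> entry of \<open>M\<close> is \<open>M $$ (0,0)\<close>.
\<close>

section \<open>Laurent polynomials and functionals\<close>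

text \<open>A Laurent polynomial in \<open>z\<close>, \<open>w\<close> is its coefficient function; the key \<open>(i, j)\<close> stands
  for \<open>z\<^sup>i w\<^sup>j\<close> and multiplication is convolution.\<close>

type_synonym laurent = "(int \<times> int) \<Rightarrow>\<^sub>0 complex"

definition zw :: "int \<Rightarrow> int \<Rightarrow> laurent" where
  "zw i j = Poly_Mapping.single (i, j) 1"

definition cst :: "complex \<Rightarrow> laurent" where
  "cst c = Poly_Mapping.single (0, 0) c"

definition cmat :: "complex mat \<Rightarrow> laurent mat" where
  "cmat M = map_mat cst M"

text \<open>\<open>lstar p\<close> is \<open>cnj (p (1 / cnj z, 1 / cnj w))\<close>.\<close>

definition lstar :: "laurent \<Rightarrow> laurent" where
  "lstar p = Poly_Mapping.map_key uminus (Poly_Mapping.map cnj p)"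

definition ldag :: "laurent mat \<Rightarrow> laurent mat" where
  "ldag Q = map_mat lstar (transpose_mat Q)"

definition rev_poly :: "nat \<Rightarrow> nat \<Rightarrow> laurent mat \<Rightarrow> laurent mat" where
  "rev_poly n m Q = zw (int n) (int m) \<cdot>\<^sub>m ldag Q"

definition mono_span :: "(int \<times> int) set \<Rightarrow> laurent set" where
  "mono_span S = {p. Poly_Mapping.keys p \<subseteq> S}"

definition Pi_space :: "nat \<Rightarrow> nat \<Rightarrow> laurent set" where
  "Pi_space n m = mono_span {(i, j). \<bar>i\<bar> \<le> int n \<and> \<bar>j\<bar> \<le> int m}"

definition hatPi_space :: "nat \<Rightarrow> nat \<Rightarrow> laurent set" where
  "hatPi_space n m = mono_span {(i, j). 0 \<le> i \<and> i \<le> int n \<and> 0 \<le> j \<and> j \<le> int m}"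

text \<open>A functional on \<open>Pi_space n m\<close> is a HOL function whose values outside this space are
  irrelevant.\<close>

definition linear_functional :: "nat \<Rightarrow> nat \<Rightarrow> (laurent \<Rightarrow> complex) \<Rightarrow> bool" where
  "linear_functional n m L \<longleftrightarrow>
     (\<forall>p\<in>Pi_space n m. \<forall>q\<in>Pi_space n m. L (p + q) = L p + L q) \<and>
     (\<forall>c. \<forall>p\<in>Pi_space n m. L (cst c * p) = c * L p)"

definition pos_def_functional :: "nat \<Rightarrow> nat \<Rightarrow> (laurent \<Rightarrow> complex) \<Rightarrow> bool" where
  "pos_def_functional n m L \<longleftrightarrow>
     linear_functional n m L \<and>
     (\<forall>i j. \<bar>i\<bar> \<le> int n \<and> \<bar>j\<bar> \<le> int m \<longrightarrow> L (zw (- i) (- j)) = cnj (L (zw i j))) \<and>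
     (\<forall>p\<in>hatPi_space n m. p \<noteq> 0 \<longrightarrow> 0 < L (p * lstar p))"

definition lprod :: "(laurent \<Rightarrow> complex) \<Rightarrow> laurent mat \<Rightarrow> laurent mat \<Rightarrow> complex mat" where
  "lprod L X Y = map_mat L (X * ldag Y)"

section \<open>Matrices\<close>

definition minv :: "complex mat \<Rightarrow> complex mat" where
  "minv A = the (mat_inverse A)"

definition mcnj :: "complex mat \<Rightarrow> complex mat" where
  "mcnj A = map_mat cnj A"

definition scalar_mat1 :: "complex \<Rightarrow> complex mat" where
  "scalar_mat1 c = mat 1 1 (\<lambda>_. c)"

text \<open>\<open>bvec k r\<close> is the column \<open>e\<^sup>k\<^sub>r\<close>, with \<open>r\<close> counted from 1.\<close>

definition bvec :: "nat \<Rightarrow> nat \<Rightarrow> complex mat" where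
  "bvec k r = mat k 1 (\<lambda>(i, _). if i + 1 = r then 1 else 0)"

definition hcat :: "complex mat \<Rightarrow> complex mat \<Rightarrow> complex mat" where
  "hcat A B = four_block_mat A B (0\<^sub>m 0 (dim_col A)) (0\<^sub>m 0 (dim_col B))"

definition Ush :: "nat \<Rightarrow> complex mat" where
  "Ush k = hcat (0\<^sub>m k 1) (1\<^sub>m k)"

definition Ush1 :: "nat \<Rightarrow> complex mat" where
  "Ush1 k = hcat (1\<^sub>m k) (0\<^sub>m k 1)"

definition upper_cholesky :: "complex mat \<Rightarrow> complex mat" where
  "upper_cholesky M = (THE B. B \<in> carrier_mat (dim_row M) (dim_row M) \<and> upper_triangular B \<and>
     (\<forall>i<dim_row M. 0 < B $$ (i, i)) \<and> M = B * mat_adjoint B)"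

definition eucl_norm :: "complex vec \<Rightarrow> real" where
  "eucl_norm v = sqrt (\<Sum>i<dim_vec v. (cmod (v $ i))\<^sup>2)"

definition op_norm :: "complex mat \<Rightarrow> real" where
  "op_norm A = (SUP x\<in>{x \<in> carrier_vec (dim_col A). eucl_norm x \<le> 1}. eucl_norm (A *\<^sub>v x))"

text \<open>\<open>hat_of G1 G\<close>: the first row of \<open>G1\<close> on top of all rows of \<open>G\<close>.\<close>

definition hat_of :: "complex mat \<Rightarrow> complex mat \<Rightarrow> complex mat" where
  "hat_of G1 G = mat (dim_row G + 1) (dim_col G)
     (\<lambda>(i, j). if i = 0 then G1 $$ (0, j) else G $$ (i - 1, j))"

text \<open>\<open>zlead n m F\<close> is the matrix of \<open>z\<^sup>n\<close>-coefficients of a column \<open>F\<close> at level \<open>(n,m)\<close>, with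
  respect to \<open>w\<^sup>m, \<dots>, 1\<close>: for \<open>F = \<Phi>\<^sub>n\<^sub>,\<^sub>m\<close> this is \<open>\<Phi>\<^sup>m\<^sub>n\<^sub>,\<^sub>n\<close>. Similarly \<open>wlead n m F\<close> is
  the matrix of \<open>w\<^sup>m\<close>-coefficients with respect to \<open>z\<^sup>n, \<dots>, 1\<close>; for \<open>F\<close> the tilde column
  at level \<open>(n,m)\<close> it carries the superscript \<open>n\<close> and the subscript \<open>m,m\<close>.\<close>

definition zlead :: "nat \<Rightarrow> nat \<Rightarrow> laurent mat \<Rightarrow> complex mat" where
  "zlead n m F = mat (m + 1) (m + 1)
     (\<lambda>(r, c). Poly_Mapping.lookup (F $$ (r, 0)) (int n, int m - int c))"

definition wlead :: "nat \<Rightarrow> nat \<Rightarrow> laurent mat \<Rightarrow> complex mat" where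
  "wlead n m F = mat (n + 1) (n + 1)
     (\<lambda>(r, c). Poly_Mapping.lookup (F $$ (r, 0)) (int n - int c, int m))"

section \<open>The algorithm\<close>

text \<open>
  The data of one level. A prefix \<open>t\<close> marks the objects with a tilde, a suffix \<open>1\<close> the
  superscript \<open>1\<close>, and \<open>E\<close>, \<open>tE\<close> are the hatted \<open>E\<close>'s; \<open>II\<close> is \<open>I\<^sub>n\<^sub>,\<^sub>m\<close>. Objects which are not
  defined at a boundary level are given as \<open>0\<^sub>m 0 0\<close> there and never used.
\<close>

record level =
  KK :: "complex mat"
  KK1 :: "complex mat"
  Gam :: "complex mat"
  Gam1 :: "complex mat"
  tGam :: "complex mat"
  tGam1 :: "complex mat"
  EE :: "complex mat"
  tEE :: "complex mat"
  HH3 :: "complex mat"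
  AA :: "complex mat"
  tAA :: "complex mat"
  II :: "complex mat"
  II1 :: "complex mat"
  Phi :: "laurent mat"
  tPhi :: "laurent mat"

type_synonym params = "int \<Rightarrow> int \<Rightarrow> complex"

definition level_origin :: "params \<Rightarrow> level" where
  "level_origin u = (let F = mat 1 1 (\<lambda>_. cst (1 / complex_of_real (sqrt (Re (u 0 0))))) in
     \<lparr> KK = 0\<^sub>m 0 0, KK1 = 0\<^sub>m 0 0, Gam = 0\<^sub>m 0 0, Gam1 = 0\<^sub>m 0 0, tGam = 0\<^sub>m 0 0, tGam1 = 0\<^sub>m 0 0,
       EE = 0\<^sub>m 0 0, tEE = 0\<^sub>m 0 0, HH3 = 0\<^sub>m 0 0, AA = 0\<^sub>m 0 0, tAA = 0\<^sub>m 0 0,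
       II = 1\<^sub>m 1, II1 = 1\<^sub>m 1, Phi = F, tPhi = F \<rparr>)"

text \<open>In what follows \<open>P i j\<close> is the data of the earlier level \<open>(i, j)\<close>.\<close>

definition level_z :: "params \<Rightarrow> nat \<Rightarrow> (nat \<Rightarrow> nat \<Rightarrow> level) \<Rightarrow> level" where
  "level_z u i P = (let
     x = u (int i) 0;
     a = complex_of_real (sqrt (1 - (cmod x)\<^sup>2));
     F = cst (1 / a) \<cdot>\<^sub>m (zw 1 0 \<cdot>\<^sub>m Phi (P (i-1) 0) - cst x \<cdot>\<^sub>m rev_poly (i-1) 0 (Phi (P (i-1) 0)));
     tF = mat (i + 1) 1 (\<lambda>(r, _). if r = 0 then F $$ (0, 0) else Phi (P (i - r) 0) $$ (0, 0))
   in
     \<lparr> KK = 0\<^sub>m 0 i, KK1 = 0\<^sub>m 0 i, Gam = 0\<^sub>m 0 1, Gam1 = 0\<^sub>m 0 1,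
       tGam = Ush i,
       tGam1 = wlead (i-1) 0 (tPhi (P (i-1) 0)) * Ush1 i * minv (wlead i 0 tF),
       EE = scalar_mat1 x, tEE = 0\<^sub>m 0 0, HH3 = 0\<^sub>m 0 0,
       AA = scalar_mat1 a, tAA = 0\<^sub>m 0 0,
       II = transpose_mat (bvec (i + 1) 1),
       II1 = (- cnj x) \<cdot>\<^sub>m transpose_mat (bvec (i + 1) 1) + a \<cdot>\<^sub>m (II1 (P (i-1) 0) * Ush i),
       Phi = F, tPhi = tF \<rparr>)"

definition level_w :: "params \<Rightarrow> nat \<Rightarrow> (nat \<Rightarrow> nat \<Rightarrow> level) \<Rightarrow> level" where
  "level_w u j P = (let
     x = u 0 (int j);
     a = complex_of_real (sqrt (1 - (cmod x)\<^sup>2));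
     tF = cst (1 / a) \<cdot>\<^sub>m (zw 0 1 \<cdot>\<^sub>m tPhi (P 0 (j-1)) - cst x \<cdot>\<^sub>m rev_poly 0 (j-1) (tPhi (P 0 (j-1))));
     F = mat (j + 1) 1 (\<lambda>(r, _). if r = 0 then tF $$ (0, 0) else tPhi (P 0 (j - r)) $$ (0, 0))
   in
     \<lparr> KK = 0\<^sub>m j 0, KK1 = 0\<^sub>m j 0,
       Gam = Ush j,
       Gam1 = zlead 0 (j-1) (Phi (P 0 (j-1))) * Ush1 j * minv (zlead 0 j F),
       tGam = 0\<^sub>m 0 1, tGam1 = 0\<^sub>m 0 1,
       EE = 0\<^sub>m 0 0, tEE = scalar_mat1 x, HH3 = 0\<^sub>m 0 0,
       AA = 0\<^sub>m 0 0, tAA = scalar_mat1 a,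
       II = bvec (j + 1) 1,
       II1 = (- cnj x) \<cdot>\<^sub>m bvec (j + 1) 1 + a \<cdot>\<^sub>m (transpose_mat (Ush j) * II1 (P 0 (j-1))),
       Phi = F, tPhi = tF \<rparr>)"

subsection \<open>The steps at a level \<open>(n,m)\<close> with \<open>n, m \<ge> 1\<close>\<close>

text \<open>\<open>step_H n m P\<close> is \<open>H\<close> at \<open>(n, m-1)\<close>, \<open>step_tH n m P\<close> its tilde
  counterpart at \<open>(n-1, m)\<close>.\<close>

definition step_H :: "nat \<Rightarrow> nat \<Rightarrow> (nat \<Rightarrow> nat \<Rightarrow> level) \<Rightarrow> complex mat" where
  "step_H n m P =
     minv (zlead n (m-2) (Phi (P n (m-2))))
     * (KK (P n (m-1)) - KK1 (P n (m-1)) * mat_adjoint (tEE (P (n-1) m)))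
     * minv (mat_adjoint (wlead (n-1) (m-1) (tPhi (P (n-1) (m-1)))))"

definition step_tH :: "nat \<Rightarrow> nat \<Rightarrow> (nat \<Rightarrow> nat \<Rightarrow> level) \<Rightarrow> complex mat" where
  "step_tH n m P =
     minv (zlead (n-1) (m-1) (Phi (P (n-1) (m-1))))
     * (KK (P (n-1) m) - EE (P n (m-1)) * mcnj (KK1 (P (n-1) m)))
     * minv (mat_adjoint (wlead (n-2) m (tPhi (P (n-2) m))))"

definition step_K :: "params \<Rightarrow> nat \<Rightarrow> nat \<Rightarrow> (nat \<Rightarrow> nat \<Rightarrow> level) \<Rightarrow> complex mat" where
  "step_K u n m P =
     (if n = 1 \<and> m = 1 then scalar_mat1 (u (-1) 1)
      else zlead n (m-1) (Phi (P n (m-1)))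
        * (u (- int n) (int m) \<cdot>\<^sub>m (bvec m m * transpose_mat (bvec n n))
           + (if m = 1 then 0\<^sub>m m n else transpose_mat (Ush1 (m-1)) * step_H n m P)
           + (if n = 1 then 0\<^sub>m m n
              else bvec m m * transpose_mat (bvec m m) * step_tH n m P * Ush1 (n-1)))
        * mat_adjoint (wlead (n-1) m (tPhi (P (n-1) m))))"

definition step_Gam :: "nat \<Rightarrow> complex mat \<Rightarrow> complex mat" where
  "step_Gam m K = hcat (0\<^sub>m m 1) (upper_cholesky (1\<^sub>m m - K * mat_adjoint K))"

definition step_tGam :: "nat \<Rightarrow> complex mat \<Rightarrow> complex mat" where
  "step_tGam n K = hcat (0\<^sub>m n 1) (upper_cholesky (1\<^sub>m n - mat_adjoint K * K))"

text \<open>The two matrix equations overlap in the rows and columns of index at least 2;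
  the matrix is required to satisfy both.\<close>

definition step_K1 :: "params \<Rightarrow> nat \<Rightarrow> nat \<Rightarrow> (nat \<Rightarrow> nat \<Rightarrow> level) \<Rightarrow> complex mat" where
  "step_K1 u n m P = (THE X. X \<in> carrier_mat m n \<and>
     X $$ (0, 0) = cnj (u (int n) (int m)) \<and>
     Ush (m-1) * X =
       minv (Gam (P n (m-1)) * transpose_mat (Ush (m-1)))
       * (KK1 (P n (m-1)) - KK (P n (m-1)) * tEE (P (n-1) m))
       * transpose_mat (minv (tAA (P (n-1) m))) \<and>
     X * transpose_mat (Ush (n-1)) =
       minv (AA (P n (m-1)))
       * (KK1 (P (n-1) m) - EE (P n (m-1)) * mcnj (KK (P (n-1) m)))
       * minv (Ush (n-1) * transpose_mat (tGam (P (n-1) m))))"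

text \<open>In the remaining steps \<open>K\<close>, \<open>K1\<close>, \<open>G\<close>, \<dots> are the data of the current level.\<close>

definition hGam :: "level \<Rightarrow> complex mat" where
  "hGam l = hat_of (Gam1 l) (Gam l)"

definition htGam :: "level \<Rightarrow> complex mat" where
  "htGam l = hat_of (tGam1 l) (tGam l)"

definition step_E ::
    "nat \<Rightarrow> nat \<Rightarrow> (nat \<Rightarrow> nat \<Rightarrow> level) \<Rightarrow> complex mat \<Rightarrow> complex mat \<Rightarrow> complex mat" where
  "step_E n m P K K1 =
     minv (hGam (P (n-1) m)) *
     (transpose_mat (Ush m)
        * (AA (P n (m-1)) * K * mat_adjoint (II1 (P (n-1) m))
           + EE (P n (m-1)) * mcnj (Gam1 (P (n-1) m)))
      + bvec (m + 1) 1 * transpose_mat (bvec m 1)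
        * (AA (P n (m-1)) * K1 * transpose_mat (II (P (n-1) m))
           + EE (P n (m-1)) * mcnj (Gam (P (n-1) m))))"

definition step_tE ::
    "nat \<Rightarrow> nat \<Rightarrow> (nat \<Rightarrow> nat \<Rightarrow> level) \<Rightarrow> complex mat \<Rightarrow> complex mat \<Rightarrow> complex mat" where
  "step_tE n m P K K1 =
     minv (htGam (P n (m-1))) *
     (transpose_mat (Ush n)
        * (tAA (P (n-1) m) * mat_adjoint K * mcnj (II1 (P n (m-1)))
           + tEE (P (n-1) m) * mcnj (tGam1 (P n (m-1))))
      + bvec (n + 1) 1 * transpose_mat (bvec n 1)
        * (tAA (P (n-1) m) * transpose_mat K1 * mcnj (II (P n (m-1)))
           + tEE (P (n-1) m) * mcnj (tGam (P n (m-1)))))"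

definition step_H2 ::
    "nat \<Rightarrow> nat \<Rightarrow> (nat \<Rightarrow> nat \<Rightarrow> level) \<Rightarrow> complex mat \<Rightarrow> complex mat \<Rightarrow> complex mat" where
  "step_H2 n m P K G =
     II (P n (m-1))
     * (mat_adjoint (II1 (P n (m-1))) * mcnj K * transpose_mat (tAA (P (n-1) m))
        + mat_adjoint (tGam1 (P n (m-1))) * tEE (P (n-1) m))
     * Ush n * minv (transpose_mat (htGam (P n (m-1))))
     * transpose_mat (II1 (P n (m-1))) * minv (Ush m * mat_adjoint G)"

definition step_H1 ::
    "nat \<Rightarrow> nat \<Rightarrow> (nat \<Rightarrow> nat \<Rightarrow> level) \<Rightarrow> complex mat \<Rightarrow> complex mat \<Rightarrow> complex mat" where
  "step_H1 n m P K G =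
     transpose_mat (tAA (P (n-1) m)) * bvec n 1 * transpose_mat (bvec (n + 1) 1)
       * minv (transpose_mat (htGam (P n (m-1))))
       * transpose_mat (II1 (P n (m-1))) * minv (Ush m * mat_adjoint G)
     + minv (mcnj (tAA (P (n-1) m))) * mat_adjoint (tEE (P (n-1) m)) * tAA (P (n-1) m)
       * mat_adjoint K * minv (Ush m * mat_adjoint G)"

definition step_H3 :: "complex mat \<Rightarrow> complex mat \<Rightarrow> complex mat \<Rightarrow> complex mat" where
  "step_H3 K1 H1 H2 =
     (H2 + K1 * H1) * mat_adjoint (H2 + K1 * H1) + K1 * mat_adjoint K1"

definition H3_entry :: "nat \<Rightarrow> complex mat \<Rightarrow> complex" where
  "H3_entry m H3 = (transpose_mat (bvec m 1) * H3 * bvec m 1) $$ (0, 0)"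

definition step_Gam1 ::
    "nat \<Rightarrow> nat \<Rightarrow> (nat \<Rightarrow> nat \<Rightarrow> level) \<Rightarrow>
     complex mat \<Rightarrow> complex mat \<Rightarrow> complex mat \<Rightarrow> complex mat \<Rightarrow> complex mat \<Rightarrow> complex mat" where
  "step_Gam1 n m P K K1 G tE H3 =
     hcat (complex_of_real (sqrt (1 - Re (H3_entry m H3))) \<cdot>\<^sub>m bvec m 1)
       ((II (P n (m-1)) * tE * transpose_mat (II1 (P n (m-1)))
         + mat_adjoint (Gam (P n (m-1))) * Gam1 (P n (m-1))
         + K1 * minv (mcnj (tAA (P (n-1) m))) * mat_adjoint (tEE (P (n-1) m))
           * tAA (P (n-1) m) * mat_adjoint K)
        * minv (Ush m * mat_adjoint G))"

definition step_I :: "nat \<Rightarrow> nat \<Rightarrow> complex mat \<Rightarrow> complex mat \<Rightarrow> complex mat \<Rightarrow> complex mat" where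
  "step_I n m K G tG =
     hcat (bvec (m + 1) 1) (- (mat_adjoint G * K * minv (Ush n * mat_adjoint tG)))"

definition step_Phi ::
    "nat \<Rightarrow> nat \<Rightarrow> (nat \<Rightarrow> nat \<Rightarrow> level) \<Rightarrow>
     complex mat \<Rightarrow> complex mat \<Rightarrow> complex mat \<Rightarrow> complex mat \<Rightarrow> laurent mat" where
  "step_Phi n m P K K1 G G1 =
     cmat (minv (hat_of G1 G)) *
     (cmat (bvec (m + 1) 1 * transpose_mat (bvec m 1))
        * (zw 0 1 \<cdot>\<^sub>m Phi (P n (m-1))
           - cmat K1 * transpose_mat (rev_poly (n-1) m (tPhi (P (n-1) m))))
      + cmat (transpose_mat (Ush m)) * (Phi (P n (m-1)) - cmat K * tPhi (P (n-1) m)))"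

definition level_inner :: "params \<Rightarrow> nat \<Rightarrow> nat \<Rightarrow> (nat \<Rightarrow> nat \<Rightarrow> level) \<Rightarrow> level" where
  "level_inner u n m P = (let
     K = step_K u n m P;
     G = step_Gam m K;
     tG = step_tGam n K;
     K1 = step_K1 u n m P;
     E = step_E n m P K K1;
     tE = step_tE n m P K K1;
     H3 = step_H3 K1 (step_H1 n m P K G) (step_H2 n m P K G);
     G1 = step_Gam1 n m P K K1 G tE H3;
     I = step_I n m K G tG;
     F = step_Phi n m P K K1 G G1;
     tF = cmat (mat_adjoint I) * F + cmat (mat_adjoint tG) * tPhi (P (n-1) m);
     A = zlead (n-1) m (Phi (P (n-1) m)) * minv (zlead n m F);
     tA = wlead n (m-1) (tPhi (P n (m-1))) * minv (wlead n m tF);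
     I1 = - (minv (mcnj A) * mat_adjoint E * A * I) + transpose_mat A * II1 (P (n-1) m) * tG;
     tG1 = wlead (n-1) m (tPhi (P (n-1) m)) * Ush1 n * minv (wlead n m tF)
   in
     \<lparr> KK = K, KK1 = K1, Gam = G, Gam1 = G1, tGam = tG, tGam1 = tG1, EE = E, tEE = tE,
       HH3 = H3, AA = A, tAA = tA, II = I, II1 = I1, Phi = F, tPhi = tF \<rparr>)"

text \<open>The recursion is total: once a condition fails, the later data are meaningless. Since the
  conditions below are imposed at all levels together, they hold only if every level was
  reached properly.\<close>

function lev :: "params \<Rightarrow> nat \<Rightarrow> nat \<Rightarrow> level" where
  "lev u n m =
     (let P = (\<lambda>i j. if i \<le> n \<and> j \<le> m \<and> (i, j) \<noteq> (n, m) then lev u i j else undefined) in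
      if n = 0 \<and> m = 0 then level_origin u
      else if m = 0 then level_z u n P
      else if n = 0 then level_w u m P
      else level_inner u n m P)"
  by pat_completeness auto
termination
  by (relation "measure (\<lambda>(u, n, m). n + m)") auto

declare lev.simps [simp del]

definition star_conditions :: "nat \<Rightarrow> nat \<Rightarrow> params \<Rightarrow> bool" where
  "star_conditions n m u \<longleftrightarrow>
     0 < u 0 0 \<and>
     (\<forall>i\<in>{1..n}. cmod (EE (lev u i 0) $$ (0, 0)) < 1) \<and>
     (\<forall>j\<in>{1..m}. cmod (tEE (lev u 0 j) $$ (0, 0)) < 1) \<and>
     (\<forall>i\<in>{1..n}. \<forall>j\<in>{1..m}. op_norm (KK (lev u i j)) < 1) \<and>
     (\<forall>i\<in>{1..n}. \<forall>j\<in>{1..m}. H3_entry j (HH3 (lev u i j)) < 1)"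

section \<open>The parameters of a functional\<close>

text \<open>\<open>onpoly L S k\<close> is the unit vector in the span of the monomials in \<open>S\<close> with positive coefficient
  at \<open>k\<close> which is orthogonal to the monomials in \<open>S - {k}\<close>.\<close>

definition onpoly :: "(laurent \<Rightarrow> complex) \<Rightarrow> (int \<times> int) set \<Rightarrow> int \<times> int \<Rightarrow> laurent" where
  "onpoly L S k = (THE p. p \<in> mono_span S \<and> L (p * lstar p) = 1 \<and>
     0 < Poly_Mapping.lookup p k \<and>
     (\<forall>(i, j)\<in>S - {k}. L (p * lstar (zw i j)) = 0))"

definition onPhi :: "(laurent \<Rightarrow> complex) \<Rightarrow> nat \<Rightarrow> nat \<Rightarrow> laurent mat" where
  "onPhi L n m = mat (m + 1) 1 (\<lambda>(r, _). let l = int m - int r in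
     onpoly L ({0..<int n} \<times> {0..int m} \<union> {int n} \<times> {0..l}) (int n, l))"

definition ontPhi :: "(laurent \<Rightarrow> complex) \<Rightarrow> nat \<Rightarrow> nat \<Rightarrow> laurent mat" where
  "ontPhi L n m = mat (n + 1) 1 (\<lambda>(r, _). let l = int n - int r in
     onpoly L ({0..int n} \<times> {0..<int m} \<union> {0..l} \<times> {int m}) (l, int m))"

text \<open>\<open>par_pos L i j\<close> is \<open>u\<^sub>i\<^sub>,\<^sub>j\<close> for \<open>i, j \<ge> 0\<close>, and \<open>par_neg L i j\<close> is \<open>u\<close> at \<open>(-i, j)\<close>
  for \<open>i, j \<ge> 1\<close>.\<close>

definition par_pos :: "(laurent \<Rightarrow> complex) \<Rightarrow> nat \<Rightarrow> nat \<Rightarrow> complex" where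
  "par_pos L i j =
     (if i = 0 \<and> j = 0 then L 1
      else if j = 0 then
        lprod L (zw 1 0 \<cdot>\<^sub>m onPhi L (i-1) 0) (rev_poly (i-1) 0 (onPhi L (i-1) 0)) $$ (0, 0)
      else if i = 0 then
        lprod L (zw 0 1 \<cdot>\<^sub>m ontPhi L 0 (j-1)) (rev_poly 0 (j-1) (ontPhi L 0 (j-1))) $$ (0, 0)
      else
        cnj (lprod L (zw 0 1 \<cdot>\<^sub>m onPhi L i (j-1))
               (transpose_mat (rev_poly (i-1) j (ontPhi L (i-1) j))) $$ (0, 0)))"

definition par_neg :: "(laurent \<Rightarrow> complex) \<Rightarrow> nat \<Rightarrow> nat \<Rightarrow> complex" where
  "par_neg L i j =
     (if i = 1 \<and> j = 1 then lprod L (onPhi L 1 0) (ontPhi L 0 1) $$ (0, 0)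
      else (transpose_mat (bvec j j)
        * minv (zlead i (j-1) (onPhi L i (j-1)))
        * lprod L (onPhi L i (j-1)) (ontPhi L (i-1) j)
        * minv (mat_adjoint (wlead (i-1) j (ontPhi L (i-1) j)))
        * bvec i i) $$ (0, 0))"

definition functional_params :: "(laurent \<Rightarrow> complex) \<Rightarrow> params" where
  "functional_params L i j =
     (if 0 \<le> i \<and> 0 \<le> j then par_pos L (nat i) (nat j)
      else if i < 0 \<and> 0 < j then par_neg L (nat (- i)) (nat j)
      else if i \<le> 0 \<and> j \<le> 0 then cnj (par_pos L (nat (- i)) (nat (- j)))
      else cnj (par_neg L (nat i) (nat (- j))))"

end

theory Submission
  imports Defs "HOL-Analysis.L2_Norm"
begin

text \<open>For a positive definite functional, \<open>\<Phi>\<close> and its tilde counterpart are orthonormal bases of what is gained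
  by admitting one more power of \<open>z\<close>, respectively \<open>w\<close>, and every matrix of the algorithm is a Gram matrix
  between such bases, possibly shifted or reversed. Expanding one basis in another one yields all the
  recurrences; hence, as long as the functional stays positive definite, the algorithm run on its parameters
  returns exactly these Gram matrices. At a level \<open>(i, j)\<close> with \<open>i, j \<ge> 1\<close> positivity passes from the two lower
  boxes first to the new box without its corner, the Schur complement being \<open>1 - K K\<^sup>\<dagger>\<close>, and then
  to the corner, where the squared norm of the residual is one minus the \<open>(1,1)\<close> entry of \<open>H\<^sup>3\<close>; on the boundary
  there is one step, governed by a scalar Szego recurrence. So the conditions at a level express positivity
  on its box. Finally each parameter is, up to conjugation, an affine function with nonzero slope
  of a single new moment. The moments can therefore be chosen one after the other so as to realise given
  parameters, the conditions ensuring positivity at each level.\<close>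

subsection \<open>Matrix algebra\<close>

text \<open>The circularity to be broken is that a level's matrices decide whether its box is
  positive, while their meaning as Gram matrices seems to presuppose it. \<open>K\<close> and
  \<open>K1\<close> involve only columns of the two lower boxes, so they are identified from those.
  The number compared with 1 at the corner involves the new orthonormal column only through its rows
  below the first, and these exist as soon as the box without its corner is positive. The matrix
  \<open>H2 + K1 * H1\<close> of the algorithm is not the Gram matrix that controls the corner; the
  two differ by a matrix with vanishing first row, which is why only the \<open>(1,1)\<close> entry
  of \<open>H3\<close> is tested. The parameter at \<open>(-n, m)\<close> becomes visible after
  division by leading coefficients: the Gram matrix of monic residuals repeats lower data except in
  its last entry. Multiplication by a monomial and reversal preserve inner products up to
  conjugation and map boxes to boxes or shifted boxes, so every object of the algorithm can be
  expanded along a chain of such spaces. Realising parameters works because the exponent of the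
  moment to be chosen arises from a single pair of monomials and the opposite exponent from
  none.\<close>

lemma mult_assoc_dim:
  fixes A B C :: "'a :: semiring_0 mat"
  assumes "dim_col A = dim_row B" "dim_col B = dim_row C"
  shows "A * B * C = A * (B * C)"
  by (rule assoc_mult_mat[of A "dim_row A" "dim_row B" B "dim_row C" C "dim_col C"])
     (use assms in auto)

lemma mult_add_dim:
  fixes A B C :: "'a :: semiring_0 mat"
  assumes "dim_col A = dim_row B" "dim_row B = dim_row C" "dim_col B = dim_col C"
  shows "A * (B + C) = A * B + A * C"
  by (rule mult_add_distrib_mat[of A "dim_row A" "dim_row B" B "dim_col C" C])
     (use assms in auto)

lemma add_mult_dim:
  fixes A B C :: "'a :: semiring_0 mat"
  assumes "dim_row A = dim_row B" "dim_col A = dim_col B" "dim_col B = dim_row C"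
  shows "(A + B) * C = A * C + B * C"
  by (rule add_mult_distrib_mat[of A "dim_row A" "dim_row C" B C "dim_col C"])
     (use assms in auto)

lemma mult_minus_dim:
  fixes A B C :: "'a :: ring mat"
  assumes "dim_col A = dim_row B" "dim_row B = dim_row C" "dim_col B = dim_col C"
  shows "A * (B - C) = A * B - A * C"
  by (rule mult_minus_distrib_mat[of A "dim_row A" "dim_row B" B "dim_col C" C])
     (use assms in auto)

lemma minus_mult_dim:
  fixes A B C :: "'a :: ring mat"
  assumes "dim_row A = dim_row B" "dim_col A = dim_col B" "dim_col B = dim_row C"
  shows "(A - B) * C = A * C - B * C"
  by (rule minus_mult_distrib_mat[of A "dim_row A" "dim_row C" B C "dim_col C"])
     (use assms in auto)

lemma mult_uminus_dim:
  fixes A B :: "'a :: ring_1 mat"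
  assumes "dim_col A = dim_row B"
  shows "A * (- B) = - (A * B)"
  by (rule eq_matI) (use assms in \<open>auto simp: scalar_prod_def sum_negf\<close>)

lemma uminus_mult_dim:
  fixes A B :: "'a :: ring_1 mat"
  assumes "dim_col A = dim_row B"
  shows "(- A) * B = - (A * B)"
  by (rule eq_matI) (use assms in \<open>auto simp: scalar_prod_def sum_negf\<close>)

lemma mult_one_dim [simp]:
  fixes A :: "'a :: semiring_1 mat"
  shows "dim_col A = n \<Longrightarrow> A * 1\<^sub>m n = A" "dim_row A = n \<Longrightarrow> 1\<^sub>m n * A = A"
  by (metis carrier_matI right_mult_one_mat) (metis carrier_matI left_mult_one_mat)

lemma mult_zero_dim [simp]:
  fixes A :: "'a :: semiring_1 mat"
  shows "dim_col A = n \<Longrightarrow> A * 0\<^sub>m n k = 0\<^sub>m (dim_row A) k"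
    "dim_row A = n \<Longrightarrow> 0\<^sub>m k n * A = 0\<^sub>m k (dim_col A)"
  by (auto simp: scalar_prod_def intro!: eq_matI sum.neutral)

lemma add_zero_dim [simp]:
  fixes A :: "'a :: monoid_add mat"
  shows "dim_row A = n \<Longrightarrow> dim_col A = k \<Longrightarrow> A + 0\<^sub>m n k = A"
    "dim_row A = n \<Longrightarrow> dim_col A = k \<Longrightarrow> 0\<^sub>m n k + A = A"
  by (auto intro!: eq_matI)

lemma minus_zero_dim [simp]:
  fixes A :: "'a :: group_add mat"
  shows "dim_row A = n \<Longrightarrow> dim_col A = k \<Longrightarrow> A - 0\<^sub>m n k = A"
    "dim_row A = n \<Longrightarrow> dim_col A = k \<Longrightarrow> 0\<^sub>m n k - A = - A"
    "dim_row A = n \<Longrightarrow> dim_col A = k \<Longrightarrow> A - A = 0\<^sub>m n k"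
  by (auto intro!: eq_matI)

lemma smult_mult_dim:
  fixes A B :: "'a :: comm_ring_1 mat"
  assumes "dim_col A = dim_row B"
  shows "(k \<cdot>\<^sub>m A) * B = k \<cdot>\<^sub>m (A * B)" "A * (k \<cdot>\<^sub>m B) = k \<cdot>\<^sub>m (A * B)"
  by (rule eq_matI; use assms in \<open>auto simp: scalar_prod_def sum_distrib_left algebra_simps\<close>)+

text \<open>Boundary levels produce matrices without rows or without columns; such matrices are
  determined by their dimensions.\<close>

lemma eq_dim_0:
  "dim_row A = 0 \<or> dim_col A = 0 \<Longrightarrow> dim_row A = dim_row B \<Longrightarrow> dim_col A = dim_col B \<Longrightarrow> A = B"
  by (auto intro!: eq_matI)

lemma mat_adjoint_dim [simp]:
  "dim_row (mat_adjoint A) = dim_col A" "dim_col (mat_adjoint A) = dim_row A"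
  unfolding mat_adjoint_def by auto

lemma mat_adjoint_index [simp]:
  fixes A :: "complex mat"
  assumes "i < dim_col A" "j < dim_row A"
  shows "mat_adjoint A $$ (i, j) = cnj (A $$ (j, i))"
  using assms unfolding mat_adjoint_def by (simp add: mat_of_rows_index)

lemma mcnj_dim [simp]: "dim_row (mcnj A) = dim_row A" "dim_col (mcnj A) = dim_col A"
  and mcnj_index [simp]:
    "i < dim_row A \<Longrightarrow> j < dim_col A \<Longrightarrow> mcnj A $$ (i, j) = cnj (A $$ (i, j))"
  by (auto simp: mcnj_def)

lemma conj_trans_simps [simp]:
  "mcnj (mcnj A) = A" "mat_adjoint (mat_adjoint A) = A"
  "transpose_mat (mat_adjoint A) = mcnj A" "mat_adjoint (transpose_mat A) = mcnj A"
  "mat_adjoint (mcnj A) = transpose_mat A" "mcnj (mat_adjoint A) = transpose_mat A"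
  "mcnj (transpose_mat A) = mat_adjoint A" "transpose_mat (mcnj A) = mat_adjoint A"
  for A :: "complex mat"
  by (auto intro!: eq_matI)

lemma adjoint_mult:
  fixes A B :: "complex mat"
  assumes "dim_col A = dim_row B"
  shows "mat_adjoint (A * B) = mat_adjoint B * mat_adjoint A"
  by (rule eq_matI) (use assms in \<open>auto simp: scalar_prod_def intro!: sum.cong\<close>)

lemma mcnj_mult: "dim_col A = dim_row B \<Longrightarrow> mcnj (A * B) = mcnj A * mcnj B"
  by (rule eq_matI) (auto simp: scalar_prod_def intro!: sum.cong)

lemma transpose_mult_dim:
  "dim_col A = dim_row B \<Longrightarrow> transpose_mat (A * B) = transpose_mat B * transpose_mat A"
  for A B :: "'a :: comm_semiring_0 mat"
  by (rule eq_matI) (auto simp: scalar_prod_def mult.commute intro!: sum.cong)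

lemma conj_trans_add:
  fixes A B :: "complex mat"
  assumes "dim_row A = dim_row B" "dim_col A = dim_col B"
  shows "mat_adjoint (A + B) = mat_adjoint A + mat_adjoint B"
    "mcnj (A + B) = mcnj A + mcnj B"
    "transpose_mat (A + B) = transpose_mat A + transpose_mat B"
    "mat_adjoint (A - B) = mat_adjoint A - mat_adjoint B"
    "mcnj (A - B) = mcnj A - mcnj B"
    "transpose_mat (A - B) = transpose_mat A - transpose_mat B"
  by (rule eq_matI; use assms in auto)+

lemma conj_trans_uminus:
  fixes A :: "complex mat"
  shows "mat_adjoint (- A) = - mat_adjoint A" "mcnj (- A) = - mcnj A"
    "transpose_mat (- A) = - transpose_mat A"
  by (rule eq_matI; auto)+

lemma conj_trans_one [simp]:
  "mat_adjoint (1\<^sub>m n :: complex mat) = 1\<^sub>m n" "mcnj (1\<^sub>m n) = 1\<^sub>m n"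
  "mat_adjoint (0\<^sub>m n k :: complex mat) = 0\<^sub>m k n" "mcnj (0\<^sub>m n k) = 0\<^sub>m n k"
  by (rule eq_matI; auto)+

text \<open>The side conditions are plain equations between dimensions, so products are multiplied
  out by simplification without naming carrier sets.\<close>

lemmas mat_distribs = mult_add_dim add_mult_dim mult_minus_dim minus_mult_dim
  mult_uminus_dim uminus_mult_dim mult_assoc_dim
  adjoint_mult mcnj_mult transpose_mult_dim conj_trans_add conj_trans_uminus

section \<open>Invertible matrices\<close>

definition nonsing :: "nat \<Rightarrow> complex mat \<Rightarrow> bool" where
  "nonsing n A \<longleftrightarrow> A \<in> carrier_mat n n \<and>
     (\<exists>B\<in>carrier_mat n n. A * B = 1\<^sub>m n \<and> B * A = 1\<^sub>m n)"

text \<open>Elimination returns an inverse exactly on the units of the matrix ring; a two-sided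
  inverse therefore makes the total function \<open>minv\<close> meaningful.\<close>

lemma minv_nonsing:
  assumes "nonsing n A"
  shows "minv A \<in> carrier_mat n n" "A * minv A = 1\<^sub>m n" "minv A * A = 1\<^sub>m n"
proof -
  obtain B where A: "A \<in> carrier_mat n n" and B: "B \<in> carrier_mat n n" "A * B = 1\<^sub>m n" "B * A = 1\<^sub>m n"
    using assms by (auto simp: nonsing_def)
  note mi = mat_inverse[OF A]
  have "mat_inverse A \<noteq> None"
    using mi(1) A B by (auto simp: Units_def ring_mat_def)
  then obtain C where C: "mat_inverse A = Some C" by auto
  show "minv A \<in> carrier_mat n n" "A * minv A = 1\<^sub>m n" "minv A * A = 1\<^sub>m n"
    using mi(2)[OF C] by (auto simp: minv_def C)
qed

lemma minv_nonsing_dim [simp]: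
  "nonsing n A \<Longrightarrow> dim_row (minv A) = n" "nonsing n A \<Longrightarrow> dim_col (minv A) = n"
  using minv_nonsing(1) by auto

lemma nonsing_dim: "nonsing n A \<Longrightarrow> dim_row A = n" "nonsing n A \<Longrightarrow> dim_col A = n"
  by (auto simp: nonsing_def)

text \<open>A right inverse of a square matrix is also a left inverse, so exhibiting
  \<open>B\<close> proves invertibility and computes \<open>minv A\<close> at once.\<close>

lemma nonsingI:
  assumes "A \<in> carrier_mat n n" "B \<in> carrier_mat n n" "A * B = 1\<^sub>m n"
  shows "nonsing n A" "minv A = B"
proof -
  have "B * A = 1\<^sub>m n" by (rule mat_mult_left_right_inverse[OF assms])
  then show ns: "nonsing n A" using assms by (auto simp: nonsing_def)
  have "minv A = minv A * (A * B)" using minv_nonsing[OF ns] assms by simp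
  also have "\<dots> = (minv A * A) * B"
    using minv_nonsing[OF ns] assms by (subst mult_assoc_dim) auto
  finally show "minv A = B" using minv_nonsing[OF ns] assms by simp
qed

lemma nonsing_conj_trans:
  assumes "nonsing n A"
  shows "nonsing n (mat_adjoint A)" "minv (mat_adjoint A) = mat_adjoint (minv A)"
    "nonsing n (mcnj A)" "minv (mcnj A) = mcnj (minv A)"
    "nonsing n (transpose_mat A)" "minv (transpose_mat A) = transpose_mat (minv A)"
proof -
  note A = minv_nonsing[OF assms] nonsing_dim[OF assms]
  have c: "A \<in> carrier_mat n n" using A by auto
  have 1: "mat_adjoint A * mat_adjoint (minv A) = 1\<^sub>m n"
    "mcnj A * mcnj (minv A) = 1\<^sub>m n" "transpose_mat A * transpose_mat (minv A) = 1\<^sub>m n"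
    using A by (simp_all flip: adjoint_mult mcnj_mult transpose_mult_dim)
  show "nonsing n (mat_adjoint A)" "minv (mat_adjoint A) = mat_adjoint (minv A)"
    "nonsing n (mcnj A)" "minv (mcnj A) = mcnj (minv A)"
    "nonsing n (transpose_mat A)" "minv (transpose_mat A) = transpose_mat (minv A)"
    by (rule nonsingI[OF _ _ 1(1)] nonsingI[OF _ _ 1(2)] nonsingI[OF _ _ 1(3)];
        use A c in \<open>auto intro!: carrier_matI\<close>)+
qed

lemma nonsing_cancel:
  assumes "nonsing n A" "dim_row X = n"
  shows "minv A * (A * X) = X" "A * (minv A * X) = X"
  using assms minv_nonsing[OF assms(1)] nonsing_dim[OF assms(1)]
  by (simp_all flip: mult_assoc_dim)

lemma nonsing_cancel_right:
  assumes "nonsing n A" "dim_col X = n"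
  shows "X * A * minv A = X" "X * minv A * A = X"
  using assms minv_nonsing[OF assms(1)] nonsing_dim[OF assms(1)]
  by (simp_all add: mult_assoc_dim)

text \<open>The expansions yield linear equations, whereas the algorithm states their solutions;
  this passes from the former to the latter.\<close>

lemma nonsing_solve:
  assumes "nonsing n A" "dim_row X = n" "A * X = Y"
  shows "minv A * Y = X"
  using nonsing_cancel[OF assms(1,2)] assms(3) by simp

lemma nonsing_solve_right:
  assumes "nonsing n A" "dim_col X = n" "X * A = Y"
  shows "Y * minv A = X"
  using nonsing_cancel_right[OF assms(1,2)] assms(3) by simp

lemma nonsing_mult:
  assumes "nonsing n A" "nonsing n B"
  shows "nonsing n (A * B)"
proof (rule nonsingI(1))
  note d = nonsing_dim[OF assms(1)] nonsing_dim[OF assms(2)]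
    minv_nonsing(1)[OF assms(1)] minv_nonsing(1)[OF assms(2)]
  show "A * B \<in> carrier_mat n n" "minv B * minv A \<in> carrier_mat n n" using d by auto
  show "A * B * (minv B * minv A) = 1\<^sub>m n"
    using d minv_nonsing[OF assms(1)] assms
    by (simp add: mult_assoc_dim nonsing_cancel[OF assms(2)])
qed

lemma nonsing_minv: "nonsing n A \<Longrightarrow> nonsing n (minv A)"
  by (rule nonsingI(1)[of _ _ A]) (use minv_nonsing nonsing_def in auto)

text \<open>The determinant of a triangular matrix vanishes only if a diagonal entry does.\<close>

lemma nonsing_upper:
  fixes A :: "complex mat"
  assumes "A \<in> carrier_mat n n" "upper_triangular A" "\<And>i. i < n \<Longrightarrow> A $$ (i, i) \<noteq> 0"
  shows "nonsing n A"
proof -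
  have "det A \<noteq> 0"
    using assms by (subst upper_triangular_imp_det_eq_0_iff) (auto simp: diag_mat_def)
  from det_non_zero_imp_unit[OF assms(1) this]
  obtain B where "B \<in> carrier_mat n n" "A * B = 1\<^sub>m n"
    by (auto simp: Units_def ring_mat_def)
  then show ?thesis using nonsingI assms(1) by blast
qed

lemma scalar_mat1_dim [simp]: "dim_row (scalar_mat1 a) = 1" "dim_col (scalar_mat1 a) = 1"
  "scalar_mat1 a $$ (0, 0) = a"
  by (auto simp: scalar_mat1_def)

lemma scalar_mat1_mult [simp]:
  "dim_row X = 1 \<Longrightarrow> scalar_mat1 a * X = a \<cdot>\<^sub>m X"
  "dim_col X = 1 \<Longrightarrow> X * scalar_mat1 a = a \<cdot>\<^sub>m X"
  by (auto intro!: eq_matI simp: scalar_prod_def scalar_mat1_def)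

lemma mat_1_1_eq: "dim_row A = 1 \<Longrightarrow> dim_col A = 1 \<Longrightarrow> A = scalar_mat1 (A $$ (0, 0))"
  by (auto intro!: eq_matI simp: scalar_mat1_def)

section \<open>Concatenation, shift matrices and basis vectors\<close>

lemma hcat_dim [simp]:
  "dim_row (hcat A B) = dim_row A" "dim_col (hcat A B) = dim_col A + dim_col B"
  by (auto simp: hcat_def)

lemma hcat_index:
  assumes "i < dim_row A" "dim_row A = dim_row B" "j < dim_col A + dim_col B"
  shows "hcat A B $$ (i, j) = (if j < dim_col A then A $$ (i, j) else B $$ (i, j - dim_col A))"
  using assms by (auto simp: hcat_def)

lemma Ush_dim [simp]: "dim_row (Ush k) = k" "dim_col (Ush k) = k + 1"
  "dim_row (Ush1 k) = k" "dim_col (Ush1 k) = k + 1"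
  by (auto simp: Ush_def Ush1_def)

lemma Ush_index: "i < k \<Longrightarrow> j < k + 1 \<Longrightarrow> Ush k $$ (i, j) = (if j = i + 1 then 1 else 0)"
  "i < k \<Longrightarrow> j < k + 1 \<Longrightarrow> Ush1 k $$ (i, j) = (if j = i then 1 else 0)"
  by (auto simp: Ush_def Ush1_def hcat_index)

lemma bvec_dim [simp]: "dim_row (bvec k r) = k" "dim_col (bvec k r) = 1"
  by (auto simp: bvec_def)

lemma bvec_index: "i < k \<Longrightarrow> bvec k r $$ (i, 0) = (if i + 1 = r then 1 else 0)"
  by (auto simp: bvec_def)

lemma sum_if_eq_lt:
  fixes f :: "nat \<Rightarrow> 'a :: semiring_1"
  shows "(\<Sum>k\<in>{0..<n}. (if k = i then 1 else 0) * f k) = (if i < n then f i else 0)"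
    "(\<Sum>k\<in>{0..<n}. f k * (if k = i then 1 else 0)) = (if i < n then f i else 0)"
proof -
  have "(\<Sum>k\<in>{0..<n}. (if k = i then 1 else 0) * f k) = (\<Sum>k\<in>{0..<n}. if k = i then f k else 0)"
    by (intro sum.cong) auto
  then show "(\<Sum>k\<in>{0..<n}. (if k = i then 1 else 0) * f k) = (if i < n then f i else 0)" by simp
  have "(\<Sum>k\<in>{0..<n}. f k * (if k = i then 1 else 0)) = (\<Sum>k\<in>{0..<n}. if k = i then f k else 0)"
    by (intro sum.cong) auto
  then show "(\<Sum>k\<in>{0..<n}. f k * (if k = i then 1 else 0)) = (if i < n then f i else 0)" by simp
qed

lemma mult_mat_index:
  assumes "dim_col A = n" "dim_row B = n" "i < dim_row A" "j < dim_col B"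
  shows "(A * B) $$ (i, j) = (\<Sum>l\<in>{0..<n}. A $$ (i, l) * B $$ (l, j))"
  using assms by (simp add: scalar_prod_def)

lemma Ush_mult_index:
  assumes "dim_row X = k + 1" "i < k" "j < dim_col X"
  shows "(Ush k * X) $$ (i, j) = X $$ (i + 1, j)" "(Ush1 k * X) $$ (i, j) = X $$ (i, j)"
proof -
  have "(Ush k * X) $$ (i, j) = (\<Sum>l\<in>{0..<k+1}. (if l = i + 1 then 1 else 0) * X $$ (l, j))"
    using assms by (subst mult_mat_index[where n = "k + 1"]) (auto intro!: sum.cong simp: Ush_index)
  then show "(Ush k * X) $$ (i, j) = X $$ (i + 1, j)" using assms by (simp only: sum_if_eq_lt) simp
  have "(Ush1 k * X) $$ (i, j) = (\<Sum>l\<in>{0..<k+1}. (if l = i then 1 else 0) * X $$ (l, j))"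
    using assms by (subst mult_mat_index[where n = "k + 1"]) (auto intro!: sum.cong simp: Ush_index)
  then show "(Ush1 k * X) $$ (i, j) = X $$ (i, j)" using assms by (simp only: sum_if_eq_lt) simp
qed

lemma mult_transpose_Ush_index:
  assumes "dim_col X = k + 1" "i < dim_row X" "j < k"
  shows "(X * transpose_mat (Ush k)) $$ (i, j) = X $$ (i, j + 1)"
proof -
  have "(X * transpose_mat (Ush k)) $$ (i, j) =
      (\<Sum>l\<in>{0..<k+1}. X $$ (i, l) * (if l = j + 1 then 1 else 0))"
    using assms by (subst mult_mat_index[where n = "k + 1"]) (auto intro!: sum.cong simp: Ush_index)
  then show ?thesis using assms by (simp only: sum_if_eq_lt) simp
qed

lemma transpose_Ush_mult_index:
  assumes "dim_row X = k" "i < k + 1" "j < dim_col X"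
  shows "(transpose_mat (Ush k) * X) $$ (i, j) = (if i = 0 then 0 else X $$ (i - 1, j))"
    "(transpose_mat (Ush1 k) * X) $$ (i, j) = (if i = k then 0 else X $$ (i, j))"
proof -
  have "(transpose_mat (Ush k) * X) $$ (i, j) =
      (\<Sum>l\<in>{0..<k}. (if i = l + 1 then 1 else 0) * X $$ (l, j))"
    using assms by (subst mult_mat_index[where n = k]) (auto intro!: sum.cong simp: Ush_index)
  also have "\<dots> = (if i = 0 then 0 else X $$ (i - 1, j))"
  proof (cases i)
    case (Suc i')
    have "(\<Sum>l\<in>{0..<k}. (if i = l + 1 then 1 else 0) * X $$ (l, j)) =
      (\<Sum>l\<in>{0..<k}. (if l = i' then 1 else 0) * X $$ (l, j))"
      by (intro sum.cong) (auto simp: Suc)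
    then show ?thesis using Suc assms by (simp only: sum_if_eq_lt) simp
  qed auto
  finally show "(transpose_mat (Ush k) * X) $$ (i, j) = (if i = 0 then 0 else X $$ (i - 1, j))" .
  have "(transpose_mat (Ush1 k) * X) $$ (i, j) =
      (\<Sum>l\<in>{0..<k}. (if l = i then 1 else 0) * X $$ (l, j))"
    using assms by (subst mult_mat_index[where n = k]) (auto intro!: sum.cong simp: Ush_index)
  then show "(transpose_mat (Ush1 k) * X) $$ (i, j) = (if i = k then 0 else X $$ (i, j))"
    using assms by (simp only: sum_if_eq_lt) auto
qed

lemma mult_Ush_index:
  assumes "dim_col X = k" "i < dim_row X" "j < k + 1"
  shows "(X * Ush k) $$ (i, j) = (if j = 0 then 0 else X $$ (i, j - 1))"
    "(X * Ush1 k) $$ (i, j) = (if j = k then 0 else X $$ (i, j))"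
proof -
  have "X * Ush k = transpose_mat (transpose_mat (Ush k) * transpose_mat X)"
    "X * Ush1 k = transpose_mat (transpose_mat (Ush1 k) * transpose_mat X)"
    using assms by (simp_all add: transpose_mult_dim)
  then show "(X * Ush k) $$ (i, j) = (if j = 0 then 0 else X $$ (i, j - 1))"
    "(X * Ush1 k) $$ (i, j) = (if j = k then 0 else X $$ (i, j))"
    using assms by (simp_all add: transpose_Ush_mult_index del: index_mult_mat(1))
qed

lemma hat_of_dim [simp]:
  "dim_row (hat_of G1 G) = dim_row G + 1" "dim_col (hat_of G1 G) = dim_col G"
  by (auto simp: hat_of_def)

lemma bvec_outer_mult_index:
  assumes "dim_row X = k" "1 \<le> k" "i < l" "j < dim_col X"
  shows "(bvec l 1 * transpose_mat (bvec k 1) * X) $$ (i, j) = (if i = 0 then X $$ (0, j) else 0)"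
proof -
  have "bvec l 1 * transpose_mat (bvec k 1) * X = bvec l 1 * (transpose_mat (bvec k 1) * X)"
    using assms by (simp add: mult_assoc_dim)
  moreover have "(transpose_mat (bvec k 1) * X) $$ (0, j) =
      (\<Sum>l\<in>{0..<k}. (if l = 0 then 1 else 0) * X $$ (l, j))"
    using assms by (subst mult_mat_index[where n = k]) (auto intro!: sum.cong simp: bvec_index)
  moreover have "\<dots> = X $$ (0, j)"
    using assms by (simp only: sum_if_eq_lt) auto
  moreover have "(bvec l 1 * Y) $$ (i, j) = (if i = 0 then Y $$ (0, j) else 0)"
    if "dim_row Y = 1" "dim_col Y = dim_col X" for Y
    using assms that by (subst mult_mat_index[where n = 1]) (auto simp: bvec_index)
  ultimately show ?thesis by simp
qed

text \<open>Writing the stacked matrix as a sum splits a linear system for it into the equation for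
  its first row and the one for the rows below.\<close>

lemma hat_of_eq:
  assumes "dim_row G1 = m" "dim_row G = m" "dim_col G1 = dim_col G" "1 \<le> m"
  shows "hat_of G1 G = bvec (m + 1) 1 * transpose_mat (bvec m 1) * G1 + transpose_mat (Ush m) * G"
  by (rule eq_matI)
     (use assms in \<open>auto simp del: index_mult_mat(1) One_nat_def
        simp: bvec_outer_mult_index transpose_Ush_mult_index hat_of_def\<close>)

subsection \<open>Laurent polynomials\<close>

abbreviation lcoeff :: "laurent \<Rightarrow> int \<times> int \<Rightarrow> complex" where
  "lcoeff \<equiv> Poly_Mapping.lookup"

lemma laurent_expand:
  assumes "finite S" "Poly_Mapping.keys p \<subseteq> S"
  shows "p = (\<Sum>k\<in>S. Poly_Mapping.single k (lcoeff p k))"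
proof (rule poly_mapping_eqI)
  fix k
  have "lcoeff (\<Sum>k\<in>S. Poly_Mapping.single k (lcoeff p k)) k = (\<Sum>l\<in>S. if l = k then lcoeff p l else 0)"
    by (simp add: lookup_sum lookup_single when_def)
  also have "\<dots> = (if k \<in> S then lcoeff p k else 0)" using assms(1) by simp
  also have "\<dots> = lcoeff p k" using assms(2) by (auto simp: in_keys_iff)
  finally show "lcoeff p k = lcoeff (\<Sum>k\<in>S. Poly_Mapping.single k (lcoeff p k)) k" ..
qed

text \<open>Identities additive in the polynomial need checking only on single terms.\<close>

lemma laurent_induct [case_names single add]:
  fixes p :: laurent
  assumes "\<And>k c. Q (Poly_Mapping.single k c)" "\<And>p q. Q p \<Longrightarrow> Q q \<Longrightarrow> Q (p + q)"
  shows "Q p"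
proof -
  have "Q (\<Sum>k\<in>A. Poly_Mapping.single k (lcoeff p k))" if "finite A" for A
    using that
  proof induction
    case empty
    then show ?case using assms(1)[of undefined 0] by simp
  qed (use assms in auto)
  from this[of "Poly_Mapping.keys p"] show ?thesis
    using laurent_expand[of "Poly_Mapping.keys p" p] by simp
qed

lemma lcoeff_cst_mult [simp]: "lcoeff (cst c * p) k = c * lcoeff p k"
proof (induction p rule: laurent_induct)
  case (single l d)
  then show ?case
    by (cases l) (simp add: cst_def mult_single plus_prod_def lookup_single when_def)
qed (simp add: distrib_left lookup_add)

lemma cst_mult_single: "cst c * Poly_Mapping.single k d = Poly_Mapping.single k (c * d)"
  by (cases k) (simp add: cst_def mult_single plus_prod_def)

lemma cst_simps [simp]: "cst 0 = 0" "cst 1 = 1" "cst (a + b) = cst a + cst b"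
  "cst (a * b) = cst a * cst b" "cst (- a) = - cst a" "cst (a - b) = cst a - cst b"
  by (simp_all add: cst_def single_add mult_single single_uminus single_diff flip: zero_prod_def)

lemma zw_mult: "zw a b * zw c d = zw (a + c) (b + d)"
  by (simp add: zw_def mult_single)

lemma lcoeff_zw_mult [simp]: "lcoeff (zw a b * p) (i, j) = lcoeff p (i - a, j - b)"
proof (induction p rule: laurent_induct)
  case (single l d)
  have "((a, b) + l = (i, j)) = (l = (i - a, j - b))" by (cases l) auto
  then show ?case
    by (simp add: zw_def mult_single lookup_single when_def)
qed (simp add: distrib_left lookup_add)

lemma lcoeff_lstar [simp]: "lcoeff (lstar p) k = cnj (lcoeff p (- k))"
proof -
  have "inj (uminus :: int \<times> int \<Rightarrow> _)" by simp
  then have "lcoeff (lstar p) k = lcoeff (Poly_Mapping.map cnj p) (- k)"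
    unfolding lstar_def by (simp add: map_key.rep_eq)
  also have "\<dots> = cnj (lcoeff p (- k))"
    by (simp add: map.rep_eq when_def)
  finally show ?thesis .
qed

lemma lstar_add [simp]: "lstar (p + q) = lstar p + lstar q"
  and lstar_lstar [simp]: "lstar (lstar p) = p"
  and lstar_0 [simp]: "lstar 0 = 0"
  and lstar_diff [simp]: "lstar (p - q) = lstar p - lstar q"
  and lstar_minus [simp]: "lstar (- p) = - lstar p"
  by (rule poly_mapping_eqI; simp add: lookup_add lookup_minus)+

lemma lstar_single: "lstar (Poly_Mapping.single k c) = Poly_Mapping.single (- k) (cnj c)"
  by (rule poly_mapping_eqI) (metis lcoeff_lstar lookup_single_eq lookup_single_not_eq complex_cnj_zero
    minus_minus)

lemma lstar_mult [simp]: "lstar (p * q) = lstar p * lstar q"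
proof (induction p rule: laurent_induct)
  case (single k c)
  show ?case
    by (induction q rule: laurent_induct) (auto simp: lstar_single mult_single distrib_left)
qed (simp add: distrib_right)

lemma lstar_cst [simp]: "lstar (cst c) = cst (cnj c)"
  by (simp add: cst_def lstar_single zero_prod_def)

lemma lstar_zw [simp]: "lstar (zw a b) = zw (- a) (- b)"
  by (simp add: zw_def lstar_single)

lemma zw_0 [simp]: "zw 0 0 = 1"
  by (simp add: zw_def flip: zero_prod_def)

lemma lcoeff_zw: "lcoeff (zw a b) k = (if k = (a, b) then 1 else 0)"
  by (auto simp: zw_def lookup_single when_def)

lemma lstar_sum: "lstar (sum f A) = (\<Sum>i\<in>A. lstar (f i))"
  by (induction A rule: infinite_finite_induct) auto

section \<open>Subspaces and spans of monomials\<close>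

definition lsubspace :: "laurent set \<Rightarrow> bool" where
  "lsubspace S \<longleftrightarrow> 0 \<in> S \<and> (\<forall>p\<in>S. \<forall>q\<in>S. p + q \<in> S) \<and> (\<forall>c. \<forall>p\<in>S. cst c * p \<in> S)"

lemma lsubspaceD:
  assumes "lsubspace S"
  shows "0 \<in> S" "p \<in> S \<Longrightarrow> q \<in> S \<Longrightarrow> p + q \<in> S" "p \<in> S \<Longrightarrow> cst c * p \<in> S"
    "p \<in> S \<Longrightarrow> q \<in> S \<Longrightarrow> p - q \<in> S" "p \<in> S \<Longrightarrow> - p \<in> S"
proof -
  show 1: "0 \<in> S" "p \<in> S \<Longrightarrow> q \<in> S \<Longrightarrow> p + q \<in> S" "p \<in> S \<Longrightarrow> cst c * p \<in> S" for p q c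
    using assms by (auto simp: lsubspace_def)
  show 2: "- p \<in> S" if "p \<in> S" for p using 1(3)[OF that, of "-1"] by (simp del: cst_simps add: cst_simps(2,5))
  show "p \<in> S \<Longrightarrow> q \<in> S \<Longrightarrow> p - q \<in> S" using 1(2)[of p "- q"] 2 by simp
qed

lemma lsubspace_sum: "lsubspace S \<Longrightarrow> (\<And>i. i \<in> A \<Longrightarrow> f i \<in> S) \<Longrightarrow> sum f A \<in> S"
  by (induction A rule: infinite_finite_induct) (auto intro: lsubspaceD)

lemma mono_span_iff: "p \<in> mono_span S \<longleftrightarrow> (\<forall>k. k \<notin> S \<longrightarrow> lcoeff p k = 0)"
  by (auto simp: mono_span_def in_keys_iff)

lemma lsubspace_mono_span: "lsubspace (mono_span S)"
  by (auto simp: lsubspace_def mono_span_iff lookup_add)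

lemma mono_span_mono: "S \<subseteq> T \<Longrightarrow> mono_span S \<subseteq> mono_span T"
  by (auto simp: mono_span_def)

lemma zw_mono_span: "(i, j) \<in> S \<Longrightarrow> zw i j \<in> mono_span S"
  by (auto simp: mono_span_iff lcoeff_zw)

lemma mono_span_expand:
  assumes "finite S" "p \<in> mono_span S"
  shows "p = (\<Sum>(i, j)\<in>S. cst (lcoeff p (i, j)) * zw i j)"
  using laurent_expand[of S p] assms
  by (simp add: mono_span_def zw_def cst_mult_single case_prod_unfold)

subsection \<open>Hermitian functionals and Gram matrices\<close>

definition col_in :: "laurent mat \<Rightarrow> laurent set \<Rightarrow> bool" where
  "col_in X S \<longleftrightarrow> dim_col X = 1 \<and> (\<forall>i<dim_row X. X $$ (i, 0) \<in> S)"

lemma cmat_dim [simp]: "dim_row (cmat A) = dim_row A" "dim_col (cmat A) = dim_col A"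
  and cmat_index [simp]: "i < dim_row A \<Longrightarrow> j < dim_col A \<Longrightarrow> cmat A $$ (i, j) = cst (A $$ (i, j))"
  by (auto simp: cmat_def)

lemma cst_sum: "cst (sum f A) = (\<Sum>i\<in>A. cst (f i))"
  by (induction A rule: infinite_finite_induct) auto

lemma cmat_mult: "dim_col A = dim_row B \<Longrightarrow> cmat (A * B) = cmat A * cmat B"
  by (rule eq_matI) (auto simp: scalar_prod_def cst_sum intro!: sum.cong)

lemma cmat_mult_assoc:
  "dim_col A = dim_row B \<Longrightarrow> dim_col B = dim_row X \<Longrightarrow> cmat A * (cmat B * X) = cmat (A * B) * X"
  by (simp add: cmat_mult mult_assoc_dim)

lemma cmat_add: "dim_row A = dim_row B \<Longrightarrow> dim_col A = dim_col B \<Longrightarrow> cmat (A + B) = cmat A + cmat B"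
  and cmat_diff: "dim_row A = dim_row B \<Longrightarrow> dim_col A = dim_col B \<Longrightarrow> cmat (A - B) = cmat A - cmat B"
  and cmat_one [simp]: "cmat (1\<^sub>m n) = 1\<^sub>m n"
  and cmat_zero [simp]: "cmat (0\<^sub>m n k) = 0\<^sub>m n k"
  by (rule eq_matI; simp)+

lemma cmat_mult_index:
  assumes "dim_col A = dim_row X" "dim_col X = 1" "i < dim_row A"
  shows "(cmat A * X) $$ (i, 0) = (\<Sum>j\<in>{0..<dim_row X}. cst (A $$ (i, j)) * X $$ (j, 0))"
  using assms by (subst mult_mat_index[where n = "dim_row X"]) auto

lemma col_in_cmat_mult:
  assumes "lsubspace S" "col_in X S" "dim_col A = dim_row X"
  shows "col_in (cmat A * X) S"
  using assms
  by (auto simp: col_in_def cmat_mult_index simp del: index_mult_mat(1)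
      intro!: lsubspace_sum lsubspaceD(3))

lemma col_in_add:
  "lsubspace S \<Longrightarrow> col_in X S \<Longrightarrow> col_in Y S \<Longrightarrow> dim_row X = dim_row Y \<Longrightarrow> col_in (X + Y) S"
  "lsubspace S \<Longrightarrow> col_in X S \<Longrightarrow> col_in Y S \<Longrightarrow> dim_row X = dim_row Y \<Longrightarrow> col_in (X - Y) S"
  by (auto simp: col_in_def intro: lsubspaceD)

lemma col_in_mono: "col_in X S \<Longrightarrow> S \<subseteq> T \<Longrightarrow> col_in X T"
  by (auto simp: col_in_def)

lemma ldag_dim [simp]: "dim_row (ldag X) = dim_col X" "dim_col (ldag X) = dim_row X"
  by (auto simp: ldag_def)

lemma lprod_dim [simp]: "dim_row (lprod L X Y) = dim_row X" "dim_col (lprod L X Y) = dim_row Y"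
  by (auto simp: lprod_def)

lemma lprod_index:
  assumes "dim_col X = 1" "dim_col Y = 1" "i < dim_row X" "j < dim_row Y"
  shows "lprod L X Y $$ (i, j) = L (X $$ (i, 0) * lstar (Y $$ (j, 0)))"
  using assms by (simp add: lprod_def ldag_def scalar_prod_def)

text \<open>The transpose of a reversed polynomial row, kept as a column so that Gram matrices with
  it can be formed. It is conjugate-linear in \<open>X\<close>, which is where the bars in the
  recurrences come from.\<close>

definition star_col :: "laurent \<Rightarrow> laurent mat \<Rightarrow> laurent mat" where
  "star_col p X = p \<cdot>\<^sub>m map_mat lstar X"

lemma star_col_dim [simp]: "dim_row (star_col p X) = dim_row X" "dim_col (star_col p X) = dim_col X"
  and star_col_index [simp]: "i < dim_row X \<Longrightarrow> j < dim_col X \<Longrightarrow>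
    star_col p X $$ (i, j) = p * lstar (X $$ (i, j))"
  by (auto simp: star_col_def)

lemma transpose_rev_poly: "transpose_mat (rev_poly n m X) = star_col (zw (int n) (int m)) X"
  by (auto simp: rev_poly_def ldag_def star_col_def intro!: eq_matI)

lemma star_col_cmat_mult:
  assumes "dim_col A = dim_row X" "dim_col X = 1"
  shows "star_col p (cmat A * X) = cmat (mcnj A) * star_col p X"
  by (rule eq_matI)
     (use assms in \<open>auto simp: cmat_mult_index lstar_sum sum_distrib_left mult_ac
        simp del: index_mult_mat(1)\<close>)

lemma star_col_add:
  assumes "dim_row X = dim_row Y" "dim_col X = dim_col Y"
  shows "star_col p (X + Y) = star_col p X + star_col p Y"
    "star_col p (X - Y) = star_col p X - star_col p Y"
  by (rule eq_matI; use assms in \<open>auto simp: algebra_simps\<close>)+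

lemma smult_cmat_mult:
  assumes "dim_col A = dim_row X"
  shows "p \<cdot>\<^sub>m (cmat A * X) = cmat A * (p \<cdot>\<^sub>m X)"
  using assms by (simp add: smult_mult_dim)

lemma smult_add_dim:
  fixes X Y :: "'a :: comm_ring_1 mat"
  assumes "dim_row X = dim_row Y" "dim_col X = dim_col Y"
  shows "p \<cdot>\<^sub>m (X + Y) = p \<cdot>\<^sub>m X + p \<cdot>\<^sub>m Y" "p \<cdot>\<^sub>m (X - Y) = p \<cdot>\<^sub>m X - p \<cdot>\<^sub>m Y"
  by (rule eq_matI; use assms in \<open>auto simp: algebra_simps\<close>)+

text \<open>With \<open>q = lstar p\<close> for a monomial \<open>p\<close>, this says that
  multiplication by a monomial is an isometry.\<close>

lemma unit_cancel:
  assumes "p * q = (1 :: laurent)"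
  shows "p * a * (q * b) = a * b"
proof -
  have "p * a * (q * b) = (p * q) * (a * b)" by (simp only: mult_ac)
  then show ?thesis using assms by simp
qed

lemma mult_cnj_cmod: "z * cnj z = complex_of_real ((cmod z)\<^sup>2)"
  by (rule complex_norm_square[symmetric])

text \<open>Linearity is required on all Laurent polynomials, which frees every computation from
  membership side conditions. A functional given only on a box is later extended by zero
  moments.\<close>

locale herm =
  fixes L :: "laurent \<Rightarrow> complex"
  assumes L_add: "L (p + q) = L p + L q"
    and L_cst: "L (cst c * p) = c * L p"
    and L_lstar: "L (lstar p) = cnj (L p)"
begin

lemma L_0 [simp]: "L 0 = 0" using L_cst[of 0 0] by simp

lemma L_minus: "L (- p) = - L p" using L_cst[of "- 1" p] by (simp del: cst_simps add: cst_simps(2,5))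

lemma L_diff: "L (p - q) = L p - L q" using L_add[of p "- q"] by (simp add: L_minus)

lemma L_sum: "L (sum f A) = (\<Sum>i\<in>A. L (f i))"
  by (induction A rule: infinite_finite_induct) (auto simp: L_add)

lemma L_swap: "L (q * lstar p) = cnj (L (p * lstar q))"
  using L_lstar[of "p * lstar q"] by (simp add: mult.commute)

lemma L_cnj: "cnj (L (p * lstar q)) = L (q * lstar p)"
  by (simp add: L_swap[of q p])

lemma lprod_swap: "dim_col X = 1 \<Longrightarrow> dim_col Y = 1 \<Longrightarrow> mat_adjoint (lprod L X Y) = lprod L Y X"
  by (rule eq_matI) (auto simp: lprod_index L_cnj)

lemma lprod_cmat_left:
  assumes "dim_col A = dim_row X" "dim_col X = 1" "dim_col Y = 1"
  shows "lprod L (cmat A * X) Y = A * lprod L X Y"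
proof (rule eq_matI)
  fix i j assume ij: "i < dim_row (A * lprod L X Y)" "j < dim_col (A * lprod L X Y)"
  then have "lprod L (cmat A * X) Y $$ (i, j) =
      (\<Sum>k\<in>{0..<dim_row X}. A $$ (i, k) * lprod L X Y $$ (k, j))"
    using assms
    by (simp add: lprod_index cmat_mult_index sum_distrib_right L_sum L_cst mult.assoc del: index_mult_mat(1))
  also have "\<dots> = (A * lprod L X Y) $$ (i, j)"
    using assms ij by (subst mult_mat_index[where n = "dim_row X"]) auto
  finally show "lprod L (cmat A * X) Y $$ (i, j) = (A * lprod L X Y) $$ (i, j)" .
qed (use assms in auto)

lemma lprod_cmat_right:
  assumes "dim_col A = dim_row Y" "dim_col X = 1" "dim_col Y = 1"
  shows "lprod L X (cmat A * Y) = lprod L X Y * mat_adjoint A"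
proof -
  have "lprod L X (cmat A * Y) = mat_adjoint (lprod L (cmat A * Y) X)"
    using assms by (simp add: lprod_swap)
  also have "\<dots> = lprod L X Y * mat_adjoint A"
    using assms by (simp add: lprod_cmat_left adjoint_mult lprod_swap)
  finally show ?thesis .
qed

lemma lprod_add:
  assumes "dim_row X = dim_row Y" "dim_col X = 1" "dim_col Y = 1" "dim_col Z = 1"
  shows "lprod L (X + Y) Z = lprod L X Z + lprod L Y Z"
    "lprod L Z (X + Y) = lprod L Z X + lprod L Z Y"
    "lprod L (X - Y) Z = lprod L X Z - lprod L Y Z"
    "lprod L Z (X - Y) = lprod L Z X - lprod L Z Y"
  by (rule eq_matI; use assms in \<open>auto simp: lprod_index algebra_simps L_add L_diff\<close>)+

lemma lprod_smult:
  assumes "p * lstar p = 1" "dim_col X = 1" "dim_col Y = 1"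
  shows "lprod L (p \<cdot>\<^sub>m X) (p \<cdot>\<^sub>m Y) = lprod L X Y"
proof (rule eq_matI)
  fix i j assume "i < dim_row (lprod L X Y)" "j < dim_col (lprod L X Y)"
  moreover have "p * a * (lstar p * b) = a * b" for a b by (rule unit_cancel[OF assms(1)])
  ultimately show "lprod L (p \<cdot>\<^sub>m X) (p \<cdot>\<^sub>m Y) $$ (i, j) = lprod L X Y $$ (i, j)"
    using assms by (simp add: lprod_index)
qed auto

text \<open>Starring exchanges the two factors of an inner product, so reversing both columns
  conjugates their Gram matrix.\<close>

lemma lprod_star_col:
  assumes "p * lstar p = 1" "dim_col X = 1" "dim_col Y = 1"
  shows "lprod L (star_col p X) (star_col p Y) = mcnj (lprod L X Y)"
proof (rule eq_matI)
  fix i j assume "i < dim_row (mcnj (lprod L X Y))" "j < dim_col (mcnj (lprod L X Y))"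
  moreover have "p * lstar a * (lstar p * b) = b * lstar a" for a b
    using unit_cancel[OF assms(1), of "lstar a" b] by (simp add: mult.commute)
  ultimately show "lprod L (star_col p X) (star_col p Y) $$ (i, j) = mcnj (lprod L X Y) $$ (i, j)"
    using assms by (simp add: lprod_index L_cnj)
qed auto

lemmas lprod_simps = lprod_cmat_left lprod_cmat_right lprod_add

definition orth :: "laurent mat \<Rightarrow> laurent set \<Rightarrow> bool" where
  "orth X S \<longleftrightarrow> (\<forall>i<dim_row X. \<forall>y\<in>S. L (X $$ (i, 0) * lstar y) = 0)"

lemma orth_mono: "orth X S \<Longrightarrow> T \<subseteq> S \<Longrightarrow> orth X T"
  by (auto simp: orth_def)

lemma orth_lprod:
  "orth X S \<Longrightarrow> col_in Y S \<Longrightarrow> dim_col X = 1 \<Longrightarrow> lprod L X Y = 0\<^sub>m (dim_row X) (dim_row Y)"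
  "orth X S \<Longrightarrow> col_in Y S \<Longrightarrow> dim_col X = 1 \<Longrightarrow> lprod L Y X = 0\<^sub>m (dim_row Y) (dim_row X)"
proof -
  assume *: "orth X S" "col_in Y S" "dim_col X = 1"
  show "lprod L X Y = 0\<^sub>m (dim_row X) (dim_row Y)"
    by (rule eq_matI) (use * in \<open>auto simp: lprod_index orth_def col_in_def\<close>)
  then have "mat_adjoint (lprod L X Y) = 0\<^sub>m (dim_row Y) (dim_row X)" by simp
  then show "lprod L Y X = 0\<^sub>m (dim_row Y) (dim_row X)" using * by (simp add: lprod_swap col_in_def)
qed

lemma orth_add:
  assumes "orth X S" "orth Y S" "dim_row X = dim_row Y" "dim_col X = 1" "dim_col Y = 1"
  shows "orth (X + Y) S" "orth (X - Y) S"
  using assms by (auto simp: orth_def algebra_simps L_add L_diff)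

lemma orth_cmat_mult:
  assumes "orth X S" "dim_col A = dim_row X" "dim_col X = 1"
  shows "orth (cmat A * X) S"
  using assms
  by (auto simp: orth_def cmat_mult_index sum_distrib_right L_sum L_cst mult.assoc
      simp del: index_mult_mat(1) intro!: sum.neutral)

lemma orth_smult:
  assumes "p * lstar p = 1" "orth X S" "dim_col X = 1"
  shows "orth (p \<cdot>\<^sub>m X) ((*) p ` S)"
proof -
  have "p * a * (lstar p * b) = a * b" for a b by (rule unit_cancel[OF assms(1)])
  then show ?thesis using assms by (auto simp: orth_def)
qed

lemma orth_star_col:
  assumes "p * lstar p = 1" "orth X S" "dim_col X = 1"
  shows "orth (star_col p X) ((\<lambda>q. p * lstar q) ` S)"
proof -
  have "p * lstar a * (lstar p * b) = b * lstar a" for a b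
    using unit_cancel[OF assms(1), of "lstar a" b] by (simp add: mult.commute)
  moreover have "L (y * lstar (X $$ (i, 0))) = 0" if "y \<in> S" "i < dim_row X" for i y
    using assms(2) that L_swap[of y "X $$ (i, 0)"] by (simp add: orth_def)
  ultimately show ?thesis using assms by (auto simp: orth_def)
qed

section \<open>Positivity and orthonormal completions\<close>

definition pd :: "laurent set \<Rightarrow> bool" where
  "pd S \<longleftrightarrow> (\<forall>p\<in>S. p \<noteq> 0 \<longrightarrow> 0 < L (p * lstar p))"

lemma pd_mono: "pd S \<Longrightarrow> T \<subseteq> S \<Longrightarrow> pd T"
  by (auto simp: pd_def)

lemma pd_zero:
  assumes "pd S" "col_in X S" "orth X S"
  shows "X = 0\<^sub>m (dim_row X) 1"
proof (rule eq_matI)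
  fix i j assume "i < dim_row (0\<^sub>m (dim_row X) 1)" "j < dim_col (0\<^sub>m (dim_row X) 1)"
  then show "X $$ (i, j) = 0\<^sub>m (dim_row X) 1 $$ (i, j)"
    using assms by (fastforce simp: pd_def col_in_def orth_def)
qed (use assms in \<open>auto simp: col_in_def\<close>)

text \<open>That \<open>F\<close> completes \<open>T\<close> to \<open>S\<close> is expressed by the
  residual of every column of \<open>S\<close> falling into \<open>T\<close>; no dimensions need to
  be counted.\<close>

definition onb :: "laurent set \<Rightarrow> laurent set \<Rightarrow> laurent mat \<Rightarrow> bool" where
  "onb S T F \<longleftrightarrow> col_in F S \<and> T \<subseteq> S \<and> orth F T \<and> lprod L F F = 1\<^sub>m (dim_row F) \<and>
     (\<forall>X. col_in X S \<longrightarrow> col_in (X - cmat (lprod L X F) * F) T)"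

lemma onbD:
  assumes "onb S T F"
  shows "col_in F S" "T \<subseteq> S" "orth F T" "lprod L F F = 1\<^sub>m (dim_row F)"
    "col_in X S \<Longrightarrow> col_in (X - cmat (lprod L X F) * F) T" "dim_col F = 1"
  using assms by (auto simp: onb_def col_in_def)

text \<open>The residual lies in \<open>T\<close> and is orthogonal to \<open>T\<close>, so
  positivity on \<open>T\<close> makes it vanish.\<close>

lemma onb_expand:
  assumes "onb S T F" "pd T" "col_in X S" "orth X T"
  shows "X = cmat (lprod L X F) * F"
proof -
  note F = onbD[OF assms(1)]
  have X: "dim_col X = 1" using assms by (simp add: col_in_def)
  let ?Y = "X - cmat (lprod L X F) * F"
  have "orth ?Y T"
    using F X assms by (intro orth_add orth_cmat_mult) auto
  then have "?Y = 0\<^sub>m (dim_row X) 1" using pd_zero[OF assms(2)] F(5)[OF assms(3)] by fastforce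
  then have "?Y $$ (i, 0) = 0" if "i < dim_row X" for i using that by simp
  then show ?thesis
    using X F by (intro eq_matI) (auto simp del: index_mult_mat(1))
qed

text \<open>All recurrences of the algorithm are instances of this two-step expansion.\<close>

lemma onb_expand2:
  assumes "onb S1 T F" "onb S S1 G" "pd T" "lsubspace S1" "col_in X S" "orth X T"
  shows "X = cmat (lprod L X F) * F + cmat (lprod L X G) * G"
proof -
  note F = onbD[OF assms(1)] and G = onbD[OF assms(2)]
  have X: "dim_col X = 1" using assms by (simp add: col_in_def)
  let ?Y = "X - cmat (lprod L X G) * G"
  have "orth ?Y T"
    using F G X assms by (intro orth_add orth_cmat_mult) (auto intro: orth_mono)
  moreover have "col_in ?Y S1" by (rule G(5)[OF assms(5)])
  ultimately have "?Y = cmat (lprod L ?Y F) * F" by (intro onb_expand[OF assms(1,3)])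
  moreover have "lprod L ?Y F = lprod L X F"
    using F G X orth_lprod(1)[OF G(3) F(1)] by (simp add: lprod_simps)
  ultimately have Y: "?Y = cmat (lprod L X F) * F" by simp
  have "X = ?Y + cmat (lprod L X G) * G"
    using X G by (intro eq_matI) (auto simp del: index_mult_mat(1))
  then show ?thesis using Y by simp
qed

text \<open>The squared norm of an element of \<open>S\<close> is that of its
  \<open>T\<close>-component plus the squared moduli of its coefficients along \<open>F\<close>; for
  a nonzero element one of the two parts is positive.\<close>

lemma pd_step:
  assumes "onb S T F" "pd T" "lsubspace T"
  shows "pd S"
  unfolding pd_def
proof (intro ballI impI)
  fix p assume p: "p \<in> S" "p \<noteq> 0"
  note F = onbD[OF assms(1)]
  define X where "X = mat 1 1 (\<lambda>_. p)"
  have X: "col_in X S" "dim_row X = 1" "dim_col X = 1" using p by (auto simp: X_def col_in_def)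
  define C where "C = lprod L X F"
  define Y where "Y = X - cmat C * F"
  have dims: "dim_row Y = 1" "dim_col Y = 1" "dim_row C = 1" "dim_col C = dim_row F"
    using X F by (auto simp: Y_def C_def)
  have Y: "col_in Y T" using F(5)[OF X(1)] by (simp add: Y_def C_def)
  have XY: "X = Y + cmat C * F" using X F by (intro eq_matI) (auto simp: Y_def C_def)
  have "lprod L X X = lprod L (Y + cmat C * F) (Y + cmat C * F)" using XY by simp
  also have "\<dots> = lprod L Y Y + C * mat_adjoint C"
    using dims F orth_lprod[OF F(3) Y]
    by (simp add: lprod_simps mult_add_dim add_mult_dim)
  finally have XX: "lprod L X X = lprod L Y Y + C * mat_adjoint C" .
  have "L (p * lstar p) = lprod L X X $$ (0, 0)"
    using X by (simp add: lprod_index) (simp add: X_def)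
  also have "\<dots> = (lprod L Y Y + C * mat_adjoint C) $$ (0, 0)" by (simp only: XX)
  also have "\<dots> = L (Y $$ (0,0) * lstar (Y $$ (0,0))) +
      (\<Sum>k\<in>{0..<dim_row F}. complex_of_real ((cmod (C $$ (0, k)))\<^sup>2))"
    using dims by (simp add: lprod_index mult_mat_index[where n = "dim_row F"] mult_cnj_cmod
        del: index_mult_mat(1))
  finally have eq: "L (p * lstar p) = L (Y $$ (0,0) * lstar (Y $$ (0,0))) +
      complex_of_real (\<Sum>k\<in>{0..<dim_row F}. (cmod (C $$ (0, k)))\<^sup>2)" by simp
  have ge: "0 \<le> (\<Sum>k\<in>{0..<dim_row F}. (cmod (C $$ (0, k)))\<^sup>2)" by (rule sum_nonneg) simp
  have pos: "0 < b" if "b = a + complex_of_real r" "0 \<le> a" "0 \<le> r" "0 < a \<or> 0 < r" for a b r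
    using that by (auto simp: less_complex_def less_eq_complex_def)
  have YT: "Y $$ (0,0) \<in> T" using Y dims by (auto simp: col_in_def)
  show "0 < L (p * lstar p)"
  proof (cases "Y $$ (0,0) = 0")
    case False
    then have "0 < L (Y $$ (0,0) * lstar (Y $$ (0,0)))" using YT assms(2) by (auto simp: pd_def)
    then show ?thesis by (intro pos[OF eq _ ge]) auto
  next
    case True
    have "\<exists>k<dim_row F. C $$ (0, k) \<noteq> 0"
    proof (rule ccontr)
      assume "\<not> ?thesis"
      then have "(cmat C * F) $$ (0, 0) = 0"
        using dims F(6) by (subst cmat_mult_index) (auto intro!: sum.neutral)
      moreover have "X $$ (0, 0) = Y $$ (0, 0) + (cmat C * F) $$ (0, 0)"
        using arg_cong[OF XY, of "\<lambda>M. M $$ (0, 0)"] dims F(6)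
        by (simp only: index_add_mat(1) index_mult_mat(2,3) cmat_dim)
      ultimately show False using True p by (simp add: X_def del: index_mult_mat(1))
    qed
    then obtain k where k: "k < dim_row F" "C $$ (0, k) \<noteq> 0" by auto
    have "0 < (\<Sum>k\<in>{0..<dim_row F}. (cmod (C $$ (0, k)))\<^sup>2)"
      using k by (intro sum_pos2[of _ k]) auto
    moreover have "L (Y $$ (0,0) * lstar (Y $$ (0,0))) = 0" by (simp add: True)
    ultimately show ?thesis by (intro pos[OF eq _ ge]) auto
  qed
qed

text \<open>A reversal that maps \<open>S\<close> to itself moves the subspace \<open>T\<close>, so
  the same space acquires a second orthonormal column, relative to another subspace.\<close>

lemma onb_star_col:
  assumes "onb S T F" "p * lstar p = 1" "\<And>q. q \<in> S \<Longrightarrow> p * lstar q \<in> S"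
  shows "onb S ((\<lambda>q. p * lstar q) ` T) (star_col p F)"
proof -
  note F = onbD[OF assms(1)]
  have inv: "p * lstar (p * lstar q) = q" for q
  proof -
    have "p * lstar (p * lstar q) = (p * lstar p) * q" by (simp add: mult.assoc)
    then show ?thesis using assms(2) by simp
  qed
  have invX: "star_col p (star_col p X) = X" for X
    by (rule eq_matI) (auto simp: inv simp del: lstar_mult)
  have in1: "col_in (star_col p X) ((\<lambda>q. p * lstar q) ` A)" if "col_in X A" for X A
    using that by (simp add: col_in_def)
  have S: "(\<lambda>q. p * lstar q) ` S \<subseteq> S" using assms(3) by blast
  have "col_in (X - cmat (lprod L X (star_col p F)) * star_col p F) ((\<lambda>q. p * lstar q) ` T)"
    if X: "col_in X S" for X
  proof -
    let ?Y = "star_col p X"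
    have d: "dim_col X = 1" using X by (simp add: col_in_def)
    have Y: "col_in ?Y S" by (rule col_in_mono[OF in1[OF X] S])
    have "star_col p (?Y - cmat (lprod L ?Y F) * F) =
        star_col p ?Y - star_col p (cmat (lprod L ?Y F) * F)"
      by (rule star_col_add(2)) (simp_all add: F(6) d)
    moreover have "star_col p (cmat (lprod L ?Y F) * F) = cmat (mcnj (lprod L ?Y F)) * star_col p F"
      by (rule star_col_cmat_mult) (simp_all add: F(6))
    moreover have "mcnj (lprod L ?Y F) = lprod L (star_col p ?Y) (star_col p F)"
      by (rule lprod_star_col[OF assms(2), symmetric]) (simp_all add: F(6) d)
    ultimately show ?thesis using in1[OF F(5)[OF Y]] by (simp only: invX)
  qed
  moreover have "col_in (star_col p F) S" by (rule col_in_mono[OF in1[OF F(1)] S])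
  moreover have "orth (star_col p F) ((\<lambda>q. p * lstar q) ` T)"
    using F(3,6) assms(2) by (intro orth_star_col)
  moreover have "lprod L (star_col p F) (star_col p F) = 1\<^sub>m (dim_row F)"
    using F(4,6) by (simp add: lprod_star_col[OF assms(2)])
  moreover have "(\<lambda>q. p * lstar q) ` T \<subseteq> S" using F(2) S by blast
  ultimately show ?thesis unfolding onb_def star_col_dim by blast
qed

end

declare One_nat_def [simp del]

subsection \<open>The two-variable recurrences\<close>

text \<open>The degree-\<open>(n,m)\<close> orthonormal columns are \<open>P n (m + 1)\<close> and \<open>Q (n + 1) m\<close>; the index counts
  the rows, so that the empty columns of the boundary levels are \<open>P n 0\<close> and \<open>Q 0 m\<close>. \<open>V a b\<close> is
  the space of polynomials of degree less than \<open>a\<close> in \<open>z\<close> and less than \<open>b\<close> in \<open>w\<close>. The locale is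
  invariant under exchanging the two variables, so that every identity has a tilde counterpart.\<close>

locale bicircle = herm L for L :: "laurent \<Rightarrow> complex" +
  fixes M :: "nat \<Rightarrow> nat \<Rightarrow> laurent" and V :: "nat \<Rightarrow> nat \<Rightarrow> laurent set"
    and P Q :: "nat \<Rightarrow> nat \<Rightarrow> laurent mat" and ok :: "nat \<Rightarrow> nat \<Rightarrow> bool"
  assumes M_mult: "M a b * M c d = M (a + c) (b + d)"
    and M_unit: "M a b * lstar (M a b) = 1"
    and V_sub: "lsubspace (V a b)"
    and V_0: "V 0 b = {0}" "V a 0 = {0}"
    and V_mono: "a \<le> c \<Longrightarrow> b \<le> d \<Longrightarrow> V a b \<subseteq> V c d"
    and V_shift: "p \<in> V a b \<Longrightarrow> M c d * p \<in> V (a + c) (b + d)"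
    and V_rev: "p \<in> V (Suc a) (Suc b) \<Longrightarrow> M a b * lstar p \<in> V (Suc a) (Suc b)"
    and ok_mono: "ok c d \<Longrightarrow> a \<le> c \<Longrightarrow> b \<le> d \<Longrightarrow> ok a b"
    and ok_pd: "ok a b \<Longrightarrow> pd (V a b)"
    and dim_P: "dim_row (P n k) = k" "dim_col (P n k) = 1"
    and dim_Q: "dim_row (Q k m) = k" "dim_col (Q k m) = 1"
    and onb_P: "ok (Suc n) k \<Longrightarrow> onb (V (Suc n) k) (V n k) (P n k)"
    and onb_Q: "ok k (Suc m) \<Longrightarrow> onb (V k (Suc m)) (V k m) (Q k m)"
begin

lemma swapped: "bicircle L (\<lambda>a b. M b a) (\<lambda>a b. V b a) (\<lambda>a b. Q b a) (\<lambda>a b. P b a) (\<lambda>a b. ok b a)"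
  by unfold_locales
     (use M_mult M_unit V_sub V_0 V_mono V_shift V_rev ok_mono ok_pd dim_P dim_Q onb_P onb_Q in auto)

abbreviation shift_z :: "laurent mat \<Rightarrow> laurent mat" where "shift_z X \<equiv> M 1 0 \<cdot>\<^sub>m X"
abbreviation shift_w :: "laurent mat \<Rightarrow> laurent mat" where "shift_w X \<equiv> M 0 1 \<cdot>\<^sub>m X"
abbreviation R :: "nat \<Rightarrow> nat \<Rightarrow> laurent mat \<Rightarrow> laurent mat" where "R a b \<equiv> star_col (M a b)"

section \<open>The matrices of the algorithm as Gram matrices\<close>

definition "gK n m = lprod L (P n m) (Q n m)"
text \<open>\<open>Q n m\<close> has degree \<open>n - 1\<close> in \<open>z\<close>, hence the
  reversal exponents \<open>n - 1\<close> and \<open>m\<close>.\<close>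

definition "gK1 n m = lprod L (shift_w (P n m)) (R (n - 1) m (Q n m))"
definition "gG n m = lprod L (P n m) (P n (Suc m))"
definition "gG1 n m = lprod L (shift_w (P n m)) (P n (Suc m))"
definition "gtG n m = lprod L (Q n m) (Q (Suc n) m)"
definition "gtG1 n m = lprod L (shift_z (Q n m)) (Q (Suc n) m)"
definition "gI n m = lprod L (P n (Suc m)) (Q (Suc n) m)"
definition "gI1 n m = lprod L (R n m (P n (Suc m))) (Q (Suc n) m)"

text \<open>The next four carry the lower index of the level from which they lead upwards.\<close>

definition "gE n m = lprod L (shift_z (P n (Suc m))) (R n m (P n (Suc m)))"
definition "gA n m = lprod L (shift_z (P n (Suc m))) (P (Suc n) (Suc m))"
definition "gtE n m = lprod L (shift_w (Q (Suc n) m)) (R n m (Q (Suc n) m))"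
definition "gtA n m = lprod L (shift_w (Q (Suc n) m)) (Q (Suc n) (Suc m))"

lemmas g_defs = gK_def gK1_def gG_def gG1_def gtG_def gtG1_def gI_def gI1_def gE_def gA_def gtE_def gtA_def

lemma g_dims [simp]:
  "dim_row (gK n m) = m" "dim_col (gK n m) = n" "dim_row (gK1 n m) = m" "dim_col (gK1 n m) = n"
  "dim_row (gG n m) = m" "dim_col (gG n m) = Suc m" "dim_row (gG1 n m) = m" "dim_col (gG1 n m) = Suc m"
  "dim_row (gtG n m) = n" "dim_col (gtG n m) = Suc n" "dim_row (gtG1 n m) = n" "dim_col (gtG1 n m) = Suc n"
  "dim_row (gI n m) = Suc m" "dim_col (gI n m) = Suc n" "dim_row (gI1 n m) = Suc m" "dim_col (gI1 n m) = Suc n"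
  "dim_row (gE n m) = Suc m" "dim_col (gE n m) = Suc m" "dim_row (gA n m) = Suc m" "dim_col (gA n m) = Suc m"
  "dim_row (gtE n m) = Suc n" "dim_col (gtE n m) = Suc n" "dim_row (gtA n m) = Suc n" "dim_col (gtA n m) = Suc n"
  by (simp_all add: g_defs dim_P dim_Q)

lemma M_rev:
  "M (a + c) (b + d) * lstar (M c d * p) = M a b * lstar p"
  "M c d * (M a b * p) = M (a + c) (b + d) * p"
  "M a b * lstar (M a b * lstar p) = p"
proof -
  have "M (a + c) (b + d) * lstar (M c d * p) = M a b * lstar p * (M c d * lstar (M c d))"
    by (simp add: mult_ac flip: M_mult)
  then show "M (a + c) (b + d) * lstar (M c d * p) = M a b * lstar p" by (simp add: M_unit)
  have "M a b * lstar (M a b * lstar p) = p * (M a b * lstar (M a b))"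
    by (simp add: mult_ac)
  then show "M a b * lstar (M a b * lstar p) = p" by (simp add: M_unit)
  have "M c d * (M a b * p) = (M a b * M c d) * p" by (simp only: mult_ac)
  then show "M c d * (M a b * p) = M (a + c) (b + d) * p" by (simp only: M_mult)
qed

text \<open>Reversal depends on the declared degree: raising that degree multiplies the result by a
  monomial, and shifting the argument cancels this factor.\<close>

lemma R_shift:
  "R (Suc a) b (shift_z X) = R a b X" "R a (Suc b) (shift_w X) = R a b X"
  "shift_z (R a b X) = R (Suc a) b X" "shift_w (R a b X) = R a (Suc b) X"
  "R a b (R a b X) = X" "R a (Suc b) (R a b X) = shift_w X" "R (Suc a) b (R a b X) = shift_z X"
  "shift_z (shift_w X) = shift_w (shift_z X)"
proof -
  show 1: "R (Suc a) b (shift_z X) = R a b X" "R a (Suc b) (shift_w X) = R a b X" for X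
    using M_rev(1)[of a 1 b 0] M_rev(1)[of a 0 b 1] by (auto intro!: eq_matI simp: Suc_eq_plus1)
  show 2: "R a b (R a b X) = X" for a b X
    by (rule eq_matI) (auto simp: M_rev(3) simp del: lstar_mult)
  show 3: "shift_z (R a b X) = R (Suc a) b X" "shift_w (R a b X) = R a (Suc b) X"
    using M_rev(2)[of 1 0 a b] M_rev(2)[of 0 1 a b] by (auto intro!: eq_matI simp: Suc_eq_plus1)
  show "R a (Suc b) (R a b X) = shift_w X"
    using 1(2)[of "R a (Suc b) (shift_w X)"] 1(2)[of X] 2[of a "Suc b" "shift_w X"] by simp
  show "R (Suc a) b (R a b X) = shift_z X"
    using 1(1)[of X] 2[of "Suc a" b "shift_z X"] by simp
  show "shift_z (shift_w X) = shift_w (shift_z X)"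
    by (rule eq_matI) (auto simp: mult_ac)
qed

lemma R_gram:
  assumes "dim_col X = 1" "dim_col Y = 1"
  shows "lprod L (R a b X) (R a b Y) = mcnj (lprod L X Y)"
    "lprod L (shift_z X) (shift_z Y) = lprod L X Y" "lprod L (shift_w X) (shift_w Y) = lprod L X Y"
    "lprod L (R a b X) Y = mcnj (lprod L X (R a b Y))"
  using assms lprod_star_col[OF M_unit, of X "R a b Y" a b]
  by (simp_all add: lprod_star_col lprod_smult M_unit R_shift)

text \<open>Reversal at the full degree of a box turns absence of the highest power of a variable
  into divisibility by that variable. This is why shifted boxes occur as the subspaces belonging to
  reversed columns.\<close>

lemma V_image:
  "(\<lambda>q. M a b * lstar q) ` V a (Suc b) = (*) (M 1 0) ` V a (Suc b)"
  "(\<lambda>q. M a b * lstar q) ` V (Suc a) b = (*) (M 0 1) ` V (Suc a) b"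
proof -
  have eq: "M a b * lstar q = M c d * (M a' b' * lstar q)" if "a = a' + c" "b = b' + d" for a b c d a' b' q
    using M_rev(2)[of c d a' b' "lstar q"] that by simp
  show "(\<lambda>q. M a b * lstar q) ` V a (Suc b) = (*) (M 1 0) ` V a (Suc b)"
  \<comment> \<open>For \<open>a = 0\<close> both sides are \<open>{0}\<close>. Otherwise the
    reversal is \<open>z\<close> times the one of degree \<open>a - 1\<close>, an involution of the
    box.\<close>
  proof (cases a)
    case (Suc a')
    have *: "M a b * lstar q = M 1 0 * (M a' b * lstar q)" for q using Suc by (intro eq) auto
    have "M 1 0 * q = M a b * lstar (M a' b * lstar q)" for q by (simp only: * M_rev(3))
    then show ?thesis using * V_rev[of _ a' b] unfolding Suc by (fastforce simp: image_iff)
  qed (simp add: V_0)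
  show "(\<lambda>q. M a b * lstar q) ` V (Suc a) b = (*) (M 0 1) ` V (Suc a) b"
  proof (cases b)
    case (Suc b')
    have *: "M a b * lstar q = M 0 1 * (M a b' * lstar q)" for q using Suc by (intro eq) auto
    have "M 0 1 * q = M a b * lstar (M a b' * lstar q)" for q by (simp only: * M_rev(3))
    then show ?thesis using * V_rev[of _ a b'] unfolding Suc by (fastforce simp: image_iff)
  qed (simp add: V_0)
qed

section \<open>Reversed columns and the basic recurrences\<close>

lemma onb_RP:
  assumes "ok (Suc n) (Suc m)"
  shows "onb (V (Suc n) (Suc m)) ((*) (M 1 0) ` V n (Suc m)) (R n m (P n (Suc m)))"
  using onb_star_col[OF onb_P[OF assms] M_unit[of n m] V_rev] by (simp add: V_image)

lemma onb_RQ: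
  assumes "ok (Suc n) (Suc m)"
  shows "onb (V (Suc n) (Suc m)) ((*) (M 0 1) ` V (Suc n) m) (R n m (Q (Suc n) m))"
  using onb_star_col[OF onb_Q[OF assms] M_unit[of n m] V_rev] by (simp add: V_image)

lemma ok_pd_z: "ok (Suc a) b \<Longrightarrow> pd ((*) (M 1 0) ` V a b)"
  and ok_pd_w: "ok a (Suc b) \<Longrightarrow> pd ((*) (M 0 1) ` V a b)"
  using V_shift[of _ a b 1 0] V_shift[of _ a b 0 1]
  by (auto intro!: pd_mono[OF ok_pd] simp: Suc_eq_plus1)

lemma col_in_shift:
  "col_in X (V a b) \<Longrightarrow> col_in (shift_z X) (V (Suc a) b)"
  "col_in X (V a b) \<Longrightarrow> col_in (shift_w X) (V a (Suc b))"
  using V_shift[of _ a b 1 0] V_shift[of _ a b 0 1] by (auto simp: col_in_def Suc_eq_plus1)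

lemma orth_shift:
  "orth X (V a b) \<Longrightarrow> dim_col X = 1 \<Longrightarrow> orth (shift_z X) ((*) (M 1 0) ` V a b)"
  "orth X (V a b) \<Longrightarrow> dim_col X = 1 \<Longrightarrow> orth (shift_w X) ((*) (M 0 1) ` V a b)"
  by (auto intro!: orth_smult M_unit)

lemma col_in_shift_image:
  "col_in X (V a b) \<Longrightarrow> col_in (shift_z X) ((*) (M 1 0) ` V a b)"
  "col_in X (V a b) \<Longrightarrow> col_in (shift_w X) ((*) (M 0 1) ` V a b)"
  by (auto simp: col_in_def)

lemma R_dims [simp]: "dim_row (P n k) = k" "dim_col (P n k) = 1" "dim_row (Q k m) = k" "dim_col (Q k m) = 1"
  by (simp_all add: dim_P dim_Q)

lemma P_facts:
  assumes "ok (Suc n) k"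
  shows "col_in (P n k) (V (Suc n) k)" "orth (P n k) (V n k)" "lprod L (P n k) (P n k) = 1\<^sub>m k"
  using onbD[OF onb_P[OF assms]] by auto

lemma Q_facts:
  assumes "ok k (Suc m)"
  shows "col_in (Q k m) (V k (Suc m))" "orth (Q k m) (V k m)" "lprod L (Q k m) (Q k m) = 1\<^sub>m k"
  using onbD[OF onb_Q[OF assms]] by auto

text \<open>The chain is the shifted box, completed by the reversed column to the current box and by
  the next column to the larger one; \<open>z P\<close> is orthogonal to its bottom.\<close>

lemma szego:
  assumes "ok (Suc (Suc n)) (Suc m)"
  shows "shift_z (P n (Suc m)) =
    cmat (gE n m) * R n m (P n (Suc m)) + cmat (gA n m) * P (Suc n) (Suc m)"
proof -
  have o: "ok (Suc n) (Suc m)" by (rule ok_mono[OF assms]) auto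
  show ?thesis unfolding gE_def gA_def
    by (rule onb_expand2[OF onb_RP[OF o] onb_P[OF assms] ok_pd_z[OF o] V_sub
          col_in_shift(1)[OF P_facts(1)[OF o]] orth_shift(1)[OF P_facts(2)[OF o]]]) simp
qed

lemma szego_rev:
  assumes "ok (Suc (Suc n)) (Suc m)"
  shows "R n m (P n (Suc m)) =
    cmat (mcnj (gE n m)) * shift_z (P n (Suc m)) + cmat (mcnj (gA n m)) * R (Suc n) m (P (Suc n) (Suc m))"
  using arg_cong[OF szego[OF assms], of "R (Suc n) m"]
  by (simp add: R_shift star_col_add star_col_cmat_mult)

text \<open>Reversal at degree \<open>n + 1\<close> exchanges \<open>z P\<close> with the reversed
  \<open>P\<close>, so the conjugate of \<open>gE\<close> equals its adjoint.\<close>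

lemma gE_sym: "transpose_mat (gE n m) = gE n m"
proof -
  have "mcnj (gE n m) = lprod L (R n m (P n (Suc m))) (shift_z (P n (Suc m)))"
    unfolding gE_def using lprod_star_col[OF M_unit, of "shift_z (P n (Suc m))" "R n m (P n (Suc m))" "Suc n" m]
    by (simp add: R_shift)
  also have "\<dots> = mat_adjoint (gE n m)" unfolding gE_def by (simp add: lprod_swap)
  finally show ?thesis using conj_trans_simps by metis
qed

lemma RP_orth:
  assumes "ok (Suc n) (Suc m)"
  shows "orth (R n m (P n (Suc m))) ((*) (M 1 0) ` V n (Suc m))" "col_in (R n m (P n (Suc m))) (V (Suc n) (Suc m))"
  using onbD[OF onb_RP[OF assms]] by auto

text \<open>Parseval's identity for \<open>z P\<close>, which stays orthonormal, in the Szego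
  recurrence.\<close>

lemma gA_norm:
  assumes "ok (Suc (Suc n)) (Suc m)"
  shows "gE n m * mat_adjoint (gE n m) + gA n m * mat_adjoint (gA n m) = 1\<^sub>m (Suc m)"
proof -
  have o: "ok (Suc n) (Suc m)" by (rule ok_mono[OF assms]) auto
  have "1\<^sub>m (Suc m) = lprod L (shift_z (P n (Suc m))) (shift_z (P n (Suc m)))"
    by (simp add: R_gram P_facts[OF o])
  also have "\<dots> = lprod L (shift_z (P n (Suc m)))
      (cmat (gE n m) * R n m (P n (Suc m)) + cmat (gA n m) * P (Suc n) (Suc m))"
    by (subst szego[OF assms]) (simp add: szego[OF assms, symmetric])
  also have "\<dots> = gE n m * mat_adjoint (gE n m) + gA n m * mat_adjoint (gA n m)"
    by (simp add: lprod_simps flip: gE_def gA_def)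
  finally show ?thesis ..
qed

text \<open>The reversed Szego recurrence is paired with the new column; its left side lies in the
  smaller box and contributes zero.\<close>

lemma conjA_mult:
  assumes "ok (Suc (Suc n)) (Suc m)"
  shows "mcnj (gA n m) * lprod L (R (Suc n) m (P (Suc n) (Suc m))) (P (Suc n) (Suc m)) =
    - (mat_adjoint (gE n m) * gA n m)"
proof -
  have o: "ok (Suc n) (Suc m)" by (rule ok_mono[OF assms]) auto
  let ?P = "P (Suc n) (Suc m)"
  let ?X = "mcnj (gA n m) * lprod L (R (Suc n) m ?P) ?P"
  have "0\<^sub>m (Suc m) (Suc m) = lprod L (R n m (P n (Suc m))) ?P"
    using orth_lprod(2)[OF P_facts(2)[OF assms] RP_orth(2)[OF o]] by simp
  also have "\<dots> = mcnj (gE n m) * gA n m + ?X"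
    by (subst szego_rev[OF assms]) (simp add: lprod_simps flip: gA_def)
  finally have *: "mcnj (gE n m) * gA n m + ?X = 0\<^sub>m (Suc m) (Suc m)" ..
  have "?X = - (mcnj (gE n m) * gA n m)"
  proof (rule eq_matI)
    fix i j assume "i < dim_row (- (mcnj (gE n m) * gA n m))" "j < dim_col (- (mcnj (gE n m) * gA n m))"
    then show "?X $$ (i, j) = (- (mcnj (gE n m) * gA n m)) $$ (i, j)"
      using arg_cong[OF *, of "\<lambda>A. A $$ (i, j)"]
      by (simp del: index_mult_mat(1) add: eq_neg_iff_add_eq_0 add.commute)
  qed auto
  moreover have "mcnj (gE n m) = mat_adjoint (gE n m)"
    using gE_sym conj_trans_simps by metis
  ultimately show ?thesis by simp
qed

text \<open>Here the box is enlarged first in \<open>w\<close>, gaining \<open>Q\<close>, and then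
  in \<open>z\<close>, gaining the new \<open>P\<close>.\<close>

lemma rec_P:
  assumes "ok (Suc n) (Suc m)"
  shows "P n m = cmat (gK n m) * Q n m + cmat (gG n m) * P n (Suc m)"
proof -
  have o: "ok n (Suc m)" "ok (Suc n) m" "ok n m" by (rule ok_mono[OF assms]; simp)+
  have "col_in (P n m) (V (Suc n) (Suc m))"
    using P_facts(1)[OF o(2)] V_mono[of "Suc n" "Suc n" m "Suc m"] by (auto intro: col_in_mono)
  then show ?thesis unfolding gK_def gG_def
    by (rule onb_expand2[OF onb_Q[OF o(1)] onb_P[OF assms] ok_pd[OF o(3)] V_sub _ P_facts(2)[OF o(2)]])
qed

text \<open>\<open>w P\<close> is orthogonal to the box shifted by \<open>w\<close>, and what this
  shifted box lacks is exactly the reversed \<open>Q\<close>.\<close>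

lemma rec_wP:
  assumes "ok (Suc (Suc n)) (Suc m)"
  shows "shift_w (P (Suc n) m) =
    cmat (gK1 (Suc n) m) * R n m (Q (Suc n) m) + cmat (gG1 (Suc n) m) * P (Suc n) (Suc m)"
proof -
  have o: "ok (Suc n) (Suc m)" "ok (Suc (Suc n)) m" by (rule ok_mono[OF assms]; simp)+
  show ?thesis unfolding gK1_def gG1_def diff_Suc_1
    by (rule onb_expand2[OF onb_RQ[OF o(1)] onb_P[OF assms] ok_pd_w[OF o(1)] V_sub
      col_in_shift(2)[OF P_facts(1)[OF o(2)]] orth_shift(2)[OF P_facts(2)[OF o(2)]]]) simp
qed

text \<open>The same enlargement as in \<open>rec_P\<close>, but with the degree in \<open>z\<close>
  raised before the degree in \<open>w\<close>.\<close>

lemma rec_I: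
  assumes "ok (Suc n) (Suc m)"
  shows "P n (Suc m) = cmat (gI n m) * Q (Suc n) m + cmat (mat_adjoint (gG n m)) * P n m"
proof -
  have o: "ok (Suc n) m" "ok n m" by (rule ok_mono[OF assms]; simp)+
  have "orth (P n (Suc m)) (V n m)"
    using P_facts(2)[OF assms] V_mono[of n n m "Suc m"] by (auto intro: orth_mono)
  then have "P n (Suc m) = cmat (lprod L (P n (Suc m)) (P n m)) * P n m
      + cmat (lprod L (P n (Suc m)) (Q (Suc n) m)) * Q (Suc n) m"
    by (rule onb_expand2[OF onb_P[OF o(1)] onb_Q[OF assms] ok_pd[OF o(2)] V_sub P_facts(1)[OF assms]])
  also have "lprod L (P n (Suc m)) (P n m) = mat_adjoint (gG n m)"
    by (simp add: gG_def lprod_swap)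
  finally show ?thesis
    by (simp add: gI_def comm_add_mat[of _ "Suc m" 1] carrier_matI)
qed

text \<open>The reversed counterpart of \<open>rec_I\<close>: the chain starts at the box shifted by
  \<open>z\<close>, which the reversed column completes.\<close>

lemma rec_I1:
  assumes "ok (Suc n) (Suc (Suc m))"
  shows "R n (Suc m) (P n (Suc (Suc m))) = cmat (gI1 n (Suc m)) * Q (Suc n) (Suc m)
    + cmat (transpose_mat (gG1 n (Suc m))) * R n m (P n (Suc m))"
proof -
  have o: "ok (Suc n) (Suc m)" "ok n (Suc (Suc m))" by (rule ok_mono[OF assms]; simp)+
  have "orth (R n (Suc m) (P n (Suc (Suc m)))) ((*) (M 1 0) ` V n (Suc m))"
    using RP_orth(1)[OF assms] by (rule orth_mono) (use V_mono[of n n "Suc m" "Suc (Suc m)"] in auto)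
  then have "R n (Suc m) (P n (Suc (Suc m))) =
      cmat (lprod L (R n (Suc m) (P n (Suc (Suc m)))) (R n m (P n (Suc m)))) * R n m (P n (Suc m))
      + cmat (lprod L (R n (Suc m) (P n (Suc (Suc m)))) (Q (Suc n) (Suc m))) * Q (Suc n) (Suc m)"
    by (rule onb_expand2[OF onb_RP[OF o(1)] onb_Q[OF assms] ok_pd_z[OF o(1)] V_sub RP_orth(2)[OF assms]])
  also have "lprod L (R n (Suc m) (P n (Suc (Suc m)))) (R n m (P n (Suc m))) = transpose_mat (gG1 n (Suc m))"
  proof -
    have "mcnj (gG1 n (Suc m)) = lprod L (R n (Suc m) (shift_w (P n (Suc m)))) (R n (Suc m) (P n (Suc (Suc m))))"
      by (simp add: gG1_def R_gram(1))
    then have "mcnj (gG1 n (Suc m)) = lprod L (R n m (P n (Suc m))) (R n (Suc m) (P n (Suc (Suc m))))"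
      by (simp add: R_shift)
    then have "mat_adjoint (mcnj (gG1 n (Suc m))) =
        lprod L (R n (Suc m) (P n (Suc (Suc m)))) (R n m (P n (Suc m)))"
      by (simp add: lprod_swap del: conj_trans_simps)
    then show ?thesis by simp
  qed
  finally show ?thesis
    by (simp add: gI1_def comm_add_mat[of _ "Suc (Suc m)" 1] carrier_matI)
qed

end

section \<open>Identities between the Gram matrices\<close>

context bicircle
begin

lemma add_eq_minus_dim:
  fixes A B C :: "complex mat"
  assumes "A + B = C" "dim_row A = dim_row B" "dim_col A = dim_col B"
  shows "A = C - B" "B = C - A"
  using assms by (auto intro!: eq_matI simp del: index_mult_mat(1))

lemma gG_norm:
  assumes "ok (Suc n) (Suc m)"
  shows "gK n m * mat_adjoint (gK n m) + gG n m * mat_adjoint (gG n m) = 1\<^sub>m m"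
proof -
  have o: "ok (Suc n) m" by (rule ok_mono[OF assms]) auto
  have "lprod L (P n m) (P n m) = lprod L (P n m) (cmat (gK n m) * Q n m + cmat (gG n m) * P n (Suc m))"
    by (subst rec_P[OF assms]) (simp add: rec_P[OF assms, symmetric])
  then show ?thesis
    using P_facts(3)[OF o] by (simp add: lprod_simps flip: gK_def gG_def)
qed

lemma gI_norm:
  assumes "ok (Suc n) (Suc m)"
  shows "gI n m * mat_adjoint (gI n m) + mat_adjoint (gG n m) * gG n m = 1\<^sub>m (Suc m)"
proof -
  have "lprod L (P n (Suc m)) (P n (Suc m)) =
      lprod L (P n (Suc m)) (cmat (gI n m) * Q (Suc n) m + cmat (mat_adjoint (gG n m)) * P n m)"
    by (subst rec_I[OF assms]) (simp add: rec_I[OF assms, symmetric])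
  moreover have "lprod L (P n (Suc m)) (P n m) = mat_adjoint (gG n m)"
    by (simp add: gG_def lprod_swap)
  ultimately show ?thesis
    using P_facts(3)[OF assms] by (simp add: lprod_simps flip: gI_def)
qed

text \<open>\<open>Q n m\<close> contains only powers of \<open>z\<close> below \<open>n\<close>, so
  it is orthogonal to \<open>P n (Suc m)\<close>; the expansion of the latter then relates the two
  products.\<close>

lemma gI_gtG:
  assumes "ok (Suc n) (Suc m)"
  shows "gI n m * mat_adjoint (gtG n m) = - (mat_adjoint (gG n m) * gK n m)"
proof -
  have o: "ok n (Suc m)" by (rule ok_mono[OF assms]) auto
  have "0\<^sub>m (Suc m) n = lprod L (P n (Suc m)) (Q n m)"
    using orth_lprod(1)[OF P_facts(2)[OF assms] Q_facts(1)[OF o]] by simp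
  also have "\<dots> = gI n m * mat_adjoint (gtG n m) + mat_adjoint (gG n m) * gK n m"
    by (subst rec_I[OF assms]) (simp add: lprod_simps gK_def gtG_def lprod_swap)
  finally have "gI n m * mat_adjoint (gtG n m) = 0\<^sub>m (Suc m) n - mat_adjoint (gG n m) * gK n m"
    by (intro add_eq_minus_dim) auto
  then show ?thesis by simp
qed

text \<open>Modulo the box with one power of \<open>z\<close> less, \<open>X\<close> is a
  combination of \<open>P\<close>; \<open>z\<close> times the remainder is orthogonal to the
  reversed column.\<close>

lemma shift_RP:
  assumes "ok (Suc n) (Suc m)" "col_in X (V (Suc n) (Suc m))"
  shows "lprod L (shift_z X) (R n m (P n (Suc m))) = lprod L X (P n (Suc m)) * gE n m"
proof -
  let ?P = "P n (Suc m)" and ?C = "lprod L X (P n (Suc m))"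
  have X: "dim_col X = 1" using assms(2) by (simp add: col_in_def)
  have "col_in (X - cmat ?C * ?P) (V n (Suc m))"
    by (rule onbD(5)[OF onb_P[OF assms(1)] assms(2)])
  then have "lprod L (shift_z (X - cmat ?C * ?P)) (R n m ?P) = 0\<^sub>m (dim_row X) (Suc m)"
    using orth_lprod(2)[OF RP_orth(1)[OF assms(1)] col_in_shift_image(1)] by fastforce
  moreover have "shift_z (X - cmat ?C * ?P) = shift_z X - cmat ?C * shift_z ?P"
    using X by (simp add: smult_add_dim smult_cmat_mult)
  ultimately have "lprod L (shift_z X) (R n m ?P) - ?C * gE n m = 0\<^sub>m (dim_row X) (Suc m)"
    using X by (simp add: lprod_simps flip: gE_def)
  then have "(lprod L (shift_z X) (R n m ?P) - ?C * gE n m) $$ (i, j) = 0" if "i < dim_row X" "j < Suc m" for i j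
    using that by (simp del: index_mult_mat(1))
  then show ?thesis by (intro eq_matI) (auto simp del: index_mult_mat(1))
qed

lemma RP_RP:
  "lprod L (R n m (P n (Suc m))) (R n (Suc m) (P n (Suc (Suc m)))) = mcnj (gG1 n (Suc m))"
proof -
  have "mcnj (gG1 n (Suc m)) = lprod L (R n (Suc m) (shift_w (P n (Suc m)))) (R n (Suc m) (P n (Suc (Suc m))))"
    by (simp add: gG1_def R_gram(1))
  then show ?thesis by (simp add: R_shift)
qed

text \<open>Both sides evaluate the inner product of \<open>z P\<close> with the reversed column of
  the next height: the left by \<open>shift_RP\<close>, the right by the Szego recurrence.\<close>

lemma gE_eq1:
  assumes "ok (Suc (Suc n)) (Suc m)" "ok (Suc n) (Suc (Suc m))"
  shows "gG n (Suc m) * gE n (Suc m) =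
    gA n m * gK (Suc n) (Suc m) * mat_adjoint (gI1 n (Suc m)) + gE n m * mcnj (gG1 n (Suc m))"
proof -
  have o: "ok (Suc n) (Suc m)" by (rule ok_mono[OF assms(1)]) auto
  let ?X = "P n (Suc m)" and ?RY = "R n (Suc m) (P n (Suc (Suc m)))" and ?P = "P (Suc n) (Suc m)"
  have "col_in ?X (V (Suc n) (Suc (Suc m)))"
    using P_facts(1)[OF o] V_mono[of "Suc n" "Suc n" "Suc m" "Suc (Suc m)"] by (auto intro: col_in_mono)
  then have "gG n (Suc m) * gE n (Suc m) = lprod L (shift_z ?X) ?RY"
    using shift_RP[OF assms(2)] by (simp add: gG_def)
  also have "\<dots> = gE n m * lprod L (R n m ?X) ?RY + gA n m * lprod L ?P ?RY"
    by (subst szego[OF assms(1)]) (simp add: lprod_simps)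
  also have "lprod L ?P ?RY = gK (Suc n) (Suc m) * mat_adjoint (gI1 n (Suc m))
      + lprod L ?P (R n m ?X) * mat_adjoint (transpose_mat (gG1 n (Suc m)))"
    by (subst rec_I1[OF assms(2)]) (simp add: lprod_simps flip: gK_def)
  also have "lprod L ?P (R n m ?X) = 0\<^sub>m (Suc m) (Suc m)"
    using orth_lprod(1)[OF P_facts(2)[OF assms(1)] RP_orth(2)[OF o]] by simp
  finally show ?thesis
    by (simp add: RP_RP mult_assoc_dim comm_add_mat[of _ "Suc m" "Suc (Suc m)"] carrier_matI)
qed

text \<open>The same double evaluation, with \<open>z w P\<close> in place of
  \<open>z P\<close>.\<close>

lemma gE_eq2:
  assumes "ok (Suc (Suc n)) (Suc m)" "ok (Suc n) (Suc (Suc m))"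
  shows "gG1 n (Suc m) * gE n (Suc m) =
    gA n m * gK1 (Suc n) (Suc m) * transpose_mat (gI n (Suc m)) + gE n m * mcnj (gG n (Suc m))"
proof -
  have o: "ok (Suc n) (Suc m)" by (rule ok_mono[OF assms(1)]) auto
  let ?X = "P n (Suc m)" and ?RY = "R n (Suc m) (P n (Suc (Suc m)))" and ?P = "P (Suc n) (Suc m)"
  have "gG1 n (Suc m) * gE n (Suc m) = lprod L (shift_z (shift_w ?X)) ?RY"
    using shift_RP[OF assms(2) col_in_shift(2)[OF P_facts(1)[OF o]]] by (simp add: gG1_def)
  also have "shift_z (shift_w ?X) = shift_w (shift_z ?X)" by (rule R_shift)
  also have "\<dots> = cmat (gE n m) * R n (Suc m) ?X + cmat (gA n m) * shift_w ?P"
    by (subst szego[OF assms(1)]) (simp add: smult_add_dim smult_cmat_mult R_shift)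
  also have "lprod L \<dots> ?RY = gE n m * lprod L (R n (Suc m) ?X) ?RY + gA n m * lprod L (shift_w ?P) ?RY"
    by (simp add: lprod_simps)
  also have "lprod L (R n (Suc m) ?X) ?RY = mcnj (gG n (Suc m))"
    by (simp add: R_gram(1) gG_def)
  also have "?RY = cmat (mcnj (gI n (Suc m))) * R n (Suc m) (Q (Suc n) (Suc m))
      + cmat (transpose_mat (gG n (Suc m))) * R n (Suc m) ?X"
    by (subst rec_I[OF assms(2)]) (simp add: star_col_add star_col_cmat_mult)
  also have "lprod L (shift_w ?P) \<dots> = gK1 (Suc n) (Suc m) * transpose_mat (gI n (Suc m))
      + lprod L (shift_w ?P) (R n (Suc m) ?X) * mcnj (gG n (Suc m))"
    by (simp add: lprod_simps gK1_def)
  also have "lprod L (shift_w ?P) (R n (Suc m) ?X) = 0\<^sub>m (Suc m) (Suc m)"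
    using orth_lprod(1)[OF orth_shift(2)[OF P_facts(2)[OF assms(1)]]
        col_in_shift_image(2)[OF RP_orth(2)[OF o]]] by (simp add: R_shift)
  finally show ?thesis
    by (simp add: mult_assoc_dim comm_add_mat[of _ "Suc m" "Suc (Suc m)"] carrier_matI)
qed

text \<open>Modulo the box shifted by \<open>z\<close>, the column \<open>Y\<close> is a combination
  of the reversed column of degree \<open>n\<close>, and the reversed column of degree
  \<open>n + 1\<close> is orthogonal to that shifted box.\<close>

lemma RP_gA:
  assumes "ok (Suc (Suc n)) (Suc m)" "col_in Y (V (Suc n) (Suc m))"
  shows "lprod L (R (Suc n) m (P (Suc n) (Suc m))) Y =
    transpose_mat (gA n m) * lprod L (R n m (P n (Suc m))) Y"
proof -
  have o: "ok (Suc n) (Suc m)" by (rule ok_mono[OF assms(1)]) auto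
  let ?RP = "R n m (P n (Suc m))" and ?RP' = "R (Suc n) m (P (Suc n) (Suc m))"
  let ?C = "lprod L Y ?RP"
  have Y: "dim_col Y = 1" using assms(2) by (simp add: col_in_def)
  have "col_in (Y - cmat ?C * ?RP) ((*) (M 1 0) ` V n (Suc m))"
    by (rule onbD(5)[OF onb_RP[OF o] assms(2)])
  moreover have "orth ?RP' ((*) (M 1 0) ` V n (Suc m))"
    using RP_orth(1)[OF assms(1)] by (rule orth_mono) (use V_mono[of n "Suc n" "Suc m" "Suc m"] in auto)
  ultimately have "lprod L (Y - cmat ?C * ?RP) ?RP' = 0\<^sub>m (dim_row Y) (Suc m)"
    using orth_lprod(2) by fastforce
  then have "lprod L Y ?RP' - ?C * lprod L ?RP ?RP' = 0\<^sub>m (dim_row Y) (Suc m)"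
    using Y by (simp add: lprod_simps)
  then have "(lprod L Y ?RP' - ?C * lprod L ?RP ?RP') $$ (i, j) = 0" if "i < dim_row Y" "j < Suc m" for i j
    using that by (simp del: index_mult_mat(1))
  then have "lprod L Y ?RP' = ?C * lprod L ?RP ?RP'"
    by (intro eq_matI) (auto simp del: index_mult_mat(1))
  moreover have "lprod L ?RP ?RP' = mcnj (gA n m)"
  proof -
    have "mcnj (gA n m) = lprod L (R (Suc n) m (shift_z (P n (Suc m)))) ?RP'"
      by (simp add: gA_def R_gram(1))
    then show ?thesis by (simp add: R_shift)
  qed
  ultimately have "mat_adjoint (lprod L Y ?RP') = mat_adjoint (?C * mcnj (gA n m))" by simp
  then show ?thesis using Y by (simp add: lprod_swap adjoint_mult)
qed

section \<open>Exchange of the two variables\<close>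

interpretation swap: bicircle L "\<lambda>a b. M b a" "\<lambda>a b. V b a" "\<lambda>a b. Q b a" "\<lambda>a b. P b a" "\<lambda>a b. ok b a"
  by (rule swapped)

text \<open>The dictionary for the exchange: a Gram matrix between a \<open>P\<close> and a
  \<open>Q\<close> becomes its adjoint, or its transpose when one of the two is reversed.\<close>

lemma swap_g:
  "swap.gK m n = mat_adjoint (gK n m)" "swap.gG m n = gtG n m" "swap.gG1 m n = gtG1 n m"
  "swap.gtG m n = gG n m" "swap.gtG1 m n = gG1 n m" "swap.gE m n = gtE n m" "swap.gA m n = gtA n m"
  "swap.gtE m n = gE n m" "swap.gtA m n = gA n m"
  "swap.gI m n = mat_adjoint (gI n m)" "swap.gI1 m n = transpose_mat (gI1 n m)"
  "swap.gK1 m n = transpose_mat (gK1 n m)"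
proof -
  show "swap.gK m n = mat_adjoint (gK n m)" "swap.gG m n = gtG n m" "swap.gG1 m n = gtG1 n m"
    "swap.gtG m n = gG n m" "swap.gtG1 m n = gG1 n m" "swap.gE m n = gtE n m" "swap.gA m n = gtA n m"
    "swap.gtE m n = gE n m" "swap.gtA m n = gA n m" "swap.gI m n = mat_adjoint (gI n m)"
    by (simp_all add: g_defs swap.g_defs lprod_swap)
  have "lprod L (R n m (Q (Suc n) m)) (P n (Suc m)) = mcnj (lprod L (Q (Suc n) m) (R n m (P n (Suc m))))"
    by (rule R_gram(4)) simp_all
  also have "lprod L (Q (Suc n) m) (R n m (P n (Suc m))) = mat_adjoint (gI1 n m)"
    by (simp add: gI1_def lprod_swap)
  finally show "swap.gI1 m n = transpose_mat (gI1 n m)" by (simp add: swap.gI1_def)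
  show "swap.gK1 m n = transpose_mat (gK1 n m)"
  \<comment> \<open>The two sides reverse with exponents \<open>n - 1\<close> and
    \<open>m - 1\<close>, which is sensible only for positive \<open>n\<close> and \<open>m\<close>;
    otherwise the matrices are empty.\<close>
  proof (cases "n = 0 \<or> m = 0")
    case True
    then show ?thesis by (intro eq_dim_0) auto
  next
    case False
    then obtain n' m' where nm: "n = Suc n'" "m = Suc m'" by (meson not0_implies_Suc)
    have "swap.gK1 m n = lprod L (R n m (R n' m (Q n m))) (R n m (shift_w (P n m)))"
      by (simp add: swap.gK1_def nm R_shift)
    also have "\<dots> = mcnj (lprod L (R n' m (Q n m)) (shift_w (P n m)))"
      by (simp add: R_gram(1))
    also have "\<dots> = mcnj (mat_adjoint (gK1 n m))"
      by (simp add: gK1_def nm lprod_swap)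
    finally show ?thesis by simp
  qed
qed

lemma rec_tI:
  assumes "ok (Suc n) (Suc m)"
  shows "Q (Suc n) m = cmat (mat_adjoint (gI n m)) * P n (Suc m) + cmat (mat_adjoint (gtG n m)) * Q n m"
  using swap.rec_I[OF assms] by (simp add: swap_g)

lemma gtG_norm:
  assumes "ok (Suc n) (Suc m)"
  shows "mat_adjoint (gK n m) * gK n m + gtG n m * mat_adjoint (gtG n m) = 1\<^sub>m n"
  using swap.gG_norm[OF assms] by (simp add: swap_g)

lemma szego_Q_rev:
  assumes "ok (Suc n) (Suc (Suc m))"
  shows "R n m (Q (Suc n) m) = cmat (mcnj (gtE n m)) * shift_w (Q (Suc n) m)
    + cmat (mcnj (gtA n m)) * R n (Suc m) (Q (Suc n) (Suc m))"
  using swap.szego_rev[OF assms] by (simp add: swap_g)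

lemma szego_Q:
  assumes "ok (Suc n) (Suc (Suc m))"
  shows "shift_w (Q (Suc n) m) = cmat (gtE n m) * R n m (Q (Suc n) m)
    + cmat (gtA n m) * Q (Suc n) (Suc m)"
  using swap.szego[OF assms] by (simp add: swap_g)

lemma gtE_sym: "transpose_mat (gtE n m) = gtE n m"
  using swap.gE_sym[of m n] by (simp add: swap_g)

lemma gtA_norm:
  assumes "ok (Suc n) (Suc (Suc m))"
  shows "gtE n m * mat_adjoint (gtE n m) + gtA n m * mat_adjoint (gtA n m) = 1\<^sub>m (Suc n)"
  using swap.gA_norm[OF assms] by (simp add: swap_g)

lemma conj_tA_mult:
  assumes "ok (Suc n) (Suc (Suc m))"
  shows "mcnj (gtA n m) * lprod L (R n (Suc m) (Q (Suc n) (Suc m))) (Q (Suc n) (Suc m)) =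
    - (mat_adjoint (gtE n m) * gtA n m)"
  using swap.conjA_mult[OF assms] by (simp add: swap_g)

lemma gtE_eq1:
  assumes "ok (Suc (Suc n)) (Suc m)" "ok (Suc n) (Suc (Suc m))"
  shows "gtG (Suc n) m * gtE (Suc n) m =
    gtA n m * mat_adjoint (gK (Suc n) (Suc m)) * mcnj (gI1 (Suc n) m) + gtE n m * mcnj (gtG1 (Suc n) m)"
  using swap.gE_eq1[OF assms(2,1)] by (simp add: swap_g)

lemma gtE_eq2:
  assumes "ok (Suc (Suc n)) (Suc m)" "ok (Suc n) (Suc (Suc m))"
  shows "gtG1 (Suc n) m * gtE (Suc n) m =
    gtA n m * transpose_mat (gK1 (Suc n) (Suc m)) * mcnj (gI (Suc n) m) + gtE n m * mcnj (gtG (Suc n) m)"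
  using swap.gE_eq2[OF assms(2,1)] by (simp add: swap_g)

text \<open>\<open>Q\<close> is expanded by \<open>rec_tI\<close>. The factor
  \<open>mcnj (gA n m)\<close> stays on the left because \<open>conjA_mult\<close> gives the needed
  inner product only together with it.\<close>

lemma gI1_rec:
  assumes "ok (Suc (Suc n)) (Suc m)"
  shows "mcnj (gA n m) * gI1 (Suc n) m = - (mat_adjoint (gE n m) * gA n m * gI (Suc n) m)
    + mcnj (gA n m) * (transpose_mat (gA n m) * gI1 n m * gtG (Suc n) m)"
proof -
  have o: "ok (Suc n) (Suc m)" by (rule ok_mono[OF assms]) auto
  let ?P = "P (Suc n) (Suc m)" and ?RP = "R (Suc n) m (P (Suc n) (Suc m))"
  have "gI1 (Suc n) m = lprod L ?RP ?P * gI (Suc n) m + lprod L ?RP (Q (Suc n) m) * gtG (Suc n) m"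
    unfolding gI1_def by (subst rec_tI[OF assms]) (simp add: lprod_simps)
  also have "lprod L ?RP (Q (Suc n) m) = transpose_mat (gA n m) * gI1 n m"
    unfolding gI1_def by (rule RP_gA[OF assms Q_facts(1)[OF o]])
  finally have "mcnj (gA n m) * gI1 (Suc n) m = mcnj (gA n m) * lprod L ?RP ?P * gI (Suc n) m
      + mcnj (gA n m) * (transpose_mat (gA n m) * gI1 n m * gtG (Suc n) m)"
    by (simp add: mult_add_dim mult_assoc_dim)
  then show ?thesis by (simp add: conjA_mult[OF assms] uminus_mult_dim)
qed

text \<open>The left argument is lowered by \<open>rec_P\<close>, the right one by the reversed
  Szego recurrence; the mixed terms cancel because shifted \<open>Q\<close> is orthonormal.\<close>

lemma gK1_rows:
  assumes "ok (Suc (Suc n)) (Suc m)" "ok (Suc n) (Suc (Suc m))"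
  shows "gG (Suc n) m * gK1 (Suc n) (Suc m) * transpose_mat (gtA n m) =
    gK1 (Suc n) m - gK (Suc n) m * gtE n m"
proof -
  let ?P = "P (Suc n) (Suc m)" and ?Pm = "P (Suc n) m" and ?Q = "Q (Suc n) m"
  let ?RQ = "R n (Suc m) (Q (Suc n) (Suc m))" and ?RQm = "R n m (Q (Suc n) m)"
  have "shift_w ?Pm = cmat (gK (Suc n) m) * shift_w ?Q + cmat (gG (Suc n) m) * shift_w ?P"
    by (subst rec_P[OF assms(1)]) (simp add: smult_add_dim smult_cmat_mult)
  then have "lprod L (shift_w ?Pm) Y = gK (Suc n) m * lprod L (shift_w ?Q) Y + gG (Suc n) m * lprod L (shift_w ?P) Y"
    if "dim_col Y = 1" for Y
    using that by (simp add: lprod_simps)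
  then have 1: "gG (Suc n) m * lprod L (shift_w ?P) Y = lprod L (shift_w ?Pm) Y - gK (Suc n) m * lprod L (shift_w ?Q) Y"
    if "dim_col Y = 1" for Y
    using that by (intro add_eq_minus_dim(2)) auto
  have 2: "lprod L X ?RQ * transpose_mat (gtA n m) = lprod L X ?RQm - lprod L X (shift_w ?Q) * transpose_mat (gtE n m)"
    if "dim_col X = 1" for X
  proof (rule add_eq_minus_dim(2))
    show "lprod L X (shift_w ?Q) * transpose_mat (gtE n m) + lprod L X ?RQ * transpose_mat (gtA n m) = lprod L X ?RQm"
      using that by (subst szego_Q_rev[OF assms(2)]) (simp add: lprod_simps)
  qed auto
  have K: "lprod L (shift_w ?Pm) (shift_w ?Q) = gK (Suc n) m" by (simp add: R_gram gK_def)
  have Q: "lprod L (shift_w ?Q) (shift_w ?Q) = 1\<^sub>m (Suc n)"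
    using assms Q_facts(3)[of "Suc n" m] by (simp add: R_gram ok_mono)
  have "gG (Suc n) m * gK1 (Suc n) (Suc m) * transpose_mat (gtA n m) =
     (lprod L (shift_w ?Pm) ?RQ - gK (Suc n) m * lprod L (shift_w ?Q) ?RQ) * transpose_mat (gtA n m)"
    using 1[of ?RQ] by (simp add: gK1_def)
  also have "\<dots> = lprod L (shift_w ?Pm) ?RQ * transpose_mat (gtA n m)
      - gK (Suc n) m * (lprod L (shift_w ?Q) ?RQ * transpose_mat (gtA n m))"
    by (simp add: minus_mult_dim mult_assoc_dim)
  also have "\<dots> = (lprod L (shift_w ?Pm) ?RQm - gK (Suc n) m * transpose_mat (gtE n m))
      - gK (Suc n) m * (lprod L (shift_w ?Q) ?RQm - transpose_mat (gtE n m))"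
    by (simp add: 2 K Q)
  also have "\<dots> = gK1 (Suc n) m - gK (Suc n) m * gtE n m"
    by (rule eq_matI)
       (auto simp: mult_minus_dim gK1_def R_shift simp del: index_mult_mat(1) simp flip: gtE_def)
  finally show ?thesis .
qed

text \<open>Only the box that contains \<open>P\<close> itself has to be positive, so this value is
  available before positivity of the next box is decided.\<close>

lemma L_wP_P:
  assumes "ok (Suc n) (Suc m)"
  shows "lprod L (shift_w (P n (Suc m))) (P n (Suc m)) =
    gI n m * gtE n m * transpose_mat (gI1 n m) + mat_adjoint (gG n m) * gG1 n m"
proof -
  let ?P = "P n (Suc m)" and ?Q = "Q (Suc n) m"
  have "lprod L (shift_w ?P) ?P = gI n m * lprod L (shift_w ?Q) ?P + mat_adjoint (gG n m) * lprod L (shift_w (P n m)) ?P"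
    by (subst rec_I[OF assms]) (simp add: smult_add_dim smult_cmat_mult lprod_simps)
  also have "lprod L (shift_w (P n m)) ?P = gG1 n m" by (simp add: gG1_def)
  also have "lprod L (shift_w ?Q) ?P = transpose_mat (lprod L (shift_w (R n m ?P)) (R n m ?Q))"
  proof -
    have "lprod L (shift_w ?Q) ?P = mcnj (lprod L (R n (Suc m) (shift_w ?Q)) (R n (Suc m) ?P))"
      by (simp add: R_gram(1))
    also have "\<dots> = mcnj (mat_adjoint (lprod L (R n (Suc m) ?P) (R n m ?Q)))"
      by (simp add: R_shift lprod_swap)
    finally show ?thesis by (simp add: R_shift)
  qed
  also have "lprod L (shift_w (R n m ?P)) (R n m ?Q) = gI1 n m * gtE n m"
    using swap.shift_RP[OF assms RP_orth(2)[OF assms]] by (simp add: swap_g gI1_def)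
  finally show ?thesis by (simp add: transpose_mult_dim gtE_sym mult_assoc_dim)
qed

text \<open>Modulo the box shifted by \<open>w\<close>, to which \<open>w P\<close> is orthogonal,
  \<open>Q\<close> is a combination of its own reversal.\<close>

lemma L_wP_Q:
  assumes "ok (Suc (Suc n)) (Suc m)" "ok (Suc n) (Suc (Suc m))"
  shows "lprod L (shift_w (P (Suc n) (Suc m))) (Q (Suc n) (Suc m)) =
    gK1 (Suc n) (Suc m) * lprod L (R n (Suc m) (Q (Suc n) (Suc m))) (Q (Suc n) (Suc m))"
proof -
  let ?wP = "shift_w (P (Suc n) (Suc m))" and ?Q = "Q (Suc n) (Suc m)" and ?RQ = "R n (Suc m) (Q (Suc n) (Suc m))"
  let ?C = "lprod L ?Q ?RQ"
  have "col_in (?Q - cmat ?C * ?RQ) ((*) (M 0 1) ` V (Suc n) (Suc m))"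
    by (rule onbD(5)[OF onb_RQ[OF assms(2)] Q_facts(1)[OF assms(2)]])
  then have "lprod L ?wP (?Q - cmat ?C * ?RQ) = 0\<^sub>m (Suc m) (Suc n)"
    using orth_lprod(1)[OF orth_shift(2)[OF P_facts(2)[OF assms(1)]]] by simp
  then have "lprod L ?wP ?Q - lprod L ?wP ?RQ * mat_adjoint ?C = 0\<^sub>m (Suc m) (Suc n)"
    by (simp add: lprod_simps)
  then have "(lprod L ?wP ?Q - lprod L ?wP ?RQ * mat_adjoint ?C) $$ (i, j) = 0" if "i < Suc m" "j < Suc n" for i j
    using that by (simp del: index_mult_mat(1))
  then have "lprod L ?wP ?Q = lprod L ?wP ?RQ * mat_adjoint ?C"
    by (intro eq_matI) (auto simp del: index_mult_mat(1))
  then show ?thesis by (simp add: gK1_def lprod_swap)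
qed

end

context bicircle
begin

lemma gK1_cols:
  assumes "ok (Suc (Suc n)) (Suc m)" "ok (Suc n) (Suc (Suc m))"
  shows "gA n m * gK1 (Suc n) (Suc m) * transpose_mat (gtG n (Suc m)) =
    gK1 n (Suc m) - gE n m * mcnj (gK n (Suc m))"
proof -
  interpret swap: bicircle L "\<lambda>a b. M b a" "\<lambda>a b. V b a" "\<lambda>a b. Q b a" "\<lambda>a b. P b a" "\<lambda>a b. ok b a"
    by (rule swapped)
  note s = swap_g
  have "gtG n (Suc m) * transpose_mat (gK1 (Suc n) (Suc m)) * transpose_mat (gA n m) =
      transpose_mat (gK1 n (Suc m)) - mat_adjoint (gK n (Suc m)) * gE n m"
    using swap.gK1_rows[OF assms(2,1)] by (simp add: s)
  from arg_cong[OF this, of transpose_mat] show ?thesis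
    by (simp add: transpose_mult_dim conj_trans_add gE_sym mult_assoc_dim)
qed

end

declare split_paired_All [simp del] split_paired_Ex [simp del]

subsection \<open>Gram-Schmidt orthogonalisation of monomials\<close>

abbreviation mono :: "int \<times> int \<Rightarrow> laurent" where "mono k \<equiv> zw (fst k) (snd k)"

lemma lcoeff_mono: "lcoeff (mono k) l = (if l = k then 1 else 0)"
  by (cases k) (simp add: lcoeff_zw)

context herm
begin

lemma L_cst_mult: "L (p * (cst c * q)) = c * L (p * q)" "L (p * cst c) = c * L p"
  "L (cst c * p * q) = c * L (p * q)"
  using L_cst[of c "p * q"] L_cst[of c p] by (simp_all only: mult_ac)

text \<open>In the inductive step the residual \<open>r\<close> of the new monomial is a direction
  orthogonal to the old span, and one further coefficient along \<open>r\<close> corrects the old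
  projection.\<close>

lemma proj_exists:
  assumes "finite S" "pd (mono_span S)"
  shows "\<exists>q\<in>mono_span S. \<forall>y\<in>mono_span S. L ((x - q) * lstar y) = 0"
  using assms
proof (induction S arbitrary: x)
  case empty
  show ?case by (intro bexI[of _ 0]) (auto simp: mono_span_def)
next
  case (insert s S)
  have sub: "mono_span S \<subseteq> mono_span (insert s S)" by (rule mono_span_mono) auto
  note IH = insert.IH[OF pd_mono[OF insert.prems sub]]
  note sp = lsubspaceD[OF lsubspace_mono_span[of "insert s S"]]
  obtain q0 where q0: "q0 \<in> mono_span S" "\<And>y. y \<in> mono_span S \<Longrightarrow> L ((mono s - q0) * lstar y) = 0"
    using IH[of "mono s"] by blast
  obtain q where q: "q \<in> mono_span S" "\<And>y. y \<in> mono_span S \<Longrightarrow> L ((x - q) * lstar y) = 0"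
    using IH[of x] by blast
  define r where "r = mono s - q0"
  have r_s: "lcoeff r s = 1"
    using q0(1) insert.hyps by (simp add: r_def lookup_minus lcoeff_mono mono_span_iff)
  have r_in: "r \<in> mono_span (insert s S)"
    unfolding r_def using q0(1) sub by (intro sp(4)) (auto simp: mono_span_iff lcoeff_mono)
  have "r \<noteq> 0" using r_s by auto
  then have r_pos: "0 < L (r * lstar r)" using r_in insert.prems by (auto simp: pd_def)
  define c where "c = L ((x - q) * lstar r) / L (r * lstar r)"
  have "L ((x - (q + cst c * r)) * lstar y) = 0" if y: "y \<in> mono_span (insert s S)" for y
  proof -
    \<comment> \<open>As \<open>r\<close> has coefficient 1 at \<open>s\<close>, this subtraction
      moves \<open>y\<close> into the old span.\<close>
    define y' where "y' = y - cst (lcoeff y s) * r"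
    have "lcoeff y' k = 0" if "k \<notin> S" for k
      using y r_in r_s that by (cases "k = s") (simp_all add: mono_span_iff y'_def lookup_minus)
    then have y': "y' \<in> mono_span S" by (simp add: mono_span_iff)
    have "(x - (q + cst c * r)) * lstar y = (x - q) * lstar y' - cst c * (r * lstar y')
      + cst (cnj (lcoeff y s)) * ((x - q) * lstar r - cst c * (r * lstar r))"
      by (simp add: y'_def algebra_simps)
    then have "L ((x - (q + cst c * r)) * lstar y) = L ((x - q) * lstar y') - c * L (r * lstar y')
      + cnj (lcoeff y s) * (L ((x - q) * lstar r) - c * L (r * lstar r))"
      by (simp only: L_add L_diff L_cst)
    moreover have "c * L (r * lstar r) = L ((x - q) * lstar r)"
      using r_pos by (auto simp: c_def)
    ultimately show ?thesis
      using q(2)[OF y'] q0(2)[OF y'] by (simp add: r_def[symmetric])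
  qed
  moreover have "q + cst c * r \<in> mono_span (insert s S)"
    using q(1) sub r_in by (intro sp(2,3)) auto
  ultimately show ?case by blast
qed

text \<open>The predicate inside the definite description \<open>onpoly\<close>, so that existence
  and uniqueness can be treated separately.\<close>

definition is_onpoly :: "(int \<times> int) set \<Rightarrow> int \<times> int \<Rightarrow> laurent \<Rightarrow> bool" where
  "is_onpoly A k p \<longleftrightarrow> p \<in> mono_span A \<and> L (p * lstar p) = 1 \<and> 0 < lcoeff p k \<and>
     (\<forall>(i, j)\<in>A - {k}. L (p * lstar (zw i j)) = 0)"

lemma is_onpoly_orth:
  assumes "is_onpoly A k p" "finite A" "y \<in> mono_span (A - {k})"
  shows "L (p * lstar y) = 0"
proof -
  have "L (p * lstar y) = (\<Sum>l\<in>A - {k}. cnj (lcoeff y l) * L (p * lstar (mono l)))"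
    using assms(2) by (subst mono_span_expand[OF _ assms(3)])
      (simp_all add: lstar_sum sum_distrib_left L_sum case_prod_unfold L_cst_mult
        del: lstar_zw)
  also have "\<dots> = 0"
    using assms(1) by (intro sum.neutral) (auto simp: is_onpoly_def simp del: lstar_zw)
  finally show ?thesis .
qed

text \<open>Subtracting the multiple of \<open>p\<close> with the same coefficient at
  \<open>k\<close> leaves something orthogonal to \<open>p\<close>. Inner products with orthonormal
  polynomials thus become quotients of coefficients.\<close>

lemma is_onpoly_inner:
  assumes "is_onpoly A k p" "finite A" "x \<in> mono_span A"
  shows "L (x * lstar p) = lcoeff x k / lcoeff p k"
proof -
  define y where "y = x - cst (lcoeff x k / lcoeff p k) * p"
  have pk: "lcoeff p k \<noteq> 0" "p \<in> mono_span A" "L (p * lstar p) = 1"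
    using assms(1) by (auto simp: is_onpoly_def)
  have "y \<in> mono_span (A - {k})"
    using assms(3) pk by (auto simp: mono_span_iff y_def lookup_minus)
  then have "L (y * lstar p) = 0"
    using is_onpoly_orth[OF assms(1,2)] L_swap[of y p] by simp
  moreover have "x * lstar p = y * lstar p + cst (lcoeff x k / lcoeff p k) * (p * lstar p)"
    by (simp add: y_def algebra_simps)
  ultimately show ?thesis using pk by (simp add: L_add L_cst)
qed

text \<open>With \<open>q\<close> scaled to the leading coefficient of \<open>p\<close>, the
  difference is orthogonal to itself; the scaling factor is positive with square 1.\<close>

lemma is_onpoly_unique:
  assumes "is_onpoly A k p" "is_onpoly A k q" "finite A" "pd (mono_span A)"
  shows "p = q"
proof -
  define c where "c = lcoeff p k / lcoeff q k"
  have pq: "p \<in> mono_span A" "q \<in> mono_span A" "0 < lcoeff p k" "0 < lcoeff q k"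
    "L (p * lstar p) = 1" "L (q * lstar q) = 1"
    using assms(1,2) by (auto simp: is_onpoly_def)
  define y where "y = p - cst c * q"
  have c: "0 < c" using pq by (auto simp: c_def less_complex_def complex_eq_iff Re_divide Im_divide)
  have yA: "y \<in> mono_span (A - {k})"
    using pq by (auto simp: mono_span_iff y_def lookup_minus c_def)
  have "y * lstar y = p * lstar y - cst c * (q * lstar y)"
    by (simp add: y_def[THEN arg_cong, of "\<lambda>z. z * lstar y"] algebra_simps)
  then have "L (y * lstar y) = L (p * lstar y) - c * L (q * lstar y)"
    by (simp only: L_diff L_cst)
  also have "\<dots> = 0" using is_onpoly_orth[OF assms(1,3) yA] is_onpoly_orth[OF assms(2,3) yA] by simp
  finally have "y = 0"
    using assms(4) yA mono_span_mono[of "A - {k}" A] by (force simp: pd_def)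
  then have p: "p = cst c * q" by (simp add: y_def)
  have "1 = c * cnj c * L (q * lstar q)"
  proof -
    have "p * lstar p = cst c * (cst (cnj c) * (q * lstar q))" by (simp add: p mult_ac)
    then show ?thesis using pq(5) by (simp only: L_cst mult.assoc)
  qed
  then have "c * c = 1" using pq(6) c by (simp add: less_complex_def complex_eq_iff)
  then have "c = 1 \<or> c = - 1" by (simp add: square_eq_1_iff)
  then have "c = 1" using c by (auto simp: less_complex_def)
  then show ?thesis using p by simp
qed

lemma is_onpoly_exists:
  assumes "finite A" "k \<in> A" "pd (mono_span A)"
  shows "\<exists>p. is_onpoly A k p"
proof -
  have sub: "mono_span (A - {k}) \<subseteq> mono_span A" by (rule mono_span_mono) auto
  obtain q where q: "q \<in> mono_span (A - {k})"
    "\<And>y. y \<in> mono_span (A - {k}) \<Longrightarrow> L ((mono k - q) * lstar y) = 0"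
    using proj_exists[of "A - {k}" "mono k"] assms pd_mono[OF assms(3) sub] by blast
  define r where "r = mono k - q"
  have rk: "lcoeff r k = 1" using q(1) by (simp add: r_def lookup_minus lcoeff_mono mono_span_iff)
  have rA: "r \<in> mono_span A" using q(1) assms(2)
    by (auto simp: r_def mono_span_iff lookup_minus lcoeff_mono)
  have "r \<noteq> 0" using rk by auto
  then have pos: "0 < L (r * lstar r)" using rA assms(3) by (auto simp: pd_def)
  define s where "s = sqrt (Re (L (r * lstar r)))"
  have s: "0 < s" "L (r * lstar r) = complex_of_real (s * s)"
    using pos by (auto simp: s_def less_complex_def complex_eq_iff)
  define c where "c = complex_of_real (1 / s)"
  have "cst c * r * lstar (cst c * r) = cst c * (cst (cnj c) * (r * lstar r))" by (simp add: mult_ac)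
  then have "L (cst c * r * lstar (cst c * r)) = c * (cnj c * L (r * lstar r))" by (simp only: L_cst)
  also have "\<dots> = 1" using s by (simp add: c_def)
  finally have "L (cst c * r * lstar (cst c * r)) = 1" .
  moreover have "cst c * r \<in> mono_span A" using rA lsubspaceD(3)[OF lsubspace_mono_span] by blast
  moreover have "0 < lcoeff (cst c * r) k" using s rk by (simp add: c_def less_complex_def)
  moreover have "L (cst c * r * lstar (zw i j)) = 0" if "(i, j) \<in> A - {k}" for i j
    using q(2)[OF zw_mono_span[OF that]] by (simp add: mult.assoc L_cst flip: r_def)
  ultimately show ?thesis unfolding is_onpoly_def by blast
qed

lemma onpoly_is_onpoly:
  assumes "finite A" "k \<in> A" "pd (mono_span A)"
  shows "is_onpoly A k (onpoly L A k)"
proof -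
  have "\<exists>!p. is_onpoly A k p"
    using is_onpoly_exists[OF assms] is_onpoly_unique[OF _ _ assms(1,3)] by blast
  from theI'[OF this] show ?thesis unfolding onpoly_def is_onpoly_def by simp
qed

lemma onpoly_eqI:
  assumes "is_onpoly A k p" "finite A" "k \<in> A" "pd (mono_span A)"
  shows "onpoly L A k = p"
  using is_onpoly_unique[OF onpoly_is_onpoly[OF assms(2-4)] assms(1,2,4)] .

end

text \<open>Each row is built from the monomials of \<open>ks\<close> from its own position on, so
  the leading coefficients form an upper triangular matrix.\<close>

definition gscol :: "(laurent \<Rightarrow> complex) \<Rightarrow> (int \<times> int) set \<Rightarrow> (int \<times> int) list \<Rightarrow> laurent mat" where
  "gscol L T ks = mat (length ks) 1 (\<lambda>(r, _). onpoly L (T \<union> set (drop r ks)) (ks ! r))"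

text \<open>The common form of \<open>zlead\<close> and \<open>wlead\<close>, for an arbitrary list
  of monomials.\<close>

definition cfm :: "(int \<times> int) list \<Rightarrow> laurent mat \<Rightarrow> complex mat" where
  "cfm ks X = mat (dim_row X) (length ks) (\<lambda>(r, c). lcoeff (X $$ (r, 0)) (ks ! c))"

lemma gscol_dim [simp]: "dim_row (gscol L T ks) = length ks" "dim_col (gscol L T ks) = 1"
  and gscol_index: "r < length ks \<Longrightarrow> gscol L T ks $$ (r, 0) = onpoly L (T \<union> set (drop r ks)) (ks ! r)"
  by (auto simp: gscol_def)

lemma cfm_dim [simp]: "dim_row (cfm ks X) = dim_row X" "dim_col (cfm ks X) = length ks"
  and cfm_index: "i < dim_row X \<Longrightarrow> j < length ks \<Longrightarrow> cfm ks X $$ (i, j) = lcoeff (X $$ (i, 0)) (ks ! j)"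
  by (auto simp: cfm_def)

lemma cfm_cmat_mult:
  assumes "dim_col A = dim_row X" "dim_col X = 1"
  shows "cfm ks (cmat A * X) = A * cfm ks X"
proof (rule eq_matI)
  fix i j assume "i < dim_row (A * cfm ks X)" "j < dim_col (A * cfm ks X)"
  then show "cfm ks (cmat A * X) $$ (i, j) = (A * cfm ks X) $$ (i, j)"
    using assms by (simp add: cfm_index cmat_mult_index lookup_sum mult_mat_index[where n = "dim_row X"]
      del: index_mult_mat(1))
qed (use assms in auto)

lemma cfm_diff:
  assumes "dim_row X = dim_row Y" "dim_col X = 1" "dim_col Y = 1"
  shows "cfm ks (X - Y) = cfm ks X - cfm ks Y"
  by (rule eq_matI) (use assms in \<open>auto simp: cfm_index lookup_minus\<close>)

lemma cfm_zero:
  assumes "col_in X (mono_span T)" "set ks \<inter> T = {}"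
  shows "cfm ks X = 0\<^sub>m (dim_row X) (length ks)"
proof (rule eq_matI)
  fix i j assume ij: "i < dim_row (0\<^sub>m (dim_row X) (length ks))" "j < dim_col (0\<^sub>m (dim_row X) (length ks))"
  then have "ks ! j \<notin> T" using assms(2) by (auto dest: nth_mem)
  then show "cfm ks X $$ (i, j) = 0\<^sub>m (dim_row X) (length ks) $$ (i, j)"
    using ij assms(1) by (simp add: cfm_index col_in_def mono_span_iff)
qed auto

lemma col_in_cfm:
  assumes "col_in X (mono_span (T \<union> set ks))" "cfm ks X = 0\<^sub>m (dim_row X) (length ks)"
  shows "col_in X (mono_span T)"
proof -
  have "lcoeff (X $$ (i, 0)) k = 0" if ik: "i < dim_row X" "k \<in> set ks" for i k
  proof -
    obtain j where "j < length ks" "k = ks ! j" using ik(2) by (metis in_set_conv_nth)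
    then show ?thesis using arg_cong[OF assms(2), of "\<lambda>A. A $$ (i, j)"] ik by (simp add: cfm_index)
  qed
  then show ?thesis using assms(1) by (simp add: col_in_def mono_span_iff) blast
qed

lemma set_drop_Suc: "r < length ks \<Longrightarrow> set (drop r ks) = insert (ks ! r) (set (drop (Suc r) ks))"
  by (metis Cons_nth_drop_Suc list.simps(15))

lemma nth_notin_drop: "distinct ks \<Longrightarrow> c < r \<Longrightarrow> c < length ks \<Longrightarrow> ks ! c \<notin> set (drop r ks)"
  by (auto simp: in_set_conv_nth nth_eq_iff_index_eq)

lemma set_drop_mono: "r \<le> s \<Longrightarrow> set (drop s ks) \<subseteq> set (drop r ks)"
  by (metis set_drop_subset_set_drop)

context herm
begin

context
  fixes T :: "(int \<times> int) set" and ks :: "(int \<times> int) list"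
  assumes T: "finite T" and ks: "distinct ks" "set ks \<inter> T = {}" and pd: "pd (mono_span (T \<union> set ks))"
begin

lemma gscol_is_onpoly:
  assumes "r < length ks"
  shows "is_onpoly (T \<union> set (drop r ks)) (ks ! r) (gscol L T ks $$ (r, 0))"
  unfolding gscol_index[OF assms]
proof (rule onpoly_is_onpoly)
  show "pd (mono_span (T \<union> set (drop r ks)))"
    by (rule pd_mono[OF pd mono_span_mono]) (use set_drop_subset in fastforce)
  show "ks ! r \<in> T \<union> set (drop r ks)" using set_drop_Suc[OF assms] by simp
qed (use T in simp)

lemma gscol_cfm:
  assumes "r < length ks" "c < length ks"
  shows "c < r \<Longrightarrow> cfm ks (gscol L T ks) $$ (r, c) = 0" "0 < cfm ks (gscol L T ks) $$ (r, r)"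
proof -
  assume "c < r"
  then have "ks ! c \<notin> T \<union> set (drop r ks)"
    using nth_notin_drop[OF ks(1) _ assms(2)] ks(2) assms(2) by (auto dest: nth_mem)
  then show "cfm ks (gscol L T ks) $$ (r, c) = 0"
    using gscol_is_onpoly[OF assms(1)] assms by (simp add: cfm_index is_onpoly_def mono_span_iff)
next
  show "0 < cfm ks (gscol L T ks) $$ (r, r)"
    using gscol_is_onpoly[OF assms(1)] assms by (simp add: cfm_index is_onpoly_def)
qed

lemma gscol_nonsing: "nonsing (length ks) (cfm ks (gscol L T ks))"
proof (rule nonsing_upper)
  fix i assume "i < length ks"
  then show "cfm ks (gscol L T ks) $$ (i, i) \<noteq> 0" using gscol_cfm(2)[of i i] by auto
qed (auto simp: gscol_cfm intro!: carrier_matI upper_triangularI)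

lemma gscol_orth: "orth (gscol L T ks) (mono_span T)"
  unfolding orth_def
proof (intro allI impI ballI)
  fix i y assume i: "i < dim_row (gscol L T ks)" and y: "y \<in> mono_span T"
  have "ks ! i \<in> set ks" using i by simp
  then have "T \<subseteq> T \<union> set (drop i ks) - {ks ! i}" using ks(2) by blast
  then have "y \<in> mono_span (T \<union> set (drop i ks) - {ks ! i})" using y mono_span_mono by blast
  then show "L (gscol L T ks $$ (i, 0) * lstar y) = 0"
    using is_onpoly_orth[OF gscol_is_onpoly, of i y] i T by simp
qed

lemma gscol_lprod:
  assumes "X $$ (i, 0) \<in> mono_span (T \<union> set (drop r ks))" "dim_col X = 1" "i < dim_row X" "r < length ks"
  shows "lprod L X (gscol L T ks) $$ (i, r) = lcoeff (X $$ (i, 0)) (ks ! r) / cfm ks (gscol L T ks) $$ (r, r)"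
  using is_onpoly_inner[OF gscol_is_onpoly[OF assms(4)], of "X $$ (i, 0)"] assms T
  by (simp add: lprod_index cfm_index)

lemma gscol_gram: "lprod L (gscol L T ks) (gscol L T ks) = 1\<^sub>m (length ks)"
proof -
  let ?F = "gscol L T ks"
  have lower: "lprod L ?F ?F $$ (i, j) = (if i = j then 1 else 0)" if "j \<le> i" "i < length ks" for i j
  proof (cases "i = j")
    case True
    then show ?thesis using gscol_is_onpoly[OF that(2)] that by (simp add: lprod_index is_onpoly_def)
  next
    case False
    have "?F $$ (i, 0) \<in> mono_span (T \<union> set (drop i ks))"
      using gscol_is_onpoly[OF that(2)] by (simp add: is_onpoly_def)
    moreover have "T \<union> set (drop i ks) \<subseteq> T \<union> set (drop j ks) - {ks ! j}"
    proof -
      have "ks ! j \<in> set ks" using that by simp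
      then have "ks ! j \<notin> T" using ks(2) by blast
      then show ?thesis
        using set_drop_mono[OF that(1), of ks] nth_notin_drop[OF ks(1), of j i] that False by auto
    qed
    ultimately have "L (?F $$ (j, 0) * lstar (?F $$ (i, 0))) = 0"
      using is_onpoly_orth[OF gscol_is_onpoly, of j "?F $$ (i, 0)"] that T mono_span_mono
      by (meson finite_UnI finite_set le_less_trans subsetD)
    then show ?thesis
      using False that L_swap[of "?F $$ (i, 0)" "?F $$ (j, 0)"] by (simp add: lprod_index)
  qed
  show ?thesis
  proof (rule eq_matI)
    fix i j assume ij: "i < dim_row (1\<^sub>m (length ks))" "j < dim_col (1\<^sub>m (length ks))"
    show "lprod L ?F ?F $$ (i, j) = 1\<^sub>m (length ks) $$ (i, j)"
    proof (cases "j \<le> i")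
      case False
      have "mat_adjoint (lprod L ?F ?F) = lprod L ?F ?F" by (simp add: lprod_swap)
      then have "lprod L ?F ?F $$ (i, j) = cnj (lprod L ?F ?F $$ (j, i))"
        using ij by (metis gscol_dim(1) index_one_mat(2,3) lprod_dim mat_adjoint_index)
      then show ?thesis using lower[of i j] False ij by simp
    qed (use lower ij in auto)
  qed auto
qed

end

text \<open>Invertible leading coefficients allow any column to be reduced into \<open>T\<close> by
  matching coefficients; orthonormality then identifies the matching matrix with the Gram
  matrix.\<close>

lemma onbI_cfm:
  assumes "set ks \<inter> T = {}" "col_in F (mono_span (T \<union> set ks))" "orth F (mono_span T)"
    "lprod L F F = 1\<^sub>m (length ks)" "dim_row F = length ks" "nonsing (length ks) (cfm ks F)"
  shows "onb (mono_span (T \<union> set ks)) (mono_span T) F"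
proof -
  have F: "dim_col F = 1" using assms(2) by (simp add: col_in_def)
  have "col_in (X - cmat (lprod L X F) * F) (mono_span T)"
    if X: "col_in X (mono_span (T \<union> set ks))" for X
  proof -
    have X1: "dim_col X = 1" using X by (simp add: col_in_def)
    define C where "C = cfm ks X * minv (cfm ks F)"
    have C: "dim_row C = dim_row X" "dim_col C = length ks"
      using assms(6) by (auto simp: C_def)
    define Y where "Y = X - cmat C * F"
    have Y1: "dim_row Y = dim_row X" "dim_col Y = 1" using C X1 F by (auto simp: Y_def)
    have "col_in Y (mono_span (T \<union> set ks))"
      unfolding Y_def using X assms C by (intro col_in_add col_in_cmat_mult lsubspace_mono_span) auto
    moreover have "cfm ks Y = 0\<^sub>m (dim_row Y) (length ks)"
      using X1 F C assms(5,6) nonsing_cancel_right[OF assms(6), of "cfm ks X"]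
      by (simp add: Y_def cfm_diff cfm_cmat_mult C_def)
    ultimately have YT: "col_in Y (mono_span T)" by (rule col_in_cfm)
    have "lprod L Y F = 0\<^sub>m (dim_row Y) (length ks)"
      using orth_lprod(2)[OF assms(3) YT F] assms(5) by simp
    then have "lprod L X F - C = 0\<^sub>m (dim_row X) (length ks)"
      using X1 F C assms(4,5) by (simp add: Y_def lprod_simps)
    then have "(lprod L X F - C) $$ (i, j) = 0" if "i < dim_row X" "j < length ks" for i j
      using that by simp
    then have "lprod L X F = C" using C assms(5) by (intro eq_matI) auto
    then show ?thesis using YT by (simp add: Y_def)
  qed
  moreover have "mono_span T \<subseteq> mono_span (T \<union> set ks)" by (rule mono_span_mono) auto
  ultimately show ?thesis using assms by (auto simp: onb_def)
qed

lemma gscol_onb: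
  assumes "finite T" "distinct ks" "set ks \<inter> T = {}" "pd (mono_span (T \<union> set ks))"
  shows "onb (mono_span (T \<union> set ks)) (mono_span T) (gscol L T ks)"
proof (rule onbI_cfm)
  show "col_in (gscol L T ks) (mono_span (T \<union> set ks))"
    unfolding col_in_def
  proof (intro conjI allI impI)
    fix i assume "i < dim_row (gscol L T ks)"
    then have "gscol L T ks $$ (i, 0) \<in> mono_span (T \<union> set (drop i ks))"
      using gscol_is_onpoly[OF assms, of i] by (simp add: is_onpoly_def)
    then show "gscol L T ks $$ (i, 0) \<in> mono_span (T \<union> set ks)"
      using mono_span_mono[of "T \<union> set (drop i ks)" "T \<union> set ks"] set_drop_subset[of i ks] by blast
  qed simp
qed (use assms gscol_orth gscol_gram gscol_nonsing in auto)

text \<open>The residual lies in \<open>T\<close> and has no coefficients at \<open>ks\<close>. Gram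
  matrices are therefore quotients of leading coefficient matrices, which is how the algorithm
  defines several of them.\<close>

lemma onb_cfm:
  assumes "onb S (mono_span T) F" "set ks \<inter> T = {}" "col_in X S"
  shows "cfm ks X = lprod L X F * cfm ks F"
proof -
  note F = onbD[OF assms(1)]
  have X: "dim_col X = 1" using assms(3) by (simp add: col_in_def)
  have "cfm ks (X - cmat (lprod L X F) * F) = 0\<^sub>m (dim_row X) (length ks)"
    using cfm_zero[OF F(5)[OF assms(3)] assms(2)] by simp
  then have "cfm ks X - lprod L X F * cfm ks F = 0\<^sub>m (dim_row X) (length ks)"
    using X F(6) by (simp add: cfm_diff cfm_cmat_mult)
  then have "(cfm ks X - lprod L X F * cfm ks F) $$ (i, j) = 0" if "i < dim_row X" "j < length ks" for i j
    using that by (simp del: index_mult_mat(1))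
  then show ?thesis by (intro eq_matI) (auto simp del: index_mult_mat(1))
qed

end

subsection \<open>The orthonormal columns of a functional\<close>

definition box :: "nat \<Rightarrow> nat \<Rightarrow> (int \<times> int) set" where
  "box a b = {0..<int a} \<times> {0..<int b}"

text \<open>The powers of \<open>w\<close> descend, to match the columns of
  \<open>zlead\<close>.\<close>

definition zkeys :: "nat \<Rightarrow> nat \<Rightarrow> (int \<times> int) list" where
  "zkeys n k = map (\<lambda>r. (int n, int k - 1 - int r)) [0..<k]"

definition wkeys :: "nat \<Rightarrow> nat \<Rightarrow> (int \<times> int) list" where
  "wkeys k m = map (\<lambda>r. (int k - 1 - int r, int m)) [0..<k]"

abbreviation Vbox :: "nat \<Rightarrow> nat \<Rightarrow> laurent set" where "Vbox a b \<equiv> mono_span (box a b)"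

definition Pcol :: "(laurent \<Rightarrow> complex) \<Rightarrow> nat \<Rightarrow> nat \<Rightarrow> laurent mat" where
  "Pcol L n k = gscol L (box n k) (zkeys n k)"

definition Qcol :: "(laurent \<Rightarrow> complex) \<Rightarrow> nat \<Rightarrow> nat \<Rightarrow> laurent mat" where
  "Qcol L k m = gscol L (box k m) (wkeys k m)"

lemma keys_length [simp]: "length (zkeys n k) = k" "length (wkeys k m) = k"
  by (auto simp: zkeys_def wkeys_def)

lemma keys_nth: "r < k \<Longrightarrow> zkeys n k ! r = (int n, int k - 1 - int r)"
  "r < k \<Longrightarrow> wkeys k m ! r = (int k - 1 - int r, int m)"
  by (auto simp: zkeys_def wkeys_def)

lemma keys_Suc: "zkeys n (Suc k) = (int n, int k) # zkeys n k" "wkeys (Suc k) m = (int k, int m) # wkeys k m"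
  by (rule nth_equalityI; auto simp: keys_nth nth_Cons split: nat.split)+

lemma keys_drop: "r \<le> k \<Longrightarrow> drop r (zkeys n k) = zkeys n (k - r)" "r \<le> k \<Longrightarrow> drop r (wkeys k m) = wkeys (k - r) m"
  by (rule nth_equalityI; auto simp: keys_nth of_nat_diff)+

lemma keys_set: "set (zkeys n k) = {int n} \<times> {0..<int k}" "set (wkeys k m) = {0..<int k} \<times> {int m}"
  by (induction k) (auto simp: keys_Suc, simp_all add: zkeys_def wkeys_def)

lemma keys_distinct: "distinct (zkeys n k)" "distinct (wkeys k m)"
  by (induction k) (auto simp: keys_Suc keys_set, simp_all add: zkeys_def wkeys_def)

lemma box_finite [simp]: "finite (box a b)" by (simp add: box_def)

lemma keys_box: "box n k \<union> set (zkeys n k) = box (Suc n) k" "box k m \<union> set (wkeys k m) = box k (Suc m)"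
  "set (zkeys n k) \<inter> box n l = {}" "set (wkeys k m) \<inter> box l m = {}"
  by (auto simp: box_def keys_set)

lemma box_mono: "a \<le> c \<Longrightarrow> b \<le> d \<Longrightarrow> box a b \<subseteq> box c d"
  by (auto simp: box_def)

lemma Pcol_dim [simp]: "dim_row (Pcol L n k) = k" "dim_col (Pcol L n k) = 1"
  and Qcol_dim [simp]: "dim_row (Qcol L k m) = k" "dim_col (Qcol L k m) = 1"
  by (auto simp: Pcol_def Qcol_def)

lemma onPhi_eq: "onPhi L n m = Pcol L n (Suc m)" "ontPhi L n m = Qcol L (Suc n) m"
proof -
  have "{0..<int n} \<times> {0..int m} \<union> {int n} \<times> {0..int m - int r} =
      box n (Suc m) \<union> set (drop r (zkeys n (Suc m)))" if "r < Suc m" for r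
    using that by (auto simp: keys_drop keys_set box_def of_nat_diff)
  then show "onPhi L n m = Pcol L n (Suc m)"
    by (intro eq_matI) (auto simp: onPhi_def Pcol_def gscol_index keys_nth Let_def)
  have "{0..int n} \<times> {0..<int m} \<union> {0..int n - int r} \<times> {int m} =
      box (Suc n) m \<union> set (drop r (wkeys (Suc n) m))" if "r < Suc n" for r
    using that by (auto simp: keys_drop keys_set box_def of_nat_diff)
  then show "ontPhi L n m = Qcol L (Suc n) m"
    by (intro eq_matI) (auto simp: ontPhi_def Qcol_def gscol_index keys_nth Let_def)
qed

lemma lead_eq:
  "dim_row F = Suc m \<Longrightarrow> zlead n m F = cfm (zkeys n (Suc m)) F"
  "dim_row F = Suc n \<Longrightarrow> wlead n m F = cfm (wkeys (Suc n) m) F"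
  by (rule eq_matI; auto simp: zlead_def wlead_def cfm_index keys_nth)+

definition zwn :: "nat \<Rightarrow> nat \<Rightarrow> laurent" where "zwn a b = zw (int a) (int b)"

text \<open>A separate name is used because \<open>bicircle\<close>, of which it becomes an
  instance, itself extends \<open>herm\<close>.\<close>

locale mfun = herm

sublocale mfun \<subseteq> bicircle L zwn Vbox "Pcol L" "Qcol L" "\<lambda>a b. pd (Vbox a b)"
proof
  fix a b c d :: nat
  show "zwn a b * zwn c d = zwn (a + c) (b + d)" by (simp add: zwn_def zw_mult)
  show "zwn a b * lstar (zwn a b) = 1" by (simp add: zwn_def zw_mult)
  show "lsubspace (Vbox a b)" by (rule lsubspace_mono_span)
  show "Vbox 0 b = {0}" "Vbox a 0 = {0}" by (auto simp: box_def mono_span_def)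
  show V: "a \<le> c \<Longrightarrow> b \<le> d \<Longrightarrow> Vbox a b \<subseteq> Vbox c d" by (intro mono_span_mono box_mono)
  show "pd (Vbox c d) \<Longrightarrow> a \<le> c \<Longrightarrow> b \<le> d \<Longrightarrow> pd (Vbox a b)"
    by (erule pd_mono) (intro mono_span_mono box_mono)
  show "pd (Vbox a b) \<Longrightarrow> pd (Vbox a b)" .
  show "p \<in> Vbox a b \<Longrightarrow> zwn c d * p \<in> Vbox (a + c) (b + d)" for p
    by (auto simp: zwn_def mono_span_iff split_paired_All box_def)
  show "p \<in> Vbox (Suc a) (Suc b) \<Longrightarrow> zwn a b * lstar p \<in> Vbox (Suc a) (Suc b)" for p
    by (auto simp: zwn_def mono_span_iff split_paired_All box_def)
  show "pd (Vbox (Suc a) b) \<Longrightarrow> onb (Vbox (Suc a) b) (Vbox a b) (Pcol L a b)"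
    using gscol_onb[of "box a b" "zkeys a b"] keys_distinct by (simp add: keys_box Pcol_def)
  show "pd (Vbox a (Suc b)) \<Longrightarrow> onb (Vbox a (Suc b)) (Vbox a b) (Qcol L a b)"
    using gscol_onb[of "box a b" "wkeys a b"] keys_distinct by (simp add: keys_box Qcol_def)
qed auto

context herm
begin

text \<open>Comparing the orthonormal columns of two nested chains of monomials gives a triangular
  Gram matrix with a leading zero column.\<close>

lemma gscol_nested:
  assumes "finite T" "distinct (k # ks)" "set (k # ks) \<inter> T = {}" "pd (mono_span (T \<union> set ks))"
    "finite T'" "T' \<subseteq> T" and ij: "i < length ks" "j < length ks"
  shows "j < i \<Longrightarrow> lprod L (gscol L T' ks) (gscol L T ks) $$ (i, j) = 0"
    "0 < lprod L (gscol L T' ks) (gscol L T ks) $$ (i, i)"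
proof -
  have dT: "set ks \<inter> T = {}" "set ks \<inter> T' = {}" "distinct ks" using assms by auto
  have pd': "pd (mono_span (T' \<union> set ks))"
    by (rule pd_mono[OF assms(4) mono_span_mono]) (use assms(6) in auto)
  note G = gscol_lprod[OF assms(1) dT(3,1) assms(4)]
  note F = gscol_is_onpoly[OF assms(5) dT(3,2) pd', of i]
  note C' = gscol_cfm[OF assms(5) dT(3,2) pd'] and C = gscol_cfm[OF assms(1) dT(3,1) assms(4)]
  have mem: "gscol L T' ks $$ (i, 0) \<in> mono_span (T \<union> set (drop j ks))" if "j \<le> i" for j
  proof -
    have "T' \<union> set (drop i ks) \<subseteq> T \<union> set (drop j ks)"
      using set_drop_mono[OF that, of ks] assms(6) by blast
    then show ?thesis using F ij mono_span_mono unfolding is_onpoly_def by blast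
  qed
  show "lprod L (gscol L T' ks) (gscol L T ks) $$ (i, j) = 0" if "j < i"
    using that G[of "gscol L T' ks" i j] mem[of j] C'(1)[of i j] ij
    by (simp add: cfm_index)
  have "lprod L (gscol L T' ks) (gscol L T ks) $$ (i, i) =
      cfm ks (gscol L T' ks) $$ (i, i) / cfm ks (gscol L T ks) $$ (i, i)"
    using G[of "gscol L T' ks" i i] mem[of i] ij by (simp add: cfm_index)
  then show "0 < lprod L (gscol L T' ks) (gscol L T ks) $$ (i, i)"
    using C'(2)[of i i] C(2)[of i i] ij by (simp add: less_complex_def Re_divide Im_divide)
qed

lemma gscol_Cons_lprod:
  assumes "dim_col X = 1" "i < dim_row X" "j < length ks"
  shows "lprod L X (gscol L T (k # ks)) $$ (i, Suc j) = lprod L X (gscol L T ks) $$ (i, j)"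
  using assms by (simp add: lprod_index gscol_index)

text \<open>The inner product with the first row is the coefficient at \<open>k\<close> divided by a
  positive number, so its vanishing and its sign can be read off from that coefficient.\<close>

lemma gscol_Cons_lprod_0:
  assumes "finite T" "distinct (k # ks)" "set (k # ks) \<inter> T = {}" "pd (mono_span (T \<union> set (k # ks)))"
    "dim_col X = 1" "i < dim_row X" "X $$ (i, 0) \<in> mono_span (T \<union> set (k # ks))"
  shows "lprod L X (gscol L T (k # ks)) $$ (i, 0) = 0 \<longleftrightarrow> lcoeff (X $$ (i, 0)) k = 0"
    "0 < lprod L X (gscol L T (k # ks)) $$ (i, 0) \<longleftrightarrow> 0 < lcoeff (X $$ (i, 0)) k"
proof -
  let ?c = "cfm (k # ks) (gscol L T (k # ks)) $$ (0, 0)"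
  have "lprod L X (gscol L T (k # ks)) $$ (i, 0) = lcoeff (X $$ (i, 0)) k / ?c"
    using gscol_lprod[OF assms(1-4), of X i 0] assms(5-7) by simp
  moreover have "0 < ?c" using gscol_cfm(2)[OF assms(1-4), of 0 0] by simp
  ultimately show "lprod L X (gscol L T (k # ks)) $$ (i, 0) = 0 \<longleftrightarrow> lcoeff (X $$ (i, 0)) k = 0"
    "0 < lprod L X (gscol L T (k # ks)) $$ (i, 0) \<longleftrightarrow> 0 < lcoeff (X $$ (i, 0)) k"
    by (auto simp: less_complex_def complex_is_Real_iff Re_divide Im_divide zero_less_divide_iff zero_less_mult_iff)
qed

end

text \<open>The shape required of an upper Cholesky factor.\<close>

definition pos_upper :: "nat \<Rightarrow> complex mat \<Rightarrow> bool" where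
  "pos_upper n B \<longleftrightarrow> B \<in> carrier_mat n n \<and> upper_triangular B \<and> (\<forall>i<n. 0 < B $$ (i, i))"

lemma pos_upper_nonsing: "pos_upper n B \<Longrightarrow> nonsing n B"
  by (rule nonsing_upper) (auto simp: pos_upper_def)

lemma Cons_mat_eq:
  assumes "\<And>i. i < m \<Longrightarrow> A $$ (i, 0) = 0" "dim_row A = m" "dim_col A = Suc k" "B \<in> carrier_mat m k"
    "\<And>i j. i < m \<Longrightarrow> j < k \<Longrightarrow> A $$ (i, Suc j) = B $$ (i, j)"
  shows "A = hcat (0\<^sub>m m 1) B" "A * transpose_mat (Ush k) = B" "A = B * Ush k"
proof -
  have A: "A $$ (i, j) = (if j = 0 then 0 else B $$ (i, j - 1))" if "i < m" "j < Suc k" for i j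
    using assms that by (cases j) auto
  show "A = hcat (0\<^sub>m m 1) B"
    by (rule eq_matI) (use assms A in \<open>auto simp: hcat_index\<close>)
  show "A * transpose_mat (Ush k) = B"
    by (rule eq_matI) (use assms in \<open>auto simp: mult_transpose_Ush_index simp del: index_mult_mat(1) simp flip: Suc_eq_plus1\<close>)
  show "A = B * Ush k"
    by (rule eq_matI) (use assms A in \<open>auto simp: mult_Ush_index simp del: index_mult_mat(1)\<close>)
qed

context mfun
begin

lemma cfm_P: "pd (Vbox (Suc n) k) \<Longrightarrow> pos_upper k (cfm (zkeys n k) (Pcol L n k))"
  and cfm_Q: "pd (Vbox k (Suc n)) \<Longrightarrow> pos_upper k (cfm (wkeys k n) (Qcol L k n))"
  using gscol_cfm[of "box n k" "zkeys n k"] gscol_cfm[of "box k n" "wkeys k n"] keys_distinct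
  by (auto simp: pos_upper_def Pcol_def Qcol_def keys_box intro!: carrier_matI upper_triangularI)

text \<open>The rows of \<open>P n (m + 1)\<close> below the first one need positivity only away from the corner.\<close>

definition PU :: "nat \<Rightarrow> nat \<Rightarrow> laurent mat" where
  "PU n m = gscol L (box n (Suc m)) (zkeys n m)"

definition QU :: "nat \<Rightarrow> nat \<Rightarrow> laurent mat" where
  "QU n m = gscol L (box (Suc n) m) (wkeys n m)"

text \<open>\<open>Bz\<close> and \<open>Bw\<close> turn out to be the Cholesky factors
  \<open>B\<close> and its tilde counterpart in the algorithm.\<close>

definition Bz :: "nat \<Rightarrow> nat \<Rightarrow> complex mat" where "Bz n m = lprod L (Pcol L n m) (PU n m)"
definition Bw :: "nat \<Rightarrow> nat \<Rightarrow> complex mat" where "Bw n m = lprod L (Qcol L n m) (QU n m)"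

text \<open>What is left of a box after its corner is removed. Listed by powers of \<open>z\<close>
  or by powers of \<open>w\<close>, it ends in the monomials of \<open>PU\<close> or of
  \<open>QU\<close>.\<close>

definition corner :: "nat \<Rightarrow> nat \<Rightarrow> (int \<times> int) set" where
  "corner n m = box (Suc n) (Suc m) - {(int n, int m)}"

lemma corner_eq: "corner n m = box n (Suc m) \<union> set (zkeys n m)" "corner n m = box (Suc n) m \<union> set (wkeys n m)"
  by (auto simp: corner_def box_def keys_set)

lemma PU_dim [simp]: "dim_row (PU n m) = m" "dim_col (PU n m) = 1"
  and QU_dim [simp]: "dim_row (QU n m) = n" "dim_col (QU n m) = 1"
  and Bz_dim [simp]: "dim_row (Bz n m) = m" "dim_col (Bz n m) = m"
  and Bw_dim [simp]: "dim_row (Bw n m) = n" "dim_col (Bw n m) = n"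
  by (auto simp: PU_def QU_def Bz_def Bw_def)

text \<open>Both columns orthogonalise the same monomials, once over a smaller and once over a
  larger set of earlier ones.\<close>

lemma Bz_pos: "pd (mono_span (corner n m)) \<Longrightarrow> pos_upper m (Bz n m)"
  and Bw_pos: "pd (mono_span (corner n m)) \<Longrightarrow> pos_upper n (Bw n m)"
proof -
  assume "pd (mono_span (corner n m))"
  note pds = this[unfolded corner_eq(1)] this[unfolded corner_eq(2)]
  have d: "distinct ((int n, int m) # zkeys n m)" "distinct ((int n, int m) # wkeys n m)"
    "set ((int n, int m) # zkeys n m) \<inter> box n (Suc m) = {}" "set ((int n, int m) # wkeys n m) \<inter> box (Suc n) m = {}"
    using keys_distinct[of n "Suc m"] keys_distinct[of "Suc n" m] keys_box(3)[of n "Suc m"] keys_box(4)[of "Suc n" m]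
    by (simp_all add: keys_Suc)
  have b: "box n m \<subseteq> box n (Suc m)" "box n m \<subseteq> box (Suc n) m" by (simp_all add: box_mono)
  show "pos_upper m (Bz n m)" "pos_upper n (Bw n m)"
    using gscol_nested[OF _ d(1,3) pds(1) _ b(1)] gscol_nested[OF _ d(2,4) pds(2) _ b(2)]
    by (auto simp: pos_upper_def Bz_def Bw_def Pcol_def Qcol_def PU_def QU_def
        intro!: carrier_matI upper_triangularI)
qed

lemma pd_corner: "pd (Vbox (Suc n) (Suc m)) \<Longrightarrow> pd (mono_span (corner n m))"
  by (erule pd_mono[OF _ mono_span_mono]) (auto simp: corner_def)

lemma P_row_mem:
  assumes "pd (Vbox (Suc n) k)" "i < k"
  shows "Pcol L n k $$ (i, 0) \<in> mono_span (box n k \<union> {int n} \<times> {0..<int k - int i})"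
    "0 < lcoeff (Pcol L n k $$ (i, 0)) (int n, int k - 1 - int i)"
proof -
  have "is_onpoly (box n k \<union> set (drop i (zkeys n k))) (zkeys n k ! i) (Pcol L n k $$ (i, 0))"
    unfolding Pcol_def
    by (rule gscol_is_onpoly[OF box_finite keys_distinct(1) keys_box(3)])
       (use assms in \<open>simp_all add: keys_box(1)\<close>)
  then show "Pcol L n k $$ (i, 0) \<in> mono_span (box n k \<union> {int n} \<times> {0..<int k - int i})"
    "0 < lcoeff (Pcol L n k $$ (i, 0)) (int n, int k - 1 - int i)"
    using assms by (simp_all add: is_onpoly_def keys_drop keys_set keys_nth of_nat_diff)
qed

lemma Q_row_mem:
  assumes "pd (Vbox k (Suc m))" "i < k"
  shows "Qcol L k m $$ (i, 0) \<in> mono_span (box k m \<union> {0..<int k - int i} \<times> {int m})"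
    "0 < lcoeff (Qcol L k m $$ (i, 0)) (int k - 1 - int i, int m)"
proof -
  have "is_onpoly (box k m \<union> set (drop i (wkeys k m))) (wkeys k m ! i) (Qcol L k m $$ (i, 0))"
    unfolding Qcol_def
    by (rule gscol_is_onpoly[OF box_finite keys_distinct(2) keys_box(4)])
       (use assms in \<open>simp_all add: keys_box(2)\<close>)
  then show "Qcol L k m $$ (i, 0) \<in> mono_span (box k m \<union> {0..<int k - int i} \<times> {int m})"
    "0 < lcoeff (Qcol L k m $$ (i, 0)) (int k - 1 - int i, int m)"
    using assms by (simp_all add: is_onpoly_def keys_drop keys_set keys_nth of_nat_diff)
qed

lemma P_Suc_lprod_0:
  assumes "pd (Vbox (Suc n) (Suc m))" "dim_col X = 1" "i < dim_row X" "X $$ (i, 0) \<in> Vbox (Suc n) (Suc m)"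
  shows "lprod L X (Pcol L n (Suc m)) $$ (i, 0) = 0 \<longleftrightarrow> lcoeff (X $$ (i, 0)) (int n, int m) = 0"
    "0 < lprod L X (Pcol L n (Suc m)) $$ (i, 0) \<longleftrightarrow> 0 < lcoeff (X $$ (i, 0)) (int n, int m)"
proof -
  have 1: "distinct ((int n, int m) # zkeys n m)" "set ((int n, int m) # zkeys n m) \<inter> box n (Suc m) = {}"
    using keys_distinct[of n "Suc m"] keys_box(3)[of n "Suc m"] by (simp_all add: keys_Suc)
  have 2: "box n (Suc m) \<union> set ((int n, int m) # zkeys n m) = box (Suc n) (Suc m)"
    using keys_box(1)[of n "Suc m"] by (simp add: keys_Suc)
  show "lprod L X (Pcol L n (Suc m)) $$ (i, 0) = 0 \<longleftrightarrow> lcoeff (X $$ (i, 0)) (int n, int m) = 0"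
    "0 < lprod L X (Pcol L n (Suc m)) $$ (i, 0) \<longleftrightarrow> 0 < lcoeff (X $$ (i, 0)) (int n, int m)"
    using gscol_Cons_lprod_0[OF box_finite 1, unfolded 2, OF assms] by (simp_all add: Pcol_def keys_Suc)
qed

lemma Q_Suc_lprod_0:
  assumes "pd (Vbox (Suc n) (Suc m))" "dim_col X = 1" "i < dim_row X" "X $$ (i, 0) \<in> Vbox (Suc n) (Suc m)"
  shows "lprod L X (Qcol L (Suc n) m) $$ (i, 0) = 0 \<longleftrightarrow> lcoeff (X $$ (i, 0)) (int n, int m) = 0"
    "0 < lprod L X (Qcol L (Suc n) m) $$ (i, 0) \<longleftrightarrow> 0 < lcoeff (X $$ (i, 0)) (int n, int m)"
proof -
  have 1: "distinct ((int n, int m) # wkeys n m)" "set ((int n, int m) # wkeys n m) \<inter> box (Suc n) m = {}"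
    using keys_distinct[of "Suc n" m] keys_box(4)[of "Suc n" m] by (simp_all add: keys_Suc)
  have 2: "box (Suc n) m \<union> set ((int n, int m) # wkeys n m) = box (Suc n) (Suc m)"
    using keys_box(2)[of "Suc n" m] by (simp add: keys_Suc)
  show "lprod L X (Qcol L (Suc n) m) $$ (i, 0) = 0 \<longleftrightarrow> lcoeff (X $$ (i, 0)) (int n, int m) = 0"
    "0 < lprod L X (Qcol L (Suc n) m) $$ (i, 0) \<longleftrightarrow> 0 < lcoeff (X $$ (i, 0)) (int n, int m)"
    using gscol_Cons_lprod_0[OF box_finite 1, unfolded 2, OF assms] by (simp_all add: Qcol_def keys_Suc)
qed

lemma P_Suc_lprod_Suc:
  "dim_col X = 1 \<Longrightarrow> i < dim_row X \<Longrightarrow> j < m \<Longrightarrow>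
    lprod L X (Pcol L n (Suc m)) $$ (i, Suc j) = lprod L X (PU n m) $$ (i, j)"
  and Q_Suc_lprod_Suc:
  "dim_col X = 1 \<Longrightarrow> i < dim_row X \<Longrightarrow> k < n \<Longrightarrow>
    lprod L X (Qcol L (Suc n) m) $$ (i, Suc k) = lprod L X (QU n m) $$ (i, k)"
  by (simp_all add: Pcol_def Qcol_def PU_def QU_def keys_Suc gscol_Cons_lprod)

text \<open>\<open>P n m\<close> does not contain the corner monomial, hence is orthogonal to the
  first row of \<open>P n (Suc m)\<close>; this is the zero column.\<close>

lemma gG_eq:
  assumes "pd (Vbox (Suc n) (Suc m))"
  shows "gG n m = hcat (0\<^sub>m m 1) (Bz n m)" "gG n m * transpose_mat (Ush m) = Bz n m" "gG n m = Bz n m * Ush m"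
proof -
  have z: "gG n m $$ (i, 0) = 0" if "i < m" for i
  proof -
    have o: "pd (Vbox (Suc n) m)" by (rule ok_mono[OF assms]) auto
    note mem = P_row_mem(1)[OF o that]
    have "box n m \<union> {int n} \<times> {0..<int m - int i} \<subseteq> box (Suc n) (Suc m)" by (auto simp: box_def)
    then have "Pcol L n m $$ (i, 0) \<in> Vbox (Suc n) (Suc m)" using mem mono_span_mono by blast
    moreover have "lcoeff (Pcol L n m $$ (i, 0)) (int n, int m) = 0"
      using mem by (simp add: mono_span_iff box_def)
    ultimately show ?thesis unfolding gG_def using that by (subst P_Suc_lprod_0(1)[OF assms]) auto
  qed
  have s: "gG n m $$ (i, Suc j) = Bz n m $$ (i, j)" if "i < m" "j < m" for i j
    using that by (simp add: gG_def Bz_def P_Suc_lprod_Suc)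
  show "gG n m = hcat (0\<^sub>m m 1) (Bz n m)" "gG n m * transpose_mat (Ush m) = Bz n m" "gG n m = Bz n m * Ush m"
    by (rule Cons_mat_eq[of m "gG n m" m "Bz n m"]; simp add: z s carrier_matI)+
qed

lemma gtG_eq:
  assumes "pd (Vbox (Suc n) (Suc m))"
  shows "gtG n m = hcat (0\<^sub>m n 1) (Bw n m)" "gtG n m * transpose_mat (Ush n) = Bw n m" "gtG n m = Bw n m * Ush n"
proof -
  have z: "gtG n m $$ (i, 0) = 0" if "i < n" for i
  proof -
    have o: "pd (Vbox n (Suc m))" by (rule ok_mono[OF assms]) auto
    note mem = Q_row_mem(1)[OF o that]
    have "box n m \<union> {0..<int n - int i} \<times> {int m} \<subseteq> box (Suc n) (Suc m)" by (auto simp: box_def)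
    then have "Qcol L n m $$ (i, 0) \<in> Vbox (Suc n) (Suc m)" using mem mono_span_mono by blast
    moreover have "lcoeff (Qcol L n m $$ (i, 0)) (int n, int m) = 0"
      using mem by (simp add: mono_span_iff box_def)
    ultimately show ?thesis unfolding gtG_def using that by (subst Q_Suc_lprod_0(1)[OF assms]) auto
  qed
  have s: "gtG n m $$ (i, Suc j) = Bw n m $$ (i, j)" if "i < n" "j < n" for i j
    using that by (simp add: gtG_def Bw_def Q_Suc_lprod_Suc)
  show "gtG n m = hcat (0\<^sub>m n 1) (Bw n m)" "gtG n m * transpose_mat (Ush n) = Bw n m" "gtG n m = Bw n m * Ush n"
    by (rule Cons_mat_eq[of n "gtG n m" n "Bw n m"]; simp add: z s carrier_matI)+
qed

text \<open>After multiplication by \<open>w\<close> only the first row of \<open>P n m\<close>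
  reaches the corner monomial, and with a positive coefficient.\<close>

lemma gG1_col:
  assumes "pd (Vbox (Suc n) (Suc m))" "i < m"
  shows "0 < i \<Longrightarrow> gG1 n m $$ (i, 0) = 0" "i = 0 \<Longrightarrow> 0 < gG1 n m $$ (i, 0)"
proof -
  have o: "pd (Vbox (Suc n) m)" by (rule ok_mono[OF assms(1)]) auto
  note mem = P_row_mem[OF o assms(2)]
  let ?X = "shift_w (Pcol L n m)"
  have "Pcol L n m $$ (i, 0) \<in> Vbox (Suc n) m"
    using P_facts(1)[OF o] assms(2) by (simp add: col_in_def)
  then have "?X $$ (i, 0) \<in> Vbox (Suc n) (Suc m)"
    using V_shift[of _ "Suc n" m 0 1] assms(2) by (simp add: Suc_eq_plus1)
  moreover have "lcoeff (?X $$ (i, 0)) (int n, int m) = lcoeff (Pcol L n m $$ (i, 0)) (int n, int m - 1)"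
    using assms(2) by (simp add: zwn_def)
  moreover have "0 < i \<Longrightarrow> lcoeff (Pcol L n m $$ (i, 0)) (int n, int m - 1) = 0"
    using mem(1) by (simp add: mono_span_iff box_def)
  ultimately show "0 < i \<Longrightarrow> gG1 n m $$ (i, 0) = 0" "i = 0 \<Longrightarrow> 0 < gG1 n m $$ (i, 0)"
    using P_Suc_lprod_0[OF assms(1), of ?X i] mem(2) assms(2) by (auto simp: gG1_def)
qed

lemma gtG1_col:
  assumes "pd (Vbox (Suc n) (Suc m))" "i < n"
  shows "0 < i \<Longrightarrow> gtG1 n m $$ (i, 0) = 0" "i = 0 \<Longrightarrow> 0 < gtG1 n m $$ (i, 0)"
proof -
  have o: "pd (Vbox n (Suc m))" by (rule ok_mono[OF assms(1)]) auto
  note mem = Q_row_mem[OF o assms(2)]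
  let ?X = "shift_z (Qcol L n m)"
  have "Qcol L n m $$ (i, 0) \<in> Vbox n (Suc m)"
    using Q_facts(1)[OF o] assms(2) by (simp add: col_in_def)
  then have "?X $$ (i, 0) \<in> Vbox (Suc n) (Suc m)"
    using V_shift[of _ n "Suc m" 1 0] assms(2) by (simp add: Suc_eq_plus1)
  moreover have "lcoeff (?X $$ (i, 0)) (int n, int m) = lcoeff (Qcol L n m $$ (i, 0)) (int n - 1, int m)"
    using assms(2) by (simp add: zwn_def)
  moreover have "0 < i \<Longrightarrow> lcoeff (Qcol L n m $$ (i, 0)) (int n - 1, int m) = 0"
    using mem(1) by (simp add: mono_span_iff box_def)
  ultimately show "0 < i \<Longrightarrow> gtG1 n m $$ (i, 0) = 0" "i = 0 \<Longrightarrow> 0 < gtG1 n m $$ (i, 0)"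
    using Q_Suc_lprod_0[OF assms(1), of ?X i] mem(2) assms(2) by (auto simp: gtG1_def)
qed

text \<open>A positive entry on top of the zero column of \<open>B * Ush k\<close>, whose other
  columns are triangular: the stacked matrix is triangular with positive diagonal.\<close>

lemma hat_nonsing:
  assumes "pd (Vbox (Suc n) (Suc m))"
  shows "1 \<le> m \<Longrightarrow> nonsing (Suc m) (hat_of (gG1 n m) (gG n m))"
    "1 \<le> n \<Longrightarrow> nonsing (Suc n) (hat_of (gtG1 n m) (gtG n m))"
proof -
  have gen: "nonsing (Suc k) (hat_of G1 (B * Ush k))"
    if "pos_upper k B" "0 < G1 $$ (0, 0)" for k G1 B
  proof (rule nonsing_upper)
    have B: "B \<in> carrier_mat k k" "upper_triangular B" "\<And>i. i < k \<Longrightarrow> 0 < B $$ (i, i)"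
      using that by (auto simp: pos_upper_def)
    show "hat_of G1 (B * Ush k) \<in> carrier_mat (Suc k) (Suc k)" using B by (intro carrier_matI) auto
    have idx: "hat_of G1 (B * Ush k) $$ (Suc i, j) = (if j = 0 then 0 else B $$ (i, j - 1))"
      if "i < k" "j < Suc k" for i j
      using that B by (simp add: hat_of_def mult_Ush_index del: index_mult_mat(1))
    have z: "hat_of G1 (B * Ush k) $$ (0, 0) = G1 $$ (0, 0)" by (simp add: hat_of_def)
    show "upper_triangular (hat_of G1 (B * Ush k))"
    proof (rule upper_triangularI)
      fix i j assume "j < i" "i < dim_row (hat_of G1 (B * Ush k))"
      then show "hat_of G1 (B * Ush k) $$ (i, j) = 0"
        using B idx[of "i - 1" j] upper_triangularD[OF B(2), of "j - 1" "i - 1"] by (cases j) auto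
    qed
    show "hat_of G1 (B * Ush k) $$ (i, i) \<noteq> 0" if "i < Suc k" for i
      using that idx[of "i - 1" i] z \<open>0 < G1 $$ (0, 0)\<close> B(3)[of "i - 1"] by (cases i) (auto simp: less_complex_def)
  qed
  note c = pd_corner[OF assms]
  show "1 \<le> m \<Longrightarrow> nonsing (Suc m) (hat_of (gG1 n m) (gG n m))"
    "1 \<le> n \<Longrightarrow> nonsing (Suc n) (hat_of (gtG1 n m) (gtG n m))"
    unfolding gG_eq(3)[OF assms] gtG_eq(3)[OF assms]
    using gen Bz_pos[OF c] Bw_pos[OF c] gG1_col(2)[OF assms] gtG1_col(2)[OF assms] by auto
qed

end

subsection \<open>Cholesky factors and the operator norm\<close>

text \<open>Entry \<open>(i, c)\<close> of the product involves only the columns from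
  \<open>c\<close> on. Going from the last column to the first, the diagonal entry is fixed by its
  square and its sign, and then the rest of the column follows.\<close>

lemma pos_upper_unique:
  assumes B: "pos_upper n B" and C: "pos_upper n C" and eq: "B * mat_adjoint B = C * mat_adjoint C"
  shows "B = C"
proof -
  have d: "dim_row B = n" "dim_col B = n" "dim_row C = n" "dim_col C = n"
    using B C by (auto simp: pos_upper_def)
  have low: "B $$ (i, j) = 0" "C $$ (i, j) = 0" if "j < i" "i < n" for i j
    using B C that upper_triangularD by (auto simp: pos_upper_def)
  have pos: "0 < B $$ (i, i)" "0 < C $$ (i, i)" if "i < n" for i
    using B C that by (auto simp: pos_upper_def)
  have split: "(A * mat_adjoint A) $$ (i, c) =
      A $$ (i, c) * cnj (A $$ (c, c)) + (\<Sum>l\<in>{c<..<n}. A $$ (i, l) * cnj (A $$ (c, l)))"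
    if "dim_row A = n" "dim_col A = n" "i < n" "c < n" "\<And>i j. j < i \<Longrightarrow> i < n \<Longrightarrow> A $$ (i, j) = 0"
    for A :: "complex mat" and i c
  proof -
    have "(A * mat_adjoint A) $$ (i, c) = (\<Sum>l\<in>{0..<n}. A $$ (i, l) * cnj (A $$ (c, l)))"
      using that by (subst mult_mat_index[where n = n]) auto
    also have "\<dots> = (\<Sum>l\<in>{c..<n}. A $$ (i, l) * cnj (A $$ (c, l)))"
      using that by (intro sum.mono_neutral_right) auto
    also have "{c..<n} = insert c {c<..<n}" using that by auto
    finally show ?thesis by simp
  qed
  \<comment> \<open>The induction variable counts columns from the right.\<close>
  have col: "\<forall>i<n. B $$ (i, n - 1 - k) = C $$ (i, n - 1 - k)" if "k < n" for k
    using that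
  proof (induction k rule: less_induct)
    case (less k)
    define c where "c = n - 1 - k"
    have c: "c < n" using less.prems by (auto simp: c_def)
    have IH: "B $$ (i, l) = C $$ (i, l)" if "i < n" "l \<in> {c<..<n}" for i l
      using less.IH[of "n - 1 - l"] that less.prems by (auto simp: c_def)
    have rest: "(\<Sum>l\<in>{c<..<n}. B $$ (i, l) * cnj (B $$ (c, l))) =
        (\<Sum>l\<in>{c<..<n}. C $$ (i, l) * cnj (C $$ (c, l)))" if "i < n" for i
      using IH[OF that] IH[OF c] by (intro sum.cong) auto
    have *: "B $$ (i, c) * cnj (B $$ (c, c)) = C $$ (i, c) * cnj (C $$ (c, c))" if "i < n" for i
      using arg_cong[OF eq, of "\<lambda>A. A $$ (i, c)"] split[OF d(1,2) that c low(1)]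
        split[OF d(3,4) that c low(2)] rest[OF that] by simp
    have "B $$ (c, c) = C $$ (c, c)"
    proof -
      have re: "cnj (B $$ (c, c)) = B $$ (c, c)" "cnj (C $$ (c, c)) = C $$ (c, c)"
        using pos[OF c] by (auto simp: less_complex_def complex_eq_iff)
      then have "(B $$ (c, c) - C $$ (c, c)) * (B $$ (c, c) + C $$ (c, c)) = 0"
        using *[OF c] by (simp add: algebra_simps)
      moreover have "B $$ (c, c) + C $$ (c, c) \<noteq> 0"
        using pos[OF c] by (auto simp: less_complex_def complex_eq_iff)
      ultimately show ?thesis by simp
    qed
    moreover have "C $$ (c, c) \<noteq> 0" using pos[OF c] by (auto simp: less_complex_def)
    ultimately have "\<forall>i<n. B $$ (i, c) = C $$ (i, c)" using * by auto
    then show ?case by (simp only: c_def)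
  qed
  have "B $$ (i, j) = C $$ (i, j)" if "i < n" "j < n" for i j
  proof -
    have "n - 1 - j < n" "n - 1 - (n - 1 - j) = j" using that by auto
    then show ?thesis using col[of "n - 1 - j"] that by simp
  qed
  then show ?thesis using d by (intro eq_matI) auto
qed

lemma upper_cholesky_eq:
  assumes "pos_upper n B" "M = B * mat_adjoint B"
  shows "upper_cholesky M = B"
proof -
  have n: "dim_row M = n" using assms by (auto simp: pos_upper_def)
  have iff: "(X \<in> carrier_mat n n \<and> upper_triangular X \<and> (\<forall>i<n. 0 < X $$ (i, i)) \<and> M = X * mat_adjoint X)
    \<longleftrightarrow> pos_upper n X \<and> M = X * mat_adjoint X" for X
    by (auto simp: pos_upper_def)
  show ?thesis unfolding upper_cholesky_def n iff
    by (rule the_equality) (use assms pos_upper_unique in auto)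
qed

lemma eucl_norm_ge_0 [simp]: "0 \<le> eucl_norm v"
  and eucl_norm_sq: "(eucl_norm v)\<^sup>2 = (\<Sum>i<dim_vec v. (cmod (v $ i))\<^sup>2)"
  by (auto simp: eucl_norm_def sum_nonneg)

lemma eucl_norm_smult: "eucl_norm (c \<cdot>\<^sub>v v) = cmod c * eucl_norm v"
  by (simp add: eucl_norm_def norm_mult power_mult_distrib real_sqrt_mult flip: sum_distrib_left)

lemma eucl_norm_eq_0: "eucl_norm v = 0 \<Longrightarrow> v = 0\<^sub>v (dim_vec v)"
  by (intro eq_vecI) (auto simp: eucl_norm_def sum_nonneg_eq_0_iff)

text \<open>Cauchy-Schwarz in every row. This Frobenius bound shows that the supremum in
  \<open>op_norm\<close> is taken over a bounded set.\<close>

lemma eucl_norm_mult_bound: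
  assumes "dim_vec x = dim_col A"
  shows "(eucl_norm (A *\<^sub>v x))\<^sup>2 \<le> (\<Sum>i<dim_row A. \<Sum>j<dim_col A. (cmod (A $$ (i, j)))\<^sup>2) * (eucl_norm x)\<^sup>2"
proof -
  have "(cmod ((A *\<^sub>v x) $ i))\<^sup>2 \<le> (\<Sum>j<dim_col A. (cmod (A $$ (i, j)))\<^sup>2) * (eucl_norm x)\<^sup>2"
    if "i < dim_row A" for i
  proof -
    have "(A *\<^sub>v x) $ i = (\<Sum>j<dim_col A. A $$ (i, j) * x $ j)"
      using that assms by (simp add: scalar_prod_def lessThan_atLeast0)
    then have "cmod ((A *\<^sub>v x) $ i) \<le> (\<Sum>j<dim_col A. cmod (A $$ (i, j)) * cmod (x $ j))"
      by (simp add: sum_norm_le norm_mult)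
    then have "(cmod ((A *\<^sub>v x) $ i))\<^sup>2 \<le> (\<Sum>j<dim_col A. cmod (A $$ (i, j)) * cmod (x $ j))\<^sup>2"
      by (intro power_mono) auto
    also have "\<dots> \<le> (\<Sum>j<dim_col A. (cmod (A $$ (i, j)))\<^sup>2) * (\<Sum>j<dim_col A. (cmod (x $ j))\<^sup>2)"
    proof -
      have "(\<Sum>j<dim_col A. cmod (A $$ (i, j)) * cmod (x $ j))\<^sup>2 \<le>
          (L2_set (\<lambda>j. cmod (A $$ (i, j))) {..<dim_col A} * L2_set (\<lambda>j. cmod (x $ j)) {..<dim_col A})\<^sup>2"
        using L2_set_mult_ineq[of "\<lambda>j. cmod (A $$ (i, j))" "\<lambda>j. cmod (x $ j)" "{..<dim_col A}"]
        by (intro power_mono) (auto intro: sum_nonneg)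
      then show ?thesis by (simp add: L2_set_def power_mult_distrib sum_nonneg)
    qed
    finally show ?thesis using assms by (simp add: eucl_norm_sq)
  qed
  then show ?thesis unfolding eucl_norm_sq[of "A *\<^sub>v x"] dim_mult_mat_vec
    unfolding sum_distrib_right[of _ "{..<dim_row A}"] by (intro sum_mono) auto
qed

lemma op_norm_bdd: "bdd_above ((\<lambda>x. eucl_norm (A *\<^sub>v x)) ` {x \<in> carrier_vec (dim_col A). eucl_norm x \<le> 1})"
proof (rule bdd_aboveI2)
  let ?F = "\<Sum>i<dim_row A. \<Sum>j<dim_col A. (cmod (A $$ (i, j)))\<^sup>2"
  fix x assume "x \<in> {x \<in> carrier_vec (dim_col A). eucl_norm x \<le> 1}"
  then have "(eucl_norm (A *\<^sub>v x))\<^sup>2 \<le> ?F * 1"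
    by (intro order_trans[OF eucl_norm_mult_bound] mult_left_mono power_le_one) (auto intro!: sum_nonneg)
  then show "eucl_norm (A *\<^sub>v x) \<le> sqrt ?F" by (simp add: real_le_rsqrt)
qed

lemma op_norm_less_1D:
  assumes "op_norm A < 1" "x \<in> carrier_vec (dim_col A)" "x \<noteq> 0\<^sub>v (dim_col A)"
  shows "eucl_norm (A *\<^sub>v x) < eucl_norm x"
proof -
  have "eucl_norm x \<noteq> 0" using eucl_norm_eq_0[of x] assms by auto
  then have pos: "0 < eucl_norm x" using eucl_norm_ge_0[of x] by linarith
  define c where "c = complex_of_real (1 / eucl_norm x)"
  have c: "cmod c * eucl_norm x = 1" using pos by (simp add: c_def norm_divide)
  have "eucl_norm (A *\<^sub>v (c \<cdot>\<^sub>v x)) \<le> op_norm A"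
    unfolding op_norm_def
    by (rule cSUP_upper[OF _ op_norm_bdd]) (use assms(2) c in \<open>simp add: eucl_norm_smult\<close>)
  moreover have "A *\<^sub>v (c \<cdot>\<^sub>v x) = c \<cdot>\<^sub>v (A *\<^sub>v x)"
    using assms(2) by (intro mult_mat_vec) auto
  ultimately have "cmod c * eucl_norm (A *\<^sub>v x) < 1" using assms(1) by (simp add: eucl_norm_smult)
  then have "cmod c * eucl_norm (A *\<^sub>v x) < cmod c * eucl_norm x" using c by simp
  moreover have "0 < cmod c" using c by (cases "c = 0") auto
  ultimately show ?thesis by simp
qed

text \<open>Vectors become one-column matrices, so that quadratic forms can be computed with matrix
  products.\<close>

definition colmat :: "complex vec \<Rightarrow> complex mat" where
  "colmat x = mat (dim_vec x) 1 (\<lambda>(i, _). x $ i)"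

lemma colmat_dim [simp]: "dim_row (colmat x) = dim_vec x" "dim_col (colmat x) = 1"
  by (auto simp: colmat_def)

lemma colmat_mult: "dim_vec x = dim_col A \<Longrightarrow> colmat (A *\<^sub>v x) = A * colmat x"
  by (rule eq_matI) (auto simp: colmat_def scalar_prod_def)

lemma adjoint_mult_self:
  fixes X :: "complex mat"
  assumes "dim_col X = 1"
  shows "(mat_adjoint X * X) $$ (0, 0) = complex_of_real (\<Sum>i<dim_row X. (cmod (X $$ (i, 0)))\<^sup>2)"
proof -
  have "(mat_adjoint X * X) $$ (0, 0) = (\<Sum>i\<in>{0..<dim_row X}. X $$ (i, 0) * cnj (X $$ (i, 0)))"
    using assms by (subst mult_mat_index[where n = "dim_row X"]) (auto simp: mult.commute)
  then show ?thesis by (simp add: mult_cnj_cmod lessThan_atLeast0 del: of_real_power)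
qed

lemma mult_adjoint_self:
  fixes C :: "complex mat"
  assumes "i < dim_row C"
  shows "(C * mat_adjoint C) $$ (i, i) = complex_of_real (\<Sum>k<dim_col C. (cmod (C $$ (i, k)))\<^sup>2)"
proof -
  have "(C * mat_adjoint C) $$ (i, i) = (\<Sum>k\<in>{0..<dim_col C}. C $$ (i, k) * cnj (C $$ (i, k)))"
    using assms by (subst mult_mat_index[where n = "dim_col C"]) auto
  then show ?thesis by (simp add: mult_cnj_cmod lessThan_atLeast0 del: of_real_power)
qed

lemma eucl_norm_colmat: "(mat_adjoint (colmat x) * colmat x) $$ (0, 0) = complex_of_real ((eucl_norm x)\<^sup>2)"
  by (simp add: adjoint_mult_self eucl_norm_sq colmat_def del: index_mult_mat(1))

text \<open>The identity says that the squared norms of \<open>A x\<close> and of the adjoint of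
  \<open>B\<close> applied to \<open>x\<close> add up to that of \<open>x\<close>. Invertibility of
  \<open>B\<close> bounds the second uniformly from below, so the supremum itself, not only each
  value, stays below 1.\<close>

lemma op_norm_less_1I:
  assumes "mat_adjoint A * A + B * mat_adjoint B = 1\<^sub>m n" "nonsing n B" "dim_col A = n"
  shows "op_norm A < 1"
proof -
  note B = nonsing_dim[OF assms(2)] minv_nonsing[OF assms(2)]
  have eq: "(eucl_norm (A *\<^sub>v x))\<^sup>2 + (eucl_norm (mat_adjoint B *\<^sub>v x))\<^sup>2 = (eucl_norm x)\<^sup>2"
    if "dim_vec x = n" for x
  proof -
    let ?X = "colmat x"
    have "mat_adjoint ?X * ((mat_adjoint A * A + B * mat_adjoint B) * ?X) = mat_adjoint ?X * ?X"
      using that by (simp add: assms(1))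
    then have "mat_adjoint (A * ?X) * (A * ?X) + mat_adjoint (mat_adjoint B * ?X) * (mat_adjoint B * ?X) =
        mat_adjoint ?X * ?X"
      using that assms(3) B by (simp add: mat_distribs)
    then have "(mat_adjoint (colmat (A *\<^sub>v x)) * colmat (A *\<^sub>v x) +
        mat_adjoint (colmat (mat_adjoint B *\<^sub>v x)) * colmat (mat_adjoint B *\<^sub>v x)) $$ (0, 0) =
        (mat_adjoint ?X * ?X) $$ (0, 0)"
      using that assms(3) B by (simp add: colmat_mult)
    then have "complex_of_real ((eucl_norm (A *\<^sub>v x))\<^sup>2 + (eucl_norm (mat_adjoint B *\<^sub>v x))\<^sup>2) =
        complex_of_real ((eucl_norm x)\<^sup>2)"
      by (simp add: eucl_norm_colmat del: index_mult_mat(1) of_real_power)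
    then show ?thesis by (simp only: of_real_eq_iff)
  qed
  define C where "C = mat_adjoint (minv B)"
  \<comment> \<open>The Frobenius bound of the inverse of the adjoint of \<open>B\<close>; adding 1
    makes it a legitimate divisor even for empty matrices.\<close>
  define F where "F = (\<Sum>i<dim_row C. \<Sum>j<dim_col C. (cmod (C $$ (i, j)))\<^sup>2) + 1"
  have F: "1 \<le> F" unfolding F_def by (simp add: sum_nonneg)
  have CB: "C * mat_adjoint B = 1\<^sub>m n"
    using B by (simp add: C_def flip: adjoint_mult)
  have le: "(eucl_norm x)\<^sup>2 \<le> F * (eucl_norm (mat_adjoint B *\<^sub>v x))\<^sup>2" if "dim_vec x = n" for x
  proof -
    let ?y = "mat_adjoint B *\<^sub>v x"
    have x: "x \<in> carrier_vec n" using that by auto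
    have "C *\<^sub>v ?y = (C * mat_adjoint B) *\<^sub>v x"
      by (rule assoc_mult_mat_vec[symmetric, OF _ _ x]) (use B in \<open>auto simp: C_def intro!: carrier_matI\<close>)
    then have "C *\<^sub>v ?y = x" using x by (simp add: CB)
    moreover have "(eucl_norm (C *\<^sub>v ?y))\<^sup>2 \<le> (F - 1) * (eucl_norm ?y)\<^sup>2"
      unfolding F_def add_diff_cancel_right' by (rule eucl_norm_mult_bound) (use B in \<open>simp add: C_def\<close>)
    moreover have "(F - 1) * (eucl_norm ?y)\<^sup>2 \<le> F * (eucl_norm ?y)\<^sup>2" by (intro mult_right_mono) auto
    ultimately show ?thesis by simp
  qed
  have "eucl_norm (A *\<^sub>v x) \<le> sqrt (1 - 1 / F)"
    if "x \<in> {x \<in> carrier_vec (dim_col A). eucl_norm x \<le> 1}" for x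
  proof -
    have x: "dim_vec x = n" "eucl_norm x \<le> 1" using that assms(3) by auto
    have "(eucl_norm x)\<^sup>2 / F \<le> (eucl_norm (mat_adjoint B *\<^sub>v x))\<^sup>2"
      using le[OF x(1)] F by (simp add: divide_le_eq mult.commute)
    then have "(eucl_norm (A *\<^sub>v x))\<^sup>2 \<le> (eucl_norm x)\<^sup>2 * (1 - 1 / F)"
      using eq[OF x(1)] by (simp add: algebra_simps)
    also have "\<dots> \<le> 1 * (1 - 1 / F)"
      using x(2) F by (intro mult_right_mono power_le_one) auto
    finally show ?thesis by (simp add: real_le_rsqrt)
  qed
  moreover have "{x \<in> carrier_vec (dim_col A). eucl_norm x \<le> 1} \<noteq> {}"
  proof -
    have "0\<^sub>v (dim_col A) \<in> {x \<in> carrier_vec (dim_col A). eucl_norm x \<le> 1}" by (simp add: eucl_norm_def)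
    then show ?thesis by blast
  qed
  ultimately have "op_norm A \<le> sqrt (1 - 1 / F)"
    unfolding op_norm_def by (intro cSUP_least) auto
  also have "\<dots> < 1" using F by simp
  finally show ?thesis .
qed

subsection \<open>Positivity criteria\<close>

context herm
begin

text \<open>An element of \<open>S\<close> is a combination of \<open>F\<close> plus an element of
  \<open>T\<close>, and the residual of \<open>X\<close> is orthogonal to both.\<close>

lemma orth_step:
  assumes "onb S T F" "orth X T" "dim_col X = 1"
  shows "orth (X - cmat (lprod L X F) * F) S"
  unfolding orth_def
proof (intro allI impI ballI)
  let ?X = "X - cmat (lprod L X F) * F"
  fix i y assume i: "i < dim_row ?X" and y: "y \<in> S"
  note F = onbD[OF assms(1)]
  define Y where "Y = mat 1 1 (\<lambda>_. y)"
  have Y: "col_in Y S" "dim_row Y = 1" "dim_col Y = 1" using y by (auto simp: Y_def col_in_def)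
  have "orth ?X T" using F(3,6) assms by (intro orth_add orth_cmat_mult) auto
  from orth_lprod(1)[OF this F(5)[OF Y(1)]]
  have "lprod L ?X (Y - cmat (lprod L Y F) * F) = 0\<^sub>m (dim_row X) 1"
    using F(6) Y assms(3) by simp
  moreover have "lprod L ?X F = 0\<^sub>m (dim_row X) (dim_row F)"
    using F(4,6) assms(3) by (simp add: lprod_simps)
  ultimately have "lprod L ?X Y = 0\<^sub>m (dim_row X) 1"
    using F(6) Y assms(3) by (simp add: lprod_add(4) lprod_cmat_right)
  then have "lprod L ?X Y $$ (i, 0) = 0" using i F(6) by simp
  then show "L (?X $$ (i, 0) * lstar y) = 0"
    using i Y F(6) assms(3) by (subst (asm) lprod_index) (auto simp: Y_def)
qed

text \<open>\<open>y\<close> is a nonzero multiple of the residual of the new monomial; if its norm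
  is positive, the normalised \<open>y\<close> is an orthonormal completion and
  \<open>pd_step\<close> applies.\<close>

lemma pd_insert_iff:
  assumes T: "pd (mono_span T)" and k: "k \<notin> T" "lcoeff y k \<noteq> 0"
    and y: "y \<in> mono_span (insert k T)" "\<And>p. p \<in> mono_span T \<Longrightarrow> L (y * lstar p) = 0"
  shows "pd (mono_span (insert k T)) \<longleftrightarrow> 0 < L (y * lstar y)"
proof
  assume "pd (mono_span (insert k T))"
  moreover have "y \<noteq> 0" using k by auto
  ultimately show "0 < L (y * lstar y)" using y(1) unfolding pd_def by blast
next
  assume pos: "0 < L (y * lstar y)"
  define s where "s = sqrt (Re (L (y * lstar y)))"
  have s: "0 < s" "L (y * lstar y) = complex_of_real (s * s)"
    using pos by (auto simp: s_def less_complex_def complex_eq_iff)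
  define F where "F = mat 1 1 (\<lambda>_. cst (complex_of_real (1 / s)) * y)"
  have F: "dim_row F = 1" "dim_col F = 1" "F $$ (0, 0) = cst (complex_of_real (1 / s)) * y"
    by (auto simp: F_def)
  have "onb (mono_span (T \<union> set [k])) (mono_span T) F"
  proof (rule onbI_cfm)
    show "set [k] \<inter> T = {}" using k by simp
    show "col_in F (mono_span (T \<union> set [k]))"
      using y(1) lsubspaceD(3)[OF lsubspace_mono_span] by (auto simp: col_in_def F)
    show "orth F (mono_span T)"
      using y(2) by (auto simp: orth_def F mult.assoc L_cst)
    show "lprod L F F = 1\<^sub>m (length [k])"
    proof (rule eq_matI)
      fix i j assume "i < dim_row (1\<^sub>m (length [k]))" "j < dim_col (1\<^sub>m (length [k]))"
      moreover have "L (F $$ (0, 0) * lstar (F $$ (0, 0))) = 1"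
      proof -
        let ?c = "cst (complex_of_real (1 / s))"
        have "F $$ (0, 0) * lstar (F $$ (0, 0)) = ?c * (?c * (y * lstar y))"
          by (simp only: F lstar_mult lstar_cst complex_cnj_complex_of_real mult_ac)
        then show ?thesis using s by (simp only: L_cst) simp
      qed
      ultimately show "lprod L F F $$ (i, j) = 1\<^sub>m (length [k]) $$ (i, j)"
        using F by (simp add: lprod_index)
    qed (use F in auto)
    show "nonsing (length [k]) (cfm [k] F)"
    proof (rule nonsing_upper)
      show "cfm [k] F $$ (i, i) \<noteq> 0" if "i < length [k]" for i
        using that k(2) s(1) by (simp add: cfm_index F)
    qed (auto simp: F intro!: carrier_matI upper_triangularI)
  qed (use F in simp)
  then show "pd (mono_span (insert k T))"
    using pd_step[OF _ T lsubspace_mono_span] by simp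
qed

text \<open>Pythagoras for two mutually orthogonal orthonormal columns.\<close>

lemma residual_gram:
  assumes d: "dim_col X = 1" "dim_col F = 1" "dim_col G = 1"
    and gram: "lprod L F F = 1\<^sub>m (dim_row F)" "lprod L G G = 1\<^sub>m (dim_row G)"
      "lprod L F G = 0\<^sub>m (dim_row F) (dim_row G)"
    and C: "C = lprod L X F" and D: "D = lprod L X G"
  shows "lprod L (X - cmat C * F - cmat D * G) (X - cmat C * F - cmat D * G) =
    lprod L X X - (C * mat_adjoint C + D * mat_adjoint D)"
proof (rule eq_matI)
  fix i j assume ij: "i < dim_row (lprod L X X - (C * mat_adjoint C + D * mat_adjoint D))"
    "j < dim_col (lprod L X X - (C * mat_adjoint C + D * mat_adjoint D))"
  have CD: "dim_row C = dim_row X" "dim_col C = dim_row F" "dim_row D = dim_row X" "dim_col D = dim_row G"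
    by (simp_all add: C D)
  have sw: "lprod L F X = mat_adjoint C" "lprod L G X = mat_adjoint D"
    "lprod L X F = C" "lprod L X G = D"
    using d by (simp_all add: C D lprod_swap)
  have FG: "lprod L G F = 0\<^sub>m (dim_row G) (dim_row F)"
    using d gram(3) by (metis conj_trans_one(3) lprod_swap)
  show "lprod L (X - cmat C * F - cmat D * G) (X - cmat C * F - cmat D * G) $$ (i, j) =
      (lprod L X X - (C * mat_adjoint C + D * mat_adjoint D)) $$ (i, j)"
    using ij CD d by (simp add: lprod_simps sw gram FG mat_distribs del: index_mult_mat(1))
qed (use d C in auto)

end

context mfun
begin

lemma onb_PU:
  assumes "pd (mono_span (corner n m))"
  shows "onb (mono_span (corner n m)) (Vbox n (Suc m)) (PU n m)"
  using gscol_onb[of "box n (Suc m)" "zkeys n m"] keys_distinct assms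
  by (simp add: keys_box corner_eq(1)[symmetric] PU_def)

lemma onb_QU:
  assumes "pd (mono_span (corner n m))"
  shows "onb (mono_span (corner n m)) (Vbox (Suc n) m) (QU n m)"
  using gscol_onb[of "box (Suc n) m" "wkeys n m"] keys_distinct assms
  by (simp add: keys_box corner_eq(2)[symmetric] QU_def)

lemma Vbox_corner: "Vbox (Suc n) m \<subseteq> mono_span (corner n m)" "Vbox n (Suc m) \<subseteq> mono_span (corner n m)"
  by (auto intro!: mono_span_mono simp: corner_def box_def)

text \<open>\<open>rec_P\<close> and its tilde counterpart with only the lower rows
  \<open>PU\<close> and \<open>QU\<close> of the new columns, which spares positivity at the
  corner.\<close>

lemma rec_P_corner:
  assumes "pd (mono_span (corner n m))"
  shows "Pcol L n m = cmat (gK n m) * Qcol L n m + cmat (Bz n m) * PU n m"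
    "Qcol L n m = cmat (mat_adjoint (gK n m)) * Pcol L n m + cmat (Bw n m) * QU n m"
    "gK n m * mat_adjoint (gK n m) + Bz n m * mat_adjoint (Bz n m) = 1\<^sub>m m"
    "mat_adjoint (gK n m) * gK n m + Bw n m * mat_adjoint (Bw n m) = 1\<^sub>m n"
proof -
  have o: "pd (Vbox (Suc n) m)" "pd (Vbox n (Suc m))"
    by (rule pd_mono[OF assms Vbox_corner(1)]) (rule pd_mono[OF assms Vbox_corner(2)])
  have oo: "pd (Vbox n m)" by (rule ok_mono[OF o(1)]) auto
  note PQ = P_facts[OF o(1)] Q_facts[OF o(2)]
  show P: "Pcol L n m = cmat (gK n m) * Qcol L n m + cmat (Bz n m) * PU n m"
    unfolding gK_def Bz_def
    by (rule onb_expand2[OF onb_Q[OF o(2)] onb_PU[OF assms] oo V_sub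
          col_in_mono[OF PQ(1) Vbox_corner(1)] PQ(2)])
  have "Qcol L n m = cmat (lprod L (Qcol L n m) (Pcol L n m)) * Pcol L n m + cmat (Bw n m) * QU n m"
    unfolding Bw_def
    by (rule onb_expand2[OF onb_P[OF o(1)] onb_QU[OF assms] oo V_sub
          col_in_mono[OF PQ(4) Vbox_corner(2)] PQ(5)])
  then show Q: "Qcol L n m = cmat (mat_adjoint (gK n m)) * Pcol L n m + cmat (Bw n m) * QU n m"
    by (simp add: gK_def lprod_swap)
  have "lprod L (Pcol L n m) (Pcol L n m) =
      lprod L (Pcol L n m) (cmat (gK n m) * Qcol L n m + cmat (Bz n m) * PU n m)"
    by (subst P) (simp add: P[symmetric])
  then show "gK n m * mat_adjoint (gK n m) + Bz n m * mat_adjoint (Bz n m) = 1\<^sub>m m"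
    using PQ(3) by (simp add: lprod_simps flip: gK_def Bz_def)
  have "lprod L (Qcol L n m) (Qcol L n m) =
      lprod L (Qcol L n m) (cmat (mat_adjoint (gK n m)) * Pcol L n m + cmat (Bw n m) * QU n m)"
    by (subst Q) (simp add: Q[symmetric])
  moreover have "lprod L (Qcol L n m) (Pcol L n m) = mat_adjoint (gK n m)"
    by (simp add: gK_def lprod_swap)
  ultimately show "mat_adjoint (gK n m) * gK n m + Bw n m * mat_adjoint (Bw n m) = 1\<^sub>m n"
    using PQ(6) by (simp add: lprod_simps flip: Bw_def)
qed

text \<open>For the converse, removing from \<open>Q\<close> its projection to \<open>P\<close>
  leaves a column \<open>X\<close> with Gram matrix \<open>1 - mat_adjoint K * K\<close>. Every
  polynomial off the corner is a part \<open>H\<close> of lower degree in \<open>w\<close> plus a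
  combination of \<open>X\<close>, orthogonal to \<open>H\<close>, and the norm condition makes the
  second part contribute positively.\<close>

lemma pd_corner_iff:
  assumes o: "pd (Vbox (Suc n) m)" "pd (Vbox n (Suc m))"
  shows "pd (mono_span (corner n m)) \<longleftrightarrow> op_norm (gK n m) < 1"
proof
  assume "pd (mono_span (corner n m))"
  then show "op_norm (gK n m) < 1"
    using op_norm_less_1I[OF rec_P_corner(4) pos_upper_nonsing[OF Bw_pos]] by simp
next
  assume less: "op_norm (gK n m) < 1"
  define K where "K = gK n m"
  have K: "dim_row K = m" "dim_col K = n" by (simp_all add: K_def)
  note PQ = P_facts[OF o(1)] Q_facts[OF o(2)]
  define X where "X = Qcol L n m - cmat (mat_adjoint K) * Pcol L n m"
  have X: "dim_row X = n" "dim_col X = 1" by (simp_all add: X_def K)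
  have QP: "lprod L (Qcol L n m) (Pcol L n m) = mat_adjoint K" "lprod L (Pcol L n m) (Qcol L n m) = K"
    by (simp_all add: K_def gK_def lprod_swap)
  have Xo: "orth X (Vbox (Suc n) m)"
    using orth_step[OF onb_P[OF o(1)] PQ(5)] by (simp add: X_def QP)
  have XX: "lprod L X X = 1\<^sub>m n - mat_adjoint K * K"
  proof (rule eq_matI)
    fix i j assume "i < dim_row (1\<^sub>m n - mat_adjoint K * K)" "j < dim_col (1\<^sub>m n - mat_adjoint K * K)"
    then show "lprod L X X $$ (i, j) = (1\<^sub>m n - mat_adjoint K * K) $$ (i, j)"
      using K PQ(3,6) by (simp add: X_def lprod_simps QP mat_distribs del: index_mult_mat(1))
  qed (use X K in auto)
  have cfmX: "cfm (wkeys n m) X = cfm (wkeys n m) (Qcol L n m)"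
  proof -
    have "cfm (wkeys n m) (Pcol L n m) = 0\<^sub>m m n"
      using cfm_zero[OF PQ(1), of "wkeys n m"] by (simp add: keys_box)
    then show ?thesis using K by (simp add: X_def cfm_diff cfm_cmat_mult)
  qed
  have XC: "col_in X (mono_span (corner n m))"
    unfolding X_def using K
    by (intro col_in_add col_in_cmat_mult lsubspace_mono_span col_in_mono[OF PQ(1) Vbox_corner(1)]
        col_in_mono[OF PQ(4) Vbox_corner(2)]) auto
  note ns = pos_upper_nonsing[OF cfm_Q[OF o(2)]]
  show "pd (mono_span (corner n m))"
    unfolding pd_def
  proof (intro ballI impI)
    fix y assume y: "y \<in> mono_span (corner n m)" "y \<noteq> 0"
    define Y where "Y = mat 1 1 (\<lambda>_. y)"
    have Y: "col_in Y (mono_span (corner n m))" "dim_row Y = 1" "dim_col Y = 1" "Y $$ (0, 0) = y"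
      using y by (auto simp: Y_def col_in_def)
    \<comment> \<open>Chosen to match the coefficients of the highest power of \<open>w\<close>,
      which \<open>X\<close> shares with \<open>Q\<close>.\<close>
    define C where "C = cfm (wkeys n m) Y * minv (cfm (wkeys n m) (Qcol L n m))"
    have C: "dim_row C = 1" "dim_col C = n" using ns Y by (simp_all add: C_def)
    define H where "H = Y - cmat C * X"
    have H: "dim_row H = 1" "dim_col H = 1" using C X Y by (simp_all add: H_def)
    have "col_in H (mono_span (box (Suc n) m \<union> set (wkeys n m)))"
      unfolding H_def corner_eq(2)[symmetric] using Y XC C X
      by (intro col_in_add col_in_cmat_mult lsubspace_mono_span) auto
    moreover have "cfm (wkeys n m) H = 0\<^sub>m (dim_row H) (length (wkeys n m))"
      using Y C X H nonsing_cancel_right(2)[OF ns, of "cfm (wkeys n m) Y"]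
      by (simp add: H_def cfm_diff cfm_cmat_mult cfmX) (simp add: C_def)
    ultimately have Hin: "col_in H (Vbox (Suc n) m)" by (rule col_in_cfm)
    have Yeq: "Y = H + cmat C * X" using C X Y by (intro eq_matI) (auto simp: H_def simp del: index_mult_mat(1))
    define Z where "Z = mat_adjoint C"
    have Z: "dim_row Z = n" "dim_col Z = 1" "C = mat_adjoint Z" using C by (simp_all add: Z_def)
    have "lprod L Y Y = lprod L (H + cmat C * X) (H + cmat C * X)" using Yeq by simp
    also have "\<dots> = lprod L H H + (C * mat_adjoint C - mat_adjoint (K * mat_adjoint C) * (K * mat_adjoint C))"
      using C X H K orth_lprod[OF Xo Hin]
      by (simp add: lprod_simps XX mat_distribs)
    also have "\<dots> = lprod L H H + (mat_adjoint Z * Z - mat_adjoint (K * Z) * (K * Z))"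
      by (simp add: Z(3))
    finally have "lprod L Y Y $$ (0, 0) = lprod L H H $$ (0, 0) +
        ((mat_adjoint Z * Z) $$ (0, 0) - (mat_adjoint (K * Z) * (K * Z)) $$ (0, 0))"
      using H Z K by simp
    moreover define x where "x = vec n (\<lambda>i. Z $$ (i, 0))"
    have x: "colmat x = Z" "dim_vec x = n" using Z by (auto simp: x_def colmat_def intro!: eq_matI)
    have "colmat (K *\<^sub>v x) = K * Z" using colmat_mult[of x K] x K by simp
    then have "(mat_adjoint Z * Z) $$ (0, 0) - (mat_adjoint (K * Z) * (K * Z)) $$ (0, 0) =
        complex_of_real ((eucl_norm x)\<^sup>2) - complex_of_real ((eucl_norm (K *\<^sub>v x))\<^sup>2)"
      using eucl_norm_colmat[of x] eucl_norm_colmat[of "K *\<^sub>v x"] x by simp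
    ultimately have eq: "L (y * lstar y) = L (H $$ (0, 0) * lstar (H $$ (0, 0))) +
        complex_of_real ((eucl_norm x)\<^sup>2 - (eucl_norm (K *\<^sub>v x))\<^sup>2)"
      using Y H by (simp add: lprod_index)
    have Hm: "H $$ (0, 0) \<in> Vbox (Suc n) m" using Hin H by (simp add: col_in_def)
    show "0 < L (y * lstar y)"
    proof (cases "x = 0\<^sub>v n")
      case True
      then have "eucl_norm x = 0" "eucl_norm (K *\<^sub>v x) = 0"
        using K by (simp_all add: eucl_norm_def scalar_prod_def)
      then have "L (y * lstar y) = L (H $$ (0, 0) * lstar (H $$ (0, 0)))" unfolding eq by simp
      moreover have "H $$ (0, 0) \<noteq> 0"
      proof
        assume "H $$ (0, 0) = 0"
        have "C $$ (0, j) = 0" if "j < n" for j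
          using arg_cong[OF True, of "\<lambda>v. v $ j"] that C by (simp add: x_def Z_def)
        then have "(cmat C * X) $$ (0, 0) = 0"
          using C X by (subst cmat_mult_index) (auto intro!: sum.neutral)
        then show False
          using \<open>H $$ (0, 0) = 0\<close> arg_cong[OF Yeq, of "\<lambda>A. A $$ (0, 0)"] y Y C X
          by (simp del: index_mult_mat(1))
      qed
      then have "0 < L (H $$ (0, 0) * lstar (H $$ (0, 0)))" using Hm o(1) unfolding pd_def by blast
      ultimately show ?thesis by (simp only:)
    next
      case False
      then have "eucl_norm (K *\<^sub>v x) < eucl_norm x"
        using op_norm_less_1D[OF less[folded K_def] carrier_vecI] x(2) K by metis
      then have "0 < (eucl_norm x)\<^sup>2 - (eucl_norm (K *\<^sub>v x))\<^sup>2"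
        by (simp add: power_strict_mono)
      moreover have "0 \<le> L (H $$ (0, 0) * lstar (H $$ (0, 0)))"
      proof (cases "H $$ (0, 0) = 0")
        case False
        then have "0 < L (H $$ (0, 0) * lstar (H $$ (0, 0)))" using Hm o(1) unfolding pd_def by blast
        then show ?thesis by (rule less_imp_le)
      qed simp
      ultimately show ?thesis unfolding eq by (simp add: less_complex_def less_eq_complex_def)
    qed
  qed
qed

text \<open>The part of \<open>gG1\<close> beyond its first column; it requires positivity only off
  the corner.\<close>

definition G1U :: "nat \<Rightarrow> nat \<Rightarrow> complex mat" where
  "G1U n m = lprod L (shift_w (Pcol L n m)) (PU n m)"

lemma G1U_dim [simp]: "dim_row (G1U n m) = m" "dim_col (G1U n m) = m"
  by (simp_all add: G1U_def)

text \<open>The last positivity condition compares the first row of \<open>w P\<close> with its projection to the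
  span of all monomials but the corner.\<close>

lemma pd_full_iff:
  assumes c: "pd (mono_span (corner (Suc n) (Suc m)))"
  shows "pd (Vbox (Suc (Suc n)) (Suc (Suc m))) \<longleftrightarrow>
    (gK1 (Suc n) (Suc m) * mat_adjoint (gK1 (Suc n) (Suc m))
      + G1U (Suc n) (Suc m) * mat_adjoint (G1U (Suc n) (Suc m))) $$ (0, 0) < 1"
proof -
  let ?N = "Suc n" and ?M = "Suc m"
  define K1 where "K1 = gK1 ?N ?M"
  define G where "G = G1U ?N ?M"
  have d: "dim_row K1 = ?M" "dim_col K1 = ?N" "dim_row G = ?M" "dim_col G = ?M"
    by (simp_all add: K1_def G_def)
  have o: "pd (Vbox (Suc ?N) ?M)" "pd (Vbox ?N (Suc ?M))"
    by (rule pd_mono[OF c Vbox_corner(1)]) (rule pd_mono[OF c Vbox_corner(2)])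
  note P = P_facts[OF o(1)]
  let ?RQ = "R n ?M (Qcol L ?N ?M)" and ?wP = "shift_w (Pcol L ?N ?M)" and ?U = "PU ?N ?M"
  have K1: "lprod L ?wP ?RQ = K1" by (simp add: K1_def gK1_def)
  note RQ = onbD[OF onb_RQ[OF o(2)]] and U = onbD[OF onb_PU[OF c]]
  define X where "X = ?wP - cmat K1 * ?RQ"
  have Xo: "orth X (Vbox ?N (Suc ?M))"
    unfolding X_def K1[symmetric]
    by (rule orth_step[OF onb_RQ[OF o(2)] orth_shift(2)[OF P(2)]]) simp_all
  have RQU: "lprod L ?RQ ?U = 0\<^sub>m ?N ?M" "lprod L ?U ?RQ = 0\<^sub>m ?M ?N"
    using orth_lprod[OF U(3) RQ(1)] by simp_all
  have XU: "lprod L X ?U = G"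
    using d RQU by (simp add: X_def lprod_simps G_def G1U_def)
  have X: "dim_row X = ?M" "dim_col X = 1" using d by (simp_all add: X_def)
  define Y where "Y = X - cmat G * ?U"
  have Yo: "orth Y (mono_span (corner ?N ?M))"
    unfolding Y_def XU[symmetric] by (rule orth_step[OF onb_PU[OF c] Xo X(2)])
  have Y: "dim_row Y = ?M" "dim_col Y = 1" using d X by (simp_all add: Y_def)
  have wPin: "col_in ?wP (Vbox (Suc ?N) (Suc ?M))" by (rule col_in_shift(2)[OF P(1)])
  have cs: "mono_span (corner ?N ?M) \<subseteq> Vbox (Suc ?N) (Suc ?M)"
    by (rule mono_span_mono) (auto simp: corner_def)
  have RQin: "col_in ?RQ (mono_span (corner ?N ?M))" by (rule col_in_mono[OF RQ(1) Vbox_corner(2)])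
  have Uin: "col_in ?U (mono_span (corner ?N ?M))" by (rule U(1))
  have Yin: "col_in Y (Vbox (Suc ?N) (Suc ?M))"
    unfolding Y_def X_def using d wPin RQin Uin cs
    by (intro col_in_add col_in_cmat_mult lsubspace_mono_span) (auto intro: col_in_mono)
  have YY: "lprod L Y Y = 1\<^sub>m ?M - (K1 * mat_adjoint K1 + G * mat_adjoint G)"
  proof -
    have "lprod L ?wP ?wP = 1\<^sub>m ?M" using P(3) by (simp add: R_gram)
    moreover have "lprod L Y Y = lprod L ?wP ?wP - (K1 * mat_adjoint K1 + G * mat_adjoint G)"
      unfolding Y_def X_def
      by (rule residual_gram) (use RQ(4) U(4) RQU K1 in \<open>simp_all add: G_def G1U_def\<close>)
    ultimately show ?thesis by simp
  qed
  define y where "y = Y $$ (0, 0)"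
  have yy: "L (y * lstar y) = 1 - (K1 * mat_adjoint K1 + G * mat_adjoint G) $$ (0, 0)"
    using arg_cong[OF YY, of "\<lambda>A. A $$ (0, 0)"] Y d
    by (simp add: y_def lprod_index del: index_mult_mat(1))
  have real: "Im ((K1 * mat_adjoint K1 + G * mat_adjoint G) $$ (0, 0)) = 0"
    using d by (simp add: mult_adjoint_self del: index_mult_mat(1))
  have yin: "y \<in> Vbox (Suc ?N) (Suc ?M)" using Yin Y by (simp add: col_in_def y_def)
  have yco: "0 < lcoeff y (int ?N, int ?M)"
  proof -
    have z: "lcoeff p (int ?N, int ?M) = 0" if "p \<in> mono_span (corner ?N ?M)" for p
      using that by (simp add: mono_span_iff corner_def)
    have "col_in (cmat K1 * ?RQ) (mono_span (corner ?N ?M))" "col_in (cmat G * ?U) (mono_span (corner ?N ?M))"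
      using d RQin Uin by (auto intro!: col_in_cmat_mult lsubspace_mono_span)
    then have "(cmat K1 * ?RQ) $$ (0, 0) \<in> mono_span (corner ?N ?M)"
      "(cmat G * ?U) $$ (0, 0) \<in> mono_span (corner ?N ?M)"
      using d by (simp_all add: col_in_def del: index_mult_mat(1))
    from this[THEN z] have "lcoeff y (int ?N, int ?M) = lcoeff (?wP $$ (0, 0)) (int ?N, int ?M)"
      using d by (simp add: y_def Y_def X_def lookup_minus del: index_mult_mat(1))
    also have "\<dots> = lcoeff (Pcol L ?N ?M $$ (0, 0)) (int ?N, int ?M - 1)" by (simp add: zwn_def)
    finally show ?thesis using P_row_mem(2)[OF o(1), of 0] by simp
  qed
  have full: "insert (int ?N, int ?M) (corner ?N ?M) = box (Suc ?N) (Suc ?M)"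
    by (auto simp: corner_def box_def)
  have "y \<in> mono_span (insert (int ?N, int ?M) (corner ?N ?M))" unfolding full by (rule yin)
  moreover have "L (y * lstar p) = 0" if "p \<in> mono_span (corner ?N ?M)" for p
    using Yo Y that by (simp add: orth_def y_def)
  moreover have "lcoeff y (int ?N, int ?M) \<noteq> 0" using yco by (metis less_irrefl)
  ultimately have "pd (Vbox (Suc ?N) (Suc ?M)) \<longleftrightarrow> 0 < L (y * lstar y)"
    using pd_insert_iff[OF c, of "(int ?N, int ?M)" y] unfolding full by (simp add: corner_def)
  moreover have "0 < 1 - t \<longleftrightarrow> t < 1" if "Im t = 0" for t :: complex
    using that by (simp add: less_complex_def)
  ultimately show ?thesis using real unfolding yy K1_def G_def by blast
qed

end

subsection \<open>The matrices of the algorithm\<close>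

context bicircle
begin

text \<open>Divided by the leading coefficients, \<open>gK\<close> becomes the Gram matrix of monic residuals. A
  shifted monic residual is again one, which fixes all rows but the last by the lower level.\<close>

lemma monic_rows:
  assumes o: "ok (Suc (Suc n)) (Suc m)" "ok (Suc n) (Suc (Suc m))"
    and ns: "nonsing (Suc m) ZL" "nonsing m ZL0" "nonsing (Suc n) WL" "nonsing (Suc n) WL0"
    and tA: "gtA n m * WL = WL0"
    and Z: "col_in (cmat (minv ZL0) * shift_w (P (Suc n) m)
      - cmat (Ush1 m) * (cmat (minv ZL) * P (Suc n) (Suc m))) (V (Suc n) (Suc m))"
  shows "Ush1 m * (minv ZL * gK (Suc n) (Suc m) * minv (mat_adjoint WL)) =
    minv ZL0 * (gK (Suc n) m - gK1 (Suc n) m * mat_adjoint (gtE n m)) * minv (mat_adjoint WL0)"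
proof -
  let ?P = "P (Suc n) (Suc m)" and ?Q = "Q (Suc n) (Suc m)" and ?wP = "shift_w (P (Suc n) m)"
  let ?K = "gK (Suc n) (Suc m)"
  note nd = nonsing_dim[OF ns(1)] nonsing_dim[OF ns(2)] nonsing_dim[OF ns(3)] nonsing_dim[OF ns(4)]
  note nd' = minv_nonsing(1)[OF ns(1)] minv_nonsing(1)[OF ns(2)]
  have "lprod L (cmat (minv ZL0) * ?wP - cmat (Ush1 m) * (cmat (minv ZL) * ?P)) ?Q = 0\<^sub>m m (Suc n)"
    using orth_lprod(2)[OF Q_facts(2)[OF o(2)] Z] ns by simp
  then have "minv ZL0 * lprod L ?wP ?Q - Ush1 m * (minv ZL * ?K) = 0\<^sub>m m (Suc n)"
    using ns by (simp add: lprod_simps flip: gK_def)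
  then have "(minv ZL0 * lprod L ?wP ?Q - Ush1 m * (minv ZL * ?K)) $$ (i, j) = 0" if "i < m" "j < Suc n" for i j
    using that by (simp del: index_mult_mat(1))
  then have 1: "minv ZL0 * lprod L ?wP ?Q = Ush1 m * (minv ZL * ?K)"
    using ns by (intro eq_matI) (auto simp del: index_mult_mat(1))
  have "cmat (gtA n m) * ?Q = shift_w (Q (Suc n) m) - cmat (gtE n m) * R n m (Q (Suc n) m)"
    by (subst szego_Q[OF o(2)]) (auto intro!: eq_matI simp del: index_mult_mat(1))
  then have "lprod L ?wP (cmat (gtA n m) * ?Q) =
      lprod L ?wP (shift_w (Q (Suc n) m) - cmat (gtE n m) * R n m (Q (Suc n) m))" by simp
  then have 2: "lprod L ?wP ?Q * mat_adjoint (gtA n m) = gK (Suc n) m - gK1 (Suc n) m * mat_adjoint (gtE n m)"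
    by (simp add: lprod_simps R_gram gK1_def flip: gK_def)
  have "mat_adjoint WL * mat_adjoint (gtA n m) = mat_adjoint WL0"
    using nd by (simp add: tA flip: adjoint_mult)
  then have "mat_adjoint WL * (mat_adjoint (gtA n m) * minv (mat_adjoint WL0)) = 1\<^sub>m (Suc n)"
    using nd nonsing_conj_trans(1)[OF ns(4)] minv_nonsing(2)[OF nonsing_conj_trans(1)[OF ns(4)]]
    by (simp flip: mult_assoc_dim)
  from nonsing_solve[OF nonsing_conj_trans(1)[OF ns(3)] _ this]
  have 3: "mat_adjoint (gtA n m) * minv (mat_adjoint WL0) = minv (mat_adjoint WL)"
    using nonsing_conj_trans(1)[OF ns(3)] by simp
  have "minv ZL0 * (gK (Suc n) m - gK1 (Suc n) m * mat_adjoint (gtE n m)) * minv (mat_adjoint WL0) =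
      (minv ZL0 * lprod L ?wP ?Q) * (mat_adjoint (gtA n m) * minv (mat_adjoint WL0))"
    unfolding 2[symmetric] using ns nonsing_conj_trans(1)[OF ns(4)] by (simp add: mult_assoc_dim)
  also have "\<dots> = Ush1 m * (minv ZL * ?K * minv (mat_adjoint WL))"
    unfolding 1 3 using ns nonsing_conj_trans(1)[OF ns(3)] by (simp add: mult_assoc_dim)
  finally show ?thesis ..
qed

end

lemma conj_Ush [simp]: "mcnj (Ush k) = Ush k" "mcnj (Ush1 k) = Ush1 k"
  "mat_adjoint (Ush k) = transpose_mat (Ush k)" "mat_adjoint (Ush1 k) = transpose_mat (Ush1 k)"
proof -
  show 1: "mcnj (Ush k) = Ush k" "mcnj (Ush1 k) = Ush1 k"
    by (auto intro!: eq_matI simp: Ush_index)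
  show "mat_adjoint (Ush k) = transpose_mat (Ush k)" "mat_adjoint (Ush1 k) = transpose_mat (Ush1 k)"
    using conj_trans_simps(8)[of "Ush k"] conj_trans_simps(8)[of "Ush1 k"] by (simp_all add: 1)
qed

context mfun
begin

lemma cfm_shift:
  assumes "dim_col X = 1"
  shows "cfm (zkeys (Suc n) k) (shift_z X) = cfm (zkeys n k) X"
    "cfm (wkeys k (Suc m)) (shift_w X) = cfm (wkeys k m) X"
  by (rule eq_matI; use assms in \<open>simp add: cfm_index keys_nth zwn_def\<close>)+

text \<open>\<open>w X\<close> has no term free of \<open>w\<close>; this is the zero column that
  \<open>Ush1\<close> appends.\<close>

lemma cfm_shift_Ush1:
  "col_in X (Vbox a k) \<Longrightarrow> cfm (zkeys n (Suc k)) (shift_w X) = cfm (zkeys n k) X * Ush1 k"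
  "col_in X (Vbox k b) \<Longrightarrow> cfm (wkeys (Suc k) m) (shift_z X) = cfm (wkeys k m) X * Ush1 k"
  by (rule eq_matI; auto simp: cfm_index keys_nth mult_Ush_index zwn_def col_in_def mono_span_iff box_def
      diff_diff_eq add.commute[of 1] simp del: index_mult_mat(1))+

abbreviation ZL :: "nat \<Rightarrow> nat \<Rightarrow> complex mat" where "ZL n k \<equiv> cfm (zkeys n k) (Pcol L n k)"
abbreviation WL :: "nat \<Rightarrow> nat \<Rightarrow> complex mat" where "WL k m \<equiv> cfm (wkeys k m) (Qcol L k m)"

lemma ZL_nonsing: "pd (Vbox (Suc n) k) \<Longrightarrow> nonsing k (ZL n k)"
  and WL_nonsing: "pd (Vbox k (Suc m)) \<Longrightarrow> nonsing k (WL k m)"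
  by (auto intro: pos_upper_nonsing cfm_P cfm_Q)

text \<open>Comparison of the highest powers of \<open>z\<close> in the Szego recurrence, where the
  reversed column does not contribute.\<close>

lemma gA_lead:
  assumes "pd (Vbox (Suc (Suc n)) (Suc m))"
  shows "gA n m * ZL (Suc n) (Suc m) = ZL n (Suc m)"
proof -
  have "pd (Vbox (Suc n) (Suc m))" by (rule ok_mono[OF assms]) auto
  then show ?thesis
    using onb_cfm[OF onb_P[OF assms] _ col_in_shift(1)[OF P_facts(1)], of "zkeys (Suc n) (Suc m)"]
    by (simp add: keys_box cfm_shift flip: gA_def)
qed

lemma gtA_lead:
  assumes "pd (Vbox (Suc n) (Suc (Suc m)))"
  shows "gtA n m * WL (Suc n) (Suc m) = WL (Suc n) m"
proof -
  have "pd (Vbox (Suc n) (Suc m))" by (rule ok_mono[OF assms]) auto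
  then show ?thesis
    using onb_cfm[OF onb_Q[OF assms] _ col_in_shift(2)[OF Q_facts(1)], of "wkeys (Suc n) (Suc m)"]
    by (simp add: keys_box cfm_shift flip: gtA_def)
qed

lemma gG1_lead:
  assumes "pd (Vbox (Suc n) (Suc m))"
  shows "gG1 n m * ZL n (Suc m) = ZL n m * Ush1 m"
proof -
  have o: "pd (Vbox (Suc n) m)" by (rule ok_mono[OF assms]) auto
  show ?thesis
    using onb_cfm[OF onb_P[OF assms] _ col_in_shift(2)[OF P_facts(1)[OF o]], of "zkeys n (Suc m)"]
      cfm_shift_Ush1(1)[OF P_facts(1)[OF o]]
    by (simp add: keys_box flip: gG1_def)
qed

lemma gtG1_lead:
  assumes "pd (Vbox (Suc n) (Suc m))"
  shows "gtG1 n m * WL (Suc n) m = WL n m * Ush1 n"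
proof -
  have o: "pd (Vbox n (Suc m))" by (rule ok_mono[OF assms]) auto
  show ?thesis
    using onb_cfm[OF onb_Q[OF assms] _ col_in_shift(1)[OF Q_facts(1)[OF o]], of "wkeys (Suc n) m"]
      cfm_shift_Ush1(2)[OF Q_facts(1)[OF o]]
    by (simp add: keys_box flip: gtG1_def)
qed

lemma gA_nonsing: "pd (Vbox (Suc (Suc n)) (Suc m)) \<Longrightarrow> nonsing (Suc m) (gA n m)"
  and gtA_nonsing: "pd (Vbox (Suc n) (Suc (Suc m))) \<Longrightarrow> nonsing (Suc n) (gtA n m)"
proof -
  assume o: "pd (Vbox (Suc (Suc n)) (Suc m))"
  then have o': "pd (Vbox (Suc n) (Suc m))" by (rule ok_mono) auto
  have "gA n m = ZL n (Suc m) * minv (ZL (Suc n) (Suc m))"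
    using nonsing_solve_right[OF ZL_nonsing[OF o] _ gA_lead[OF o]] by simp
  then show "nonsing (Suc m) (gA n m)"
    using nonsing_mult nonsing_minv ZL_nonsing[OF o] ZL_nonsing[OF o'] by simp
next
  assume o: "pd (Vbox (Suc n) (Suc (Suc m)))"
  then have o': "pd (Vbox (Suc n) (Suc m))" by (rule ok_mono) auto
  have "gtA n m = WL (Suc n) m * minv (WL (Suc n) (Suc m))"
    using nonsing_solve_right[OF WL_nonsing[OF o] _ gtA_lead[OF o]] by simp
  then show "nonsing (Suc n) (gtA n m)"
    using nonsing_mult nonsing_minv WL_nonsing[OF o] WL_nonsing[OF o'] by simp
qed

text \<open>Both terms are monic at the same monomials, so the leading coefficients cancel.\<close>

lemma monic_diff_z:
  assumes "pd (Vbox (Suc (Suc n)) (Suc m))"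
  shows "col_in (cmat (minv (ZL (Suc n) m)) * shift_w (Pcol L (Suc n) m)
    - cmat (Ush1 m) * (cmat (minv (ZL (Suc n) (Suc m))) * Pcol L (Suc n) (Suc m))) (Vbox (Suc n) (Suc m))"
proof (rule col_in_cfm)
  have o: "pd (Vbox (Suc (Suc n)) m)" by (rule ok_mono[OF assms]) auto
  note ns = ZL_nonsing[OF assms] ZL_nonsing[OF o]
  let ?X = "cmat (minv (ZL (Suc n) m)) * shift_w (Pcol L (Suc n) m)
    - cmat (Ush1 m) * (cmat (minv (ZL (Suc n) (Suc m))) * Pcol L (Suc n) (Suc m))"
  show "col_in ?X (mono_span (box (Suc n) (Suc m) \<union> set (zkeys (Suc n) (Suc m))))"
    unfolding keys_box using ns
    by (intro col_in_add col_in_cmat_mult lsubspace_mono_span col_in_shift(2)[OF P_facts(1)[OF o]] P_facts(1)[OF assms])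
       auto
  show "cfm (zkeys (Suc n) (Suc m)) ?X = 0\<^sub>m (dim_row ?X) (length (zkeys (Suc n) (Suc m)))"
    using ns minv_nonsing[OF ns(1)] cfm_shift_Ush1(1)[OF P_facts(1)[OF o], of "Suc n"]
      nonsing_cancel(1)[OF ns(2), of "Ush1 m"]
    by (simp add: cfm_diff cfm_cmat_mult) (simp add: Suc_eq_plus1)
qed

lemma monic_diff_w:
  assumes "pd (Vbox (Suc n) (Suc (Suc m)))"
  shows "col_in (cmat (minv (WL n (Suc m))) * shift_z (Qcol L n (Suc m))
    - cmat (Ush1 n) * (cmat (minv (WL (Suc n) (Suc m))) * Qcol L (Suc n) (Suc m))) (Vbox (Suc n) (Suc m))"
proof (rule col_in_cfm)
  have o: "pd (Vbox n (Suc (Suc m)))" by (rule ok_mono[OF assms]) auto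
  note ns = WL_nonsing[OF assms] WL_nonsing[OF o]
  let ?X = "cmat (minv (WL n (Suc m))) * shift_z (Qcol L n (Suc m))
    - cmat (Ush1 n) * (cmat (minv (WL (Suc n) (Suc m))) * Qcol L (Suc n) (Suc m))"
  show "col_in ?X (mono_span (box (Suc n) (Suc m) \<union> set (wkeys (Suc n) (Suc m))))"
    unfolding keys_box using ns
    by (intro col_in_add col_in_cmat_mult lsubspace_mono_span col_in_shift(1)[OF Q_facts(1)[OF o]] Q_facts(1)[OF assms])
       auto
  show "cfm (wkeys (Suc n) (Suc m)) ?X = 0\<^sub>m (dim_row ?X) (length (wkeys (Suc n) (Suc m)))"
    using ns minv_nonsing[OF ns(1)] cfm_shift_Ush1(2)[OF Q_facts(1)[OF o], of "Suc m"]
      nonsing_cancel(1)[OF ns(2), of "Ush1 n"]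
    by (simp add: cfm_diff cfm_cmat_mult) (simp add: Suc_eq_plus1)
qed

text \<open>Its last entry, in the last row and column, is the only one that the lower levels do not
  determine.\<close>

definition monK :: "nat \<Rightarrow> nat \<Rightarrow> complex mat" where
  "monK n m = minv (ZL n m) * gK n m * minv (mat_adjoint (WL n m))"

text \<open>The invariant of the recursion. The guard \<open>0 < n + m\<close> exempts the
  placeholders at the origin, whose dimensions differ from those of the Gram matrices;
  \<open>HH3\<close> is left out since only its \<open>(1,1)\<close> entry is compared with Gram
  matrices.\<close>

definition canon :: "nat \<Rightarrow> nat \<Rightarrow> level \<Rightarrow> bool" where
  "canon n m l \<longleftrightarrow> KK l = gK n m \<and> KK1 l = gK1 n m \<and>
     (0 < n + m \<longrightarrow> Gam l = gG n m \<and> Gam1 l = gG1 n m \<and> tGam l = gtG n m \<and> tGam1 l = gtG1 n m) \<and>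
     (\<forall>k. n = Suc k \<longrightarrow> EE l = gE k m \<and> AA l = gA k m) \<and>
     (\<forall>k. m = Suc k \<longrightarrow> tEE l = gtE n k \<and> tAA l = gtA n k) \<and>
     II l = gI n m \<and> II1 l = gI1 n m \<and> Phi l = Pcol L n (Suc m) \<and> tPhi l = Qcol L (Suc n) m"

section \<open>Steps of a level that need only the two lower boxes\<close>

context
  fixes n m :: nat and D :: "nat \<Rightarrow> nat \<Rightarrow> level" and u :: params
  assumes oz: "pd (Vbox (Suc (Suc n)) (Suc m))" and ow: "pd (Vbox (Suc n) (Suc (Suc m)))"
    and D: "\<And>i j. i \<le> Suc n \<Longrightarrow> j \<le> Suc m \<Longrightarrow> (i, j) \<noteq> (Suc n, Suc m) \<Longrightarrow> canon i j (D i j)"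
begin

lemma Dz: "canon (Suc n) m (D (Suc n) m)" and Dw: "canon n (Suc m) (D n (Suc m))" and D0: "canon n m (D n m)"
  by (auto intro!: D)

lemma Dz_simps:
  "KK (D (Suc n) m) = gK (Suc n) m" "KK1 (D (Suc n) m) = gK1 (Suc n) m"
  "Gam (D (Suc n) m) = gG (Suc n) m" "Gam1 (D (Suc n) m) = gG1 (Suc n) m"
  "tGam (D (Suc n) m) = gtG (Suc n) m" "tGam1 (D (Suc n) m) = gtG1 (Suc n) m"
  "EE (D (Suc n) m) = gE n m" "AA (D (Suc n) m) = gA n m"
  "II (D (Suc n) m) = gI (Suc n) m" "II1 (D (Suc n) m) = gI1 (Suc n) m"
  "Phi (D (Suc n) m) = Pcol L (Suc n) (Suc m)" "tPhi (D (Suc n) m) = Qcol L (Suc (Suc n)) m"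
  using Dz by (simp_all add: canon_def)

lemma Dw_simps:
  "KK (D n (Suc m)) = gK n (Suc m)" "KK1 (D n (Suc m)) = gK1 n (Suc m)"
  "Gam (D n (Suc m)) = gG n (Suc m)" "Gam1 (D n (Suc m)) = gG1 n (Suc m)"
  "tGam (D n (Suc m)) = gtG n (Suc m)" "tGam1 (D n (Suc m)) = gtG1 n (Suc m)"
  "tEE (D n (Suc m)) = gtE n m" "tAA (D n (Suc m)) = gtA n m"
  "II (D n (Suc m)) = gI n (Suc m)" "II1 (D n (Suc m)) = gI1 n (Suc m)"
  "Phi (D n (Suc m)) = Pcol L n (Suc (Suc m))" "tPhi (D n (Suc m)) = Qcol L (Suc n) (Suc m)"
  using Dw by (simp_all add: canon_def)

lemma o00: "pd (Vbox (Suc n) (Suc m))"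
  by (rule ok_mono[OF oz]) auto

lemma monK_dim [simp]: "dim_row (monK (Suc n) (Suc m)) = Suc m" "dim_col (monK (Suc n) (Suc m)) = Suc n"
  using ZL_nonsing[OF oz] nonsing_conj_trans(1)[OF WL_nonsing[OF ow]] by (simp_all add: monK_def)

lemma gK_monK: "ZL (Suc n) (Suc m) * monK (Suc n) (Suc m) * mat_adjoint (WL (Suc n) (Suc m)) = gK (Suc n) (Suc m)"
proof -
  note z = ZL_nonsing[OF oz] and w = nonsing_conj_trans(1)[OF WL_nonsing[OF ow]]
  show ?thesis
    using z w nonsing_cancel(2)[OF z, of "gK (Suc n) (Suc m)"] nonsing_cancel_right(2)[OF w, of "gK (Suc n) (Suc m)"]
      minv_nonsing[OF w]
    by (simp add: monK_def mult_assoc_dim nonsing_cancel)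
qed

text \<open>The term \<open>H\<close> of the algorithm supplies all rows of the monic matrix but the
  last.\<close>

lemma step_H_monK:
  assumes "m = Suc k"
  shows "step_H (Suc n) (Suc m) D = Ush1 m * monK (Suc n) (Suc m)"
proof -
  have k: "canon (Suc n) k (D (Suc n) k)" using assms by (intro D) auto
  have oz': "pd (Vbox (Suc (Suc n)) m)" by (rule ok_mono[OF oz]) auto
  have "Ush1 m * monK (Suc n) (Suc m) = minv (ZL (Suc n) m) *
      (gK (Suc n) m - gK1 (Suc n) m * mat_adjoint (gtE n m)) * minv (mat_adjoint (WL (Suc n) m))"
    unfolding monK_def
    by (rule monic_rows[OF oz ow ZL_nonsing[OF oz] ZL_nonsing[OF oz'] WL_nonsing[OF ow] WL_nonsing[OF o00]
          gtA_lead[OF ow] monic_diff_z[OF oz]])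
  moreover have "Phi (D (Suc n) k) = Pcol L (Suc n) m" "tPhi (D n m) = Qcol L (Suc n) m"
    using k D0 assms by (simp_all add: canon_def)
  ultimately show ?thesis
    by (simp add: step_H_def assms numeral_2_eq_2 lead_eq Dz_simps[unfolded assms] Dw_simps[unfolded assms])
qed

text \<open>Exchange of the variables, followed by taking adjoints: the tilde term supplies all
  columns but the last.\<close>

lemma step_tH_monK:
  assumes "n = Suc k"
  shows "step_tH (Suc n) (Suc m) D = monK (Suc n) (Suc m) * transpose_mat (Ush1 n)"
proof -
  have k: "canon k (Suc m) (D k (Suc m))" using assms by (intro D) auto
  have ow': "pd (Vbox n (Suc (Suc m)))" by (rule ok_mono[OF ow]) auto
  interpret swap: bicircle L "\<lambda>a b. zwn b a" "\<lambda>a b. Vbox b a" "\<lambda>a b. Qcol L b a" "\<lambda>a b. Pcol L b a"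
    "\<lambda>a b. pd (Vbox b a)" by (rule swapped)
  note nz = ZL_nonsing[OF oz] ZL_nonsing[OF o00] and nw = WL_nonsing[OF ow] WL_nonsing[OF ow']
  have "Ush1 n * (minv (WL (Suc n) (Suc m)) * swap.gK (Suc m) (Suc n) * minv (mat_adjoint (ZL (Suc n) (Suc m)))) =
      minv (WL n (Suc m)) * (swap.gK (Suc m) n - swap.gK1 (Suc m) n * mat_adjoint (swap.gtE m n))
        * minv (mat_adjoint (ZL n (Suc m)))"
    by (rule swap.monic_rows[OF ow oz nw nz])
       (use gA_lead[OF oz] monic_diff_w[OF ow] in \<open>simp_all add: swap_g\<close>)
  from arg_cong[OF this, of mat_adjoint]
  have "monK (Suc n) (Suc m) * transpose_mat (Ush1 n) =
      minv (ZL n (Suc m)) * (gK n (Suc m) - gE n m * mcnj (gK1 n (Suc m))) * minv (mat_adjoint (WL n (Suc m)))"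
    using nz nw nonsing_conj_trans[OF nz(1)] nonsing_conj_trans[OF nz(2)]
      nonsing_conj_trans[OF nw(1)] nonsing_conj_trans[OF nw(2)] nonsing_dim[OF nw(1)] nonsing_dim[OF nz(1)]
    by (simp add: monK_def swap_g adjoint_mult conj_trans_add mult_assoc_dim)
  moreover have "Phi (D n m) = Pcol L n (Suc m)" "tPhi (D k (Suc m)) = Qcol L n (Suc m)"
    using k D0 assms by (simp_all add: canon_def)
  ultimately show ?thesis
    by (simp add: step_tH_def assms numeral_2_eq_2 lead_eq Dz_simps[unfolded assms] Dw_simps[unfolded assms])
qed

end

end

lemma bvec_row_index:
  assumes "dim_row X = k" "b < k" "j < dim_col X"
  shows "(transpose_mat (bvec k (Suc b)) * X) $$ (0, j) = X $$ (b, j)"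
proof -
  have "(transpose_mat (bvec k (Suc b)) * X) $$ (0, j) = (\<Sum>l\<in>{0..<k}. (if l = b then 1 else 0) * X $$ (l, j))"
    using assms by (subst mult_mat_index[where n = k]) (auto intro!: sum.cong simp: bvec_index)
  then show ?thesis using assms by (simp only: sum_if_eq_lt) simp
qed

lemma bvec_col_index:
  assumes "dim_col X = k" "b < k" "i < dim_row X"
  shows "(X * bvec k (Suc b)) $$ (i, 0) = X $$ (i, b)"
proof -
  have "(X * bvec k (Suc b)) $$ (i, 0) = (\<Sum>l\<in>{0..<k}. X $$ (i, l) * (if l = b then 1 else 0))"
    using assms by (subst mult_mat_index[where n = k]) (auto intro!: sum.cong simp: bvec_index)
  then show ?thesis using assms by (simp only: sum_if_eq_lt) simp
qed

lemma bvec_outer_index: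
  assumes "dim_row X = k" "b < k" "i < l" "j < dim_col X"
  shows "(bvec l (Suc a) * transpose_mat (bvec k (Suc b)) * X) $$ (i, j) = (if i = a then X $$ (b, j) else 0)"
proof -
  have "bvec l (Suc a) * transpose_mat (bvec k (Suc b)) * X = bvec l (Suc a) * (transpose_mat (bvec k (Suc b)) * X)"
    using assms by (simp add: mult_assoc_dim)
  moreover have "(bvec l (Suc a) * Y) $$ (i, j) = (if i = a then Y $$ (0, j) else 0)"
    if "dim_row Y = 1" "dim_col Y = dim_col X" for Y
    using assms that by (subst mult_mat_index[where n = 1]) (auto simp: bvec_index One_nat_def)
  ultimately show ?thesis using bvec_row_index[OF assms(1,2,4)] assms by simp
qed

lemma mult_transpose_Ush1_index:
  assumes "dim_col X = k + 1" "i < dim_row X" "j < k"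
  shows "(X * transpose_mat (Ush1 k)) $$ (i, j) = X $$ (i, j)"
proof -
  have "(X * transpose_mat (Ush1 k)) $$ (i, j) = (\<Sum>l\<in>{0..<k+1}. X $$ (i, l) * (if l = j then 1 else 0))"
    using assms by (subst mult_mat_index[where n = "k + 1"]) (auto intro!: sum.cong simp: Ush_index)
  then show ?thesis using assms by (simp only: sum_if_eq_lt) simp
qed

context mfun
begin

lemma gG_block:
  assumes "pd (Vbox (Suc n) (Suc m))"
  shows "nonsing m (gG n m * transpose_mat (Ush m))" "nonsing n (gtG n m * transpose_mat (Ush n))"
  using pos_upper_nonsing[OF Bz_pos[OF pd_corner[OF assms]]] pos_upper_nonsing[OF Bw_pos[OF pd_corner[OF assms]]]
  by (simp_all add: gG_eq(2)[OF assms] gtG_eq(2)[OF assms])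

context
  fixes n m :: nat and D :: "nat \<Rightarrow> nat \<Rightarrow> level" and u :: params
  assumes oz: "pd (Vbox (Suc (Suc n)) (Suc m))" and ow: "pd (Vbox (Suc n) (Suc (Suc m)))"
    and D: "\<And>i j. i \<le> Suc n \<Longrightarrow> j \<le> Suc m \<Longrightarrow> (i, j) \<noteq> (Suc n, Suc m) \<Longrightarrow> canon i j (D i j)"
begin

lemmas Dzs = Dz_simps[OF oz ow D, simplified] and Dws = Dw_simps[OF oz ow D, simplified]

text \<open>Level \<open>(1,1)\<close> is exceptional because there the parameter is defined without
  division by the leading coefficients.\<close>

lemma par_neg_monK:
  "par_neg L (Suc n) (Suc m) = (if n = 0 \<and> m = 0 then gK (Suc n) (Suc m) $$ (0, 0) else monK (Suc n) (Suc m) $$ (m, n))"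
proof (cases "n = 0 \<and> m = 0")
  case True
  then show ?thesis by (simp add: par_neg_def onPhi_eq gK_def One_nat_def)
next
  case False
  then have F: "(Suc n = 1 \<and> Suc m = 1) = False" "(n = 0 \<and> m = 0) = False" by (auto simp: One_nat_def)
  have d: "dim_row (monK (Suc n) (Suc m)) = Suc m" "dim_col (monK (Suc n) (Suc m)) = Suc n"
    by (rule monK_dim[OF oz ow D]; assumption)+
  note z = ZL_nonsing[OF oz] and w = nonsing_conj_trans(1)[OF WL_nonsing[OF ow]]
  let ?b = "transpose_mat (bvec (Suc m) (Suc m))" and ?c = "bvec (Suc n) (Suc n)"
  have "par_neg L (Suc n) (Suc m) =
      (?b * minv (ZL (Suc n) (Suc m)) * gK (Suc n) (Suc m) * minv (mat_adjoint (WL (Suc n) (Suc m))) * ?c) $$ (0, 0)"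
    unfolding par_neg_def F if_False by (simp add: onPhi_eq lead_eq gK_def)
  also have "?b * minv (ZL (Suc n) (Suc m)) * gK (Suc n) (Suc m) * minv (mat_adjoint (WL (Suc n) (Suc m))) * ?c =
      ?b * (monK (Suc n) (Suc m) * ?c)"
    using z w by (simp add: monK_def mult_assoc_dim)
  also have "\<dots> $$ (0, 0) = monK (Suc n) (Suc m) $$ (m, n)"
    using d by (simp add: bvec_row_index bvec_col_index del: index_mult_mat(1))
  finally show ?thesis unfolding F if_False .
qed

text \<open>The monic matrix is assembled from disjoint pieces: all rows but the last from
  \<open>H\<close>, the last row without its last entry from the tilde term, and the last entry from
  the parameter.\<close>

lemma step_K_canon:
  assumes u: "u (- int (Suc n)) (int (Suc m)) = par_neg L (Suc n) (Suc m)"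
  shows "step_K u (Suc n) (Suc m) D = gK (Suc n) (Suc m)"
proof (cases "n = 0 \<and> m = 0")
  case True
  then have "gK (Suc n) (Suc m) = scalar_mat1 (gK (Suc n) (Suc m) $$ (0, 0))"
    by (intro mat_1_1_eq) (simp_all add: One_nat_def)
  then show ?thesis using True u par_neg_monK by (simp add: step_K_def One_nat_def)
next
  case False
  then have F: "(Suc n = 1 \<and> Suc m = 1) = False" "(n = 0 \<and> m = 0) = False" by (auto simp: One_nat_def)
  have uN: "u (- int (Suc n)) (int (Suc m)) = monK (Suc n) (Suc m) $$ (m, n)"
    using u unfolding par_neg_monK F if_False .
  let ?N = "monK (Suc n) (Suc m)"
  have d: "dim_row ?N = Suc m" "dim_col ?N = Suc n"
    by (rule monK_dim[OF oz ow D]; assumption)+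
  define H where "H = (if m = 0 then 0\<^sub>m (Suc m) (Suc n) else transpose_mat (Ush1 m) * step_H (Suc n) (Suc m) D)"
  define H' where "H' = (if n = 0 then 0\<^sub>m (Suc m) (Suc n)
    else bvec (Suc m) (Suc m) * transpose_mat (bvec (Suc m) (Suc m)) * step_tH (Suc n) (Suc m) D * Ush1 n)"
  have H: "dim_row H = Suc m" "dim_col H = Suc n" "\<And>i j. i < Suc m \<Longrightarrow> j < Suc n \<Longrightarrow> H $$ (i, j) = (if i = m then 0 else ?N $$ (i, j))"
  proof -
    have "dim_row H = Suc m \<and> dim_col H = Suc n \<and>
      (\<forall>i<Suc m. \<forall>j<Suc n. H $$ (i, j) = (if i = m then 0 else ?N $$ (i, j)))"
    proof (cases m)
      case (Suc k)
      then have "H = transpose_mat (Ush1 m) * (Ush1 m * ?N)"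
        using step_H_monK[OF oz ow D] by (simp add: H_def)
      then show ?thesis
        using d by (simp add: transpose_Ush_mult_index Ush_mult_index del: index_mult_mat(1))
    qed (simp add: H_def)
    then show "dim_row H = Suc m" "dim_col H = Suc n" "\<And>i j. i < Suc m \<Longrightarrow> j < Suc n \<Longrightarrow> H $$ (i, j) = (if i = m then 0 else ?N $$ (i, j))"
      by blast+
  qed
  have H': "dim_row H' = Suc m" "dim_col H' = Suc n" "\<And>i j. i < Suc m \<Longrightarrow> j < Suc n \<Longrightarrow> H' $$ (i, j) = (if i = m \<and> j \<noteq> n then ?N $$ (i, j) else 0)"
  proof -
    have "dim_row H' = Suc m \<and> dim_col H' = Suc n \<and>
      (\<forall>i<Suc m. \<forall>j<Suc n. H' $$ (i, j) = (if i = m \<and> j \<noteq> n then ?N $$ (i, j) else 0))"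
    proof (cases n)
      case (Suc k)
      then have "H' = bvec (Suc m) (Suc m) * transpose_mat (bvec (Suc m) (Suc m)) * (?N * transpose_mat (Ush1 n)) * Ush1 n"
        using step_tH_monK[OF oz ow D] by (simp add: H'_def)
      then show ?thesis
        using d by (simp add: mult_Ush_index bvec_outer_index mult_transpose_Ush1_index less_Suc_eq
            del: index_mult_mat(1))
    qed (simp add: H'_def)
    then show "dim_row H' = Suc m" "dim_col H' = Suc n" "\<And>i j. i < Suc m \<Longrightarrow> j < Suc n \<Longrightarrow> H' $$ (i, j) = (if i = m \<and> j \<noteq> n then ?N $$ (i, j) else 0)"
      by blast+
  qed
  define e where "e = bvec (Suc m) (Suc m) * transpose_mat (bvec (Suc n) (Suc n))"
  have e: "dim_row e = Suc m" "dim_col e = Suc n"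
    "\<And>i j. i < Suc m \<Longrightarrow> j < Suc n \<Longrightarrow> e $$ (i, j) = (if i = m \<and> j = n then 1 else 0)"
  proof -
    show "e $$ (i, j) = (if i = m \<and> j = n then 1 else 0)" if "i < Suc m" "j < Suc n" for i j
      unfolding e_def using that by (subst mult_mat_index[where n = 1]) (auto simp: bvec_index)
  qed (simp_all add: e_def)
  have "u (- int (Suc n)) (int (Suc m)) \<cdot>\<^sub>m e + H + H' = ?N"
    by (rule eq_matI) (use e H H' d in \<open>auto simp: uN less_Suc_eq simp del: of_nat_Suc\<close>)
  moreover have "step_K u (Suc n) (Suc m) D = ZL (Suc n) (Suc m) *
      (u (- int (Suc n)) (int (Suc m)) \<cdot>\<^sub>m e + H + H') * mat_adjoint (WL (Suc n) (Suc m))"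
    unfolding step_K_def F if_False by (simp add: Dzs Dws lead_eq e_def H_def H'_def One_nat_def)
  ultimately show ?thesis using gK_monK[OF oz ow D] by simp
qed

lemma par_pos_gK1: "par_pos L (Suc n) (Suc m) = cnj (gK1 (Suc n) (Suc m) $$ (0, 0))"
proof -
  have "zw 0 1 = zwn 0 1" by (simp add: zwn_def)
  then show ?thesis
    by (simp add: par_pos_def onPhi_eq transpose_rev_poly[folded zwn_def] gK1_def del: of_nat_Suc)
qed

text \<open>The Gram matrix satisfies both overlapping equations, so their compatibility is
  automatic; the first entry, the rows from the second on and the columns from the second on exhaust
  the matrix, which gives uniqueness.\<close>

lemma step_K1_canon:
  assumes u: "u (int (Suc n)) (int (Suc m)) = par_pos L (Suc n) (Suc m)"
  shows "step_K1 u (Suc n) (Suc m) D = gK1 (Suc n) (Suc m)"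
proof -
  let ?K = "gK1 (Suc n) (Suc m)"
  have oz': "pd (Vbox (Suc (Suc n)) (Suc m))" and ow': "pd (Vbox (Suc n) (Suc (Suc m)))" by (rule oz, rule ow)
  note nB = gG_block(1)[OF oz] and nA = nonsing_conj_trans(5,6)[OF gtA_nonsing[OF ow]]
  note nA' = gA_nonsing[OF oz] and nB' = gG_block(2)[OF ow]
  have row0: "gG (Suc n) m = gG (Suc n) m * transpose_mat (Ush m) * Ush m"
    using gG_eq[OF oz] by simp
  have col0: "gtG n (Suc m) = gtG n (Suc m) * transpose_mat (Ush n) * Ush n"
    using gtG_eq[OF ow] by simp
  define B where "B = gG (Suc n) m * transpose_mat (Ush m)"
  define B' where "B' = gtG n (Suc m) * transpose_mat (Ush n)"
  have rows: "Ush m * ?K = minv B * (gK1 (Suc n) m - gK (Suc n) m * gtE n m) * transpose_mat (minv (gtA n m))"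
  proof -
    have eq: "B * (Ush m * ?K) * transpose_mat (gtA n m) = gK1 (Suc n) m - gK (Suc n) m * gtE n m"
      using gK1_rows[OF oz ow] row0 nonsing_dim[OF nB] unfolding B_def
      by (metis (no_types, lifting) Ush_dim(1,2) Suc_eq_plus1 g_dims(3) index_mult_mat(2,3) index_transpose_mat(3) mult_assoc_dim)
    have eq2: "B * (Ush m * ?K) = (gK1 (Suc n) m - gK (Suc n) m * gtE n m) * minv (transpose_mat (gtA n m))"
      using nonsing_solve_right[OF nA(1) _ eq] by simp
    have "Ush m * ?K = minv B * ((gK1 (Suc n) m - gK (Suc n) m * gtE n m) * minv (transpose_mat (gtA n m)))"
      using nonsing_solve[OF nB[folded B_def] _ eq2] by simp
    then show ?thesis using nB[folded B_def] nA gtA_nonsing[OF ow] by (simp add: mult_assoc_dim)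
  qed
  have cols: "?K * transpose_mat (Ush n) = minv (gA n m) * (gK1 n (Suc m) - gE n m * mcnj (gK n (Suc m)))
      * minv (Ush n * transpose_mat (gtG n (Suc m)))"
  proof -
    have tB: "transpose_mat B' = Ush n * transpose_mat (gtG n (Suc m))"
      by (simp add: B'_def transpose_mult_dim)
    have "transpose_mat (gtG n (Suc m)) = transpose_mat (Ush n) * transpose_mat B'"
      using arg_cong[OF col0, of transpose_mat] nonsing_dim[OF nB'] unfolding B'_def
      by (simp add: transpose_mult_dim)
    then have eq: "gA n m * (?K * transpose_mat (Ush n)) * transpose_mat B' = gK1 n (Suc m) - gE n m * mcnj (gK n (Suc m))"
      using gK1_cols[OF oz ow] nonsing_dim[OF nB'] by (simp add: mult_assoc_dim B'_def)
    have eq2: "gA n m * (?K * transpose_mat (Ush n)) = (gK1 n (Suc m) - gE n m * mcnj (gK n (Suc m))) * minv (transpose_mat B')"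
      using nonsing_solve_right[OF nonsing_conj_trans(5)[OF nB'[folded B'_def]] _ eq] by simp
    have "?K * transpose_mat (Ush n) = minv (gA n m) * ((gK1 n (Suc m) - gE n m * mcnj (gK n (Suc m))) * minv (transpose_mat B'))"
      using nonsing_solve[OF nA' _ eq2] by simp
    then show ?thesis
      using nA' nonsing_conj_trans(5)[OF nB'[folded B'_def]] by (simp add: mult_assoc_dim tB)
  qed
  let ?R = "\<lambda>X. X \<in> carrier_mat (Suc m) (Suc n) \<and> X $$ (0, 0) = cnj (u (int (Suc n)) (int (Suc m))) \<and>
     Ush m * X = Ush m * ?K \<and> X * transpose_mat (Ush n) = ?K * transpose_mat (Ush n)"
  have "step_K1 u (Suc n) (Suc m) D = (THE X. ?R X)"
    unfolding step_K1_def rows cols B_def by (simp add: Dzs Dws)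
  also have "\<dots> = ?K"
  proof (rule the_equality)
    show "?R ?K" using u par_pos_gK1 by (auto intro: carrier_matI)
    fix X assume X: "?R X"
    then have dX: "dim_row X = Suc m" "dim_col X = Suc n" by auto
    show "X = ?K"
    proof (rule eq_matI)
      fix i j assume ij: "i < dim_row ?K" "j < dim_col ?K"
      consider "i = 0" "j = 0" | i' where "i = Suc i'" | j' where "j = Suc j'" by (cases i; cases j) auto
      then show "X $$ (i, j) = ?K $$ (i, j)"
      proof cases
        case 1
        then show ?thesis using X u par_pos_gK1 by simp
      next
        case 2
        have "X $$ (i, j) = (Ush m * X) $$ (i', j)"
          using ij dX 2 Ush_mult_index(1)[of X m i' j] by (simp del: index_mult_mat(1) flip: Suc_eq_plus1)
        also have "Ush m * X = Ush m * ?K" using X by blast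
        also have "(Ush m * ?K) $$ (i', j) = ?K $$ (i, j)"
          using ij 2 Ush_mult_index(1)[of ?K m i' j] by (simp del: index_mult_mat(1) flip: Suc_eq_plus1)
        finally show ?thesis .
      next
        case 3
        have "X $$ (i, j) = (X * transpose_mat (Ush n)) $$ (i, j')"
          using ij dX 3 mult_transpose_Ush_index[of X n i j'] by (simp del: index_mult_mat(1) flip: Suc_eq_plus1)
        also have "X * transpose_mat (Ush n) = ?K * transpose_mat (Ush n)" using X by blast
        also have "(?K * transpose_mat (Ush n)) $$ (i, j') = ?K $$ (i, j)"
          using ij 3 mult_transpose_Ush_index[of ?K n i j'] by (simp del: index_mult_mat(1) flip: Suc_eq_plus1)
        finally show ?thesis .
      qed
    qed (use X in auto)
  qed
  finally show ?thesis .
qed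

text \<open>\<open>gE_eq2\<close> is used for the first row of the stacked system and
  \<open>gE_eq1\<close> for the rows below it.\<close>

lemma step_E_canon: "step_E (Suc n) (Suc m) D (gK (Suc n) (Suc m)) (gK1 (Suc n) (Suc m)) = gE n (Suc m)"
proof -
  note h = hat_nonsing(1)[OF ow]
  have "hat_of (gG1 n (Suc m)) (gG n (Suc m)) * gE n (Suc m) =
      transpose_mat (Ush (Suc m)) * (gG n (Suc m) * gE n (Suc m))
      + bvec (Suc m + 1) 1 * transpose_mat (bvec (Suc m) 1) * (gG1 n (Suc m) * gE n (Suc m))"
    by (subst hat_of_eq[where m = "Suc m"])
       (auto simp: add_mult_dim mult_assoc_dim comm_add_mat[of _ "Suc m + 1" "Suc (Suc m)"] carrier_matI)
  from nonsing_solve[OF h _ this] show ?thesis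
    by (simp add: step_E_def hGam_def Dzs Dws gE_eq1[OF oz ow] gE_eq2[OF oz ow])
qed

lemma step_tE_canon: "step_tE (Suc n) (Suc m) D (gK (Suc n) (Suc m)) (gK1 (Suc n) (Suc m)) = gtE (Suc n) m"
proof -
  note h = hat_nonsing(2)[OF oz]
  have "hat_of (gtG1 (Suc n) m) (gtG (Suc n) m) * gtE (Suc n) m =
      transpose_mat (Ush (Suc n)) * (gtG (Suc n) m * gtE (Suc n) m)
      + bvec (Suc n + 1) 1 * transpose_mat (bvec (Suc n) 1) * (gtG1 (Suc n) m * gtE (Suc n) m)"
    by (subst hat_of_eq[where m = "Suc n"])
       (auto simp: add_mult_dim mult_assoc_dim comm_add_mat[of _ "Suc n + 1" "Suc (Suc n)"] carrier_matI)
  from nonsing_solve[OF h _ this] show ?thesis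
    by (simp add: step_tE_def htGam_def Dzs Dws gtE_eq1[OF oz ow] gtE_eq2[OF oz ow])
qed

end

end

lemma hcat_zero_block:
  assumes "B \<in> carrier_mat m m"
  shows "hcat (0\<^sub>m m 1) B = B * Ush m" "Ush m * mat_adjoint (hcat (0\<^sub>m m 1) B) = mat_adjoint B"
proof -
  have 1: "hcat (0\<^sub>m m 1) B = B * Ush m" "hcat (0\<^sub>m m 1) B * transpose_mat (Ush m) = B"
    by (rule Cons_mat_eq[of m _ m B]; use assms in \<open>auto simp: hcat_index\<close>)+
  show "hcat (0\<^sub>m m 1) B = B * Ush m" by (rule 1)
  have "mat_adjoint B = mat_adjoint (hcat (0\<^sub>m m 1) B * transpose_mat (Ush m))" by (simp only: 1(2))
  also have "\<dots> = Ush m * mat_adjoint (hcat (0\<^sub>m m 1) B)"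
    using assms by (subst adjoint_mult) auto
  finally show "Ush m * mat_adjoint (hcat (0\<^sub>m m 1) B) = mat_adjoint B" ..
qed

lemma minus_eq_dim:
  fixes A B C :: "complex mat"
  assumes "A + B = C" "dim_row A = dim_row B" "dim_col A = dim_col B"
  shows "C - A = B"
  using assms by (auto intro!: eq_matI simp del: index_mult_mat(1))

lemma H3_entry_eq: "dim_row X = Suc m \<Longrightarrow> dim_col X = Suc m \<Longrightarrow> H3_entry (Suc m) X = X $$ (0, 0)"
  using bvec_row_index[of X "Suc m" 0 0] bvec_col_index[of "transpose_mat (bvec (Suc m) (Suc 0)) * X" "Suc m" 0 0]
  by (simp add: H3_entry_def One_nat_def del: index_mult_mat(1))

context mfun
begin

text \<open>Both first rows are the orthonormal polynomial of the full box at its corner.\<close>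

lemma gI_P_eq_Q: "Pcol L n (Suc m) $$ (0, 0) = Qcol L (Suc n) m $$ (0, 0)"
  by (simp add: Pcol_def Qcol_def gscol_index keys_nth keys_box)

lemma gI_col:
  assumes "pd (Vbox (Suc n) (Suc m))" "i < Suc m"
  shows "gI n m $$ (i, 0) = (if i = 0 then 1 else 0)"
proof -
  have "gI n m $$ (i, 0) = lprod L (Pcol L n (Suc m)) (Pcol L n (Suc m)) $$ (i, 0)"
    using assms by (simp add: gI_def lprod_index gI_P_eq_Q)
  then show ?thesis using assms P_facts(3)[OF assms(1)] by simp
qed

text \<open>Parseval exhibits \<open>Bz\<close> and \<open>Bw\<close> as factors of the right
  products, and a Cholesky factor is unique.\<close>

lemma Gam_corner:
  assumes "pd (mono_span (corner n m))"
  shows "step_Gam m (gK n m) = hcat (0\<^sub>m m 1) (Bz n m)" "step_tGam n (gK n m) = hcat (0\<^sub>m n 1) (Bw n m)"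
proof -
  have "1\<^sub>m m - gK n m * mat_adjoint (gK n m) = Bz n m * mat_adjoint (Bz n m)"
    by (rule minus_eq_dim[OF rec_P_corner(3)[OF assms]]) auto
  from upper_cholesky_eq[OF Bz_pos[OF assms] this]
  show "step_Gam m (gK n m) = hcat (0\<^sub>m m 1) (Bz n m)" by (simp add: step_Gam_def)
  have "1\<^sub>m n - mat_adjoint (gK n m) * gK n m = Bw n m * mat_adjoint (Bw n m)"
    by (rule minus_eq_dim[OF rec_P_corner(4)[OF assms]]) auto
  from upper_cholesky_eq[OF Bw_pos[OF assms] this]
  show "step_tGam n (gK n m) = hcat (0\<^sub>m n 1) (Bw n m)" by (simp add: step_tGam_def)
qed

lemma Bz_carrier: "Bz n m \<in> carrier_mat m m" and Bw_carrier: "Bw n m \<in> carrier_mat n n"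
  by (auto intro: carrier_matI)

lemma Ush_Gam_corner:
  assumes "pd (mono_span (corner n m))"
  shows "Ush m * mat_adjoint (step_Gam m (gK n m)) = mat_adjoint (Bz n m)"
    "Ush n * mat_adjoint (step_tGam n (gK n m)) = mat_adjoint (Bw n m)"
  by (simp_all add: Gam_corner[OF assms] hcat_zero_block(2) Bz_carrier Bw_carrier)

text \<open>In the Gram matrix of \<open>w P\<close> with \<open>P\<close>, the second argument is
  expanded by \<open>rec_P_corner\<close>. The \<open>PU\<close> part yields \<open>G1U\<close>;
  everything else is known from the lower boxes by \<open>L_wP_P\<close> and
  \<open>L_wP_Q\<close>.\<close>

lemma G1U_eq:
  assumes c: "pd (mono_span (corner (Suc n) (Suc m)))"
  shows "G1U (Suc n) (Suc m) * mat_adjoint (Bz (Suc n) (Suc m)) =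
    gI (Suc n) m * gtE (Suc n) m * transpose_mat (gI1 (Suc n) m) + mat_adjoint (gG (Suc n) m) * gG1 (Suc n) m
    + gK1 (Suc n) (Suc m) * minv (mcnj (gtA n m)) * mat_adjoint (gtE n m) * gtA n m * mat_adjoint (gK (Suc n) (Suc m))"
proof -
  have oz: "pd (Vbox (Suc (Suc n)) (Suc m))" and ow: "pd (Vbox (Suc n) (Suc (Suc m)))"
    by (rule pd_mono[OF c Vbox_corner(1)]) (rule pd_mono[OF c Vbox_corner(2)])
  note nA = nonsing_conj_trans(3)[OF gtA_nonsing[OF ow]]
  let ?P = "Pcol L (Suc n) (Suc m)" and ?Q = "Qcol L (Suc n) (Suc m)" and ?K = "gK (Suc n) (Suc m)"
  let ?X = "lprod L (R n (Suc m) ?Q) ?Q" and ?B = "Bz (Suc n) (Suc m)" and ?G = "G1U (Suc n) (Suc m)"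
  define S where "S = gI (Suc n) m * gtE (Suc n) m * transpose_mat (gI1 (Suc n) m)
    + mat_adjoint (gG (Suc n) m) * gG1 (Suc n) m"
  define Y where "Y = minv (mcnj (gtA n m)) * (mat_adjoint (gtE n m) * gtA n m)"
  have d: "dim_row S = Suc m" "dim_col S = Suc m" "dim_row Y = Suc n" "dim_col Y = Suc n"
    using nA by (simp_all add: S_def Y_def)
  have "mcnj (gtA n m) * ?X = - (mat_adjoint (gtE n m) * gtA n m)" by (rule conj_tA_mult[OF ow])
  from nonsing_solve[OF nA _ this] have X: "?X = - Y"
    using nA by (simp add: Y_def mult_uminus_dim)
  have "lprod L (shift_w ?P) ?P = lprod L (shift_w ?P) ?Q * mat_adjoint ?K + ?G * mat_adjoint ?B"
    by (subst (2) rec_P_corner(1)[OF c]) (simp add: lprod_simps flip: G1U_def)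
  then have "?G * mat_adjoint ?B = S - lprod L (shift_w ?P) ?Q * mat_adjoint ?K"
    unfolding L_wP_P[OF oz] S_def by (intro minus_eq_dim[symmetric]) auto
  also have "lprod L (shift_w ?P) ?Q = - (gK1 (Suc n) (Suc m) * Y)"
    unfolding L_wP_Q[OF oz ow] X using d by (simp add: mult_uminus_dim)
  also have "S - - (gK1 (Suc n) (Suc m) * Y) * mat_adjoint ?K = S + gK1 (Suc n) (Suc m) * Y * mat_adjoint ?K"
    using d by (auto intro!: eq_matI simp: uminus_mult_dim simp del: index_mult_mat(1))
  finally show ?thesis using nA by (simp add: S_def Y_def mult_assoc_dim)
qed

section \<open>Steps of a level that need positivity off the corner\<close>

context
  fixes n m :: nat and D :: "nat \<Rightarrow> nat \<Rightarrow> level" and u :: params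
  assumes pc: "pd (mono_span (corner (Suc n) (Suc m)))"
    and D: "\<And>i j. i \<le> Suc n \<Longrightarrow> j \<le> Suc m \<Longrightarrow> (i, j) \<noteq> (Suc n, Suc m) \<Longrightarrow> canon i j (D i j)"
begin

lemma ozc: "pd (Vbox (Suc (Suc n)) (Suc m))" and owc: "pd (Vbox (Suc n) (Suc (Suc m)))"
  by (rule pd_mono[OF pc Vbox_corner(1)]) (rule pd_mono[OF pc Vbox_corner(2)])

lemmas Dzc = Dz_simps[OF ozc owc D, simplified] and Dwc = Dw_simps[OF ozc owc D, simplified]

private abbreviation "K \<equiv> gK (Suc n) (Suc m)"
private abbreviation "K1 \<equiv> gK1 (Suc n) (Suc m)"
private abbreviation "B \<equiv> Bz (Suc n) (Suc m)"
private abbreviation "Gm \<equiv> step_Gam (Suc m) K"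
private abbreviation "H1 \<equiv> step_H1 (Suc n) (Suc m) D K Gm"
private abbreviation "H2 \<equiv> step_H2 (Suc n) (Suc m) D K Gm"

lemma nBa: "nonsing (Suc m) (mat_adjoint B)"
  by (rule nonsing_conj_trans(1)[OF pos_upper_nonsing[OF Bz_pos[OF pc]]])

lemma G1U_solve: "G1U (Suc n) (Suc m) = (gI (Suc n) m * gtE (Suc n) m * transpose_mat (gI1 (Suc n) m)
    + mat_adjoint (gG (Suc n) m) * gG1 (Suc n) m
    + K1 * minv (mcnj (gtA n m)) * mat_adjoint (gtE n m) * gtA n m * mat_adjoint K) * minv (mat_adjoint B)"
  using nonsing_solve_right[OF nBa _ G1U_eq[OF pc]] by simp

text \<open>The formula for \<open>H2 + K1 * H1\<close> drops terms with the left factor \<open>mat_adjoint (gG (Suc n) m)\<close>,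
  whose first row vanishes.\<close>

lemma H12_eq: "\<exists>Y. dim_row Y = m \<and> dim_col Y = Suc m \<and>
    G1U (Suc n) (Suc m) = (H2 + K1 * H1) + mat_adjoint (gG (Suc n) m) * Y
    \<and> dim_row H1 = Suc n \<and> dim_col H1 = Suc m \<and> dim_row H2 = Suc m \<and> dim_col H2 = Suc m"
proof -
  note h = nonsing_conj_trans(5)[OF hat_nonsing(2)[OF ozc]]
  define N where "N = minv (mat_adjoint B)"
  have N: "dim_row N = Suc m" "dim_col N = Suc m" using nBa by (simp_all add: N_def)
  define ht where "ht = hat_of (gtG1 (Suc n) m) (gtG (Suc n) m)"
  have ht: "nonsing (Suc (Suc n)) (transpose_mat ht)" using h by (simp add: ht_def)
  define b where "b = bvec (Suc n) 1 * transpose_mat (bvec (Suc n + 1) 1)"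
  have b: "dim_row b = Suc n" "dim_col b = Suc (Suc n)" by (simp_all add: b_def)
  define W where "W = minv (transpose_mat ht) * transpose_mat (gI1 (Suc n) m)"
  have W: "dim_row W = Suc (Suc n)" "dim_col W = Suc m" using ht by (simp_all add: W_def)
  define T where "T = minv (mcnj (gtA n m)) * mat_adjoint (gtE n m) * gtA n m * mat_adjoint K"
  have nA: "nonsing (Suc n) (mcnj (gtA n m))" by (rule nonsing_conj_trans(3)[OF gtA_nonsing[OF owc]])
  have T: "dim_row T = Suc n" "dim_col T = Suc m" using nA by (simp_all add: T_def)
  define X where "X = mat_adjoint (gI1 (Suc n) m) * mcnj K * transpose_mat (gtA n m)
    + mat_adjoint (gtG1 (Suc n) m) * gtE n m"
  define X2 where "X2 = mat_adjoint (gI (Suc n) m) * K1 * transpose_mat (gtA n m)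
    + mat_adjoint (gtG (Suc n) m) * gtE n m"
  have X: "dim_row X = Suc (Suc n)" "dim_col X = Suc n" "dim_row X2 = Suc (Suc n)" "dim_col X2 = Suc n"
    by (simp_all add: X_def X2_def)
  have E: "gtG (Suc n) m * gtE (Suc n) m = transpose_mat X"
    "gtG1 (Suc n) m * gtE (Suc n) m = transpose_mat X2"
    unfolding gtE_eq1[OF ozc owc] gtE_eq2[OF ozc owc] X_def X2_def
    by (simp_all add: conj_trans_add transpose_mult_dim gtE_sym mult_assoc_dim)
  have "ht * gtE (Suc n) m = transpose_mat b * transpose_mat X2 + transpose_mat (Ush (Suc n)) * transpose_mat X"
  proof -
    have "ht * gtE (Suc n) m =
        bvec (Suc n + 1) 1 * transpose_mat (bvec (Suc n) 1) * (gtG1 (Suc n) m * gtE (Suc n) m)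
        + transpose_mat (Ush (Suc n)) * (gtG (Suc n) m * gtE (Suc n) m)"
      unfolding ht_def by (subst hat_of_eq[where m = "Suc n"]) (auto simp: add_mult_dim mult_assoc_dim)
    then show ?thesis unfolding E by (simp add: b_def transpose_mult_dim)
  qed
  from arg_cong[OF this, of transpose_mat]
  have "gtE (Suc n) m * transpose_mat ht = X2 * b + X * Ush (Suc n)"
    using b X ht nonsing_dim[OF ht] by (simp add: transpose_mult_dim conj_trans_add gtE_sym)
  from nonsing_solve_right[OF ht _ this]
  have tE: "gtE (Suc n) m = (X2 * b + X * Ush (Suc n)) * minv (transpose_mat ht)" by simp
  have gtEW: "gtE (Suc n) m * transpose_mat (gI1 (Suc n) m) = X2 * (b * W) + X * (Ush (Suc n) * W)"
    unfolding tE using b X ht by (simp add: W_def mult_assoc_dim add_mult_dim)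
  \<comment> \<open>The terms to be dropped later arise here: \<open>gI\<close> times its adjoint is
    the identity minus a product starting with the adjoint of \<open>gG\<close>, and so does its
    product with the adjoint of \<open>gtG\<close>, up to sign.\<close>
  have gIX2: "gI (Suc n) m * X2 = K1 * transpose_mat (gtA n m)
      - mat_adjoint (gG (Suc n) m) * (gG (Suc n) m * (K1 * transpose_mat (gtA n m)))
      - mat_adjoint (gG (Suc n) m) * (gK (Suc n) m * gtE n m)"
  proof -
    have "gI (Suc n) m * mat_adjoint (gI (Suc n) m) = 1\<^sub>m (Suc m) - mat_adjoint (gG (Suc n) m) * gG (Suc n) m"
      using gI_norm[OF ozc] by (intro add_eq_minus_dim(1)) auto
    then have 1: "gI (Suc n) m * mat_adjoint (gI (Suc n) m) * (K1 * transpose_mat (gtA n m)) =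
        K1 * transpose_mat (gtA n m) - mat_adjoint (gG (Suc n) m) * (gG (Suc n) m * (K1 * transpose_mat (gtA n m)))"
      by (simp add: minus_mult_dim mult_assoc_dim)
    have 2: "gI (Suc n) m * mat_adjoint (gtG (Suc n) m) * gtE n m =
        - (mat_adjoint (gG (Suc n) m) * (gK (Suc n) m * gtE n m))"
      unfolding gI_gtG[OF ozc] by (simp add: uminus_mult_dim mult_assoc_dim)
    have "gI (Suc n) m * X2 = gI (Suc n) m * mat_adjoint (gI (Suc n) m) * (K1 * transpose_mat (gtA n m))
        + gI (Suc n) m * mat_adjoint (gtG (Suc n) m) * gtE n m"
      by (simp add: X2_def mult_add_dim mult_assoc_dim)
    then show ?thesis unfolding 1 2 by (auto intro!: eq_matI simp del: index_mult_mat(1))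
  qed
  \<comment> \<open>The collected right factors of the terms that begin with the adjoint of
    \<open>gG (Suc n) m\<close>.\<close>
  define Z where "Z = gG1 (Suc n) m - gG (Suc n) m * (K1 * (transpose_mat (gtA n m) * (b * W)))
    - gK (Suc n) m * (gtE n m * (b * W))"
  have Z: "dim_row Z = m" "dim_col Z = Suc m" using W b by (simp_all add: Z_def)
  have H2: "H2 = gI (Suc n) m * (X * (Ush (Suc n) * (W * N)))"
    unfolding step_H2_def htGam_def diff_Suc_1 Dzc Dwc Ush_Gam_corner[OF pc] ht_def[symmetric] X_def[symmetric] N_def[symmetric]
    using X N W ht by (simp add: W_def mult_assoc_dim)
  have H1: "H1 = transpose_mat (gtA n m) * (b * (W * N)) + T * N"
    unfolding step_H1_def htGam_def diff_Suc_1 Dzc Dwc Ush_Gam_corner[OF pc] ht_def[symmetric] N_def[symmetric]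
    using N W ht b nA by (simp add: W_def T_def b_def mult_assoc_dim)
  have "G1U (Suc n) (Suc m) = (gI (Suc n) m * (gtE (Suc n) m * transpose_mat (gI1 (Suc n) m))
      + mat_adjoint (gG (Suc n) m) * gG1 (Suc n) m + K1 * T) * N"
    unfolding G1U_solve N_def[symmetric] using nA by (simp add: T_def mult_assoc_dim)
  also have "gI (Suc n) m * (gtE (Suc n) m * transpose_mat (gI1 (Suc n) m)) =
      (gI (Suc n) m * X2) * (b * W) + gI (Suc n) m * (X * (Ush (Suc n) * W))"
    unfolding gtEW using X b W by (simp add: mult_add_dim mult_assoc_dim)
  also have "(gI (Suc n) m * X2) * (b * W) + gI (Suc n) m * (X * (Ush (Suc n) * W)) + mat_adjoint (gG (Suc n) m) * gG1 (Suc n) m + K1 * T =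
      gI (Suc n) m * (X * (Ush (Suc n) * W)) + K1 * (transpose_mat (gtA n m) * (b * W)) + K1 * T
      + mat_adjoint (gG (Suc n) m) * Z"
    unfolding gIX2 Z_def using b W X T
    by (auto intro!: eq_matI simp: minus_mult_dim mult_minus_dim mult_assoc_dim simp del: index_mult_mat(1))
  also have "\<dots> * N = (H2 + K1 * H1) + mat_adjoint (gG (Suc n) m) * (Z * N)"
    unfolding H1 H2 using b W X T N Z
    by (auto intro!: eq_matI simp: add_mult_dim mult_add_dim mult_assoc_dim simp del: index_mult_mat(1))
  finally have "G1U (Suc n) (Suc m) = (H2 + K1 * H1) + mat_adjoint (gG (Suc n) m) * (Z * N)" .
  moreover have "dim_row H1 = Suc n" "dim_col H1 = Suc m" "dim_row H2 = Suc m" "dim_col H2 = Suc m"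
    unfolding H1 H2 using b W X T N by simp_all
  ultimately show ?thesis using Z N by (intro exI[of _ "Z * N"]) simp
qed

text \<open>The \<open>(1,1)\<close> entry sees only the first row of \<open>H2 + K1 * H1\<close>,
  and there this matrix coincides with \<open>G1U\<close>.\<close>

lemma H3_canon: "H3_entry (Suc m) (step_H3 K1 H1 H2) =
   (K1 * mat_adjoint K1 + G1U (Suc n) (Suc m) * mat_adjoint (G1U (Suc n) (Suc m))) $$ (0, 0)"
proof -
  obtain Y where Y: "dim_row Y = m" "dim_col Y = Suc m"
    "G1U (Suc n) (Suc m) = (H2 + K1 * H1) + mat_adjoint (gG (Suc n) m) * Y"
    and d: "dim_row H1 = Suc n" "dim_col H1 = Suc m" "dim_row H2 = Suc m" "dim_col H2 = Suc m"
    using H12_eq by blast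
  have "mat_adjoint (gG (Suc n) m) * Y = transpose_mat (Ush m) * (mat_adjoint (Bz (Suc n) m) * Y)"
    using Y by (simp add: gG_eq(3)[OF ozc] adjoint_mult mult_assoc_dim)
  then have "(mat_adjoint (gG (Suc n) m) * Y) $$ (0, j) = 0" if "j < Suc m" for j
    using Y that by (simp add: transpose_Ush_mult_index del: index_mult_mat(1))
  then have row: "(H2 + K1 * H1) $$ (0, j) = G1U (Suc n) (Suc m) $$ (0, j)" if "j < Suc m" for j
    unfolding Y(3) using that d Y by (simp del: index_mult_mat(1))
  have HH: "dim_row (H2 + K1 * H1) = Suc m" "dim_col (H2 + K1 * H1) = Suc m" using d by simp_all
  have "H3_entry (Suc m) (step_H3 K1 H1 H2) =
      ((H2 + K1 * H1) * mat_adjoint (H2 + K1 * H1)) $$ (0, 0) + (K1 * mat_adjoint K1) $$ (0, 0)"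
    unfolding step_H3_def using HH by (subst H3_entry_eq) (simp_all del: index_mult_mat(1))
  also have "((H2 + K1 * H1) * mat_adjoint (H2 + K1 * H1)) $$ (0, 0) =
      (G1U (Suc n) (Suc m) * mat_adjoint (G1U (Suc n) (Suc m))) $$ (0, 0)"
    using HH row by (simp add: mult_adjoint_self del: index_mult_mat(1) index_add_mat)
  finally show ?thesis by (simp add: add.commute del: index_mult_mat(1))
qed

lemma Gam1_block: "(II (D (Suc n) m) * gtE (Suc n) m * transpose_mat (II1 (D (Suc n) m))
       + mat_adjoint (Gam (D (Suc n) m)) * Gam1 (D (Suc n) m)
       + K1 * minv (mcnj (tAA (D n (Suc m)))) * mat_adjoint (tEE (D n (Suc m)))
         * tAA (D n (Suc m)) * mat_adjoint K)
      * minv (Ush (Suc m) * mat_adjoint Gm) = G1U (Suc n) (Suc m)"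
  unfolding Dzc Dwc Ush_Gam_corner[OF pc] G1U_solve ..

end

end

context bicircle
begin

lemma gG1_norm:
  assumes "ok (Suc (Suc n)) (Suc m)"
  shows "gK1 (Suc n) m * mat_adjoint (gK1 (Suc n) m) + gG1 (Suc n) m * mat_adjoint (gG1 (Suc n) m) = 1\<^sub>m m"
proof -
  have o: "ok (Suc (Suc n)) m" by (rule ok_mono[OF assms]) auto
  let ?wP = "shift_w (P (Suc n) m)"
  have "lprod L ?wP ?wP = lprod L ?wP (cmat (gK1 (Suc n) m) * R n m (Q (Suc n) m) + cmat (gG1 (Suc n) m) * P (Suc n) (Suc m))"
    by (subst rec_wP[OF assms]) (simp add: rec_wP[OF assms, symmetric])
  moreover have "lprod L ?wP (R n m (Q (Suc n) m)) = gK1 (Suc n) m" by (simp add: gK1_def)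
  ultimately show ?thesis
    using P_facts(3)[OF o] by (simp add: lprod_simps R_gram flip: gG1_def)
qed

end

context mfun
begin

section \<open>Steps of a level whose full box is positive\<close>

context
  fixes n m :: nat and D :: "nat \<Rightarrow> nat \<Rightarrow> level" and u :: params
  assumes pf: "pd (Vbox (Suc (Suc n)) (Suc (Suc m)))"
    and D: "\<And>i j. i \<le> Suc n \<Longrightarrow> j \<le> Suc m \<Longrightarrow> (i, j) \<noteq> (Suc n, Suc m) \<Longrightarrow> canon i j (D i j)"
begin

lemma ozf: "pd (Vbox (Suc (Suc n)) (Suc m))" and owf: "pd (Vbox (Suc n) (Suc (Suc m)))"
  by (rule ok_mono[OF pf]; simp)+

lemma pcf: "pd (mono_span (corner (Suc n) (Suc m)))"
  by (rule pd_corner[OF pf])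

lemmas Dzf = Dz_simps[OF ozf owf D, simplified] and Dwf = Dw_simps[OF ozf owf D, simplified]

private abbreviation "kK \<equiv> gK (Suc n) (Suc m)"
private abbreviation "kK1 \<equiv> gK1 (Suc n) (Suc m)"

lemma Gam_full: "step_Gam (Suc m) kK = gG (Suc n) (Suc m)" "step_tGam (Suc n) kK = gtG (Suc n) (Suc m)"
  by (simp_all add: Gam_corner[OF pcf] gG_eq(1)[OF pf] gtG_eq(1)[OF pf])

text \<open>Rows of \<open>w P\<close> have norm 1, so the first rows of \<open>gK1\<close> and
  \<open>gG1\<close> have squared norms adding up to 1. This determines the modulus of the first
  entry of \<open>gG1\<close>, which is positive.\<close>

lemma Gam1_full:
  "step_Gam1 (Suc n) (Suc m) D kK kK1 (gG (Suc n) (Suc m)) (gtE (Suc n) m)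
     (step_H3 kK1 (step_H1 (Suc n) (Suc m) D kK (gG (Suc n) (Suc m))) (step_H2 (Suc n) (Suc m) D kK (gG (Suc n) (Suc m))))
   = gG1 (Suc n) (Suc m)"
proof -
  let ?G = "gG1 (Suc n) (Suc m)" and ?U = "G1U (Suc n) (Suc m)"
  define h where "h = (kK1 * mat_adjoint kK1 + ?U * mat_adjoint ?U) $$ (0, 0)"
  have H3: "H3_entry (Suc m) (step_H3 kK1 (step_H1 (Suc n) (Suc m) D kK (gG (Suc n) (Suc m))) (step_H2 (Suc n) (Suc m) D kK (gG (Suc n) (Suc m)))) = h"
    using H3_canon[OF pcf D] unfolding Gam_full h_def by simp
  have U: "?G $$ (i, Suc j) = ?U $$ (i, j)" if "i < Suc m" "j < Suc m" for i j
    using that by (simp add: gG1_def G1U_def P_Suc_lprod_Suc)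
  have "complex_of_real (\<Sum>k<Suc (Suc m). (cmod (?G $$ (0, k)))\<^sup>2) =
      complex_of_real ((cmod (?G $$ (0, 0)))\<^sup>2) + (?U * mat_adjoint ?U) $$ (0, 0)"
  proof -
    have "(\<Sum>k<Suc m. (cmod (?G $$ (0, Suc k)))\<^sup>2) = (\<Sum>k<Suc m. (cmod (?U $$ (0, k)))\<^sup>2)"
      by (intro sum.cong) (auto simp: U)
    then show ?thesis
      unfolding sum.lessThan_Suc_shift[of _ "Suc m"] of_real_add
      by (simp add: mult_adjoint_self del: index_mult_mat(1) sum.lessThan_Suc)
  qed
  then have "(?G * mat_adjoint ?G) $$ (0, 0) = complex_of_real ((cmod (?G $$ (0, 0)))\<^sup>2) + (?U * mat_adjoint ?U) $$ (0, 0)"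
    by (simp add: mult_adjoint_self del: index_mult_mat(1) sum.lessThan_Suc)
  moreover have "(kK1 * mat_adjoint kK1 + ?G * mat_adjoint ?G) $$ (0, 0) = 1"
    by (simp only: gG1_norm[OF pf]) simp
  ultimately have "complex_of_real ((cmod (?G $$ (0, 0)))\<^sup>2) = 1 - h"
    unfolding h_def by (simp del: index_mult_mat(1) of_real_power)
      (simp add: algebra_simps del: index_mult_mat(1) of_real_power)
  then have "(cmod (?G $$ (0, 0)))\<^sup>2 = 1 - Re h" by (metis Re_complex_of_real minus_complex.sel(1) one_complex.sel(1))
  then have "cmod (?G $$ (0, 0)) = sqrt (1 - Re h)" by (metis norm_ge_zero real_sqrt_unique)
  moreover have "?G $$ (0, 0) = complex_of_real (cmod (?G $$ (0, 0)))"
    using gG1_col(2)[OF pf, of 0] by (simp add: less_complex_def cmod_eq_Re complex_eq_iff)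
  ultimately have 0: "?G $$ (0, 0) = complex_of_real (sqrt (1 - Re h))" by simp
  have "hcat (complex_of_real (sqrt (1 - Re h)) \<cdot>\<^sub>m bvec (Suc m) 1) ?U = ?G"
  proof (rule eq_matI)
    fix i j assume ij: "i < dim_row ?G" "j < dim_col ?G"
    then show "hcat (complex_of_real (sqrt (1 - Re h)) \<cdot>\<^sub>m bvec (Suc m) 1) ?U $$ (i, j) = ?G $$ (i, j)"
      using 0 U gG1_col(1)[OF pf, of i] by (cases j) (auto simp: hcat_index bvec_index)
  qed auto
  then show ?thesis
    unfolding step_Gam1_def H3 using Gam1_block[OF pcf D] by (simp add: Gam_full)
qed

text \<open>The first column comes from the common first row of \<open>P\<close> and
  \<open>Q\<close>; the others are obtained by solving \<open>gI_gtG\<close>.\<close>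

lemma I_full: "step_I (Suc n) (Suc m) kK (gG (Suc n) (Suc m)) (gtG (Suc n) (Suc m)) = gI (Suc n) (Suc m)"
proof -
  let ?I = "gI (Suc n) (Suc m)" and ?B = "Bw (Suc n) (Suc m)" and ?GK = "mat_adjoint (gG (Suc n) (Suc m)) * kK"
  have ns: "nonsing (Suc n) (mat_adjoint ?B)"
    by (rule nonsing_conj_trans(1)[OF pos_upper_nonsing[OF Bw_pos[OF pcf]]])
  have "?I * transpose_mat (Ush (Suc n)) * mat_adjoint ?B = ?I * mat_adjoint (gtG (Suc n) (Suc m))"
    unfolding gtG_eq(3)[OF pf] by (simp add: adjoint_mult mult_assoc_dim)
  also have "\<dots> = - ?GK" by (rule gI_gtG[OF pf])
  finally have "- ?GK * minv (mat_adjoint ?B) = ?I * transpose_mat (Ush (Suc n))"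
    by (intro nonsing_solve_right[OF ns]) auto
  then have I: "- (?GK * minv (mat_adjoint ?B)) = ?I * transpose_mat (Ush (Suc n))"
    using ns by (simp add: uminus_mult_dim)
  have "Ush (Suc n) * mat_adjoint (gtG (Suc n) (Suc m)) = mat_adjoint ?B"
    using Ush_Gam_corner(2)[OF pcf] by (simp add: Gam_full)
  then have "step_I (Suc n) (Suc m) kK (gG (Suc n) (Suc m)) (gtG (Suc n) (Suc m)) =
      hcat (bvec (Suc m + 1) 1) (?I * transpose_mat (Ush (Suc n)))"
    unfolding step_I_def I[symmetric] by simp
  also have "\<dots> = ?I"
  proof (rule eq_matI)
    fix i j assume ij: "i < dim_row ?I" "j < dim_col ?I"
    then show "hcat (bvec (Suc m + 1) 1) (?I * transpose_mat (Ush (Suc n))) $$ (i, j) = ?I $$ (i, j)"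
      using gI_col[OF pf, of i]
      by (cases j) (auto simp: hcat_index bvec_index mult_transpose_Ush_index simp del: index_mult_mat(1) simp flip: Suc_eq_plus1)
  qed auto
  finally show ?thesis .
qed

text \<open>The linear system for the new column is \<open>rec_wP\<close> for its first row and
  \<open>rec_P\<close> for the rows below.\<close>

lemma Phi_full: "step_Phi (Suc n) (Suc m) D kK kK1 (gG (Suc n) (Suc m)) (gG1 (Suc n) (Suc m)) = Pcol L (Suc n) (Suc (Suc m))"
proof -
  let ?P = "Pcol L (Suc n) (Suc m)" and ?Q = "Qcol L (Suc n) (Suc m)" and ?P' = "Pcol L (Suc n) (Suc (Suc m))"
  let ?G = "gG (Suc n) (Suc m)" and ?G1 = "gG1 (Suc n) (Suc m)"
  define b where "b = bvec (Suc m + 1) 1 * transpose_mat (bvec (Suc m) 1)"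
  have b: "dim_row b = Suc (Suc m)" "dim_col b = Suc m" by (simp_all add: b_def)
  have zw: "zw 0 1 = zwn 0 1" by (simp add: zwn_def)
  have h: "nonsing (Suc (Suc m)) (hat_of ?G1 ?G)" using hat_nonsing(1)[OF pf] by simp
  have 1: "zw 0 1 \<cdot>\<^sub>m ?P - cmat kK1 * transpose_mat (rev_poly n (Suc m) ?Q) = cmat ?G1 * ?P'"
    unfolding zw transpose_rev_poly[folded zwn_def] rec_wP[OF pf]
    by (auto intro!: eq_matI simp del: index_mult_mat(1))
  have 2: "?P - cmat kK * ?Q = cmat ?G * ?P'"
    by (subst rec_P[OF pf]) (auto intro!: eq_matI simp del: index_mult_mat(1))
  have hat: "hat_of ?G1 ?G = b * ?G1 + transpose_mat (Ush (Suc m)) * ?G"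
    unfolding b_def by (rule hat_of_eq) auto
  have "cmat b * (cmat ?G1 * ?P') + cmat (transpose_mat (Ush (Suc m))) * (cmat ?G * ?P') = cmat (hat_of ?G1 ?G) * ?P'"
    unfolding hat using b by (simp add: cmat_add cmat_mult add_mult_dim mult_assoc_dim)
  then have "step_Phi (Suc n) (Suc m) D kK kK1 ?G ?G1 = cmat (minv (hat_of ?G1 ?G)) * (cmat (hat_of ?G1 ?G) * ?P')"
    unfolding step_Phi_def diff_Suc_1 Dzf Dwf 1 2 b_def by simp
  also have "\<dots> = cmat (minv (hat_of ?G1 ?G) * hat_of ?G1 ?G) * ?P'"
    using h by (intro cmat_mult_assoc) auto
  also have "\<dots> = ?P'" using minv_nonsing(3)[OF h] by simp
  finally show ?thesis .
qed

lemma level_inner_canon: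
  assumes u: "u (- int (Suc n)) (int (Suc m)) = par_neg L (Suc n) (Suc m)"
    "u (int (Suc n)) (int (Suc m)) = par_pos L (Suc n) (Suc m)"
  shows "canon (Suc n) (Suc m) (level_inner u (Suc n) (Suc m) D)"
proof -
  let ?P = "Pcol L (Suc n) (Suc (Suc m))" and ?Q = "Qcol L (Suc (Suc n)) (Suc m)"
  have K: "step_K u (Suc n) (Suc m) D = kK" by (rule step_K_canon[where u = u, OF ozf owf D]) (use u in auto)
  have K1: "step_K1 u (Suc n) (Suc m) D = kK1" by (rule step_K1_canon[where u = u, OF ozf owf D]) (use u in auto)
  have E: "step_E (Suc n) (Suc m) D kK kK1 = gE n (Suc m)" "step_tE (Suc n) (Suc m) D kK kK1 = gtE (Suc n) m"
    by (rule step_E_canon[OF ozf owf D] step_tE_canon[OF ozf owf D]; assumption)+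
  have Q: "cmat (mat_adjoint (gI (Suc n) (Suc m))) * ?P + cmat (mat_adjoint (gtG (Suc n) (Suc m))) * Qcol L (Suc n) (Suc m) = ?Q"
    by (rule rec_tI[OF pf, symmetric])
  note nz = ZL_nonsing[OF pf] and nw = WL_nonsing[OF pf]
  have A: "zlead n (Suc m) (Pcol L n (Suc (Suc m))) * minv (zlead (Suc n) (Suc m) ?P) = gA n (Suc m)"
    using nonsing_solve_right[OF nz _ gA_lead[OF pf]] by (simp add: lead_eq)
  have tA: "wlead (Suc n) m (Qcol L (Suc (Suc n)) m) * minv (wlead (Suc n) (Suc m) ?Q) = gtA (Suc n) m"
    using nonsing_solve_right[OF nw _ gtA_lead[OF pf]] by (simp add: lead_eq)
  have tG1: "wlead n (Suc m) (Qcol L (Suc n) (Suc m)) * Ush1 (Suc n) * minv (wlead (Suc n) (Suc m) ?Q) = gtG1 (Suc n) (Suc m)"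
    using nonsing_solve_right[OF nw _ gtG1_lead[OF pf]] by (simp add: lead_eq)
  note nA = nonsing_conj_trans(3)[OF gA_nonsing[OF pf]]
  have I1: "- (minv (mcnj (gA n (Suc m))) * mat_adjoint (gE n (Suc m)) * gA n (Suc m) * gI (Suc n) (Suc m))
      + transpose_mat (gA n (Suc m)) * gI1 n (Suc m) * gtG (Suc n) (Suc m) = gI1 (Suc n) (Suc m)"
    using nonsing_solve[OF nA _ gI1_rec[OF pf]] nA nonsing_cancel(1)[OF nA]
    by (simp add: mult_add_dim mult_uminus_dim mult_assoc_dim)
  show ?thesis
    unfolding level_inner_def Let_def K K1 E Gam_full Gam1_full I_full Phi_full diff_Suc_1 Dzf Dwf Q A tA tG1 I1
    by (simp add: canon_def)
qed

end

end

section \<open>Boundary levels\<close>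

context bicircle
begin

lemma gI1_rec_w:
  assumes "ok (Suc n) (Suc (Suc m))"
  shows "mcnj (gtA n m) * transpose_mat (gI1 n (Suc m)) = - (mat_adjoint (gtE n m) * gtA n m * mat_adjoint (gI n (Suc m)))
    + mcnj (gtA n m) * (transpose_mat (gtA n m) * transpose_mat (gI1 n m) * gG n (Suc m))"
proof -
  interpret swap: bicircle L "\<lambda>a b. M b a" "\<lambda>a b. V b a" "\<lambda>a b. Q b a" "\<lambda>a b. P b a" "\<lambda>a b. ok b a"
    by (rule swapped)
  show ?thesis using swap.gI1_rec[OF assms] by (simp add: swap_g)
qed

end

lemma transpose_1_1: "dim_row A = Suc 0 \<Longrightarrow> dim_col A = 1 \<Longrightarrow> transpose_mat A = A"
  by (auto intro!: eq_matI simp: One_nat_def)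

lemma rev_poly_1_1: "dim_row X = Suc 0 \<Longrightarrow> dim_col X = 1 \<Longrightarrow> rev_poly a b X = star_col (zwn a b) X"
  using transpose_rev_poly[of a b X, folded zwn_def] transpose_1_1[of "star_col (zwn a b) X"]
  by (metis star_col_dim transpose_transpose)

lemma mat_Suc_0_eq: "dim_row A = Suc 0 \<Longrightarrow> dim_col A = Suc 0 \<Longrightarrow> A = scalar_mat1 (A $$ (0, 0))"
  by (rule mat_1_1_eq) (simp_all add: One_nat_def)

lemma cmat_scalar_mult:
  "dim_row X = Suc 0 \<Longrightarrow> cmat (scalar_mat1 a) * X = cst a \<cdot>\<^sub>m X"
  by (rule eq_matI) (auto simp: scalar_mat1_def scalar_prod_def One_nat_def)

lemma scalar_mat1_eq_sqrt:
  assumes "scalar_mat1 x * mat_adjoint (scalar_mat1 x) + scalar_mat1 a * mat_adjoint (scalar_mat1 a) = 1\<^sub>m (Suc 0)" "0 < a"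
  shows "a = complex_of_real (sqrt (1 - (cmod x)\<^sup>2))" "cmod x < 1"
proof -
  have "x * cnj x + a * cnj a = 1"
    using arg_cong[OF assms(1), of "\<lambda>A. A $$ (0, 0)"]
    by (simp add: scalar_mat1_def scalar_prod_def One_nat_def)
  then have "complex_of_real ((cmod x)\<^sup>2 + (cmod a)\<^sup>2) = 1"
    by (simp only: mult_cnj_cmod of_real_add)
  then have eq: "(cmod x)\<^sup>2 + (cmod a)\<^sup>2 = 1" by (metis of_real_eq_1_iff)
  have a: "a = complex_of_real (cmod a)" "0 < cmod a"
    using assms(2) by (auto simp: less_complex_def cmod_eq_Re complex_eq_iff)
  have "cmod a = sqrt (1 - (cmod x)\<^sup>2)" using eq by (intro real_sqrt_unique[symmetric]) auto
  then show "a = complex_of_real (sqrt (1 - (cmod x)\<^sup>2))" using a by simp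
  have "0 < (cmod a)\<^sup>2" using a(2) by simp
  then have "(cmod x)\<^sup>2 < 1\<^sup>2" using eq unfolding power_one by linarith
  then show "cmod x < 1" by (rule power2_less_imp_less) simp
qed

context herm
begin

text \<open>\<open>X\<close> and \<open>F\<close> are orthogonal to the same \<open>T0\<close>,
  which \<open>F\<close> completes to \<open>T\<close>. The residual of \<open>X\<close> along
  \<open>F\<close> is therefore orthogonal to all of \<open>T\<close>, and its squared norm is 1
  minus the squared modulus of the coefficient.\<close>

lemma pd_szego_step:
  assumes T: "pd (mono_span T)" and k: "k \<notin> T" and F: "onb (mono_span T) T0 F" "dim_row F = Suc 0"
    and X: "col_in X (mono_span (insert k T))" "dim_row X = Suc 0" "orth X T0" "lprod L X X = 1\<^sub>m (Suc 0)"
      "lcoeff (X $$ (0, 0)) k \<noteq> 0"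
  shows "pd (mono_span (insert k T)) \<longleftrightarrow> cmod (lprod L X F $$ (0, 0)) < 1"
proof -
  define x where "x = lprod L X F $$ (0, 0)"
  have d: "dim_col X = 1" "dim_col F = 1" using X(1) onbD(6)[OF F(1)] by (auto simp: col_in_def)
  have C: "lprod L X F = scalar_mat1 x" unfolding x_def by (rule mat_Suc_0_eq) (simp_all add: X F)
  define Y where "Y = X - cmat (lprod L X F) * F"
  have Y: "dim_row Y = Suc 0" "dim_col Y = 1" using d X F by (simp_all add: Y_def)
  have Yo: "orth Y (mono_span T)" unfolding Y_def by (rule orth_step[OF F(1) X(3) d(1)])
  have FT: "col_in F (mono_span T)" by (rule onbD(1)[OF F(1)])
  have FkT: "col_in F (mono_span (insert k T))" by (rule col_in_mono[OF FT mono_span_mono]) auto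
  have Yin: "col_in Y (mono_span (insert k T))"
    unfolding Y_def using X FkT F d by (intro col_in_add col_in_cmat_mult lsubspace_mono_span) auto
  have "lprod L F X = mat_adjoint (lprod L X F)" using d by (simp add: lprod_swap)
  then have "lprod L Y Y = 1\<^sub>m (Suc 0) - scalar_mat1 x * mat_adjoint (scalar_mat1 x)"
    using d X F onbD(4)[OF F(1)] unfolding Y_def
    by (auto intro!: eq_matI simp: lprod_simps mat_distribs C simp del: index_mult_mat(1) scalar_mat1_mult)
  then have "lprod L Y Y $$ (0, 0) = 1 - x * cnj x"
    by (simp add: scalar_mat1_def scalar_prod_def One_nat_def)
  then have yy: "L (Y $$ (0, 0) * lstar (Y $$ (0, 0))) = complex_of_real (1 - (cmod x)\<^sup>2)"
    using Y by (simp add: lprod_index mult_cnj_cmod)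
  have "lcoeff (F $$ (0, 0)) k = 0" using FT F k by (simp add: col_in_def mono_span_iff)
  then have "lcoeff (Y $$ (0, 0)) k = lcoeff (X $$ (0, 0)) k"
    using d X F by (simp add: Y_def C cmat_scalar_mult lookup_minus)
  moreover have "Y $$ (0, 0) \<in> mono_span (insert k T)" using Yin Y by (simp add: col_in_def)
  moreover have "L (Y $$ (0, 0) * lstar p) = 0" if "p \<in> mono_span T" for p
    using Yo Y that by (simp add: orth_def)
  ultimately have "pd (mono_span (insert k T)) \<longleftrightarrow> 0 < complex_of_real (1 - (cmod x)\<^sup>2)"
    using pd_insert_iff[OF T k, of "Y $$ (0, 0)"] X(5) unfolding yy by simp
  also have "\<dots> \<longleftrightarrow> (cmod x)\<^sup>2 < 1\<^sup>2" by (simp add: less_complex_def)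
  also have "\<dots> \<longleftrightarrow> cmod x < 1" by (metis norm_ge_zero power2_less_imp_less power_strict_mono zero_le_one zero_less_numeral)
  finally show ?thesis unfolding x_def .
qed

end

context mfun
begin

lemma pd_origin_iff: "pd (Vbox (Suc 0) (Suc 0)) \<longleftrightarrow> 0 < L 1"
proof -
  have "pd (mono_span {})" by (auto simp: pd_def mono_span_def)
  moreover have b: "insert (0, 0) {} = box (Suc 0) (Suc 0)" by (auto simp: box_def)
  moreover have "zw 0 0 \<in> mono_span (insert (0, 0) {})" by (rule zw_mono_span) simp
  ultimately show ?thesis
    using pd_insert_iff[of "{}" "(0, 0)" "zw 0 0"] by (auto simp: lcoeff_zw mono_span_def simp del: zw_0)
      (auto simp: mono_span_def)
qed

lemma par_pos_gE: "par_pos L (Suc n) 0 = gE n 0 $$ (0, 0)"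
  using rev_poly_1_1[of "Pcol L n (Suc 0)" n 0] by (simp add: par_pos_def onPhi_eq gE_def zwn_def)

lemma par_pos_gtE: "par_pos L 0 (Suc m) = gtE 0 m $$ (0, 0)"
  using rev_poly_1_1[of "Qcol L (Suc 0) m" 0 m] by (simp add: par_pos_def onPhi_eq gtE_def zwn_def)

lemma pd_z_iff:
  assumes o: "pd (Vbox (Suc n) (Suc 0))"
  shows "pd (Vbox (Suc (Suc n)) (Suc 0)) \<longleftrightarrow> cmod (gE n 0 $$ (0, 0)) < 1"
proof -
  have b: "insert (int (Suc n), 0) (box (Suc n) (Suc 0)) = box (Suc (Suc n)) (Suc 0)" by (auto simp: box_def)
  let ?X = "shift_z (Pcol L n (Suc 0))"
  have "0 < lcoeff (?X $$ (0, 0)) (int (Suc n), 0)"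
    using P_row_mem(2)[OF o, of 0] by (simp add: zwn_def)
  then have "lcoeff (?X $$ (0, 0)) (int (Suc n), 0) \<noteq> 0" by (metis less_irrefl)
  moreover have "col_in ?X (mono_span (insert (int (Suc n), 0) (box (Suc n) (Suc 0))))"
    unfolding b by (rule col_in_shift(1)[OF P_facts(1)[OF o]])
  moreover have "orth ?X ((*) (zwn 1 0) ` Vbox n (Suc 0))" by (rule orth_shift(1)[OF P_facts(2)[OF o]]) simp
  moreover have "lprod L ?X ?X = 1\<^sub>m (Suc 0)" using P_facts(3)[OF o] by (simp add: R_gram)
  moreover have "(int (Suc n), 0) \<notin> box (Suc n) (Suc 0)" by (simp add: box_def)
  ultimately show ?thesis
    unfolding b[symmetric] gE_def by (intro pd_szego_step[OF o _ onb_RP[OF o]]) simp_all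
qed

lemma pd_w_iff:
  assumes o: "pd (Vbox (Suc 0) (Suc m))"
  shows "pd (Vbox (Suc 0) (Suc (Suc m))) \<longleftrightarrow> cmod (gtE 0 m $$ (0, 0)) < 1"
proof -
  have b: "insert (0, int (Suc m)) (box (Suc 0) (Suc m)) = box (Suc 0) (Suc (Suc m))" by (auto simp: box_def)
  let ?X = "shift_w (Qcol L (Suc 0) m)"
  have "0 < lcoeff (?X $$ (0, 0)) (0, int (Suc m))"
    using Q_row_mem(2)[OF o, of 0] by (simp add: zwn_def)
  then have "lcoeff (?X $$ (0, 0)) (0, int (Suc m)) \<noteq> 0" by (metis less_irrefl)
  moreover have "col_in ?X (mono_span (insert (0, int (Suc m)) (box (Suc 0) (Suc m))))"
    unfolding b by (rule col_in_shift(2)[OF Q_facts(1)[OF o]])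
  moreover have "orth ?X ((*) (zwn 0 1) ` Vbox (Suc 0) m)" by (rule orth_shift(2)[OF Q_facts(2)[OF o]]) simp
  moreover have "lprod L ?X ?X = 1\<^sub>m (Suc 0)" using Q_facts(3)[OF o] by (simp add: R_gram)
  moreover have "(0, int (Suc m)) \<notin> box (Suc 0) (Suc m)" by (simp add: box_def)
  ultimately show ?thesis
    unfolding b[symmetric] gtE_def by (intro pd_szego_step[OF o _ onb_RQ[OF o]]) simp_all
qed

lemma origin_canon:
  assumes "pd (Vbox (Suc 0) (Suc 0))" "u 0 0 = L 1"
  shows "canon 0 0 (level_origin u)"
proof -
  have pos: "0 < L 1" using assms(1) by (simp add: pd_origin_iff)
  define s where "s = sqrt (Re (L 1))"
  have s: "0 < s" "L 1 = complex_of_real (s * s)"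
    using pos by (auto simp: s_def less_complex_def complex_eq_iff)
  have b: "box (Suc 0) (Suc 0) = {(0, 0)}" by (auto simp: box_def)
  have "onpoly L (box (Suc 0) (Suc 0)) (0, 0) = cst (1 / complex_of_real s)"
  proof (rule onpoly_eqI)
    have "L (cst (1 / complex_of_real s) * lstar (cst (1 / complex_of_real s))) =
        1 / complex_of_real s * (1 / complex_of_real s * L 1)"
      using L_cst[of "1 / complex_of_real s" "cst (1 / complex_of_real s) * 1"] L_cst[of "1 / complex_of_real s" 1]
      by simp
    also have "\<dots> = 1" using s by simp
    finally show "is_onpoly (box (Suc 0) (Suc 0)) (0, 0) (cst (1 / complex_of_real s))"
      using s(1) by (auto simp: is_onpoly_def b mono_span_iff cst_def lookup_single when_def less_complex_def zero_prod_def)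
  qed (use assms in \<open>auto simp: b\<close>)
  then have P: "Pcol L 0 (Suc 0) = mat 1 1 (\<lambda>_. cst (1 / complex_of_real s))"
    "Qcol L (Suc 0) 0 = mat 1 1 (\<lambda>_. cst (1 / complex_of_real s))"
    by (auto intro!: eq_matI simp: Pcol_def Qcol_def gscol_index keys_nth keys_box One_nat_def)
  have R: "R 0 0 (Pcol L 0 (Suc 0)) = Pcol L 0 (Suc 0)"
    unfolding P by (rule eq_matI) (auto simp: zwn_def)
  have "lprod L (Pcol L 0 (Suc 0)) (Qcol L (Suc 0) 0) = 1\<^sub>m 1"
    using P_facts(3)[OF assms(1)] unfolding P by (simp add: One_nat_def)
  then have I: "gI 0 0 = 1\<^sub>m 1" "gI1 0 0 = 1\<^sub>m 1" by (simp_all only: gI_def gI1_def R)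
  have e: "gK 0 0 = 0\<^sub>m 0 0" "gK1 0 0 = 0\<^sub>m 0 0" by (rule eq_dim_0; simp)+
  show ?thesis
    unfolding canon_def level_origin_def Let_def assms(2) s_def[symmetric]
    by (simp add: P I e)
qed

text \<open>As a quotient of leading coefficients the scalar \<open>gA\<close> is positive, and
  Parseval then fixes its value.\<close>

lemma gA_z:
  assumes pf: "pd (Vbox (Suc (Suc n)) (Suc 0))"
  shows "gE n 0 = scalar_mat1 (gE n 0 $$ (0, 0))"
    "gA n 0 = scalar_mat1 (complex_of_real (sqrt (1 - (cmod (gE n 0 $$ (0, 0)))\<^sup>2)))"
    "cmod (gE n 0 $$ (0, 0)) < 1"
proof -
  have o: "pd (Vbox (Suc n) (Suc 0))" by (rule ok_mono[OF pf]) auto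
  show E: "gE n 0 = scalar_mat1 (gE n 0 $$ (0, 0))" by (rule mat_Suc_0_eq) simp_all
  have A: "gA n 0 = scalar_mat1 (gA n 0 $$ (0, 0))" by (rule mat_Suc_0_eq) simp_all
  have pos: "0 < ZL n (Suc 0) $$ (0, 0)" "0 < ZL (Suc n) (Suc 0) $$ (0, 0)"
    using cfm_P[OF o] cfm_P[OF pf] by (auto simp: pos_upper_def)
  have "gA n 0 $$ (0, 0) * ZL (Suc n) (Suc 0) $$ (0, 0) = ZL n (Suc 0) $$ (0, 0)"
    using arg_cong[OF gA_lead[OF pf], of "\<lambda>A. A $$ (0, 0)"]
    by (subst (asm) mult_mat_index[where n = "Suc 0"]) auto
  then have "gA n 0 $$ (0, 0) = ZL n (Suc 0) $$ (0, 0) / ZL (Suc n) (Suc 0) $$ (0, 0)"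
    using pos by (auto simp: field_simps)
  then have "0 < gA n 0 $$ (0, 0)" using pos by (simp add: less_complex_def Re_divide Im_divide)
  from scalar_mat1_eq_sqrt[OF _ this] gA_norm[OF pf]
  show "gA n 0 = scalar_mat1 (complex_of_real (sqrt (1 - (cmod (gE n 0 $$ (0, 0)))\<^sup>2)))" "cmod (gE n 0 $$ (0, 0)) < 1"
    using E A by metis+
qed

lemma gtA_w:
  assumes pf: "pd (Vbox (Suc 0) (Suc (Suc m)))"
  shows "gtE 0 m = scalar_mat1 (gtE 0 m $$ (0, 0))"
    "gtA 0 m = scalar_mat1 (complex_of_real (sqrt (1 - (cmod (gtE 0 m $$ (0, 0)))\<^sup>2)))"
    "cmod (gtE 0 m $$ (0, 0)) < 1"
proof -
  have o: "pd (Vbox (Suc 0) (Suc m))" by (rule ok_mono[OF pf]) auto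
  show E: "gtE 0 m = scalar_mat1 (gtE 0 m $$ (0, 0))" by (rule mat_Suc_0_eq) simp_all
  have A: "gtA 0 m = scalar_mat1 (gtA 0 m $$ (0, 0))" by (rule mat_Suc_0_eq) simp_all
  have pos: "0 < WL (Suc 0) m $$ (0, 0)" "0 < WL (Suc 0) (Suc m) $$ (0, 0)"
    using cfm_Q[OF o] cfm_Q[OF pf] by (auto simp: pos_upper_def)
  have "gtA 0 m $$ (0, 0) * WL (Suc 0) (Suc m) $$ (0, 0) = WL (Suc 0) m $$ (0, 0)"
    using arg_cong[OF gtA_lead[OF pf], of "\<lambda>A. A $$ (0, 0)"]
    by (subst (asm) mult_mat_index[where n = "Suc 0"]) auto
  then have "gtA 0 m $$ (0, 0) = WL (Suc 0) m $$ (0, 0) / WL (Suc 0) (Suc m) $$ (0, 0)"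
    using pos by (auto simp: field_simps)
  then have "0 < gtA 0 m $$ (0, 0)" using pos by (simp add: less_complex_def Re_divide Im_divide)
  from scalar_mat1_eq_sqrt[OF _ this] gtA_norm[OF pf]
  show "gtA 0 m = scalar_mat1 (complex_of_real (sqrt (1 - (cmod (gtE 0 m $$ (0, 0)))\<^sup>2)))" "cmod (gtE 0 m $$ (0, 0)) < 1"
    using E A by metis+
qed

text \<open>On a boundary one of the two columns just lists the scalar orthonormal polynomials found
  so far.\<close>

lemma Qcol_rows: "i \<le> n \<Longrightarrow> Qcol L (Suc n) 0 $$ (n - i, 0) = Pcol L i (Suc 0) $$ (0, 0)"
  and Pcol_rows: "j \<le> m \<Longrightarrow> Pcol L 0 (Suc m) $$ (m - j, 0) = Qcol L (Suc 0) j $$ (0, 0)"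
proof -
  assume "i \<le> n"
  then have "box (Suc n) 0 \<union> set (drop (n - i) (wkeys (Suc n) 0)) = box (Suc i) (Suc 0)"
    "wkeys (Suc n) 0 ! (n - i) = (int i, 0)"
    by (auto simp: keys_drop keys_set keys_nth box_def of_nat_diff)
  then show "Qcol L (Suc n) 0 $$ (n - i, 0) = Pcol L i (Suc 0) $$ (0, 0)"
    by (simp add: Pcol_def Qcol_def gscol_index keys_box keys_nth)
next
  assume "j \<le> m"
  then have "box 0 (Suc m) \<union> set (drop (m - j) (zkeys 0 (Suc m))) = box (Suc 0) (Suc j)"
    "zkeys 0 (Suc m) ! (m - j) = (0, int j)"
    by (auto simp: keys_drop keys_set keys_nth box_def of_nat_diff)
  then show "Pcol L 0 (Suc m) $$ (m - j, 0) = Qcol L (Suc 0) j $$ (0, 0)"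
    by (simp add: Pcol_def Qcol_def gscol_index keys_box keys_nth)
qed

lemma one_pos_upper: "pos_upper n (1\<^sub>m n)"
  by (auto simp: pos_upper_def less_complex_def)

lemma z_canon:
  assumes pf: "pd (Vbox (Suc (Suc n)) (Suc 0))"
    and D: "\<And>i. i \<le> n \<Longrightarrow> canon i 0 (D i 0)" and u: "u (int (Suc n)) 0 = par_pos L (Suc n) 0"
  shows "canon (Suc n) 0 (level_z u (Suc n) D)"
proof -
  define x where "x = gE n 0 $$ (0, 0)"
  define a where "a = complex_of_real (sqrt (1 - (cmod x)\<^sup>2))"
  have ux: "u (int (Suc n)) 0 = x" using u by (simp add: par_pos_gE x_def del: of_nat_Suc)
  have E: "gE n 0 = scalar_mat1 x" and A: "gA n 0 = scalar_mat1 a" and x1: "cmod x < 1"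
    using gA_z[OF pf] by (simp_all add: x_def a_def)
  have a: "a \<noteq> 0" "cnj a = a"
  proof -
    have "(cmod x)\<^sup>2 < 1" using x1 by (simp add: abs_square_less_1)
    then show "a \<noteq> 0" "cnj a = a" by (simp_all add: a_def)
  qed
  let ?P = "Pcol L n (Suc 0)" and ?P' = "Pcol L (Suc n) (Suc 0)" and ?Q = "Qcol L (Suc (Suc n)) 0"
  have Dn: "Phi (D i 0) = Pcol L i (Suc 0)" if "i \<le> n" for i using D[OF that] by (simp add: canon_def)
  have D': "tPhi (D n 0) = Qcol L (Suc n) 0" "II1 (D n 0) = gI1 n 0" using D[of n] by (simp_all add: canon_def)
  have zw: "zw 1 0 = zwn 1 0" by (simp add: zwn_def)
  have "zw 1 0 \<cdot>\<^sub>m ?P - cst x \<cdot>\<^sub>m rev_poly n 0 ?P = cst a \<cdot>\<^sub>m ?P'"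
    unfolding zw szego[OF pf] E A
    by (auto intro!: eq_matI simp: rev_poly_1_1 cmat_scalar_mult)
  then have F: "cst (1 / a) \<cdot>\<^sub>m (zw 1 0 \<cdot>\<^sub>m ?P - cst x \<cdot>\<^sub>m rev_poly n 0 ?P) = ?P'"
    using a by (auto intro!: eq_matI simp: mult.assoc[symmetric] simp flip: cst_simps(4))
  have tF: "mat (Suc n + 1) 1 (\<lambda>(r, _). if r = 0 then ?P' $$ (0, 0) else Phi (D (Suc n - r) 0) $$ (0, 0)) = ?Q"
  proof (rule eq_matI)
    fix r j assume "r < dim_row ?Q" "j < dim_col ?Q"
    then show "mat (Suc n + 1) 1 (\<lambda>(r, _). if r = 0 then ?P' $$ (0, 0) else Phi (D (Suc n - r) 0) $$ (0, 0)) $$ (r, j) = ?Q $$ (r, j)"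
      using Qcol_rows[of "Suc n - r" "Suc n"] Dn[of "Suc n - r"] by (cases r) auto
  qed auto
  \<comment> \<open>\<open>K\<close> has no rows here, so the Cholesky factor is that of the
    identity matrix.\<close>
  have tG: "gtG (Suc n) 0 = Ush (Suc n)"
  proof -
    have "mat_adjoint (gK (Suc n) 0) * gK (Suc n) 0 = 0\<^sub>m (Suc n) (Suc n)"
      by (rule eq_matI) (auto simp: scalar_prod_def)
    then have "gtG (Suc n) 0 * mat_adjoint (gtG (Suc n) 0) = 1\<^sub>m (Suc n)"
      using gtG_norm[OF pf] by simp
    moreover have "gK (Suc n) 0 = 0\<^sub>m 0 (Suc n)" by (rule eq_dim_0) auto
    ultimately have "Bw (Suc n) 0 * mat_adjoint (Bw (Suc n) 0) = 1\<^sub>m (Suc n) * mat_adjoint (1\<^sub>m (Suc n))"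
      using rec_P_corner(4)[OF pd_corner[OF pf]] by simp
    then have "Bw (Suc n) 0 = 1\<^sub>m (Suc n)"
      by (rule pos_upper_unique[OF Bw_pos[OF pd_corner[OF pf]] one_pos_upper])
    then show ?thesis using gtG_eq(3)[OF pf] by simp
  qed
  have tG1: "wlead n 0 (Qcol L (Suc n) 0) * Ush1 (Suc n) * minv (wlead (Suc n) 0 ?Q) = gtG1 (Suc n) 0"
    using nonsing_solve_right[OF WL_nonsing[OF pf] _ gtG1_lead[OF pf]] by (simp add: lead_eq)
  have I: "gI (Suc n) 0 = transpose_mat (bvec (Suc n + 1) 1)"
  proof (rule eq_matI)
    fix i j assume ij: "i < dim_row (transpose_mat (bvec (Suc n + 1) 1))" "j < dim_col (transpose_mat (bvec (Suc n + 1) 1))"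
    then have "gI (Suc n) 0 $$ (i, j) = lprod L ?Q ?Q $$ (0, j)"
      using gI_P_eq_Q[of "Suc n" 0] by (simp add: gI_def lprod_index)
    then show "gI (Suc n) 0 $$ (i, j) = transpose_mat (bvec (Suc n + 1) 1) $$ (i, j)"
      using ij Q_facts(3)[OF pf] by (simp add: bvec_index)
  qed (auto simp: One_nat_def)
  \<comment> \<open>\<open>gI1_rec\<close> determines the matrix up to the left factor
    \<open>gA\<close>, here a nonzero real scalar that is cancelled entry by entry.\<close>
  have I1: "(- cnj x) \<cdot>\<^sub>m transpose_mat (bvec (Suc n + 1) 1) + a \<cdot>\<^sub>m (gI1 n 0 * Ush (Suc n)) = gI1 (Suc n) 0"
  proof -
    have nA: "nonsing (Suc 0) (mcnj (gA n 0))" by (rule nonsing_conj_trans(3)[OF gA_nonsing[OF pf]])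
    have sc: "mcnj (scalar_mat1 a) = scalar_mat1 a" "transpose_mat (scalar_mat1 a) = scalar_mat1 a"
      "mat_adjoint (scalar_mat1 x) = scalar_mat1 (cnj x)"
      using a by (auto intro!: eq_matI simp: scalar_mat1_def)
    have mult: "scalar_mat1 c * Y = c \<cdot>\<^sub>m Y" if "dim_row Y = Suc 0" for c Y
      using that by (intro scalar_mat1_mult(1)) (simp add: One_nat_def)
    have "a \<cdot>\<^sub>m gI1 (Suc n) 0 = - (a \<cdot>\<^sub>m (cnj x \<cdot>\<^sub>m gI (Suc n) 0)) + a \<cdot>\<^sub>m (a \<cdot>\<^sub>m (gI1 n 0 * Ush (Suc n)))"
      using gI1_rec[OF pf] unfolding E A sc tG
      by (simp add: mult mult_assoc_dim smult_mult_dim)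
    note eq = this
    show ?thesis
    proof (rule eq_matI)
      fix i j assume ij: "i < dim_row (gI1 (Suc n) 0)" "j < dim_col (gI1 (Suc n) 0)"
      have "a * gI1 (Suc n) 0 $$ (i, j) =
          a * (- (cnj x * gI (Suc n) 0 $$ (i, j)) + a * (gI1 n 0 * Ush (Suc n)) $$ (i, j))"
        using arg_cong[OF eq, of "\<lambda>X. X $$ (i, j)"] ij by (simp add: algebra_simps del: index_mult_mat(1))
      then show "((- cnj x) \<cdot>\<^sub>m transpose_mat (bvec (Suc n + 1) 1) + a \<cdot>\<^sub>m (gI1 n 0 * Ush (Suc n))) $$ (i, j) =
          gI1 (Suc n) 0 $$ (i, j)"
        using a ij unfolding I[symmetric] by (simp del: index_mult_mat(1))
    qed (simp_all add: One_nat_def)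
  qed
  have empties: "0\<^sub>m 0 (Suc n) = gK (Suc n) 0" "0\<^sub>m 0 (Suc n) = gK1 (Suc n) 0"
    "0\<^sub>m 0 1 = gG (Suc n) 0" "0\<^sub>m 0 1 = gG1 (Suc n) 0"
    by (rule eq_dim_0; simp add: One_nat_def)+
  show ?thesis
    unfolding level_z_def Let_def diff_Suc_1 ux a_def[symmetric] Dn[OF order_refl] F tF D' tG1 I1
    by (simp add: canon_def E A I tG empties[symmetric])
qed

lemma w_canon:
  assumes pf: "pd (Vbox (Suc 0) (Suc (Suc m)))"
    and D: "\<And>j. j \<le> m \<Longrightarrow> canon 0 j (D 0 j)" and u: "u 0 (int (Suc m)) = par_pos L 0 (Suc m)"
  shows "canon 0 (Suc m) (level_w u (Suc m) D)"
proof -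
  define x where "x = gtE 0 m $$ (0, 0)"
  define a where "a = complex_of_real (sqrt (1 - (cmod x)\<^sup>2))"
  have ux: "u 0 (int (Suc m)) = x" using u by (simp add: par_pos_gtE x_def del: of_nat_Suc)
  have E: "gtE 0 m = scalar_mat1 x" and A: "gtA 0 m = scalar_mat1 a" and x1: "cmod x < 1"
    using gtA_w[OF pf] by (simp_all add: x_def a_def)
  have a: "a \<noteq> 0" "cnj a = a"
  proof -
    have "(cmod x)\<^sup>2 < 1" using x1 by (simp add: abs_square_less_1)
    then show "a \<noteq> 0" "cnj a = a" by (simp_all add: a_def)
  qed
  let ?Q = "Qcol L (Suc 0) m" and ?Q' = "Qcol L (Suc 0) (Suc m)" and ?P = "Pcol L 0 (Suc (Suc m))"
  have Dm: "tPhi (D 0 j) = Qcol L (Suc 0) j" if "j \<le> m" for j using D[OF that] by (simp add: canon_def)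
  have D': "Phi (D 0 m) = Pcol L 0 (Suc m)" "II1 (D 0 m) = gI1 0 m" using D[of m] by (simp_all add: canon_def)
  have zw: "zw 0 1 = zwn 0 1" by (simp add: zwn_def)
  have "zw 0 1 \<cdot>\<^sub>m ?Q - cst x \<cdot>\<^sub>m rev_poly 0 m ?Q = cst a \<cdot>\<^sub>m ?Q'"
    unfolding zw szego_Q[OF pf] E A
    by (auto intro!: eq_matI simp: rev_poly_1_1 cmat_scalar_mult)
  then have F: "cst (1 / a) \<cdot>\<^sub>m (zw 0 1 \<cdot>\<^sub>m ?Q - cst x \<cdot>\<^sub>m rev_poly 0 m ?Q) = ?Q'"
    using a by (auto intro!: eq_matI simp: mult.assoc[symmetric] simp flip: cst_simps(4))
  have tF: "mat (Suc m + 1) 1 (\<lambda>(r, _). if r = 0 then ?Q' $$ (0, 0) else tPhi (D 0 (Suc m - r)) $$ (0, 0)) = ?P"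
  proof (rule eq_matI)
    fix r j assume "r < dim_row ?P" "j < dim_col ?P"
    then show "mat (Suc m + 1) 1 (\<lambda>(r, _). if r = 0 then ?Q' $$ (0, 0) else tPhi (D 0 (Suc m - r)) $$ (0, 0)) $$ (r, j) = ?P $$ (r, j)"
      using Pcol_rows[of "Suc m - r" "Suc m"] Dm[of "Suc m - r"] by (cases r) auto
  qed auto
  have G: "gG 0 (Suc m) = Ush (Suc m)"
  proof -
    have "gK 0 (Suc m) * mat_adjoint (gK 0 (Suc m)) = 0\<^sub>m (Suc m) (Suc m)"
      by (rule eq_matI) (auto simp: scalar_prod_def)
    then have "Bz 0 (Suc m) * mat_adjoint (Bz 0 (Suc m)) = 1\<^sub>m (Suc m) * mat_adjoint (1\<^sub>m (Suc m))"
      using rec_P_corner(3)[OF pd_corner[OF pf]] by simp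
    then have "Bz 0 (Suc m) = 1\<^sub>m (Suc m)"
      by (rule pos_upper_unique[OF Bz_pos[OF pd_corner[OF pf]] one_pos_upper])
    then show ?thesis using gG_eq(3)[OF pf] by simp
  qed
  have G1: "zlead 0 m (Pcol L 0 (Suc m)) * Ush1 (Suc m) * minv (zlead 0 (Suc m) ?P) = gG1 0 (Suc m)"
    using nonsing_solve_right[OF ZL_nonsing[OF pf] _ gG1_lead[OF pf]] by (simp add: lead_eq)
  have I: "gI 0 (Suc m) = bvec (Suc m + 1) 1"
  proof (rule eq_matI)
    fix i j assume ij: "i < dim_row (bvec (Suc m + 1) 1)" "j < dim_col (bvec (Suc m + 1) 1)"
    then show "gI 0 (Suc m) $$ (i, j) = bvec (Suc m + 1) 1 $$ (i, j)"
      using gI_col[OF pf, of i] by (simp add: bvec_index)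
  qed (auto simp: One_nat_def)
  have I1: "(- cnj x) \<cdot>\<^sub>m bvec (Suc m + 1) 1 + a \<cdot>\<^sub>m (transpose_mat (Ush (Suc m)) * gI1 0 m) = gI1 0 (Suc m)"
  proof -
    have nA: "nonsing (Suc 0) (mcnj (gtA 0 m))" by (rule nonsing_conj_trans(3)[OF gtA_nonsing[OF pf]])
    have sc: "mcnj (scalar_mat1 a) = scalar_mat1 a" "transpose_mat (scalar_mat1 a) = scalar_mat1 a"
      "mat_adjoint (scalar_mat1 x) = scalar_mat1 (cnj x)"
      using a by (auto intro!: eq_matI simp: scalar_mat1_def)
    have mult: "scalar_mat1 c * Y = c \<cdot>\<^sub>m Y" if "dim_row Y = Suc 0" for c Y
      using that by (intro scalar_mat1_mult(1)) (simp add: One_nat_def)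
    have eq: "a \<cdot>\<^sub>m transpose_mat (gI1 0 (Suc m)) = - (a \<cdot>\<^sub>m (cnj x \<cdot>\<^sub>m mat_adjoint (gI 0 (Suc m))))
        + a \<cdot>\<^sub>m (a \<cdot>\<^sub>m (transpose_mat (gI1 0 m) * Ush (Suc m)))"
      using gI1_rec_w[OF pf] unfolding E A sc G
      by (simp add: mult mult_assoc_dim smult_mult_dim)
    have tr: "transpose_mat (gI1 0 m) * Ush (Suc m) = transpose_mat (transpose_mat (Ush (Suc m)) * gI1 0 m)"
      by (simp add: transpose_mult_dim)
    have real: "mat_adjoint (gI 0 (Suc m)) = transpose_mat (bvec (Suc m + 1) 1)"
      unfolding I by (rule eq_matI) (auto simp: bvec_index)
    show ?thesis
    proof (rule eq_matI)
      fix i j assume ij: "i < dim_row (gI1 0 (Suc m))" "j < dim_col (gI1 0 (Suc m))"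
      have "a * gI1 0 (Suc m) $$ (i, j) =
          a * (- (cnj x * bvec (Suc m + 1) 1 $$ (i, j)) + a * (transpose_mat (Ush (Suc m)) * gI1 0 m) $$ (i, j))"
        using arg_cong[OF eq[unfolded tr real], of "\<lambda>X. X $$ (j, i)"] ij
        by (simp add: algebra_simps One_nat_def del: index_mult_mat(1))
      then show "((- cnj x) \<cdot>\<^sub>m bvec (Suc m + 1) 1 + a \<cdot>\<^sub>m (transpose_mat (Ush (Suc m)) * gI1 0 m)) $$ (i, j) =
          gI1 0 (Suc m) $$ (i, j)"
        using a ij by (simp add: One_nat_def del: index_mult_mat(1))
    qed (simp_all add: One_nat_def)
  qed
  have empties: "0\<^sub>m (Suc m) 0 = gK 0 (Suc m)" "0\<^sub>m (Suc m) 0 = gK1 0 (Suc m)"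
    "0\<^sub>m 0 1 = gtG 0 (Suc m)" "0\<^sub>m 0 1 = gtG1 0 (Suc m)"
    by (rule eq_dim_0; simp add: One_nat_def)+
  show ?thesis
    unfolding level_w_def Let_def diff_Suc_1 ux a_def[symmetric] Dm[OF order_refl] F tF D' G1 I1
    by (simp add: canon_def E A I G empties[symmetric])
qed

end

subsection \<open>One level of the recursion\<close>

text \<open>The share of one level in the conditions, to be matched with positivity on the box of
  that level.\<close>

definition level_cond :: "params \<Rightarrow> nat \<Rightarrow> nat \<Rightarrow> bool" where
  "level_cond u i j \<longleftrightarrow> (i = 0 \<and> j = 0 \<longrightarrow> 0 < u 0 0) \<and>
     (0 < i \<and> j = 0 \<longrightarrow> cmod (EE (lev u i 0) $$ (0, 0)) < 1) \<and>
     (i = 0 \<and> 0 < j \<longrightarrow> cmod (tEE (lev u 0 j) $$ (0, 0)) < 1) \<and>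
     (0 < i \<and> 0 < j \<longrightarrow> op_norm (KK (lev u i j)) < 1 \<and> H3_entry j (HH3 (lev u i j)) < 1)"

lemma star_conditions_cond: "star_conditions n m u \<longleftrightarrow> (\<forall>i\<le>n. \<forall>j\<le>m. level_cond u i j)"
  unfolding star_conditions_def level_cond_def by (auto simp: Ball_def Suc_le_eq One_nat_def)

definition has_params :: "(laurent \<Rightarrow> complex) \<Rightarrow> params \<Rightarrow> nat \<Rightarrow> nat \<Rightarrow> bool" where
  "has_params L u i j \<longleftrightarrow> u (int i) (int j) = par_pos L i j \<and> (0 < i \<and> 0 < j \<longrightarrow> u (- int i) (int j) = par_neg L i j)"

context mfun
begin

text \<open>The equivalence is read off before the box of the level is known to be positive:
  \<open>K\<close> and \<open>K1\<close> are identified from the two lower boxes, and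
  \<open>H3\<close> only once the norm condition has given positivity off the corner. Full
  positivity then identifies the remaining data.\<close>

lemma level_step:
  assumes lower: "\<And>a b. a \<le> i \<Longrightarrow> b \<le> j \<Longrightarrow> (a, b) \<noteq> (i, j) \<Longrightarrow> canon a b (lev u a b) \<and> pd (Vbox (Suc a) (Suc b))"
    and p: "has_params L u i j"
  shows "level_cond u i j \<longleftrightarrow> pd (Vbox (Suc i) (Suc j))" "pd (Vbox (Suc i) (Suc j)) \<Longrightarrow> canon i j (lev u i j)"
proof -
  define D where "D a b = (if a \<le> i \<and> b \<le> j \<and> (a, b) \<noteq> (i, j) then lev u a b else undefined)" for a b
  have D: "canon a b (D a b)" if "a \<le> i" "b \<le> j" "(a, b) \<noteq> (i, j)" for a b
    using lower[OF that] that by (simp add: D_def)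
  have DE: "(\<lambda>a b. if a \<le> i \<and> b \<le> j \<and> (a, b) \<noteq> (i, j) then lev u a b else undefined) = D"
    by (intro ext) (simp only: D_def)
  have lev: "lev u i j = (if i = 0 \<and> j = 0 then level_origin u else if j = 0 then level_z u i D
      else if i = 0 then level_w u j D else level_inner u i j D)"
    by (subst lev.simps) (simp only: Let_def DE)
  have "(level_cond u i j \<longleftrightarrow> pd (Vbox (Suc i) (Suc j))) \<and> (pd (Vbox (Suc i) (Suc j)) \<longrightarrow> canon i j (lev u i j))"
  proof (cases i; cases j)
    assume ij: "i = 0" "j = 0"
    have "u 0 0 = L 1" using p ij by (simp add: has_params_def par_pos_def)
    then show ?thesis using ij lev origin_canon[of u] by (simp add: level_cond_def pd_origin_iff)
  next
    fix n assume ij: "i = Suc n" "j = 0"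
    have o: "pd (Vbox (Suc n) (Suc 0))" using lower[of n 0] ij by simp
    have u: "u (int (Suc n)) 0 = par_pos L (Suc n) 0" using p ij by (simp add: has_params_def)
    have l: "lev u (Suc n) 0 = level_z u (Suc n) D" using lev unfolding ij by simp
    have "level_cond u i j \<longleftrightarrow> cmod (gE n 0 $$ (0, 0)) < 1"
      using ij u by (simp add: level_cond_def l level_z_def Let_def par_pos_gE scalar_mat1_def del: of_nat_Suc)
    moreover have "canon i j (lev u i j)" if pf: "pd (Vbox (Suc (Suc n)) (Suc 0))"
      unfolding ij l by (rule z_canon[where u = u and D = D, OF pf _ u]) (use D ij in auto)
    ultimately show ?thesis using pd_z_iff[OF o] ij by simp
  next
    fix m assume ij: "i = 0" "j = Suc m"
    have o: "pd (Vbox (Suc 0) (Suc m))" using lower[of 0 m] ij by simp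
    have u: "u 0 (int (Suc m)) = par_pos L 0 (Suc m)" using p ij by (simp add: has_params_def)
    have l: "lev u 0 (Suc m) = level_w u (Suc m) D" using lev unfolding ij by simp
    have "level_cond u i j \<longleftrightarrow> cmod (gtE 0 m $$ (0, 0)) < 1"
      using ij u by (simp add: level_cond_def l level_w_def Let_def par_pos_gtE scalar_mat1_def del: of_nat_Suc)
    moreover have "canon i j (lev u i j)" if pf: "pd (Vbox (Suc 0) (Suc (Suc m)))"
      unfolding ij l by (rule w_canon[where u = u and D = D, OF pf _ u]) (use D ij in auto)
    ultimately show ?thesis using pd_w_iff[OF o] ij by simp
  next
    fix n m assume ij: "i = Suc n" "j = Suc m"
    have oz: "pd (Vbox (Suc (Suc n)) (Suc m))" and ow: "pd (Vbox (Suc n) (Suc (Suc m)))"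
      using lower[of "Suc n" m] lower[of n "Suc m"] ij by simp_all
    have u: "u (- int (Suc n)) (int (Suc m)) = par_neg L (Suc n) (Suc m)"
      "u (int (Suc n)) (int (Suc m)) = par_pos L (Suc n) (Suc m)" using p ij by (simp_all add: has_params_def)
    have DD: "\<And>a b. a \<le> Suc n \<Longrightarrow> b \<le> Suc m \<Longrightarrow> (a, b) \<noteq> (Suc n, Suc m) \<Longrightarrow> canon a b (D a b)"
      using D ij by simp
    have K: "step_K u (Suc n) (Suc m) D = gK (Suc n) (Suc m)"
      by (rule step_K_canon[where u = u, OF oz ow DD]) (use u in auto)
    have K1: "step_K1 u (Suc n) (Suc m) D = gK1 (Suc n) (Suc m)"
      by (rule step_K1_canon[where u = u, OF oz ow DD]) (use u in auto)
    have l: "lev u (Suc n) (Suc m) = level_inner u (Suc n) (Suc m) D" using lev unfolding ij by simp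
    have "KK (lev u i j) = gK (Suc n) (Suc m)" unfolding ij l level_inner_def Let_def K by simp
    then have c1: "op_norm (KK (lev u i j)) < 1 \<longleftrightarrow> pd (mono_span (corner (Suc n) (Suc m)))"
      using pd_corner_iff[OF oz ow] by simp
    have c2: "H3_entry j (HH3 (lev u i j)) < 1 \<longleftrightarrow> pd (Vbox (Suc (Suc n)) (Suc (Suc m)))"
      if c: "pd (mono_span (corner (Suc n) (Suc m)))"
    proof -
      have "H3_entry j (HH3 (lev u i j)) = (gK1 (Suc n) (Suc m) * mat_adjoint (gK1 (Suc n) (Suc m))
          + G1U (Suc n) (Suc m) * mat_adjoint (G1U (Suc n) (Suc m))) $$ (0, 0)"
        unfolding ij l level_inner_def Let_def K K1 using H3_canon[OF c DD]
        by (simp del: index_add_mat(1) index_mult_mat(1))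
      then show ?thesis using pd_full_iff[OF c] by (simp del: index_add_mat(1) index_mult_mat(1))
    qed
    have "canon i j (lev u i j)" if pf: "pd (Vbox (Suc (Suc n)) (Suc (Suc m)))"
      unfolding ij l by (rule level_inner_canon[where u = u, OF pf DD]) (use u in auto)
    then show ?thesis using ij c1 c2 pd_corner by (auto simp: level_cond_def)
  qed
  then show "level_cond u i j \<longleftrightarrow> pd (Vbox (Suc i) (Suc j))" "pd (Vbox (Suc i) (Suc j)) \<Longrightarrow> canon i j (lev u i j)"
    by blast+
qed

lemma canon_all:
  assumes "pd (Vbox (Suc i) (Suc j))" "\<And>a b. a \<le> i \<Longrightarrow> b \<le> j \<Longrightarrow> has_params L u a b"
  shows "canon i j (lev u i j)"
  using assms
proof (induction "i + j" arbitrary: i j rule: less_induct)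
  case less
  have "canon a b (lev u a b) \<and> pd (Vbox (Suc a) (Suc b))" if ab: "a \<le> i" "b \<le> j" "(a, b) \<noteq> (i, j)" for a b
  proof -
    have "pd (Vbox (Suc a) (Suc b))" by (rule ok_mono[OF less.prems(1)]) (use ab in auto)
    moreover have "a + b < i + j" using ab by auto
    ultimately show ?thesis using less.hyps[of a b] less.prems(2) ab by (meson order_trans)
  qed
  then show ?case using level_step(2)[of i j u] less.prems by blast
qed

end

subsection \<open>Moments\<close>

text \<open>Any family of moments gives a functional on all Laurent polynomials, so single moments
  can be altered freely.\<close>

definition mfunctional :: "(int \<times> int \<Rightarrow> complex) \<Rightarrow> laurent \<Rightarrow> complex" where
  "mfunctional c p = (\<Sum>k\<in>Poly_Mapping.keys p. lcoeff p k * c k)"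

lemma mfunctional_superset:
  "finite S \<Longrightarrow> Poly_Mapping.keys p \<subseteq> S \<Longrightarrow> mfunctional c p = (\<Sum>k\<in>S. lcoeff p k * c k)"
  unfolding mfunctional_def by (rule sum.mono_neutral_left) (auto simp: in_keys_iff)

lemma mfunctional_mono [simp]: "mfunctional c (zw i j) = c (i, j)"
  by (simp add: mfunctional_def zw_def)

lemma mfunctional_herm:
  assumes "\<And>k. c (- k) = cnj (c k)"
  shows "mfun (mfunctional c)"
proof (unfold_locales)
  show "mfunctional c (p + q) = mfunctional c p + mfunctional c q" for p q
  proof -
    let ?S = "Poly_Mapping.keys p \<union> Poly_Mapping.keys q"
    have "Poly_Mapping.keys (p + q) \<subseteq> ?S" by (rule keys_add)
    then show ?thesis
      by (simp add: mfunctional_superset[of ?S] lookup_add distrib_right sum.distrib)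
  qed
  show "mfunctional c (cst a * p) = a * mfunctional c p" for a p
  proof -
    have "Poly_Mapping.keys (cst a * p) \<subseteq> Poly_Mapping.keys p" by (auto simp: in_keys_iff)
    then show ?thesis
      by (simp add: mfunctional_superset[of "Poly_Mapping.keys p"] sum_distrib_left mult.assoc)
  qed
  show "mfunctional c (lstar p) = cnj (mfunctional c p)" for p
  proof -
    have k: "Poly_Mapping.keys (lstar p) = uminus ` Poly_Mapping.keys p"
    proof (rule Set.set_eqI)
      fix k
      have "k \<in> Poly_Mapping.keys (lstar p) \<longleftrightarrow> - k \<in> Poly_Mapping.keys p" by (simp add: in_keys_iff)
      also have "\<dots> \<longleftrightarrow> k \<in> uminus ` Poly_Mapping.keys p" by (metis image_iff minus_minus)
      finally show "k \<in> Poly_Mapping.keys (lstar p) \<longleftrightarrow> k \<in> uminus ` Poly_Mapping.keys p" .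
    qed
    show ?thesis unfolding mfunctional_def k
      by (subst sum.reindex) (auto simp: assms intro!: sum.cong)
  qed
qed

definition Pikeys :: "nat \<Rightarrow> nat \<Rightarrow> (int \<times> int) set" where
  "Pikeys n m = {(i, j). \<bar>i\<bar> \<le> int n \<and> \<bar>j\<bar> \<le> int m}"

lemma Pi_space_eq: "Pi_space n m = mono_span (Pikeys n m)"
  by (simp add: Pi_space_def Pikeys_def)

lemma hatPi_space_eq: "hatPi_space n m = Vbox (Suc n) (Suc m)"
proof -
  have "{(i, j). 0 \<le> i \<and> i \<le> int n \<and> 0 \<le> j \<and> j \<le> int m} = box (Suc n) (Suc m)" by (auto simp: box_def)
  then show ?thesis by (simp add: hatPi_space_def)
qed

lemma Vbox_mult_Pi:
  assumes "p \<in> Vbox (Suc n) (Suc m)" "q \<in> Vbox (Suc n) (Suc m)"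
  shows "p * lstar q \<in> Pi_space n m"
proof -
  have q: "p' * lstar q \<in> Pi_space n m" if p': "p' = zw i j" "(i, j) \<in> box (Suc n) (Suc m)" for p' i j
  proof -
    have "p' * lstar q = (\<Sum>(k, l)\<in>box (Suc n) (Suc m). cst (cnj (lcoeff q (k, l))) * zw (i - k) (j - l))"
    proof -
      have "zw i j * (cst d * zw (- k) (- l)) = cst d * zw (i - k) (j - l)" for d k l
        by (simp add: mult.left_commute[of "zw i j"] zw_mult)
      then show ?thesis
        unfolding p' by (subst mono_span_expand[OF _ assms(2)])
          (simp_all add: lstar_sum sum_distrib_left case_prod_unfold)
    qed
    also have "\<dots> \<in> Pi_space n m"
      unfolding Pi_space_eq case_prod_unfold using p'(2)
      by (intro lsubspace_sum lsubspaceD(3) lsubspace_mono_span zw_mono_span) (auto simp: box_def Pikeys_def)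
    finally show ?thesis .
  qed
  have "p * lstar q = (\<Sum>(i, j)\<in>box (Suc n) (Suc m). cst (lcoeff p (i, j)) * (zw i j * lstar q))"
    by (subst mono_span_expand[OF _ assms(1)]) (simp_all add: sum_distrib_right case_prod_unfold mult.assoc)
  also have "\<dots> \<in> Pi_space n m"
    using q unfolding Pi_space_eq case_prod_unfold
    by (intro lsubspace_sum lsubspaceD(3) lsubspace_mono_span) auto
  finally show ?thesis .
qed

section \<open>Dependence of the parameters on the moments\<close>

definition agree :: "nat \<Rightarrow> nat \<Rightarrow> (laurent \<Rightarrow> complex) \<Rightarrow> (laurent \<Rightarrow> complex) \<Rightarrow> bool" where
  "agree n m L L' \<longleftrightarrow> (\<forall>p\<in>Pi_space n m. L p = L' p)"

lemma agree_mono: "agree n m L L' \<Longrightarrow> i \<le> n \<Longrightarrow> j \<le> m \<Longrightarrow> agree i j L L'"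
  unfolding agree_def Pi_space_eq
  using mono_span_mono[of "Pikeys i j" "Pikeys n m"] by (fastforce simp: Pikeys_def)

lemma agree_mult: "agree n m L L' \<Longrightarrow> p \<in> Vbox (Suc n) (Suc m) \<Longrightarrow> q \<in> Vbox (Suc n) (Suc m) \<Longrightarrow>
    L (p * lstar q) = L' (p * lstar q)"
  using Vbox_mult_Pi unfolding agree_def by blast

text \<open>The definite description evaluates the functional only at products of two polynomials
  from the box.\<close>

lemma onpoly_agree:
  assumes "agree n m L L'" "A \<subseteq> box (Suc n) (Suc m)"
  shows "onpoly L A k = onpoly L' A k"
proof -
  have "(p \<in> mono_span A \<and> L (p * lstar p) = 1 \<and> 0 < lcoeff p k \<and> (\<forall>(i, j)\<in>A - {k}. L (p * lstar (zw i j)) = 0)) \<longleftrightarrow>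
      (p \<in> mono_span A \<and> L' (p * lstar p) = 1 \<and> 0 < lcoeff p k \<and> (\<forall>(i, j)\<in>A - {k}. L' (p * lstar (zw i j)) = 0))" for p
  proof (cases "p \<in> mono_span A")
    case True
    then have p: "p \<in> Vbox (Suc n) (Suc m)" using mono_span_mono[OF assms(2)] by blast
    have "L (p * lstar (zw i j)) = L' (p * lstar (zw i j))" if "(i, j) \<in> A" for i j
      using agree_mult[OF assms(1) p zw_mono_span] that assms(2) by blast
    then show ?thesis using agree_mult[OF assms(1) p p] by (auto simp: Ball_def simp del: lstar_zw)
  qed simp
  then show ?thesis unfolding onpoly_def by simp
qed

lemma Pcol_agree: "agree n m L L' \<Longrightarrow> i \<le> n \<Longrightarrow> k \<le> Suc m \<Longrightarrow> Pcol L i k = Pcol L' i k"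
  and Qcol_agree: "agree n m L L' \<Longrightarrow> k' \<le> Suc n \<Longrightarrow> j \<le> m \<Longrightarrow> Qcol L k' j = Qcol L' k' j"
proof -
  have dr: "set (drop r ks) \<subseteq> set ks" for r and ks :: "(int \<times> int) list" by (rule set_drop_subset)
  show "Pcol L i k = Pcol L' i k" if a: "agree n m L L'" "i \<le> n" "k \<le> Suc m"
  proof (rule eq_matI)
    fix r c assume "r < dim_row (Pcol L' i k)" "c < dim_col (Pcol L' i k)"
    moreover have "box i k \<union> set (drop r (zkeys i k)) \<subseteq> box (Suc n) (Suc m)" for r
      using dr[of r "zkeys i k"] keys_box(1)[of i k] box_mono[of "Suc i" "Suc n" k "Suc m"] a by blast
    ultimately show "Pcol L i k $$ (r, c) = Pcol L' i k $$ (r, c)"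
      by (simp add: Pcol_def gscol_index onpoly_agree[OF a(1)])
  qed auto
  show "Qcol L k' j = Qcol L' k' j" if a: "agree n m L L'" "k' \<le> Suc n" "j \<le> m"
  proof (rule eq_matI)
    fix r c assume "r < dim_row (Qcol L' k' j)" "c < dim_col (Qcol L' k' j)"
    moreover have "box k' j \<union> set (drop r (wkeys k' j)) \<subseteq> box (Suc n) (Suc m)" for r
      using dr[of r "wkeys k' j"] keys_box(2)[of k' j] box_mono[of k' "Suc n" "Suc j" "Suc m"] a by blast
    ultimately show "Qcol L k' j $$ (r, c) = Qcol L' k' j $$ (r, c)"
      by (simp add: Qcol_def gscol_index onpoly_agree[OF a(1)])
  qed auto
qed

lemma lprod_agree:
  assumes "agree n m L L'" "col_in X (Vbox (Suc n) (Suc m))" "col_in Y (Vbox (Suc n) (Suc m))"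
  shows "lprod L X Y = lprod L' X Y"
  using assms agree_mult[OF assms(1)] by (auto intro!: eq_matI simp: col_in_def lprod_index)

text \<open>Only the moments with exponents of absolute values \<open>i\<close> and
  \<open>j\<close>, which no lower level contains, remain free.\<close>

definition lower_agree :: "nat \<Rightarrow> nat \<Rightarrow> (laurent \<Rightarrow> complex) \<Rightarrow> (laurent \<Rightarrow> complex) \<Rightarrow> bool" where
  "lower_agree i j L L' \<longleftrightarrow> (\<forall>a\<le>i. \<forall>b\<le>j. (a, b) \<noteq> (i, j) \<longrightarrow> agree a b L L')"

lemma lower_agreeD: "lower_agree i j L L' \<Longrightarrow> a \<le> i \<Longrightarrow> b \<le> j \<Longrightarrow> (a, b) \<noteq> (i, j) \<Longrightarrow> agree a b L L'"
  by (simp add: lower_agree_def)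

lemma agree_lower: "agree i j L L' \<Longrightarrow> lower_agree i j L L'"
  using agree_mono by (auto simp: lower_agree_def)

text \<open>\<open>f\<close> accounts for the conjugation in the definition of the parameter at
  inner levels. The corner coefficient of \<open>p\<close> and the constant term of \<open>q\<close>
  produce the slope; the missing corner of \<open>q\<close> keeps the moment at
  \<open>(-i, -j)\<close> out of the formula.\<close>

definition pos_rep :: "(laurent \<Rightarrow> complex) \<Rightarrow> nat \<Rightarrow> nat \<Rightarrow> laurent \<Rightarrow> laurent \<Rightarrow> (complex \<Rightarrow> complex) \<Rightarrow> bool" where
  "pos_rep L i j p q f \<longleftrightarrow> p \<in> Vbox (Suc i) (Suc j) \<and> q \<in> Vbox (Suc i) (Suc j) \<and>
    lcoeff p (int i, int j) \<noteq> 0 \<and> lcoeff q (0, 0) \<noteq> 0 \<and> lcoeff q (int i, int j) = 0 \<and> (f = id \<or> f = cnj) \<and>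
    (\<forall>L'. lower_agree i j L L' \<longrightarrow> par_pos L' i j = f (L' (p * lstar q)))"

context mfun
begin

lemma pd_agree: "agree n m L L' \<Longrightarrow> pd (Vbox (Suc n) (Suc m)) \<Longrightarrow> herm.pd L' (Vbox (Suc n) (Suc m))" if "mfun L'"
proof -
  interpret L': mfun L' by (rule that)
  show "agree n m L L' \<Longrightarrow> pd (Vbox (Suc n) (Suc m)) \<Longrightarrow> L'.pd (Vbox (Suc n) (Suc m))"
    by (simp add: pd_def L'.pd_def agree_mult[symmetric])
qed

text \<open>Each parameter is a fixed sesquilinear expression in the moments, in which only one of the
  moments of the current level occurs. The polynomials \<open>p\<close> and \<open>q\<close> only depend on the lower moments.\<close>

lemma par_neg_form:
  assumes oz: "pd (Vbox (Suc (Suc n)) (Suc m))" and ow: "pd (Vbox (Suc n) (Suc (Suc m)))"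
  shows "\<exists>p q. p \<in> Vbox (Suc (Suc n)) (Suc m) \<and> q \<in> Vbox (Suc n) (Suc (Suc m)) \<and>
    lcoeff p (int (Suc n), 0) \<noteq> 0 \<and> lcoeff q (0, int (Suc m)) \<noteq> 0 \<and>
    (\<forall>L'. mfun L' \<and> lower_agree (Suc n) (Suc m) L L' \<longrightarrow> par_neg L' (Suc n) (Suc m) = L' (p * lstar q))"
proof -
  let ?P = "Pcol L (Suc n) (Suc m)" and ?Q = "Qcol L (Suc n) (Suc m)"
  have PQ: "Pcol L' (Suc n) (Suc m) = ?P" "Qcol L' (Suc n) (Suc m) = ?Q"
    if "lower_agree (Suc n) (Suc m) L L'" for L'
    using Pcol_agree[OF lower_agreeD[OF that, of "Suc n" m], of "Suc n" "Suc m"]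
      Qcol_agree[OF lower_agreeD[OF that, of n "Suc m"], of "Suc n" "Suc m"] by simp_all
  note P = P_facts(1)[OF oz] and Q = Q_facts(1)[OF ow]
  show ?thesis
  proof (cases "n = 0 \<and> m = 0")
    case True
    have "0 < lcoeff (?P $$ (0, 0)) (int (Suc n), 0)" "0 < lcoeff (?Q $$ (0, 0)) (0, int (Suc m))"
      using P_row_mem(2)[OF oz, of 0] Q_row_mem(2)[OF ow, of 0] True by simp_all
    then have "lcoeff (?P $$ (0, 0)) (int (Suc n), 0) \<noteq> 0" "lcoeff (?Q $$ (0, 0)) (0, int (Suc m)) \<noteq> 0"
      by (metis less_irrefl)+
    moreover have "par_neg L' (Suc n) (Suc m) = L' (?P $$ (0, 0) * lstar (?Q $$ (0, 0)))"
      if "lower_agree (Suc n) (Suc m) L L'" for L'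
      using PQ[OF that] True by (simp add: par_neg_def onPhi_eq lprod_index One_nat_def)
    moreover have "?P $$ (0, 0) \<in> Vbox (Suc (Suc n)) (Suc m)" "?Q $$ (0, 0) \<in> Vbox (Suc n) (Suc (Suc m))"
      using P Q by (simp_all add: col_in_def)
    ultimately show ?thesis by blast
  next
    case False
    then have F: "(Suc n = 1 \<and> Suc m = 1) = False" by (auto simp: One_nat_def)
    \<comment> \<open>Dividing by the leading coefficients beforehand turns the parameter into one
      inner product of two fixed polynomials.\<close>
    define Z where "Z = cmat (minv (ZL (Suc n) (Suc m))) * ?P"
    define W where "W = cmat (minv (WL (Suc n) (Suc m))) * ?Q"
    note nz = ZL_nonsing[OF oz] and nw = WL_nonsing[OF ow]
    have d: "dim_row Z = Suc m" "dim_col Z = 1" "dim_row W = Suc n" "dim_col W = 1"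
      using nz nw by (simp_all add: Z_def W_def)
    have Zin: "col_in Z (Vbox (Suc (Suc n)) (Suc m))" and Win: "col_in W (Vbox (Suc n) (Suc (Suc m)))"
      unfolding Z_def W_def using P Q nz nw by (auto intro!: col_in_cmat_mult lsubspace_mono_span)
    have cZ: "cfm (zkeys (Suc n) (Suc m)) Z = 1\<^sub>m (Suc m)" and cW: "cfm (wkeys (Suc n) (Suc m)) W = 1\<^sub>m (Suc n)"
      using minv_nonsing(3)[OF nz] minv_nonsing(3)[OF nw] nz nw by (simp_all add: Z_def W_def cfm_cmat_mult)
    have "lcoeff (Z $$ (m, 0)) (int (Suc n), 0) \<noteq> 0" "lcoeff (W $$ (n, 0)) (0, int (Suc m)) \<noteq> 0"
      using arg_cong[OF cZ, of "\<lambda>A. A $$ (m, m)"] arg_cong[OF cW, of "\<lambda>A. A $$ (n, n)"] d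
      by (simp_all add: cfm_index keys_nth)
    moreover have "Z $$ (m, 0) \<in> Vbox (Suc (Suc n)) (Suc m)" "W $$ (n, 0) \<in> Vbox (Suc n) (Suc (Suc m))"
      using Zin Win d by (simp_all add: col_in_def)
    moreover have "par_neg L' (Suc n) (Suc m) = L' (Z $$ (m, 0) * lstar (W $$ (n, 0)))"
      if L': "mfun L'" "lower_agree (Suc n) (Suc m) L L'" for L'
    proof -
      interpret L': mfun L' by (rule L'(1))
      note nw' = nonsing_conj_trans(1,2)[OF nw]
      have dw: "dim_row (minv (WL (Suc n) (Suc m))) = Suc n" "dim_col (minv (WL (Suc n) (Suc m))) = Suc n"
        using nw by simp_all
      let ?b = "transpose_mat (bvec (Suc m) (Suc m))" and ?c = "bvec (Suc n) (Suc n)"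
      have PQZW: "minv (ZL (Suc n) (Suc m)) * lprod L' ?P ?Q * minv (mat_adjoint (WL (Suc n) (Suc m))) = lprod L' Z W"
        unfolding Z_def W_def nw'(2) using nz dw
        by (simp add: L'.lprod_cmat_left L'.lprod_cmat_right mult_assoc_dim)
      have "par_neg L' (Suc n) (Suc m) = (?b * minv (ZL (Suc n) (Suc m)) * lprod L' ?P ?Q * minv (mat_adjoint (WL (Suc n) (Suc m))) * ?c) $$ (0, 0)"
        unfolding par_neg_def F if_False by (simp add: onPhi_eq lead_eq PQ[OF L'(2)])
      also have "?b * minv (ZL (Suc n) (Suc m)) * lprod L' ?P ?Q * minv (mat_adjoint (WL (Suc n) (Suc m))) * ?c =
          ?b * (lprod L' Z W * ?c)"
        unfolding PQZW[symmetric] nw'(2) using nz dw by (simp add: mult_assoc_dim)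
      also have "\<dots> $$ (0, 0) = lprod L' Z W $$ (m, n)"
        using d by (simp add: bvec_row_index bvec_col_index del: index_mult_mat(1))
      finally show ?thesis using d by (simp add: lprod_index)
    qed
    ultimately show ?thesis by blast
  qed
qed

lemma par_pos_rep_inner:
  assumes oz: "pd (Vbox (Suc (Suc n)) (Suc m))" and ow: "pd (Vbox (Suc n) (Suc (Suc m)))"
  shows "\<exists>p q. pos_rep L (Suc n) (Suc m) p q cnj"
proof -
  let ?P = "Pcol L (Suc n) (Suc m)" and ?Q = "Qcol L (Suc n) (Suc m)"
  have zw01: "zw 0 1 = zwn 0 1" by (simp add: zwn_def)
  define p q where "p = zwn 0 1 * ?P $$ (0, 0)" and "q = zwn n (Suc m) * lstar (?Q $$ (0, 0))"
  have P: "?P $$ (0, 0) \<in> Vbox (Suc (Suc n)) (Suc m)" and Q: "?Q $$ (0, 0) \<in> Vbox (Suc n) (Suc (Suc m))"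
    using P_facts(1)[OF oz] Q_facts(1)[OF ow] by (simp_all add: col_in_def)
  have l0: "0 < lcoeff (?P $$ (0, 0)) (int (Suc n), int m)" "0 < lcoeff (?Q $$ (0, 0)) (int n, int (Suc m))"
    using P_row_mem(2)[OF oz, of 0] Q_row_mem(2)[OF ow, of 0] by simp_all
  have l1: "lcoeff p (int (Suc n), int (Suc m)) = lcoeff (?P $$ (0, 0)) (int (Suc n), int m)"
    "lcoeff q (0, 0) = cnj (lcoeff (?Q $$ (0, 0)) (int n, int (Suc m)))"
    by (simp_all add: p_def q_def zwn_def add.commute)
  have pq: "lcoeff p (int (Suc n), int (Suc m)) \<noteq> 0" "lcoeff q (0, 0) \<noteq> 0"
    unfolding l1 using l0 by (auto simp: less_complex_def)
  have p: "p \<in> Vbox (Suc (Suc n)) (Suc (Suc m))"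
    using V_shift[OF P, of 0 1] by (simp add: p_def One_nat_def)
  have q: "q \<in> Vbox (Suc n) (Suc (Suc m))" unfolding q_def by (rule V_rev[OF Q])
  have q': "q \<in> Vbox (Suc (Suc n)) (Suc (Suc m))"
    by (rule subsetD[OF mono_span_mono[OF box_mono] q]) simp_all
  have q0: "lcoeff q (int (Suc n), int (Suc m)) = 0"
    by (rule q[unfolded mono_span_iff, rule_format]) (simp add: box_def)
  have "par_pos L' (Suc n) (Suc m) = cnj (L' (p * lstar q))" if l: "lower_agree (Suc n) (Suc m) L L'" for L'
  proof -
    have a: "agree (Suc n) m L L'" "agree n (Suc m) L L'"
      by (rule lower_agreeD[OF l]; simp)+
    have "Pcol L' (Suc n) (Suc m) = ?P" "Qcol L' (Suc n) (Suc m) = ?Q"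
      by (simp_all add: Pcol_agree[OF a(1), of "Suc n" "Suc m"] Qcol_agree[OF a(2), of "Suc n" "Suc m"])
    then have "par_pos L' (Suc n) (Suc m) = cnj (lprod L' (zwn 0 1 \<cdot>\<^sub>m ?P) (R n (Suc m) ?Q) $$ (0, 0))"
      unfolding par_pos_def by (simp add: onPhi_eq transpose_rev_poly[folded zwn_def] zw01 del: of_nat_Suc)
    then show ?thesis unfolding p_def q_def by (simp add: lprod_index del: of_nat_Suc lstar_mult)
  qed
  then have "pos_rep L (Suc n) (Suc m) p q cnj"
    unfolding pos_rep_def using p q' pq q0 by blast
  then show ?thesis by blast
qed

lemma par_pos_rep_z:
  assumes o: "pd (Vbox (Suc n) (Suc 0))"
  shows "\<exists>p q. pos_rep L (Suc n) 0 p q id"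
proof -
  let ?P = "Pcol L n (Suc 0)"
  define p q where "p = zwn 1 0 * ?P $$ (0, 0)" and "q = zwn n 0 * lstar (?P $$ (0, 0))"
  have P: "?P $$ (0, 0) \<in> Vbox (Suc n) (Suc 0)" using P_facts(1)[OF o] by (simp add: col_in_def)
  have l0: "0 < lcoeff (?P $$ (0, 0)) (int n, 0)" using P_row_mem(2)[OF o, of 0] by simp
  have l1: "lcoeff p (int (Suc n), int 0) = lcoeff (?P $$ (0, 0)) (int n, 0)"
    "lcoeff q (0, 0) = cnj (lcoeff (?P $$ (0, 0)) (int n, 0))"
    by (simp_all add: p_def q_def zwn_def)
  have pq: "lcoeff p (int (Suc n), int 0) \<noteq> 0" "lcoeff q (0, 0) \<noteq> 0"
    unfolding l1 using l0 by (auto simp: less_complex_def)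
  have p: "p \<in> Vbox (Suc (Suc n)) (Suc 0)"
    using V_shift[OF P, of 1 0] by (simp add: p_def One_nat_def)
  have q: "q \<in> Vbox (Suc n) (Suc 0)" unfolding q_def by (rule V_rev[OF P])
  have q': "q \<in> Vbox (Suc (Suc n)) (Suc 0)"
    by (rule subsetD[OF mono_span_mono[OF box_mono] q]) simp_all
  have q0: "lcoeff q (int (Suc n), int 0) = 0"
    by (rule q[unfolded mono_span_iff, rule_format]) (simp add: box_def)
  have "par_pos L' (Suc n) 0 = id (L' (p * lstar q))" if l: "lower_agree (Suc n) 0 L L'" for L'
  proof -
    have a: "agree n 0 L L'" by (rule lower_agreeD[OF l]) simp_all
    have "Pcol L' n (Suc 0) = ?P" by (simp add: Pcol_agree[OF a, of n "Suc 0"])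
    then have "par_pos L' (Suc n) 0 = lprod L' (zwn 1 0 \<cdot>\<^sub>m ?P) (R n 0 ?P) $$ (0, 0)"
      by (simp add: par_pos_def onPhi_eq rev_poly_1_1 zwn_def)
    then show ?thesis unfolding p_def q_def by (simp add: lprod_index del: of_nat_Suc lstar_mult)
  qed
  then have "pos_rep L (Suc n) 0 p q id"
    unfolding pos_rep_def using p q' pq q0 by blast
  then show ?thesis by blast
qed

lemma par_pos_rep_w:
  assumes o: "pd (Vbox (Suc 0) (Suc m))"
  shows "\<exists>p q. pos_rep L 0 (Suc m) p q id"
proof -
  let ?Q = "Qcol L (Suc 0) m"
  define p q where "p = zwn 0 1 * ?Q $$ (0, 0)" and "q = zwn 0 m * lstar (?Q $$ (0, 0))"
  have Q: "?Q $$ (0, 0) \<in> Vbox (Suc 0) (Suc m)" using Q_facts(1)[OF o] by (simp add: col_in_def)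
  have l0: "0 < lcoeff (?Q $$ (0, 0)) (0, int m)" using Q_row_mem(2)[OF o, of 0] by simp
  have l1: "lcoeff p (int 0, int (Suc m)) = lcoeff (?Q $$ (0, 0)) (0, int m)"
    "lcoeff q (0, 0) = cnj (lcoeff (?Q $$ (0, 0)) (0, int m))"
    by (simp_all add: p_def q_def zwn_def)
  have pq: "lcoeff p (int 0, int (Suc m)) \<noteq> 0" "lcoeff q (0, 0) \<noteq> 0"
    unfolding l1 using l0 by (auto simp: less_complex_def)
  have p: "p \<in> Vbox (Suc 0) (Suc (Suc m))"
    using V_shift[OF Q, of 0 1] by (simp add: p_def One_nat_def)
  have q: "q \<in> Vbox (Suc 0) (Suc m)" unfolding q_def by (rule V_rev[OF Q])
  have q': "q \<in> Vbox (Suc 0) (Suc (Suc m))"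
    by (rule subsetD[OF mono_span_mono[OF box_mono] q]) simp_all
  have q0: "lcoeff q (int 0, int (Suc m)) = 0"
    by (rule q[unfolded mono_span_iff, rule_format]) (simp add: box_def)
  have "par_pos L' 0 (Suc m) = id (L' (p * lstar q))" if l: "lower_agree 0 (Suc m) L L'" for L'
  proof -
    have a: "agree 0 m L L'" by (rule lower_agreeD[OF l]) simp_all
    have "Qcol L' (Suc 0) m = ?Q" by (simp add: Qcol_agree[OF a, of "Suc 0" m])
    then have "par_pos L' 0 (Suc m) = lprod L' (zwn 0 1 \<cdot>\<^sub>m ?Q) (R 0 m ?Q) $$ (0, 0)"
      by (simp add: par_pos_def onPhi_eq rev_poly_1_1 zwn_def)
    then show ?thesis unfolding p_def q_def by (simp add: lprod_index del: of_nat_Suc lstar_mult)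
  qed
  then have "pos_rep L 0 (Suc m) p q id"
    unfolding pos_rep_def using p q' pq q0 by blast
  then show ?thesis by blast
qed

lemma par_pos_rep:
  assumes lower: "\<And>a b. a \<le> i \<Longrightarrow> b \<le> j \<Longrightarrow> (a, b) \<noteq> (i, j) \<Longrightarrow> pd (Vbox (Suc a) (Suc b))"
    and ij: "(i, j) \<noteq> (0, 0)"
  shows "\<exists>p q f. pos_rep L i j p q f"
proof -
  consider (z) n where "i = Suc n" "j = 0" | (w) m where "i = 0" "j = Suc m" | (inner) n m where "i = Suc n" "j = Suc m"
    using ij by (cases i; cases j) auto
  then show ?thesis
  proof cases
    case z
    have "pd (Vbox (Suc n) (Suc 0))" by (rule lower) (simp_all add: z)
    then obtain p q where "pos_rep L (Suc n) 0 p q id" using par_pos_rep_z by blast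
    then show ?thesis unfolding z by (intro exI)
  next
    case w
    have "pd (Vbox (Suc 0) (Suc m))" by (rule lower) (simp_all add: w)
    then obtain p q where "pos_rep L 0 (Suc m) p q id" using par_pos_rep_w by blast
    then show ?thesis unfolding w by (intro exI)
  next
    case inner
    have "pd (Vbox (Suc (Suc n)) (Suc m))" "pd (Vbox (Suc n) (Suc (Suc m)))"
      by (rule lower; simp add: inner)+
    then obtain p q where "pos_rep L (Suc n) (Suc m) p q cnj" using par_pos_rep_inner by blast
    then show ?thesis unfolding inner by (intro exI)
  qed
qed

text \<open>The representation of the parameter by fixed polynomials is applied both to the
  functional itself and to the other one.\<close>

lemma par_agree:
  assumes pf: "pd (Vbox (Suc i) (Suc j))" and a: "agree i j L L'"
  shows "par_pos L' i j = par_pos L i j" "0 < i \<Longrightarrow> 0 < j \<Longrightarrow> par_neg L' i j = par_neg L i j"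
proof -
  have o: "pd (Vbox (Suc a) (Suc b))" if "a \<le> i" "b \<le> j" for a b
    by (rule ok_mono[OF pf]) (use that in auto)
  show "par_pos L' i j = par_pos L i j"
  proof (cases "(i, j) = (0, 0)")
    case True
    have "1 \<in> Vbox (Suc 0) (Suc 0)" using zw_mono_span[of 0 0 "box (Suc 0) (Suc 0)"] by (simp add: box_def)
    then have "L (1 * lstar 1) = L' (1 * lstar 1)"
      using True by (intro agree_mult[OF a]) simp_all
    then show ?thesis using True lstar_zw[of 0 0] by (simp add: par_pos_def)
  next
    case False
    have "\<exists>p q f. pos_rep L i j p q f" by (rule par_pos_rep[OF _ False]) (rule o)
    then obtain p q f where "pos_rep L i j p q f" by (elim exE)
    then have *: "p \<in> Vbox (Suc i) (Suc j)" "q \<in> Vbox (Suc i) (Suc j)"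
      and eq: "lower_agree i j L L' \<Longrightarrow> par_pos L' i j = f (L' (p * lstar q))" for L'
      by (simp_all add: pos_rep_def)
    have "lower_agree i j L L" by (simp add: lower_agree_def agree_def)
    from eq[OF this] eq[OF agree_lower[OF a]] show ?thesis by (simp only: agree_mult[OF a *])
  qed
  show "par_neg L' i j = par_neg L i j" if ij: "0 < i" "0 < j"
  proof -
    obtain n m where nm: "i = Suc n" "j = Suc m" using ij by (metis gr0_implies_Suc)
    have P: "col_in (Pcol L (Suc n) (Suc m)) (Vbox (Suc i) (Suc j))"
      by (rule col_in_mono[OF P_facts(1)[OF o[of "Suc n" m]] mono_span_mono[OF box_mono]]) (use nm in auto)
    have Q: "col_in (Qcol L (Suc n) (Suc m)) (Vbox (Suc i) (Suc j))"
      by (rule col_in_mono[OF Q_facts(1)[OF o[of n "Suc m"]] mono_span_mono[OF box_mono]]) (use nm in auto)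
    have "Pcol L' (Suc n) (Suc m) = Pcol L (Suc n) (Suc m)" "Qcol L' (Suc n) (Suc m) = Qcol L (Suc n) (Suc m)"
      using Pcol_agree[OF a, of "Suc n" "Suc m"] Qcol_agree[OF a, of "Suc n" "Suc m"] nm by simp_all
    then show ?thesis
      using lprod_agree[OF a P Q] unfolding nm
      by (cases "n = 0 \<and> m = 0") (auto simp: par_neg_def onPhi_eq One_nat_def)
  qed
qed

end

section \<open>Choosing the moments\<close>

definition symm :: "(int \<times> int \<Rightarrow> complex) \<Rightarrow> bool" where
  "symm c \<longleftrightarrow> (\<forall>k. c (- k) = cnj (c k))"

lemma symm_mfun: "symm c \<Longrightarrow> mfun (mfunctional c)"
  by (rule mfunctional_herm) (simp add: symm_def)

lemma mfunctional_cong: "(\<And>k. lcoeff p k \<noteq> 0 \<Longrightarrow> c k = c' k) \<Longrightarrow> mfunctional c p = mfunctional c' p"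
  unfolding mfunctional_def by (rule sum.cong) (auto simp: in_keys_iff)

lemma agree_mfunctional: "(\<And>k. k \<in> Pikeys n m \<Longrightarrow> c k = c' k) \<Longrightarrow> agree n m (mfunctional c) (mfunctional c')"
  unfolding agree_def Pi_space_eq by (blast intro: mfunctional_cong dest: mono_span_iff[THEN iffD1])

text \<open>Changing the moment at \<open>k\<close> forces the conjugate change at
  \<open>-k\<close>. As \<open>r\<close> has no coefficient there, its value is affine in the one
  moment with slope \<open>lcoeff r k\<close>.\<close>

lemma choose_moment:
  assumes c: "symm c" and k: "k \<noteq> - k" and r: "lcoeff r k \<noteq> 0" "lcoeff r (- k) = 0"
  shows "\<exists>c'. symm c' \<and> (\<forall>l. l \<noteq> k \<longrightarrow> l \<noteq> - k \<longrightarrow> c' l = c l) \<and> mfunctional c' r = t"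
proof -
  define v where "v = c k + (t - mfunctional c r) / lcoeff r k"
  define c' where "c' = c(k := v, - k := cnj v)"
  have "symm c'" unfolding symm_def
  proof
    fix l
    have "(- l = k) = (l = - k)" "(- l = - k) = (l = k)" by (rule minus_equation_iff[THEN trans, OF eq_commute], rule neg_equal_iff_equal)
    then show "c' (- l) = cnj (c' l)" using c k by (simp add: c'_def symm_def)
  qed
  moreover have "mfunctional c' r = t"
  proof -
    have "mfunctional c' r - mfunctional c r = (\<Sum>l\<in>Poly_Mapping.keys r. lcoeff r l * (c' l - c l))"
      by (simp add: mfunctional_def sum_subtractf algebra_simps)
    also have "\<dots> = (\<Sum>l\<in>Poly_Mapping.keys r. if l = k then lcoeff r k * (v - c k) else 0)"
      using k r(2) by (intro sum.cong) (auto simp: c'_def in_keys_iff)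
    also have "\<dots> = lcoeff r k * (v - c k)" using r(1) by (simp add: in_keys_iff)
    also have "\<dots> = t - mfunctional c r" using r(1) by (simp add: v_def)
    finally show ?thesis by simp
  qed
  ultimately show ?thesis by (intro exI[of _ c']) (simp add: c'_def)
qed

lemma lcoeff_mult_lstar:
  assumes "finite B" "q \<in> mono_span B"
  shows "lcoeff (p * lstar q) k = (\<Sum>b\<in>B. lcoeff p (k + b) * cnj (lcoeff q b))"
proof -
  have c: "p * (cst d * zw a b) = cst d * (zw a b * p)" for d a b by (simp add: mult_ac)
  have "p * lstar q = (\<Sum>b\<in>B. cst (cnj (lcoeff q b)) * (zw (- fst b) (- snd b) * p))"
    by (subst mono_span_expand[OF assms]) (simp add: lstar_sum sum_distrib_left case_prod_unfold c)
  then show ?thesis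
    by (cases k) (simp add: lookup_sum plus_prod_def mult.commute[of "cnj d" for d])
qed

lemma lcoeff_unique:
  assumes "finite B" "q \<in> mono_span B" "b \<in> B" "\<And>b'. b' \<in> B \<Longrightarrow> b' \<noteq> b \<Longrightarrow> lcoeff p (k + b') * cnj (lcoeff q b') = 0"
  shows "lcoeff (p * lstar q) k = lcoeff p (k + b) * cnj (lcoeff q b)"
proof -
  have "lcoeff (p * lstar q) k = (\<Sum>b'\<in>B. if b' = b then lcoeff p (k + b) * cnj (lcoeff q b) else 0)"
    unfolding lcoeff_mult_lstar[OF assms(1,2)] using assms(4) by (intro sum.cong) auto
  then show ?thesis using assms(1,3) by simp
qed

text \<open>The exponents of the product range from \<open>-n\<close> to \<open>n + 1\<close> in
  \<open>z\<close> and from \<open>-(m + 1)\<close> to \<open>m\<close> in \<open>w\<close>. Of the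
  four extreme exponents only one lies in this range, and a single pair of monomials attains
  it.\<close>

lemma neg_coeffs:
  assumes p: "p \<in> Vbox (Suc (Suc n)) (Suc m)" and q: "q \<in> Vbox (Suc n) (Suc (Suc m))"
  shows "lcoeff (p * lstar q) (int (Suc n), - int (Suc m)) = lcoeff p (int (Suc n), 0) * cnj (lcoeff q (0, int (Suc m)))"
    "lcoeff (p * lstar q) (- int (Suc n), int (Suc m)) = 0"
    "lcoeff (p * lstar q) (int (Suc n), int (Suc m)) = 0"
    "lcoeff (p * lstar q) (- int (Suc n), - int (Suc m)) = 0"
proof -
  have p0: "lcoeff p (a, b) = 0" if "a < 0 \<or> int (Suc n) < a \<or> b < 0 \<or> int m < b" for a b
    using p that by (auto simp: mono_span_iff box_def)
  note L = lcoeff_mult_lstar[OF box_finite q]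
  show "lcoeff (p * lstar q) (int (Suc n), - int (Suc m)) = lcoeff p (int (Suc n), 0) * cnj (lcoeff q (0, int (Suc m)))"
    by (subst lcoeff_unique[OF box_finite q, of "(0, int (Suc m))"])
       (auto simp: box_def simp del: of_nat_Suc intro!: p0)
  show "lcoeff (p * lstar q) (- int (Suc n), int (Suc m)) = 0"
    "lcoeff (p * lstar q) (int (Suc n), int (Suc m)) = 0"
    "lcoeff (p * lstar q) (- int (Suc n), - int (Suc m)) = 0"
    unfolding L by (rule sum.neutral; auto simp: box_def intro!: p0)+
qed

text \<open>The exponent \<open>(i, j)\<close> arises only from the corner of \<open>p\<close> and
  the constant term of \<open>q\<close>, the opposite one only from the corner of \<open>q\<close>,
  which is absent.\<close>

lemma pos_coeffs:
  assumes p: "p \<in> Vbox (Suc i) (Suc j)" and q: "q \<in> Vbox (Suc i) (Suc j)" "lcoeff q (int i, int j) = 0"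
  shows "lcoeff (p * lstar q) (int i, int j) = lcoeff p (int i, int j) * cnj (lcoeff q (0, 0))"
    "lcoeff (p * lstar q) (- int i, - int j) = 0"
proof -
  have p0: "lcoeff p (a, b) = 0" if "a < 0 \<or> int i < a \<or> b < 0 \<or> int j < b" for a b
    using p that by (auto simp: mono_span_iff box_def)
  show "lcoeff (p * lstar q) (int i, int j) = lcoeff p (int i, int j) * cnj (lcoeff q (0, 0))"
    by (subst lcoeff_unique[OF box_finite q(1), of "(0, 0)"]) (auto simp: box_def intro!: p0)
  have "lcoeff p ((- int i, - int j) + b) * cnj (lcoeff q b) = 0" if bb: "b \<in> box (Suc i) (Suc j)" for b
  proof -
    obtain x y where b: "b = (x, y)" by (cases b)
    consider "x = int i" "y = int j" | "x - int i < 0 \<or> y - int j < 0"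
      using bb unfolding b box_def by fastforce
    then show ?thesis using q(2) p0[of "x - int i" "y - int j"] by cases (auto simp: b)
  qed
  then show "lcoeff (p * lstar q) (- int i, - int j) = 0"
    unfolding lcoeff_mult_lstar[OF box_finite q(1)] by simp
qed

text \<open>At an inner level the moment at \<open>(i, -j)\<close> is adjusted to the negative
  parameter and then the one at \<open>(i, j)\<close> to the positive parameter. The polynomials
  involved come from the lower levels, so nothing is presupposed about the new box.\<close>

lemma extend_moments:
  assumes c: "symm c" and u0: "0 < u 0 0"
    and lower: "\<And>a b. a \<le> i \<Longrightarrow> b \<le> j \<Longrightarrow> (a, b) \<noteq> (i, j) \<Longrightarrow> herm.pd (mfunctional c) (Vbox (Suc a) (Suc b))"
  shows "\<exists>c'. symm c' \<and> (\<forall>k. \<bar>fst k\<bar> \<noteq> int i \<or> \<bar>snd k\<bar> \<noteq> int j \<longrightarrow> c' k = c k) \<and> has_params (mfunctional c') u i j"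
proof (cases "(i, j) = (0, 0)")
  case True
  have "cnj (u 0 0) = u 0 0" using u0 by (simp add: less_complex_def complex_eq_iff)
  then have "symm (c((0, 0) := u 0 0))"
    using c unfolding symm_def by (auto simp: zero_prod_def)
  moreover have "mfunctional (c((0, 0) := u 0 0)) 1 = u 0 0"
    using mfunctional_mono[of "c((0, 0) := u 0 0)" 0 0] by simp
  ultimately show ?thesis
    using True by (intro exI[of _ "c((0, 0) := u 0 0)"]) (auto simp: has_params_def par_pos_def)
next
  case False
  interpret mfun "mfunctional c" by (rule symm_mfun[OF c])
  have "\<exists>p q f. pos_rep (mfunctional c) i j p q f" by (rule par_pos_rep[OF _ False]) (rule lower)
  then obtain p q f where "pos_rep (mfunctional c) i j p q f" by (elim exE)
  then have pq: "p \<in> Vbox (Suc i) (Suc j)" "q \<in> Vbox (Suc i) (Suc j)"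
    "lcoeff p (int i, int j) \<noteq> 0" "lcoeff q (0, 0) \<noteq> 0" "lcoeff q (int i, int j) = 0" "f = id \<or> f = cnj"
    and pp: "\<And>L'. lower_agree i j (mfunctional c) L' \<Longrightarrow> par_pos L' i j = f (L' (p * lstar q))"
    by (simp_all add: pos_rep_def)
  have la: "lower_agree i j (mfunctional c) (mfunctional c')"
    if "\<forall>k. \<bar>fst k\<bar> \<noteq> int i \<or> \<bar>snd k\<bar> \<noteq> int j \<longrightarrow> c' k = c k" for c'
    unfolding lower_agree_def using that by (auto intro!: agree_mfunctional simp: Pikeys_def)
  have pos: "\<exists>c''. symm c'' \<and> (\<forall>k. k \<noteq> (int i, int j) \<longrightarrow> k \<noteq> - (int i, int j) \<longrightarrow> c'' k = c' k) \<and>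
      mfunctional c'' (p * lstar q) = f (u (int i) (int j))" if "symm c'" for c'
  proof (rule choose_moment[OF that])
    show "(int i, int j) \<noteq> - (int i, int j)" using False by auto
    show "lcoeff (p * lstar q) (int i, int j) \<noteq> 0" "lcoeff (p * lstar q) (- (int i, int j)) = 0"
      using pos_coeffs[OF pq(1,2,5)] pq(3,4) by simp_all
  qed
  have ne: "k \<noteq> (int i, int j)" "k \<noteq> - (int i, int j)" "k \<noteq> (int i, - int j)" "k \<noteq> - (int i, - int j)"
    if "\<bar>fst k\<bar> \<noteq> int i \<or> \<bar>snd k\<bar> \<noteq> int j" for k using that by auto
  have ff: "f (f x) = x" for x using pq(6) by auto
  show ?thesis
  proof (cases "0 < i \<and> 0 < j")
    case F: False
    obtain c' where c': "symm c'" "\<forall>k. k \<noteq> (int i, int j) \<longrightarrow> k \<noteq> - (int i, int j) \<longrightarrow> c' k = c k"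
      "mfunctional c' (p * lstar q) = f (u (int i) (int j))" using pos[OF c] by blast
    have e: "\<forall>k. \<bar>fst k\<bar> \<noteq> int i \<or> \<bar>snd k\<bar> \<noteq> int j \<longrightarrow> c' k = c k" using c'(2) ne by blast
    have "has_params (mfunctional c') u i j" unfolding has_params_def pp[OF la[OF e]] c'(3) ff using F by auto
    then show ?thesis using c'(1) e by blast
  next
    case True
    then obtain n m where nm: "i = Suc n" "j = Suc m" by (metis gr0_implies_Suc)
    have oz: "pd (Vbox (Suc (Suc n)) (Suc m))" and ow: "pd (Vbox (Suc n) (Suc (Suc m)))"
      using lower[of "Suc n" m] lower[of n "Suc m"] nm by simp_all
    obtain p' q' where pq': "p' \<in> Vbox (Suc (Suc n)) (Suc m)" "q' \<in> Vbox (Suc n) (Suc (Suc m))"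
      "lcoeff p' (int (Suc n), 0) \<noteq> 0" "lcoeff q' (0, int (Suc m)) \<noteq> 0"
      and pn: "\<And>L'. mfun L' \<Longrightarrow> lower_agree i j (mfunctional c) L' \<Longrightarrow> par_neg L' i j = L' (p' * lstar q')"
      using par_neg_form[OF oz ow] unfolding nm by metis
    note nc = neg_coeffs[OF pq'(1,2), folded nm]
    have "\<exists>c'. symm c' \<and> (\<forall>k. k \<noteq> (int i, - int j) \<longrightarrow> k \<noteq> - (int i, - int j) \<longrightarrow> c' k = c k) \<and>
      mfunctional c' (p' * lstar q') = u (- int i) (int j)"
    proof (rule choose_moment[OF c])
      show "(int i, - int j) \<noteq> - (int i, - int j)" using True by auto
      show "lcoeff (p' * lstar q') (int i, - int j) \<noteq> 0" "lcoeff (p' * lstar q') (- (int i, - int j)) = 0"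
        using nc(1,2) pq'(3,4) unfolding nm by (simp_all del: of_nat_Suc)
    qed
    then obtain c1 where c1: "symm c1" "\<forall>k. k \<noteq> (int i, - int j) \<longrightarrow> k \<noteq> - (int i, - int j) \<longrightarrow> c1 k = c k"
      "mfunctional c1 (p' * lstar q') = u (- int i) (int j)" by blast
    obtain c' where c': "symm c'" "\<forall>k. k \<noteq> (int i, int j) \<longrightarrow> k \<noteq> - (int i, int j) \<longrightarrow> c' k = c1 k"
      "mfunctional c' (p * lstar q) = f (u (int i) (int j))" using pos[OF c1(1)] by blast
    have e: "\<forall>k. \<bar>fst k\<bar> \<noteq> int i \<or> \<bar>snd k\<bar> \<noteq> int j \<longrightarrow> c' k = c k" using c'(2) c1(2) ne by metis
    \<comment> \<open>The second adjustment does not disturb the first: this product has no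
      coefficients at \<open>(i, j)\<close> and \<open>(-i, -j)\<close>.\<close>
    have "mfunctional c' (p' * lstar q') = mfunctional c1 (p' * lstar q')"
      using c'(2) nc(3,4) by (intro mfunctional_cong) (metis uminus_Pair)
    then have "has_params (mfunctional c') u i j"
      unfolding has_params_def pp[OF la[OF e]] c'(3) ff pn[OF symm_mfun[OF c'(1)] la[OF e]] c1(3) by simp
    then show ?thesis using c'(1) e by blast
  qed
qed

text \<open>The levels are processed row by row, level \<open>(a, b)\<close> having number
  \<open>a * Suc m + b\<close>; all levels below a given one then come earlier, as
  \<open>extend_moments\<close> requires.\<close>

lemma moments_exist:
  assumes st: "star_conditions n m u"
  shows "\<exists>c. symm c \<and> (\<forall>a\<le>n. \<forall>b\<le>m. has_params (mfunctional c) u a b) \<and>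
    herm.pd (mfunctional c) (Vbox (Suc n) (Suc m))"
proof -
  have u0: "0 < u 0 0" using st by (simp add: star_conditions_def)
  define D where "D k = {(a, b). b \<le> m \<and> a * Suc m + b < k}" for k
  have "k \<le> Suc n * Suc m \<Longrightarrow> \<exists>c. symm c \<and> (\<forall>(a, b)\<in>D k. has_params (mfunctional c) u a b \<and>
    herm.pd (mfunctional c) (Vbox (Suc a) (Suc b)))" for k
  proof (induction k)
    case 0
    have "symm (\<lambda>_. 0)" by (simp add: symm_def)
    then show ?case by (auto simp: D_def)
  next
    case (Suc k)
    then obtain c where c: "symm c"
      "\<And>a b. (a, b) \<in> D k \<Longrightarrow> has_params (mfunctional c) u a b \<and> herm.pd (mfunctional c) (Vbox (Suc a) (Suc b))" by auto
    define i j where "i = k div Suc m" and "j = k mod Suc m"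
    have k: "k = i * Suc m + j" by (simp only: i_def j_def div_mult_mod_eq)
    have j: "j \<le> m" by (simp add: j_def less_Suc_eq_le[symmetric])
    have "i * Suc m < Suc n * Suc m" using Suc.prems k by linarith
    then have i: "i \<le> n" by (simp only: mult_less_cancel2) simp
    have D: "(a, b) \<in> D k \<longleftrightarrow> b \<le> m \<and> (a < i \<or> a = i \<and> b < j)" for a b
    proof (cases a i rule: linorder_cases)
      case less
      then have "Suc a * Suc m \<le> i * Suc m" by (intro mult_le_mono1) simp
      then show ?thesis using less by (auto simp: D_def k)
    next
      case greater
      then have "Suc i * Suc m \<le> a * Suc m" by (intro mult_le_mono1) simp
      then show ?thesis using greater j by (auto simp: D_def k)
    qed (auto simp: D_def k)
    have D': "(a, b) \<in> D (Suc k) \<longleftrightarrow> (a, b) \<in> D k \<or> (a, b) = (i, j)" for a b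
    proof -
      have "a = i \<and> b = j" if "b \<le> m" "a * Suc m + b = k"
        unfolding i_def j_def that(2)[symmetric] using that(1)
        by (simp add: div_mult_self3 mod_mult_self3 del: mult_Suc_right)
      then show ?thesis using k j by (auto simp: D_def less_Suc_eq)
    qed
    have lowD: "(a, b) \<in> D k" if "a \<le> i" "b \<le> j" "(a, b) \<noteq> (i, j)" for a b
      using that j unfolding D by auto
    have "\<exists>c'. symm c' \<and> (\<forall>k. \<bar>fst k\<bar> \<noteq> int i \<or> \<bar>snd k\<bar> \<noteq> int j \<longrightarrow> c' k = c k) \<and>
        has_params (mfunctional c') u i j"
      by (rule extend_moments[where u = u, OF c(1) u0]) (use c(2) lowD in blast)
    then obtain c' where c': "symm c'" "\<forall>k. \<bar>fst k\<bar> \<noteq> int i \<or> \<bar>snd k\<bar> \<noteq> int j \<longrightarrow> c' k = c k"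
      "has_params (mfunctional c') u i j" by blast
    interpret c: mfun "mfunctional c" by (rule symm_mfun[OF c(1)])
    interpret c': mfun "mfunctional c'" by (rule symm_mfun[OF c'(1)])
    \<comment> \<open>Levels treated earlier have smaller first index, or equal first and smaller
      second index, so the altered moments lie outside their range.\<close>
    have old: "has_params (mfunctional c') u a b \<and> c'.pd (Vbox (Suc a) (Suc b))" if ab: "(a, b) \<in> D k" for a b
    proof -
      have a: "agree a b (mfunctional c) (mfunctional c')"
      proof (rule agree_mfunctional)
        fix l assume "l \<in> Pikeys a b"
        then have "\<bar>fst l\<bar> \<noteq> int i \<or> \<bar>snd l\<bar> \<noteq> int j" using ab by (auto simp: D Pikeys_def)
        then show "c l = c' l" using c'(2) by simp
      qed
      have pf: "c.pd (Vbox (Suc a) (Suc b))" by (rule conjunct2[OF c(2)[OF ab]])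
      have "has_params (mfunctional c') u a b"
        using conjunct1[OF c(2)[OF ab]] c.par_agree[OF pf a] by (simp add: has_params_def)
      then show ?thesis by (rule conjI[OF _ c.pd_agree[OF c'.mfun_axioms a pf]])
    qed
    have can: "c'.canon a b (lev u a b) \<and> c'.pd (Vbox (Suc a) (Suc b))" if ab: "a \<le> i" "b \<le> j" "(a, b) \<noteq> (i, j)" for a b
    proof -
      have o: "has_params (mfunctional c') u a' b' \<and> c'.pd (Vbox (Suc a') (Suc b'))" if "a' \<le> a" "b' \<le> b" for a' b'
      proof -
        have "a' \<le> i" "b' \<le> j" using that ab(1,2) by linarith+
        moreover have "(a', b') \<noteq> (i, j)"
        proof
          assume "(a', b') = (i, j)"
          then have "a = i" "b = j" using that ab(1,2) by simp_all
          then show False using ab(3) by simp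
        qed
        ultimately show ?thesis by (intro old lowD)
      qed
      have "c'.canon a b (lev u a b)"
      proof (rule c'.canon_all)
        show "c'.pd (Vbox (Suc a) (Suc b))" by (rule conjunct2[OF o[OF order_refl order_refl]])
        show "has_params (mfunctional c') u a' b'" if "a' \<le> a" "b' \<le> b" for a' b' using o[OF that] by (rule conjunct1)
      qed
      then show ?thesis by (rule conjI[OF _ conjunct2[OF o[OF order_refl order_refl]]])
    qed
    \<comment> \<open>The only place where the condition at the new level enters: it yields
      positivity of the new box.\<close>
    have "level_cond u i j" using st i j by (simp add: star_conditions_cond)
    moreover have "level_cond u i j \<longleftrightarrow> c'.pd (Vbox (Suc i) (Suc j))"
      by (rule c'.level_step(1)[OF can c'(3)])
    ultimately have new: "c'.pd (Vbox (Suc i) (Suc j))" by (rule iffD1[rotated])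
    have "has_params (mfunctional c') u a b \<and> c'.pd (Vbox (Suc a) (Suc b))" if "(a, b) \<in> D (Suc k)" for a b
    proof (cases "(a, b) \<in> D k")
      case False
      then have "a = i" "b = j" using that D'[of a b] by simp_all
      then show ?thesis using conjI[OF c'(3) new] by (simp only:)
    qed (rule old)
    then have "\<forall>(a, b)\<in>D (Suc k). has_params (mfunctional c') u a b \<and> c'.pd (Vbox (Suc a) (Suc b))"
      by auto
    then show ?case by (intro exI[of _ c'] conjI[OF c'(1)])
  qed
  from this[of "Suc n * Suc m"] obtain c where c: "symm c"
    "\<And>a b. (a, b) \<in> D (Suc n * Suc m) \<Longrightarrow> has_params (mfunctional c) u a b \<and> herm.pd (mfunctional c) (Vbox (Suc a) (Suc b))"
    by auto
  have "(a, b) \<in> D (Suc n * Suc m)" if "a \<le> n" "b \<le> m" for a b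
    using that mult_le_mono1[of a n "Suc m"] by (auto simp: D_def)
  then show ?thesis using c by (intro exI[of _ c]) auto
qed

section \<open>Sufficiency and necessity\<close>

lemma moments_pos_def:
  assumes c: "symm c" and pf: "herm.pd (mfunctional c) (Vbox (Suc n) (Suc m))"
  shows "pos_def_functional n m (mfunctional c)"
proof -
  interpret mfun "mfunctional c" by (rule symm_mfun[OF c])
  have "c (- i, - j) = cnj (c (i, j))" for i j using c unfolding symm_def by (metis uminus_Pair)
  then show ?thesis
    using pf by (auto simp: pos_def_functional_def linear_functional_def L_add L_cst hatPi_space_eq pd_def)
qed

context mfun
begin

text \<open>Of two different columns the lower one lies in the box to which the higher one is
  orthogonal.\<close>

lemma Phi_orthonormal:
  assumes pf: "pd (Vbox (Suc n) (Suc m))"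
  shows "i \<le> n \<Longrightarrow> j \<le> n \<Longrightarrow> lprod L (Pcol L i (Suc m)) (Pcol L j (Suc m)) = (if i = j then 1\<^sub>m (Suc m) else 0\<^sub>m (Suc m) (Suc m))"
    "k \<le> m \<Longrightarrow> l \<le> m \<Longrightarrow> lprod L (Qcol L (Suc n) k) (Qcol L (Suc n) l) = (if k = l then 1\<^sub>m (Suc n) else 0\<^sub>m (Suc n) (Suc n))"
proof -
  have o: "pd (Vbox a b)" if "a \<le> Suc n" "b \<le> Suc m" for a b by (rule ok_mono[OF pf that])
  have P: "lprod L (Pcol L i (Suc m)) (Pcol L j (Suc m)) = 0\<^sub>m (Suc m) (Suc m)"
    "lprod L (Pcol L j (Suc m)) (Pcol L i (Suc m)) = 0\<^sub>m (Suc m) (Suc m)" if "i < j" "j \<le> n" for i j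
  proof -
    have oi: "pd (Vbox (Suc i) (Suc m))" and oj: "pd (Vbox (Suc j) (Suc m))" by (rule o; use that in simp)+
    have "col_in (Pcol L i (Suc m)) (Vbox j (Suc m))"
      by (rule col_in_mono[OF P_facts(1)[OF oi] V_mono]) (use that in auto)
    from orth_lprod[OF P_facts(2)[OF oj] this]
    show "lprod L (Pcol L i (Suc m)) (Pcol L j (Suc m)) = 0\<^sub>m (Suc m) (Suc m)"
      "lprod L (Pcol L j (Suc m)) (Pcol L i (Suc m)) = 0\<^sub>m (Suc m) (Suc m)" by simp_all
  qed
  have Q: "lprod L (Qcol L (Suc n) i) (Qcol L (Suc n) j) = 0\<^sub>m (Suc n) (Suc n)"
    "lprod L (Qcol L (Suc n) j) (Qcol L (Suc n) i) = 0\<^sub>m (Suc n) (Suc n)" if "i < j" "j \<le> m" for i j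
  proof -
    have oi: "pd (Vbox (Suc n) (Suc i))" and oj: "pd (Vbox (Suc n) (Suc j))" by (rule o; use that in simp)+
    have "col_in (Qcol L (Suc n) i) (Vbox (Suc n) j)"
      by (rule col_in_mono[OF Q_facts(1)[OF oi] V_mono]) (use that in auto)
    from orth_lprod[OF Q_facts(2)[OF oj] this]
    show "lprod L (Qcol L (Suc n) i) (Qcol L (Suc n) j) = 0\<^sub>m (Suc n) (Suc n)"
      "lprod L (Qcol L (Suc n) j) (Qcol L (Suc n) i) = 0\<^sub>m (Suc n) (Suc n)" by simp_all
  qed
  show "lprod L (Pcol L i (Suc m)) (Pcol L j (Suc m)) = (if i = j then 1\<^sub>m (Suc m) else 0\<^sub>m (Suc m) (Suc m))"
    if "i \<le> n" "j \<le> n"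
    using P[of i j] P[of j i] P_facts(3)[OF o[of "Suc i" "Suc m"]] that
    by (cases i j rule: linorder_cases) simp_all
  show "lprod L (Qcol L (Suc n) k) (Qcol L (Suc n) l) = (if k = l then 1\<^sub>m (Suc n) else 0\<^sub>m (Suc n) (Suc n))"
    if "k \<le> m" "l \<le> m"
    using Q[of k l] Q[of l k] Q_facts(3)[OF o[of "Suc n" "Suc k"]] that
    by (cases k l rule: linorder_cases) simp_all
qed

end

lemma star_conditions_sufficient:
  assumes "star_conditions n m u"
  shows "\<exists>L. pos_def_functional n m L \<and>
    (\<forall>i\<le>n. \<forall>j\<le>n. lprod L (Phi (lev u i m)) (Phi (lev u j m)) = (if i = j then 1\<^sub>m (m + 1) else 0\<^sub>m (m + 1) (m + 1))) \<and>
    (\<forall>i\<le>m. \<forall>j\<le>m. lprod L (tPhi (lev u n i)) (tPhi (lev u n j)) = (if i = j then 1\<^sub>m (n + 1) else 0\<^sub>m (n + 1) (n + 1)))"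
proof -
  obtain c where c: "symm c" "\<And>a b. a \<le> n \<Longrightarrow> b \<le> m \<Longrightarrow> has_params (mfunctional c) u a b"
    "herm.pd (mfunctional c) (Vbox (Suc n) (Suc m))"
    using moments_exist[OF assms] by blast
  interpret mfun "mfunctional c" by (rule symm_mfun[OF c(1)])
  have can: "canon i j (lev u i j)" if "i \<le> n" "j \<le> m" for i j
  proof (rule canon_all)
    show "pd (Vbox (Suc i) (Suc j))" by (rule ok_mono[OF c(3)]) (use that in auto)
    show "has_params (mfunctional c) u a b" if "a \<le> i" "b \<le> j" for a b
      by (rule c(2)) (use that \<open>i \<le> n\<close> \<open>j \<le> m\<close> in auto)
  qed
  have "Phi (lev u i m) = Pcol (mfunctional c) i (Suc m)" if "i \<le> n" for i
    using can[OF that order_refl] by (simp add: canon_def)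
  moreover have "tPhi (lev u n j) = Qcol (mfunctional c) (Suc n) j" if "j \<le> m" for j
    using can[OF order_refl that] by (simp add: canon_def)
  ultimately show ?thesis
    using moments_pos_def[OF c(1,3)] Phi_orthonormal[OF c(3)]
    by (intro exI[of _ "mfunctional c"]) (simp flip: Suc_eq_plus1)
qed

text \<open>A functional is unconstrained outside its space of Laurent polynomials. Setting the
  other moments to zero gives a hermitian functional on everything with the same values on that
  space.\<close>

lemma moments_agree:
  assumes "pos_def_functional n m L"
  shows "\<exists>c. symm c \<and> agree n m (mfunctional c) L"
proof -
  define c where "c = (\<lambda>(i, j). if (i, j) \<in> Pikeys n m then L (zw i j) else 0)"
  have lin: "L (p + q) = L p + L q" "L (cst d * p) = d * L p" if "p \<in> Pi_space n m" "q \<in> Pi_space n m" for p q d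
    using assms that by (auto simp: pos_def_functional_def linear_functional_def)
  have h: "L (zw (- i) (- j)) = cnj (L (zw i j))" if "\<bar>i\<bar> \<le> int n" "\<bar>j\<bar> \<le> int m" for i j
    using assms that by (simp add: pos_def_functional_def)
  have "symm c" unfolding symm_def
  proof
    fix k show "c (- k) = cnj (c k)" by (cases k) (simp add: c_def Pikeys_def h)
  qed
  moreover have "mfunctional c p = L p" if p: "p \<in> Pi_space n m" for p
  proof -
    have fin: "finite (Pikeys n m)"
      by (rule finite_subset[of _ "{- int n..int n} \<times> {- int m..int m}"]) (auto simp: Pikeys_def)
    have zw: "zw i j \<in> Pi_space n m" if "(i, j) \<in> Pikeys n m" for i j
      unfolding Pi_space_eq by (rule zw_mono_span[OF that])
    have ls: "lsubspace (Pi_space n m)" unfolding Pi_space_eq by (rule lsubspace_mono_span)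
    have L0: "L 0 = 0" using lin(2)[OF lsubspaceD(1)[OF ls] lsubspaceD(1)[OF ls], of 0] by simp
    have sum: "L (\<Sum>k\<in>S. cst (d k) * zw (fst k) (snd k)) = (\<Sum>k\<in>S. d k * L (zw (fst k) (snd k)))"
      if "S \<subseteq> Pikeys n m" for S d
      using finite_subset[OF that fin] that
    proof (induction S)
      case (insert k S)
      then have zk: "zw (fst k) (snd k) \<in> Pi_space n m" by (intro zw) simp
      have "cst (d k) * zw (fst k) (snd k) \<in> Pi_space n m"
        "(\<Sum>k\<in>S. cst (d k) * zw (fst k) (snd k)) \<in> Pi_space n m"
        using insert by (auto intro!: lsubspaceD(3)[OF ls] lsubspace_sum[OF ls] zw)
      from lin(1)[OF this] insert lin(2)[OF zk zk] show ?case by simp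
    qed (simp add: L0)
    have "mfunctional c p = (\<Sum>k\<in>Pikeys n m. lcoeff p k * L (zw (fst k) (snd k)))"
      using p by (subst mfunctional_superset[OF fin])
        (auto simp: Pi_space_eq mono_span_def c_def intro!: sum.cong)
    also have "\<dots> = L (\<Sum>k\<in>Pikeys n m. cst (lcoeff p k) * zw (fst k) (snd k))"
      by (rule sum[symmetric]) simp
    also have "(\<Sum>k\<in>Pikeys n m. cst (lcoeff p k) * zw (fst k) (snd k)) = p"
      using mono_span_expand[OF fin p[unfolded Pi_space_eq]] by (simp add: case_prod_unfold)
    finally show ?thesis .
  qed
  ultimately show ?thesis unfolding agree_def by blast
qed

text \<open>The parameters are transferred to the extended functional, for which
  \<open>level_step\<close> is read from positivity to the condition of each level.\<close>

lemma star_conditions_necessary: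
  assumes L: "pos_def_functional n m L"
  shows "star_conditions n m (functional_params L)"
proof -
  obtain c where c: "symm c" and a: "agree n m (mfunctional c) L" using moments_agree[OF L] by blast
  interpret mfun "mfunctional c" by (rule symm_mfun[OF c])
  have pf: "pd (Vbox (Suc n) (Suc m))"
    using L agree_mult[OF a] by (auto simp: pos_def_functional_def hatPi_space_eq pd_def)
  have o: "pd (Vbox (Suc i) (Suc j))" if "i \<le> n" "j \<le> m" for i j
    by (rule ok_mono[OF pf]) (use that in auto)
  have has_params: "has_params (mfunctional c) (functional_params L) i j" if "i \<le> n" "j \<le> m" for i j
    using par_agree[OF o[OF that] agree_mono[OF a that]]
    by (auto simp: has_params_def functional_params_def)
  have can: "canon i j (lev (functional_params L) i j)" if "i \<le> n" "j \<le> m" for i j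
    by (rule canon_all[OF o[OF that]], rule has_params) (use that in auto)
  have "level_cond (functional_params L) i j" if "i \<le> n" "j \<le> m" for i j
  proof -
    have "level_cond (functional_params L) i j \<longleftrightarrow> pd (Vbox (Suc i) (Suc j))"
    proof (rule level_step(1))
      show "has_params (mfunctional c) (functional_params L) i j" by (rule has_params[OF that])
      show "canon a b (lev (functional_params L) a b) \<and> pd (Vbox (Suc a) (Suc b))" if "a \<le> i" "b \<le> j" for a b
      proof -
        have "a \<le> n" "b \<le> m" using that \<open>i \<le> n\<close> \<open>j \<le> m\<close> by auto
        then show ?thesis by (intro conjI can o)
      qed
    qed
    then show ?thesis using o[OF that] by (rule iffD2)
  qed
  then show ?thesis by (simp add: star_conditions_cond)
qed

theorem theorem6p1:
  fixes n m :: nat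
  shows "(\<forall>u :: params.
            (\<forall>i j. 0 \<le> i \<and> i \<le> int n \<and> \<bar>j\<bar> \<le> int m \<longrightarrow> u (- i) j = cnj (u i (- j))) \<and>
            star_conditions n m u \<longrightarrow>
            (\<exists>L. pos_def_functional n m L \<and>
               (\<forall>i\<le>n. \<forall>j\<le>n. lprod L (Phi (lev u i m)) (Phi (lev u j m)) =
                  (if i = j then 1\<^sub>m (m + 1) else 0\<^sub>m (m + 1) (m + 1))) \<and>
               (\<forall>i\<le>m. \<forall>j\<le>m. lprod L (tPhi (lev u n i)) (tPhi (lev u n j)) =
                  (if i = j then 1\<^sub>m (n + 1) else 0\<^sub>m (n + 1) (n + 1))))) \<and>
         (\<forall>L. pos_def_functional n m L \<longrightarrow> star_conditions n m (functional_params L))"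
  by (intro conjI allI impI star_conditions_sufficient star_conditions_necessary) (erule conjunct2 | assumption)+

end
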